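(* Let $\alpha=2$ (gravitational case), $n\ge2$, $k_1>1$, $k_2=\dots=k_n=1$, $N=n+k_1-1$, with masses $m_{1,1},\dots,m_{1,k_1},m_{2,1},\dots,m_{n,1}>0$. Let $m\ge2$ be an integer, $\theta=2\pi/m$, and let $\sigma$ be a permutation of $\{1,\dots,n\}$ with $\sigma^m=1$, $\sigma(1)=1$ and $m_{\sigma(j),1}=m_{j,1}$ for $j=2,\dots,n$. Let $a_0=(a_{0,1},\dots,a_{0,n})$ be a nondegenerate central configuration of the $n$-body problem with masses $M_1=\sum_{k=1}^{k_1}m_{1,k}$, $M_j=m_{j,1}$ $(j\ge2)$, such that $$a_{0,j}=\exp(-\theta J)a_{0,\sigma(j)}\qquad (j=1,\dots,n)$$ (so in particular $a_{0,1}=0$), and let $a_1=(a_{1,1},\dots,a_{1,k_1})$ be a $2\pi/m$-nondegenerate central configuration of the $k_1$-body problem with masses $m_{1,1},\dots,m_{1,k_1}$. For $\varepsilon>0$ put $$r_1=\varepsilon,\qquad \omega_1=\varepsilon^{-3/2},\qquad \nu=\varepsilon^{-3/2}-1.$$ Then for every sufficiently small $\varepsilon>0$ there are at least $2$ solutions (counted up to simultaneous rotation of all bodies) of the $N$-body problem $$m_{j,k}\ddot q_{j,k}=-\sum_{(j',k')\ne(j,k)}m_{j,k}m_{j',k'}\frac{q_{j,k}-q_{j',k'}}{\|q_{j,k}-q_{j',k'}\|^{3}}$$ with components of the form $$q_{1,k}(t)=\exp(tJ)u_{0,1}(\nu t)+r_1\exp(t\omega_1J)u_{1,k}(\nu t),\quad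 k=1,\dots,k_1,\qquad q_{j,1}(t)=\exp(tJ)u_{0,j}(\nu t),\quad j=2,\dots,n,$$ where $u_{0,j},u_{1,k}$ are $2\pi$-periodic, $u_{0,j}(\nu t)=a_{0,j}+\mathcal O_X(\varepsilon)$ and $u_{1,k}(\nu t)=e^{\vartheta_1J}a_{1,k}+\mathcal O_X(\varepsilon)$ for some phase $\vartheta_1\in S^1$. Furthermore, each $u_{1,k}(s)$ is $2\pi/m$-periodic and $$u_{0,j}(s)=\exp(-\theta J)u_{0,\sigma(j)}(s+\theta).$$ (The number $2$ is the Lyusternik–Schnirelmann category of the circle $U(1)$.)
   Context: $E=\mathbb{R}^2$ with its Euclidean inner product; $J=\begin{pmatrix}0&-1\\1&0\end{pmatrix}$; $\mathcal J_n=J\oplus\dots\oplus J$ acts on $E^n$. The body with index $1$ in the $n$-body configuration is replaced by a cluster of $k_1$ bodies $q_{1,1},\dots,q_{1,k_1}$. Central configurations ($\alpha=2$). For $K$ bodies with masses $\mu_1,\dots,\mu_K>0$, let $E_{red}=\{u\in E^K:\sum_i\mu_iu_i=0\}$, $\mathcal M=\mu_1I\oplus\dots\oplus\mu_KI$, $U(u)=\sum_{i<i'}\mu_i\mu_{i'}/\|u_i-u_{i'}\|$, and $V(u)=\frac12\|\mathcal M^{1/2}u\|^2+U(u)$. A central configuration (of frequency one and zero center of mass) is a collision-free critical point $a\in E_{red}$ of $V$. It is nondegenerate if the Hessian at $a$ of $V|_{E_{red}}$ has kernel exactly $\mathrm{span}(\mathcal J_Ka)$. A central configuration $a$ is $2\pi/m$-nondegenerate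 if the functional $$A(u)=\int_0^{2\pi}\Big(\tfrac12\big\|\mathcal M^{1/2}(\partial_s+\mathcal J_K)u(s)\big\|^2+U(u(s))\Big)ds$$ restricted to the closed subspace of $2\pi/m$-periodic paths in $H^1(S^1,E_{red})$, $S^1=\mathbb{R}/2\pi\mathbb{Z}$, has Hessian at the constant path $a$ with kernel exactly $\mathrm{span}(\mathcal J_Ka)$. $\mathcal O_X(\varepsilon)$ denotes a $2\pi$-periodic function of $s=\nu t$ whose $H^1(S^1)$-norm is bounded by a constant (independent of $\varepsilon$) times $\varepsilon$. The solutions satisfy $\sum_jM_ju_{0,j}=0$ and $\sum_km_{1,k}u_{1,k}=0$. *)

theory Defs
  imports "HOL-Analysis.Analysis"
begin

section \<open>The Sobolev space of periodic paths\<close>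

text \<open>
  With \<open>S\<^sup>1 = \<real>/2\<pi>\<int>\<close>, an element of \<open>H\<^sup>1(S\<^sup>1, 'a)\<close> is identified with its continuous
  representative: a \<open>2\<pi>\<close>-periodic path that is the indefinite integral of a square-integrable
  function \<open>v\<close>, its weak derivative. Only the restriction of \<open>v\<close> to one period matters, and it is
  determined up to null sets (lemma \<open>weak_deriv_unique\<close>).
\<close>

definition has_weak_deriv :: "(real \<Rightarrow> 'a::euclidean_space) \<Rightarrow> (real \<Rightarrow> 'a) \<Rightarrow> bool" where
  "has_weak_deriv u v \<longleftrightarrow>
     v \<in> borel_measurable borel \<and>
     set_integrable lborel {0..2*pi} (\<lambda>s. (norm (v s))\<^sup>2) \<and>
     (\<forall>t\<in>{0..2*pi}. u t = u 0 + (LINT s:{0..t}|lborel. v s))"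

typedef (overloaded) 'a h1 =
  "{u :: real \<Rightarrow> 'a::euclidean_space.
      (\<forall>s. u (s + 2*pi) = u s) \<and> (\<exists>v. has_weak_deriv u v)}"
  morphisms h1_path Abs_h1
proof -
  have "has_weak_deriv (\<lambda>s. 0::'a) (\<lambda>s. 0)"
    by (simp add: has_weak_deriv_def set_integrable_def)
  then show ?thesis by (intro exI[of _ "\<lambda>s. 0"] CollectI conjI allI exI[of _ "\<lambda>s. 0"] refl)
qed

definition wderiv :: "'a::euclidean_space h1 \<Rightarrow> real \<Rightarrow> 'a" where
  "wderiv u = (SOME v. has_weak_deriv (h1_path u) v)"

lemma path_periodic: "h1_path u (s + 2*pi) = h1_path u s"
  using h1_path[of u] by simp

lemma has_weak_deriv_wderiv: "has_weak_deriv (h1_path u) (wderiv u)"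
proof -
  have "\<exists>v. has_weak_deriv (h1_path u) v" using h1_path[of u] by simp
  then show ?thesis unfolding wderiv_def by (rule someI_ex)
qed

lemma h1_eqI: "h1_path u = h1_path w \<Longrightarrow> u = w"
  by (simp add: h1_path_inject)

lemma has_weak_derivD:
  assumes "has_weak_deriv u v"
  shows "v \<in> borel_measurable borel"
    and "set_integrable lborel {0..2*pi} (\<lambda>s. (norm (v s))\<^sup>2)"
    and "t \<in> {0..2*pi} \<Longrightarrow> u t = u 0 + (LINT s:{0..t}|lborel. v s)"
proof -
  note a = assms[unfolded has_weak_deriv_def]
  show "v \<in> borel_measurable borel" by (rule conjunct1[OF a])
  show "set_integrable lborel {0..2*pi} (\<lambda>s. (norm (v s))\<^sup>2)"
    by (rule conjunct1[OF conjunct2[OF a]])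
  show "t \<in> {0..2*pi} \<Longrightarrow> u t = u 0 + (LINT s:{0..t}|lborel. v s)"
    by (rule bspec[OF conjunct2[OF conjunct2[OF a]]])
qed

lemma has_weak_derivI:
  assumes "v \<in> borel_measurable borel"
    and "set_integrable lborel {0..2*pi} (\<lambda>s. (norm (v s))\<^sup>2)"
    and "\<And>t. t \<in> {0..2*pi} \<Longrightarrow> u t = u 0 + (LINT s:{0..t}|lborel. v s)"
  shows "has_weak_deriv u v"
  unfolding has_weak_deriv_def by (intro conjI ballI assms)

lemma set_integrable_sq_imp:
  fixes v :: "real \<Rightarrow> 'a::euclidean_space"
  assumes "v \<in> borel_measurable borel" "set_integrable lborel {0..2*pi} (\<lambda>s. (norm (v s))\<^sup>2)"
  shows "set_integrable lborel {0..2*pi} v"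
proof (rule set_integrable_bound)
  have "set_integrable lborel {0..2*pi} (\<lambda>s. 1::real)"
    by (simp add: set_integrable_def)
  then show "set_integrable lborel {0..2*pi} (\<lambda>s. 1 + (norm (v s))\<^sup>2)"
    using assms(2) by (rule set_integral_add)
  show "set_borel_measurable lborel {0..2*pi} v"
    using assms(1) unfolding set_borel_measurable_def by measurable
  have "norm (v s) \<le> 1 + (norm (v s))\<^sup>2" for s
  proof -
    have "0 \<le> (norm (v s) - 1)\<^sup>2" by simp
    then have "2 * norm (v s) \<le> (norm (v s))\<^sup>2 + 1"
      by (simp add: power2_diff)
    then show ?thesis using norm_ge_zero[of "v s"] by linarith
  qed
  then show "AE s in lborel. s \<in> {0..2*pi} \<longrightarrow> norm (v s) \<le> norm (1 + (norm (v s))\<^sup>2)"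
    by (auto intro!: AE_I2 order_trans[OF _ abs_ge_self])
qed

lemma set_integrable_inner_sq:
  fixes v w :: "real \<Rightarrow> 'a::euclidean_space"
  assumes [measurable]: "v \<in> borel_measurable borel" "w \<in> borel_measurable borel"
    and "set_integrable lborel {0..2*pi} (\<lambda>s. (norm (v s))\<^sup>2)"
        "set_integrable lborel {0..2*pi} (\<lambda>s. (norm (w s))\<^sup>2)"
  shows "set_integrable lborel {0..2*pi} (\<lambda>s. v s \<bullet> w s)"
proof (rule set_integrable_bound)
  show "set_integrable lborel {0..2*pi} (\<lambda>s. (norm (v s))\<^sup>2 + (norm (w s))\<^sup>2)"
    using assms(3,4) by (rule set_integral_add)
  show "set_borel_measurable lborel {0..2*pi} (\<lambda>s. v s \<bullet> w s)"
    unfolding set_borel_measurable_def by measurable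
  have "\<bar>v s \<bullet> w s\<bar> \<le> (norm (v s))\<^sup>2 + (norm (w s))\<^sup>2" for s
  proof -
    have "2 * (norm (v s) * norm (w s)) \<le> (norm (v s))\<^sup>2 + (norm (w s))\<^sup>2"
      using sum_squares_bound[of "norm (v s)" "norm (w s)"] by simp
    moreover have "0 \<le> norm (v s) * norm (w s)" by simp
    ultimately show ?thesis using Cauchy_Schwarz_ineq2[of "v s" "w s"] by linarith
  qed
  then show "AE s in lborel. s \<in> {0..2*pi} \<longrightarrow>
      norm (v s \<bullet> w s) \<le> norm ((norm (v s))\<^sup>2 + (norm (w s))\<^sup>2)"
    by (auto intro!: AE_I2 order_trans[OF _ abs_ge_self])
qed

lemma set_integrable_sub:
  fixes f :: "real \<Rightarrow> 'a::euclidean_space"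
  assumes "set_integrable lborel {0..2*pi} f" "t \<le> 2*pi"
  shows "set_integrable lborel {0..t::real} f"
  by (rule set_integrable_subset[OF assms(1)]) (use assms(2) in auto)

lemma has_weak_deriv_add:
  fixes u w :: "real \<Rightarrow> 'a::euclidean_space"
  assumes "has_weak_deriv u v" "has_weak_deriv w z"
  shows "has_weak_deriv (\<lambda>s. u s + w s) (\<lambda>s. v s + z s)"
proof -
  have m [measurable]: "v \<in> borel_measurable borel" "z \<in> borel_measurable borel"
    and i: "set_integrable lborel {0..2*pi} (\<lambda>s. (norm (v s))\<^sup>2)"
      "set_integrable lborel {0..2*pi} (\<lambda>s. (norm (z s))\<^sup>2)"
    using has_weak_derivD[OF assms(1)] has_weak_derivD[OF assms(2)] by blast+
  have "(\<lambda>s. (norm (v s + z s))\<^sup>2) =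
      (\<lambda>s. (norm (v s))\<^sup>2 + (norm (z s))\<^sup>2 + 2 *\<^sub>R (v s \<bullet> z s))"
    by (auto simp: power2_norm_eq_inner inner_add_left inner_add_right inner_commute)
  then have "set_integrable lborel {0..2*pi} (\<lambda>s. (norm (v s + z s))\<^sup>2)"
    using i set_integrable_inner_sq[OF m i] by auto
  moreover have "u t + w t = u 0 + w 0 + (LINT s:{0..t}|lborel. v s + z s)"
    if t: "t \<in> {0..2*pi}" for t
  proof -
    have "set_integrable lborel {0..t} v" "set_integrable lborel {0..t} z"
      using t by (auto intro!: set_integrable_sub set_integrable_sq_imp m i)
    then have "(LINT s:{0..t}|lborel. v s + z s)
        = (LINT s:{0..t}|lborel. v s) + (LINT s:{0..t}|lborel. z s)"
      by (rule set_integral_add)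
    moreover have "u t = u 0 + (LINT s:{0..t}|lborel. v s)" "w t = w 0 + (LINT s:{0..t}|lborel. z s)"
      by (rule has_weak_derivD(3)[OF assms(1) t] has_weak_derivD(3)[OF assms(2) t])+
    ultimately show ?thesis by (simp add: algebra_simps)
  qed
  moreover have "(\<lambda>s. v s + z s) \<in> borel_measurable borel" by measurable
  ultimately show ?thesis by (intro has_weak_derivI)
qed

lemma has_weak_deriv_scaleR:
  fixes u :: "real \<Rightarrow> 'a::euclidean_space"
  assumes "has_weak_deriv u v"
  shows "has_weak_deriv (\<lambda>s. c *\<^sub>R u s) (\<lambda>s. c *\<^sub>R v s)"
proof -
  have [measurable]: "v \<in> borel_measurable borel" by (rule has_weak_derivD[OF assms])
  have "(\<lambda>s. c *\<^sub>R v s) \<in> borel_measurable borel" by measurable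
  moreover have "set_integrable lborel {0..2*pi} (\<lambda>s. (norm (c *\<^sub>R v s))\<^sup>2)"
    using has_weak_derivD(2)[OF assms] by (simp add: power_mult_distrib)
  moreover have "c *\<^sub>R u t = c *\<^sub>R u 0 + (LINT s:{0..t}|lborel. c *\<^sub>R v s)"
    if "t \<in> {0..2*pi}" for t
    unfolding set_integral_scaleR_right scaleR_right_distrib[symmetric]
    using has_weak_derivD(3)[OF assms that] by (rule arg_cong)
  ultimately show ?thesis by (intro has_weak_derivI)
qed

lemma has_weak_deriv_const: "has_weak_deriv (\<lambda>s. c) (\<lambda>s. 0)"
  by (simp add: has_weak_deriv_def set_integrable_def)

lemma weak_deriv_unique:
  fixes u :: "real \<Rightarrow> 'a::euclidean_space"
  assumes "has_weak_deriv u v" "has_weak_deriv u w"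
  shows "AE s in lborel. s \<in> {0..2*pi} \<longrightarrow> v s = w s"
proof -
  define g where "g s = indicator {0..2*pi} s *\<^sub>R (v s - w s)" for s
  have d: "has_weak_deriv (\<lambda>s. 0::'a) (\<lambda>s. v s - w s)"
    using has_weak_deriv_add[OF assms(1) has_weak_deriv_scaleR[OF assms(2), of "-1"]]
    by (simp only: scaleR_minus1_left add.right_inverse add_uminus_conv_diff)
  have m: "(\<lambda>s. v s - w s) \<in> borel_measurable borel"
    and sq: "set_integrable lborel {0..2*pi} (\<lambda>s. (norm (v s - w s))\<^sup>2)"
    using d by (rule has_weak_derivD)+
  have g: "integrable lborel g"
    using set_integrable_sq_imp[OF m sq] unfolding g_def[abs_def] set_integrable_def .
  have z: "(LINT s:{0..t}|lborel. v s - w s) = 0" if "t \<in> {0..2*pi}" for t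
  proof -
    have "0 = 0 + (LINT s:{0..t}|lborel. v s - w s)"
      by (rule has_weak_derivD(3)[OF d that])
    then show ?thesis by (simp only: add_0)
  qed
  have gt: "(LINT s:{..t}|lborel. g s) = 0" for t
  proof (cases "t < 0")
    case True
    then have "(\<lambda>s. indicator {..t} s *\<^sub>R g s) = (\<lambda>s. 0)"
      by (auto simp: g_def indicator_def)
    then show ?thesis by (simp add: set_lebesgue_integral_def)
  next
    case False
    then have "(\<lambda>s. indicator {..t} s *\<^sub>R g s)
        = (\<lambda>s. indicator {0..min t (2*pi)} s *\<^sub>R (v s - w s))"
      by (auto simp: g_def indicator_def)
    then show ?thesis
      using z[of "min t (2*pi)"] False by (simp add: set_lebesgue_integral_def)
  qed
  have tot: "(LINT s|lborel. g s) = 0"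
    using z[of "2*pi"] by (simp add: g_def[abs_def] set_lebesgue_integral_def)
  have gA: "set_integrable lborel A g" if "A \<in> sets borel" for A
    using g that unfolding set_integrable_def by (intro integrable_mult_indicator) auto
  have all: "(LINT s:A|lborel. g s) = 0" if "A \<in> sets lborel" for A
  proof -
    have sb: "B \<in> sets borel" if "B \<in> sigma_sets UNIV (range (\<lambda>a::real. {..a}))" for B
      using that by (simp add: borel_eq_atMost)
    have "Int_stable (range (\<lambda>a::real. {..a}))"
      by (auto simp: Int_stable_def)
    moreover have "range (\<lambda>a::real. {..a}) \<subseteq> Pow UNIV" by simp
    moreover have "A \<in> sigma_sets UNIV (range (\<lambda>a::real. {..a}))"
      using that by (simp add: borel_eq_atMost)
    ultimately show ?thesis
    proof (induction rule: sigma_sets_induct_disjoint)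
      case (basic A) then show ?case using gt by auto
    next
      case empty then show ?case by (simp add: set_lebesgue_integral_def)
    next
      case (compl A)
      have "(LINT s:A \<union> (UNIV - A)|lborel. g s)
          = (LINT s:A|lborel. g s) + (LINT s:UNIV - A|lborel. g s)"
        using sb[OF compl(1)] by (intro set_integral_Un gA) auto
      then show ?case using compl tot by (simp add: set_lebesgue_integral_def)
    next
      case (union F)
      have "\<And>i. F i \<in> sets borel" using union sb by auto
      then have "(LINT s:(\<Union>i. F i)|lborel. g s) = (\<Sum>i. (LINT s:F i|lborel. g s))"
        using union(1)
        by (intro lebesgue_integral_countable_add gA) (auto simp: disjoint_family_on_def)
      then show ?case using union by simp
    qed
  qed
  have "AE s in lborel. g s = 0"
    by (rule sigma_finite_measure.density_zero[OF sigma_finite_lborel g all])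
  then show ?thesis
    by eventually_elim (auto simp: g_def)
qed

lemma has_weak_deriv_continuous:
  assumes "has_weak_deriv u v"
  shows "continuous_on {0..2*pi} u"
proof -
  have si: "set_integrable lborel {0..2*pi} v"
    by (rule set_integrable_sq_imp[OF has_weak_derivD(1,2)[OF assms]])
  then have "v integrable_on {0..2*pi}"
    by (rule set_borel_integral_eq_integral)
  then have "continuous_on {0..2*pi} (\<lambda>t. integral {0..t} v)"
    by (rule indefinite_integral_continuous_1)
  then have "continuous_on {0..2*pi} (\<lambda>t. u 0 + integral {0..t} v)"
    by (intro continuous_intros)
  moreover have "u 0 + integral {0..t} v = u t" if t: "t \<in> {0..2*pi}" for t
  proof -
    have "set_integrable lborel {0..t} v"
      using t si by (auto intro: set_integrable_sub)
    then have "(LINT s:{0..t}|lborel. v s) = integral {0..t} v"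
      by (rule set_borel_integral_eq_integral)
    then show ?thesis using has_weak_derivD(3)[OF assms t] by simp
  qed
  ultimately show ?thesis by (rule continuous_on_eq)
qed

lemma path_reduce:
  defines "r \<equiv> \<lambda>s::real. s - 2*pi * of_int \<lfloor>s / (2*pi)\<rfloor>"
  shows "r s \<in> {0..2*pi}" "h1_path u s = h1_path u (r s)"
proof -
  have "2*pi * of_int \<lfloor>s / (2*pi)\<rfloor> \<le> 2*pi * (s / (2*pi))"
    "2*pi * (s / (2*pi)) \<le> 2*pi * (of_int \<lfloor>s / (2*pi)\<rfloor> + 1)"
    by (intro mult_left_mono of_int_floor_le real_of_int_floor_add_one_ge; simp)+
  then show "r s \<in> {0..2*pi}" by (simp add: r_def distrib_left)
  have per: "h1_path u (s + 2*pi * of_int k) = h1_path u s" for k :: int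
  proof (induction k rule: int_induct[where k=0])
    case base then show ?case by simp
  next
    case (step1 i)
    then show ?case using path_periodic[of u "s + 2*pi * of_int i"] by (simp add: algebra_simps)
  next
    case (step2 i)
    then show ?case using path_periodic[of u "s + 2*pi * of_int (i-1)"] by (simp add: algebra_simps)
  qed
  show "h1_path u s = h1_path u (r s)"
    using per[of "- \<lfloor>s / (2*pi)\<rfloor>"] by (simp add: r_def)
qed

lemma path_measurable_sq:
  fixes u :: "'a::euclidean_space h1"
  shows "h1_path u \<in> borel_measurable borel" "set_integrable lborel {0..2*pi} (\<lambda>s. (norm (h1_path u s))\<^sup>2)"
proof -
  have c0: "continuous_on {0..2*pi} (h1_path u)"
    by (rule has_weak_deriv_continuous[OF has_weak_deriv_wderiv])
  define r where "r s = s - 2*pi * of_int \<lfloor>s / (2*pi)\<rfloor>" for s :: real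
  have r: "r s \<in> {0..2*pi}" and pr: "h1_path u s = h1_path u (r s)" for s
    unfolding r_def by (rule path_reduce)+
  have [measurable]: "(\<lambda>s. indicator {0..2*pi} s *\<^sub>R h1_path u s) \<in> borel_measurable borel"
    using c0 by (intro borel_measurable_continuous_on_indicator) auto
  have [measurable]: "r \<in> borel_measurable borel" unfolding r_def by measurable
  have "h1_path u = (\<lambda>s. (\<lambda>x. indicator {0..2*pi} x *\<^sub>R h1_path u x) (r s))"
    using r pr by (auto simp: indicator_def)
  also have "\<dots> \<in> borel_measurable borel"
    by measurable
  finally show "h1_path u \<in> borel_measurable borel" .
  show "set_integrable lborel {0..2*pi} (\<lambda>s. (norm (h1_path u s))\<^sup>2)"
    using c0 by (intro borel_integrable_atLeastAtMost' continuous_intros)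
qed

instantiation h1 :: (euclidean_space) real_inner
begin

definition "0 = Abs_h1 (\<lambda>s. 0)"
definition "u + w = Abs_h1 (\<lambda>s. h1_path u s + h1_path w s)"
definition "r *\<^sub>R u = Abs_h1 (\<lambda>s. r *\<^sub>R h1_path u s)"
definition "- (u :: 'a h1) = (-1) *\<^sub>R u"
definition "(u :: 'a h1) - w = u + - w"
definition "u \<bullet> w =
  (LINT s:{0..2*pi}|lborel. h1_path u s \<bullet> h1_path w s) +
  (LINT s:{0..2*pi}|lborel. wderiv u s \<bullet> wderiv w s)"
definition "norm (u :: 'a h1) = sqrt (u \<bullet> u)"
definition "dist (u :: 'a h1) w = norm (u - w)"
definition "sgn (u :: 'a h1) = inverse (norm u) *\<^sub>R u"
definition "uniformity = (INF e\<in>{0 <..}. principal {(u :: 'a h1, w). dist u w < e})"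
definition "open (U :: 'a h1 set) \<longleftrightarrow>
  (\<forall>x\<in>U. eventually (\<lambda>(x', y). x' = x \<longrightarrow> y \<in> U) uniformity)"

lemma path_zero: "h1_path (0 :: 'a h1) = (\<lambda>s. 0)"
  unfolding zero_h1_def by (subst Abs_h1_inverse) (auto intro: has_weak_deriv_const)

lemma path_add: "h1_path (u + w) = (\<lambda>s. h1_path u s + h1_path (w :: 'a h1) s)"
  unfolding plus_h1_def
  by (subst Abs_h1_inverse)
    (auto simp: path_periodic intro: has_weak_deriv_add has_weak_deriv_wderiv)

lemma path_scaleR: "h1_path (r *\<^sub>R u) = (\<lambda>s. r *\<^sub>R h1_path (u :: 'a h1) s)"
  unfolding scaleR_h1_def
  by (subst Abs_h1_inverse)
    (auto simp: path_periodic intro: has_weak_deriv_scaleR has_weak_deriv_wderiv)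

lemma wderiv_measurable: "wderiv (u :: 'a h1) \<in> borel_measurable borel"
  and wderiv_sq: "set_integrable lborel {0..2*pi} (\<lambda>s. (norm (wderiv u s))\<^sup>2)"
  using has_weak_derivD(1,2)[OF has_weak_deriv_wderiv[of u]] by auto

lemma wderiv_inner_cong:
  assumes "has_weak_deriv (h1_path (u :: 'a h1)) v"
  shows "(LINT s:{0..2*pi}|lborel. wderiv u s \<bullet> wderiv (w :: 'a h1) s)
    = (LINT s:{0..2*pi}|lborel. v s \<bullet> wderiv w s)"
proof (rule set_lebesgue_integral_cong_AE)
  have [measurable]: "v \<in> borel_measurable borel"
    using assms by (rule has_weak_derivD)
  note [measurable] = wderiv_measurable
  show "(\<lambda>s. wderiv u s \<bullet> wderiv w s) \<in> borel_measurable lborel"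
    "(\<lambda>s. v s \<bullet> wderiv w s) \<in> borel_measurable lborel" by measurable
  show "AE s\<in>{0..2*pi} in lborel. wderiv u s \<bullet> wderiv w s = v s \<bullet> wderiv w s"
    using weak_deriv_unique[OF has_weak_deriv_wderiv assms] by eventually_elim auto
qed simp

instance
proof
  fix u w x :: "'a h1" and r q :: real
  show "u + w + x = u + (w + x)" "u + w = w + u" "0 + u = u"
    "r *\<^sub>R (u + w) = r *\<^sub>R u + r *\<^sub>R w" "(r + q) *\<^sub>R u = r *\<^sub>R u + q *\<^sub>R u"
    "r *\<^sub>R q *\<^sub>R u = (r * q) *\<^sub>R u" "1 *\<^sub>R u = u" "- u + u = 0"
    by (auto intro!: h1_eqI simp: path_add path_zero path_scaleR uminus_h1_def algebra_simps)
  show "u - w = u + - w" by (simp add: minus_h1_def)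
  show "dist u w = norm (u - w)" by (rule dist_h1_def)
  show "sgn u = inverse (norm u) *\<^sub>R u" by (rule sgn_h1_def)
  show "uniformity = (INF e\<in>{0 <..}. principal {(u :: 'a h1, w). dist u w < e})"
    by (rule uniformity_h1_def)
  show "open U \<longleftrightarrow> (\<forall>x\<in>U. \<forall>\<^sub>F (x', y) in uniformity. x' = x \<longrightarrow> y \<in> U)" for U :: "'a h1 set"
    by (rule open_h1_def)
  show "norm u = sqrt (u \<bullet> u)" by (rule norm_h1_def)
  show "u \<bullet> w = w \<bullet> u" by (simp add: inner_h1_def inner_commute)
  note pi = set_integrable_inner_sq[OF path_measurable_sq(1) path_measurable_sq(1)
      path_measurable_sq(2) path_measurable_sq(2)]
  note wi = set_integrable_inner_sq[OF wderiv_measurable wderiv_measurable wderiv_sq wderiv_sq]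
  have "has_weak_deriv (h1_path (u + w)) (\<lambda>s. wderiv u s + wderiv w s)"
    unfolding path_add by (intro has_weak_deriv_add has_weak_deriv_wderiv)
  from wderiv_inner_cong[OF this, of x]
  show "(u + w) \<bullet> x = u \<bullet> x + w \<bullet> x"
    using pi[of u x] pi[of w x] wi[of u x] wi[of w x]
    by (simp add: inner_h1_def path_add inner_add_left)
  have "has_weak_deriv (h1_path (r *\<^sub>R u)) (\<lambda>s. r *\<^sub>R wderiv u s)"
    unfolding path_scaleR by (intro has_weak_deriv_scaleR has_weak_deriv_wderiv)
  from wderiv_inner_cong[OF this, of w]
  show "(r *\<^sub>R u) \<bullet> w = r * (u \<bullet> w)"
    by (simp add: inner_h1_def path_scaleR distrib_left)
  have nn: "0 \<le> (LINT s:{0..2*pi}|lborel. f s \<bullet> f s)" for f :: "real \<Rightarrow> 'a"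
    unfolding set_lebesgue_integral_def by (intro integral_nonneg_AE) auto
  show "0 \<le> u \<bullet> u" using nn[of "h1_path u"] nn[of "wderiv u"] by (simp add: inner_h1_def)
  show "u \<bullet> u = 0 \<longleftrightarrow> u = 0"
  proof
    assume "u = 0"
    have "has_weak_deriv (h1_path (0::'a h1)) (\<lambda>s. 0)"
      unfolding path_zero by (rule has_weak_deriv_const)
    from wderiv_inner_cong[OF this, of 0] \<open>u = 0\<close> show "u \<bullet> u = 0"
      by (simp add: inner_h1_def path_zero)
  next
    assume "u \<bullet> u = 0"
    then have z: "(LINT s:{0..2*pi}|lborel. h1_path u s \<bullet> h1_path u s) = 0"
      "(LINT s:{0..2*pi}|lborel. wderiv u s \<bullet> wderiv u s) = 0"
      using nn[of "h1_path u"] nn[of "wderiv u"] by (auto simp: inner_h1_def)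
    have c: "continuous_on {0..2*pi} (h1_path u)"
      by (rule has_weak_deriv_continuous[OF has_weak_deriv_wderiv])
    have hz: "((\<lambda>s. h1_path u s \<bullet> h1_path u s) has_integral 0) {0..2*pi}"
      using set_borel_integral_eq_integral[OF pi[of u u]] z(1)
      by (simp add: has_integral_iff)
    have on: "h1_path u s = 0" if "s \<in> {0..2*pi}" for s
    proof -
      have "h1_path u s \<bullet> h1_path u s = 0"
        by (rule has_integral_0_cbox_imp_0[of 0 "2*pi" "\<lambda>s. h1_path u s \<bullet> h1_path u s"])
          (use c hz that in \<open>auto intro!: continuous_intros simp: not_le\<close>)
      then show ?thesis by simp
    qed
    have "h1_path u s = 0" for s
      using on[OF path_reduce(1)[of s]] path_reduce(2)[of u s] by simp
    then show "u = 0" by (auto intro!: h1_eqI simp: path_zero)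
  qed
qed

end

definition h1_const :: "'a::euclidean_space \<Rightarrow> 'a h1" where
  "h1_const a = Abs_h1 (\<lambda>s. a)"

lemma h1_path_const: "h1_path (h1_const a) = (\<lambda>s. a)"
  unfolding h1_const_def by (subst Abs_h1_inverse) (auto intro: has_weak_deriv_const)


section \<open>Critical points and Hessians of restricted functionals\<close>

text \<open>
  Below \<open>S\<close> is always a linear subspace, so that derivatives within \<open>S\<close> are the derivatives of
  \<open>f\<close> restricted to \<open>S\<close>. Linear maps \<open>D\<close> with \<open>(f has_derivative D) (at u within S)\<close> are determined
  only on \<open>S\<close>; hence only the values \<open>B h k\<close> with \<open>h, k \<in> S\<close> of the second derivative are used.
\<close>

definition critical_point_on :: "'a::real_normed_vector set \<Rightarrow> ('a \<Rightarrow> real) \<Rightarrow> 'a \<Rightarrow> bool" where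
  "critical_point_on S f a \<longleftrightarrow> a \<in> S \<and> (f has_derivative (\<lambda>h. 0)) (at a within S)"

definition has_hessian_on ::
  "'a::real_normed_vector set \<Rightarrow> ('a \<Rightarrow> real) \<Rightarrow> 'a \<Rightarrow> ('a \<Rightarrow> 'a \<Rightarrow>\<^sub>L real) \<Rightarrow> bool" where
  "has_hessian_on S f a B \<longleftrightarrow>
     (\<exists>F :: 'a \<Rightarrow> 'a \<Rightarrow>\<^sub>L real.
        (\<exists>d>0. \<forall>u\<in>S. dist u a < d \<longrightarrow> (f has_derivative blinfun_apply (F u)) (at u within S)) \<and>
        (F has_derivative B) (at a within S))"

definition hessian_has_kernel ::
  "'a::real_normed_vector set \<Rightarrow> ('a \<Rightarrow> real) \<Rightarrow> 'a \<Rightarrow> 'a set \<Rightarrow> bool" where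
  "hessian_has_kernel S f a K \<longleftrightarrow>
     (\<exists>B. has_hessian_on S f a B \<and> {h \<in> S. \<forall>k\<in>S. blinfun_apply (B h) k = 0} = K)"


section \<open>Central configurations in the plane\<close>

definition J :: "real^2^2" where
  "J = vector [vector [0, -1], vector [1, 0]]"

definition matrix_exp :: "real^'d^'d \<Rightarrow> real^'d^'d" where
  "matrix_exp A = (\<Sum>k. (1 / fact k) *\<^sub>R (((**) A ^^ k) (mat 1)))"

definition rot :: "real \<Rightarrow> real^2^2" where
  "rot t = matrix_exp (t *\<^sub>R J)"

lemma rot_eq: "rot t = vector [vector [cos t, - sin t], vector [sin t, cos t]]"
proof -
  define P :: "nat \<Rightarrow> real^2^2" where "P k = ((**) (t *\<^sub>R J) ^^ k) (mat 1)" for k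
  have P: "P k $ 1 $ 1 /\<^sub>R fact k = cos_coeff k * t ^ k \<and>
      P k $ 1 $ 2 /\<^sub>R fact k = - (sin_coeff k * t ^ k) \<and>
      P k $ 2 $ 1 /\<^sub>R fact k = sin_coeff k * t ^ k \<and> P k $ 2 $ 2 /\<^sub>R fact k = cos_coeff k * t ^ k" for k
  proof (induction k)
    case 0
    then show ?case by (simp add: P_def mat_def cos_coeff_def sin_coeff_def)
  next
    case (Suc k)
    have S: "P (Suc k) = (t *\<^sub>R J) ** P k" by (simp add: P_def)
    have "P (Suc k) $ 1 $ j = - (t * P k $ 2 $ j)" "P (Suc k) $ 2 $ j = t * P k $ 1 $ j" for j
      unfolding S by (simp_all add: matrix_matrix_mult_def J_def sum_2 vector_2)
    with Suc show ?case
      by (simp add: cos_coeff_Suc sin_coeff_Suc field_simps del: of_nat_Suc)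
  qed
  have "(\<lambda>k. (1 / fact k) *\<^sub>R P k) sums vector [vector [cos t, - sin t], vector [sin t, cos t]]"
    unfolding sums_def
  proof (intro vec_tendstoI)
    fix i j :: 2
    have "(\<lambda>k. ((1 / fact k) *\<^sub>R P k) $ i $ j)
        sums ((vector [vector [cos t, - sin t], vector [sin t, cos t]] :: real^2^2) $ i $ j)"
      using exhaust_2[of i] exhaust_2[of j] P cos_converges[of t] sin_converges[of t]
        sums_minus[OF sin_converges[of t]]
      by (auto simp: vector_2 divide_inverse)
    then show "(\<lambda>n. (\<Sum>k<n. (1 / fact k) *\<^sub>R P k) $ i $ j)
        \<longlonglongrightarrow> (vector [vector [cos t, - sin t], vector [sin t, cos t]] :: real^2^2) $ i $ j"
      by (simp add: sums_def)
  qed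
  then show ?thesis unfolding rot_def matrix_exp_def P_def by (simp add: sums_iff)
qed

definition J_all :: "(real^2)^'k \<Rightarrow> (real^2)^'k" where
  "J_all u = (\<chi> i. J *v (u $ i))"

definition E_red :: "('k::finite \<Rightarrow> real) \<Rightarrow> ((real^2)^'k) set" where
  "E_red \<mu> = {u. (\<Sum>i\<in>UNIV. \<mu> i *\<^sub>R (u $ i)) = 0}"

definition sqrt_mass :: "('k \<Rightarrow> real) \<Rightarrow> (real^2)^'k \<Rightarrow> (real^2)^'k" where
  "sqrt_mass \<mu> u = (\<chi> i. sqrt (\<mu> i) *\<^sub>R (u $ i))"

text \<open>The factor \<open>1/2\<close> is due to the sum over ordered pairs, which counts each pair twice.\<close>

definition newton_U :: "('k::finite \<Rightarrow> real) \<Rightarrow> (real^2)^'k \<Rightarrow> real" where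
  "newton_U \<mu> u = 1/2 * (\<Sum>i\<in>UNIV. \<Sum>j\<in>UNIV - {i}. \<mu> i * \<mu> j / norm (u $ i - u $ j))"

definition amended_V :: "('k::finite \<Rightarrow> real) \<Rightarrow> (real^2)^'k \<Rightarrow> real" where
  "amended_V \<mu> u = 1/2 * (norm (sqrt_mass \<mu> u))\<^sup>2 + newton_U \<mu> u"

definition collision_free :: "(real^2)^'k \<Rightarrow> bool" where
  "collision_free u \<longleftrightarrow> (\<forall>i j. i \<noteq> j \<longrightarrow> u $ i \<noteq> u $ j)"

definition central_configuration :: "('k::finite \<Rightarrow> real) \<Rightarrow> (real^2)^'k \<Rightarrow> bool" where
  "central_configuration \<mu> a \<longleftrightarrow>
     collision_free a \<and> critical_point_on (E_red \<mu>) (amended_V \<mu>) a"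

definition nondegenerate_cc :: "('k::finite \<Rightarrow> real) \<Rightarrow> (real^2)^'k \<Rightarrow> bool" where
  "nondegenerate_cc \<mu> a \<longleftrightarrow>
     central_configuration \<mu> a \<and>
     hessian_has_kernel (E_red \<mu>) (amended_V \<mu>) a (span {J_all a})"

definition action_A :: "('k::finite \<Rightarrow> real) \<Rightarrow> ((real^2)^'k) h1 \<Rightarrow> real" where
  "action_A \<mu> u =
     (LINT s:{0..2*pi}|lborel.
        1/2 * (norm (sqrt_mass \<mu> (wderiv u s + J_all (h1_path u s))))\<^sup>2
        + newton_U \<mu> (h1_path u s))"

definition H1_red_periodic :: "('k::finite \<Rightarrow> real) \<Rightarrow> nat \<Rightarrow> (((real^2)^'k) h1) set" where
  "H1_red_periodic \<mu> m =
     {u. \<forall>s. h1_path u s \<in> E_red \<mu> \<and> h1_path u (s + 2*pi / real m) = h1_path u s}"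

definition periodic_nondegenerate_cc :: "nat \<Rightarrow> ('k::finite \<Rightarrow> real) \<Rightarrow> (real^2)^'k \<Rightarrow> bool" where
  "periodic_nondegenerate_cc m \<mu> a \<longleftrightarrow>
     central_configuration \<mu> a \<and>
     hessian_has_kernel (H1_red_periodic \<mu> m) (action_A \<mu>) (h1_const a)
       (span {h1_const (J_all a)})"


section \<open>The N-body problem\<close>

text \<open>Solutions are global in time and free of collisions; bodies are labelled by a finite set \<open>I\<close>.\<close>

definition nbody_solution ::
  "'i set \<Rightarrow> ('i \<Rightarrow> real) \<Rightarrow> ('i \<Rightarrow> real \<Rightarrow> real^2) \<Rightarrow> bool" where
  "nbody_solution I \<mu> q \<longleftrightarrow>
     (\<forall>t. inj_on (\<lambda>i. q i t) I) \<and>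
     (\<exists>v acc. \<forall>i\<in>I. \<forall>t.
        (q i has_vector_derivative v i t) (at t) \<and>
        (v i has_vector_derivative acc i t) (at t) \<and>
        \<mu> i *\<^sub>R acc i t =
          - (\<Sum>j\<in>I - {i}. (\<mu> i * \<mu> j / norm (q i t - q j t) ^ 3) *\<^sub>R (q i t - q j t)))"

definition rotation_equivalent ::
  "'i set \<Rightarrow> ('i \<Rightarrow> real \<Rightarrow> real^2) \<Rightarrow> ('i \<Rightarrow> real \<Rightarrow> real^2) \<Rightarrow> bool" where
  "rotation_equivalent I q p \<longleftrightarrow> (\<exists>\<phi>. \<forall>i\<in>I. \<forall>t. p i t = rot \<phi> *v q i t)"

text \<open>
  The body \<open>c\<close> of an \<open>n\<close>-body configuration is replaced by a cluster with labels in \<open>'k\<close>: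
  \<open>Inl k\<close> is the \<open>k\<close>-th body of the cluster, and \<open>Inr j\<close> with \<open>j \<noteq> c\<close> is the body that alone
  occupies position \<open>j\<close>. The label \<open>Inr c\<close> is not used, so there are \<open>n + k\<^sub>1 - 1\<close> bodies.
\<close>

definition cluster_bodies :: "'n \<Rightarrow> ('k + 'n) set" where
  "cluster_bodies c = range Inl \<union> Inr ` (- {c})"

definition total_masses :: "'n \<Rightarrow> ('k::finite \<Rightarrow> real) \<Rightarrow> ('n \<Rightarrow> real) \<Rightarrow> 'n \<Rightarrow> real" where
  "total_masses c m1 mo = mo(c := (\<Sum>k\<in>UNIV. m1 k))"

end

theory Submission
  imports Defs
begin

text \<open>In the frame that rotates with frequency one the equations form a system in the variable
  \<open>s = \<nu> t\<close> that is slow for the outer configuration, with rate \<open>1 / \<nu>\<close>, and of order one for the cluster.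
  At \<open>\<epsilon> = 0\<close> the averaged outer equations linearise to the bordered Hessian of the amended potential at
  \<open>a0\<close> and the cluster equations to the Hessian of the action at \<open>a1\<close>. The nondegeneracy hypotheses say
  that both are invertible modulo rotations. After adding two multipliers, constant forces along \<open>J a0\<close>
  and \<open>J a1\<close>, a contraction in the supremum norm, performed within the paths with the prescribed symmetry,
  yields a solution for small \<open>\<epsilon>\<close>. The balances of energy and angular momentum over one relative period
  then force both multipliers to vanish.

  One solution suffices. The equations are autonomous, so a time shift followed by a rotation yields
  another solution of the required form with the outer configuration still near \<open>a0\<close> and another phase of the
  cluster, and a suitable phase makes the two inequivalent.\<close>

text \<open>The slow equation is singular in the limit: its derivative carries the factor
  \<open>slowness\<close>, which tends to 0, so that in the limit every constant path is a solution
  and only the mean of the force selects one. Hence the constant part and the mean-zero part of the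
  slow component need different inverses. The equations exist for \<epsilon> > 0 only and contain
  \<open>\<epsilon> powr (3/2)\<close>; what is carried through is therefore a uniformly small
  Lipschitz constant, not smoothness in \<epsilon>. The center of mass is not prescribed in the
  contraction. It turns out to move like a free particle seen from a rotating frame, and it must
  rest because its rotation rate is not in resonance with the period. The nondegeneracy hypotheses
  concern Hessians given only by their existence. They are evaluated along lines in the subspace,
  and for the action an integration by parts against merely weakly differentiable test paths leads
  back to a differential equation. Outer bodies and cluster have one rotation each, hence two
  multipliers, but the full system is invariant only under the common rotation. Its second symmetry,
  time translation, supplies the missing conservation law.\<close>

section \<open>Contraction of paths in the supremum norm\<close>

text \<open>Banach's fixed point theorem for bounded continuous functions, with all hypotheses
  phrased by pointwise bounds so that the type of such functions stays inside the proof. The map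
  \<open>T\<close> has to behave well on \<open>X\<close> only.\<close>

lemma sup_norm_contraction:
  fixes T :: "(real \<Rightarrow> 'b::banach) \<Rightarrow> real \<Rightarrow> 'b" and X :: "(real \<Rightarrow> 'b) set"
  assumes ne: "x0 \<in> X"
    and cont: "\<And>y. y \<in> X \<Longrightarrow> continuous_on UNIV y"
    and bnd: "\<And>y s. y \<in> X \<Longrightarrow> norm (y s) \<le> r"
    and closed: "\<And>y. continuous_on UNIV y \<Longrightarrow> (\<And>e. e > 0 \<Longrightarrow> \<exists>x\<in>X. \<forall>s. norm (x s - y s) \<le> e) \<Longrightarrow> y \<in> X"
    and self: "\<And>y. y \<in> X \<Longrightarrow> T y \<in> X"
    and lip: "\<And>y y' B s. y \<in> X \<Longrightarrow> y' \<in> X \<Longrightarrow> (\<And>s. norm (y s - y' s) \<le> B) \<Longrightarrow> norm (T y s - T y' s) \<le> B / 2"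
  obtains y where "y \<in> X" "T y = y"
proof -
  have inb: "y \<in> bcontfun" if "y \<in> X" for y
    using cont[OF that] bnd[OF that] by (intro bcontfun_normI) auto
  define S where "S = {f :: real \<Rightarrow>\<^sub>C 'b. apply_bcontfun f \<in> X}"
  define F where "F f = Bcontfun (T (apply_bcontfun f))" for f :: "real \<Rightarrow>\<^sub>C 'b"
  have appF: "apply_bcontfun (F f) = T (apply_bcontfun f)" if "f \<in> S" for f
    unfolding F_def using that by (intro Bcontfun_inverse inb self) (simp add: S_def)
  have "closed S"
    unfolding closure_subset_eq[symmetric]
  proof
    fix f assume "f \<in> closure S"
    then have *: "\<forall>e>0. \<exists>y\<in>S. dist y f < e" by (simp add: closure_approachable)
    have "apply_bcontfun f \<in> X"
    proof (rule closed)
      show "continuous_on UNIV (apply_bcontfun f)" by simp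
      fix e :: real assume "e > 0"
      with * obtain y where y: "y \<in> S" "dist y f < e" by auto
      have "norm (y s - f s) \<le> e" for s
        using dist_bounded[of y s f] y by (simp add: dist_norm)
      with y show "\<exists>x\<in>X. \<forall>s. norm (x s - f s) \<le> e" by (auto simp: S_def)
    qed
    then show "f \<in> S" by (simp add: S_def)
  qed
  then have "complete S" by (simp add: complete_eq_closed)
  moreover have "S \<noteq> {}"
    using ne inb[OF ne] Bcontfun_inverse[of x0] by (auto simp: S_def intro!: exI[of _ "Bcontfun x0"])
  moreover have "F ` S \<subseteq> S" using appF self by (auto simp: S_def)
  moreover have "dist (F f) (F g) \<le> 1/2 * dist f g" if "f \<in> S \<and> g \<in> S" for f g
  proof (rule dist_bound)
    fix s
    have "norm (T f s - T g s) \<le> dist f g / 2"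
      using that dist_bounded[of f _ g] by (intro lip) (auto simp: S_def dist_norm)
    then show "dist (F f s) (F g s) \<le> 1/2 * dist f g"
      using that appF by (simp add: dist_norm)
  qed
  ultimately have "\<exists>!f. f \<in> S \<and> F f = f"
    using Banach_fix[of S "1/2" F] by auto
  then obtain f where f: "f \<in> S" "F f = f" by auto
  show ?thesis
    by (rule that[of "apply_bcontfun f"]) (use f appF[of f] in \<open>auto simp: S_def\<close>)
qed

subsection \<open>Exponentials of endomorphisms\<close>

text \<open>Bounded linear functions are not an instance of the algebra classes for which \<open>exp\<close> is defined;
  this copy of the type is.\<close>

typedef (overloaded) 'a endo = "UNIV :: ('a::euclidean_space \<Rightarrow>\<^sub>L 'a) set"
  morphisms the_endo Endo by simp

instantiation endo :: (euclidean_space) real_normed_algebra_1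
begin

definition "0 = Endo 0"
definition "1 = Endo id_blinfun"
definition "f + g = Endo (the_endo f + the_endo g)"
definition "f - g = Endo (the_endo f - the_endo g)"
definition "- f = Endo (- the_endo f)"
definition "f * g = Endo (the_endo f o\<^sub>L the_endo g)"
definition "r *\<^sub>R f = Endo (r *\<^sub>R the_endo f)"
definition "norm f = norm (the_endo f)"
definition "dist (f :: 'a endo) g = norm (f - g)"
definition "sgn (f :: 'a endo) = inverse (norm f) *\<^sub>R f"
definition "uniformity = (INF e\<in>{0 <..}. principal {(f :: 'a endo, g). dist f g < e})"
definition "open (U :: 'a endo set) \<longleftrightarrow>
  (\<forall>x\<in>U. eventually (\<lambda>(x', y). x' = x \<longrightarrow> y \<in> U) uniformity)"

lemmas endo_defs = zero_endo_def one_endo_def plus_endo_def minus_endo_def uminus_endo_def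
  times_endo_def scaleR_endo_def norm_endo_def

lemma the_endo_Endo [simp]: "the_endo (Endo f) = f"
  by (rule Endo_inverse) simp

lemma endo_eq_iff: "f = g \<longleftrightarrow> the_endo f = the_endo g"
  by (simp add: the_endo_inject)

lemma the_endo_simps [simp]:
  "the_endo 0 = 0" "the_endo 1 = id_blinfun" "the_endo (f + g) = the_endo f + the_endo g"
  "the_endo (f - g) = the_endo f - the_endo g" "the_endo (- f) = - the_endo f"
  "the_endo (f * g) = the_endo f o\<^sub>L the_endo g" "the_endo (r *\<^sub>R f) = r *\<^sub>R the_endo f"
  by (simp_all add: endo_defs)

instance
proof
  fix f g h :: "'a endo" and r q :: real
  show "uniformity = (INF e\<in>{0 <..}. principal {(f :: 'a endo, g). dist f g < e})"
    by (rule uniformity_endo_def)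
  show "open U \<longleftrightarrow> (\<forall>x\<in>U. \<forall>\<^sub>F (x', y) in uniformity. x' = x \<longrightarrow> y \<in> U)" for U :: "'a endo set"
    by (rule open_endo_def)
  show "dist f g = norm (f - g)" by (rule dist_endo_def)
  show "sgn f = inverse (norm f) *\<^sub>R f" by (rule sgn_endo_def)
  show "norm (f * g) \<le> norm f * norm g"
    by (simp add: norm_endo_def norm_blinfun_compose)
  show "norm (1 :: 'a endo) = 1" by (simp add: norm_endo_def)
  show "(norm f = 0) = (f = 0)" by (simp add: norm_endo_def endo_eq_iff)
  show "norm (f + g) \<le> norm f + norm g" by (simp add: norm_endo_def norm_triangle_ineq)
  show "norm (r *\<^sub>R f) = \<bar>r\<bar> * norm f" by (simp add: norm_endo_def)
  show "(0::'a endo) \<noteq> 1"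
  proof
    assume "(0::'a endo) = 1"
    then have "norm (0 :: 'a \<Rightarrow>\<^sub>L 'a) = norm (id_blinfun :: 'a \<Rightarrow>\<^sub>L 'a)" by (simp add: endo_eq_iff)
    then show False by (metis norm_zero norm_blinfun_id zero_neq_one)
  qed
qed (auto simp: endo_eq_iff blinfun_eqI algebra_simps blinfun.bilinear_simps intro!: blinfun_eqI)

end

instance endo :: (euclidean_space) banach
proof
  fix X :: "nat \<Rightarrow> 'a endo" assume "Cauchy X"
  then have "Cauchy (\<lambda>n. the_endo (X n))"
    by (simp add: Cauchy_def dist_norm norm_endo_def)
  then obtain L where "(\<lambda>n. the_endo (X n)) \<longlonglongrightarrow> L" using convergent_eq_Cauchy by blast
  then have "X \<longlonglongrightarrow> Endo L"
    unfolding lim_sequentially by (simp add: dist_norm norm_endo_def)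
  then show "convergent X" by (auto simp: convergent_def)
qed

lemma bounded_linear_the_endo: "bounded_linear the_endo"
  by (rule bounded_linear_intro[of _ 1]) (auto simp: norm_endo_def)

subsection \<open>Linear differential equations and primitives\<close>

text \<open>The flow is the exponential of \<open>s *\<^sub>R A\<close>. The four listed properties
  are all that variation of constants and uniqueness require of it.\<close>

lemma linear_flow:
  fixes A :: "'a::euclidean_space \<Rightarrow>\<^sub>L 'a"
  obtains \<Phi> :: "real \<Rightarrow> 'a \<Rightarrow>\<^sub>L 'a"
  where "\<Phi> 0 = id_blinfun" "\<And>s. (\<Phi> has_vector_derivative (A o\<^sub>L \<Phi> s)) (at s)"
    "\<And>s. A o\<^sub>L \<Phi> s = \<Phi> s o\<^sub>L A" "\<And>s x. \<Phi> s (\<Phi> (- s) x) = x"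
proof (rule that[of "\<lambda>s. the_endo (exp (s *\<^sub>R Endo A))"])
  fix s x
  have "((\<lambda>s. the_endo (exp (s *\<^sub>R Endo A))) has_vector_derivative the_endo (Endo A * exp (s *\<^sub>R Endo A))) (at s)"
    by (intro bounded_linear.has_vector_derivative[OF bounded_linear_the_endo]
        exp_scaleR_has_vector_derivative_left)
  then show "((\<lambda>s. the_endo (exp (s *\<^sub>R Endo A))) has_vector_derivative
      (A o\<^sub>L the_endo (exp (s *\<^sub>R Endo A)))) (at s)" by simp
  have "the_endo (Endo A * exp (s *\<^sub>R Endo A)) = the_endo (exp (s *\<^sub>R Endo A) * Endo A)"
    by (simp only: exp_times_scaleR_commute)
  then show "A o\<^sub>L the_endo (exp (s *\<^sub>R Endo A)) = the_endo (exp (s *\<^sub>R Endo A)) o\<^sub>L A" by simp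
  have "exp (s *\<^sub>R Endo A) * exp (- (s *\<^sub>R Endo A)) = 1" by (rule exp_minus_inverse)
  then have "the_endo (exp (s *\<^sub>R Endo A)) o\<^sub>L the_endo (exp ((- s) *\<^sub>R Endo A)) = id_blinfun"
    by (simp add: endo_eq_iff)
  then show "the_endo (exp (s *\<^sub>R Endo A)) (the_endo (exp ((- s) *\<^sub>R Endo A)) x) = x"
    by (metis blinfun_apply_blinfun_compose id_blinfun.rep_eq)
qed simp

lemma zero_derivative_const:
  fixes f :: "real \<Rightarrow> 'a::real_normed_vector"
  assumes "\<And>s. (f has_vector_derivative 0) (at s)"
  shows "f s = f r"
proof -
  have "\<exists>c. \<forall>s. f s = c"
    using has_derivative_zero_constant[of UNIV f] assms by (auto simp: has_vector_derivative_def)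
  then show ?thesis by metis
qed

lemma bounded_derivative_lipschitz:
  fixes f :: "real \<Rightarrow> 'a::real_normed_vector"
  assumes "\<And>s. s \<in> {a..b} \<Longrightarrow> (f has_vector_derivative f' s) (at s)"
    and "\<And>s. s \<in> {a..b} \<Longrightarrow> norm (f' s) \<le> B" and "s \<in> {a..b}" "r \<in> {a..b}"
  shows "norm (f s - f r) \<le> B * \<bar>s - r\<bar>"
proof -
  have "norm (f s - f r) \<le> B * norm (s - r)"
  proof (rule differentiable_bound[of "{a..b}" f "\<lambda>s h. h *\<^sub>R f' s"])
    fix x assume x: "x \<in> {a..b}"
    show "(f has_derivative (\<lambda>h. h *\<^sub>R f' x)) (at x within {a..b})"
      using assms(1)[OF x] has_vector_derivative_at_within unfolding has_vector_derivative_def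
      by (metis has_derivative_at_withinI)
    have "norm (h *\<^sub>R f' x) \<le> B * norm h" for h
      using mult_right_mono[OF assms(2)[OF x], of "norm h"] by (simp add: mult.commute)
    then show "onorm (\<lambda>h. h *\<^sub>R f' x) \<le> B" by (rule onorm_le)
  qed (use assms in auto)
  then show ?thesis by simp
qed

lemma continuous_antiderivative:
  fixes h :: "real \<Rightarrow> 'a::euclidean_space"
  assumes "continuous_on UNIV h"
  obtains H where "H 0 = 0" "\<And>s. (H has_vector_derivative h s) (at s)"
proof -
  have "\<exists>F. \<forall>x :: real. -\<infinity> < ereal x \<longrightarrow> ereal x < \<infinity> \<longrightarrow> (F has_vector_derivative h x) (at x)"
    using assms by (intro einterval_antiderivative) (auto simp: continuous_on_eq_continuous_at)
  then obtain F where F: "\<And>x. (F has_vector_derivative h x) (at x)" by auto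
  have "((\<lambda>s. F s - F 0) has_vector_derivative h x) (at x)" for x
    using F[of x] has_vector_derivative_diff_const by (auto intro: derivative_eq_intros)
  then show ?thesis using that[of "\<lambda>s. F s - F 0"] by auto
qed

lemma has_integral_antiderivative:
  fixes h :: "real \<Rightarrow> 'a::euclidean_space"
  assumes "\<And>s. (H has_vector_derivative h s) (at s)" "a \<le> b"
  shows "(h has_integral (H b - H a)) {a..b}"
  using assms by (intro fundamental_theorem_of_calculus) (auto intro: has_vector_derivative_at_within)

lemma periodic_reduce:
  fixes f :: "real \<Rightarrow> 'a"
  assumes "T > 0" "\<And>s. f (s + T) = f s"
  obtains r where "r \<in> {0..T}" "f s = f r"
proof -
  have nat: "f (s + real n * T) = f s" for s n
  proof (induction n)
    case (Suc n)
    have "f (s + real (Suc n) * T) = f ((s + real n * T) + T)" by (simp add: algebra_simps)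
    with Suc show ?case using assms(2) by simp
  qed simp
  have int: "f (s + of_int k * T) = f s" for k
  proof (cases "k \<ge> 0")
    case True
    then show ?thesis using nat[of s "nat k"] by simp
  next
    case False
    then show ?thesis using nat[of "s + of_int k * T" "nat (-k)"] by simp
  qed
  define k where "k = \<lfloor>s / T\<rfloor>"
  have "of_int k \<le> s / T" "s / T \<le> of_int k + 1" unfolding k_def by linarith+
  then have "of_int k * T \<le> s" "s \<le> (of_int k + 1) * T"
    using assms(1) by (simp_all add: field_simps)
  then show ?thesis
    using that[of "s + of_int (- k) * T"] int[of "- k"] by (auto simp: algebra_simps)
qed

text \<open>Transported back by the flow, \<open>\<Phi> (- s) (z s)\<close> has derivative zero,
  since \<open>A\<close> commutes with its exponential.\<close>

lemma linear_ode_unique: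
  fixes A :: "'a::euclidean_space \<Rightarrow>\<^sub>L 'a"
  assumes z: "\<And>s. (z has_vector_derivative A (z s)) (at s)" and z0: "z 0 = 0"
  shows "z s = 0"
proof -
  obtain \<Phi> where \<Phi>: "\<Phi> 0 = id_blinfun" "\<And>s. (\<Phi> has_vector_derivative (A o\<^sub>L \<Phi> s)) (at s)"
    "\<And>s. A o\<^sub>L \<Phi> s = \<Phi> s o\<^sub>L A" "\<And>s x. \<Phi> s (\<Phi> (- s) x) = x"
    using linear_flow[of A] by blast
  have d: "((\<lambda>s. \<Phi> (- s)) has_vector_derivative - (\<Phi> (- s) o\<^sub>L A)) (at s)" for s
  proof -
    have "((\<Phi> \<circ> uminus) has_vector_derivative (-1) *\<^sub>R (A o\<^sub>L \<Phi> (- s))) (at s)"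
      by (rule vector_diff_chain_at)
        (use \<Phi>(2)[of "- s"] in \<open>auto intro!: derivative_eq_intros simp: has_real_derivative_iff_has_vector_derivative[symmetric]\<close>)
    then show ?thesis by (simp add: o_def \<Phi>(3))
  qed
  have "((\<lambda>s. \<Phi> (- s) (z s)) has_vector_derivative 0) (at s)" for s
    using bounded_bilinear.has_vector_derivative[OF bounded_bilinear_blinfun_apply d z]
    by (simp add: blinfun.bilinear_simps)
  then have "\<Phi> (- s) (z s) = \<Phi> (- 0) (z 0)" by (rule zero_derivative_const)
  then have "\<Phi> (- s) (z s) = 0" using z0 by (simp add: blinfun.bilinear_simps)
  then have "\<Phi> s (\<Phi> (- s) (z s)) = 0" by (simp add: blinfun.bilinear_simps)
  then show ?thesis using \<Phi>(4) by simp
qed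

text \<open>Variation of constants turns the periodic problem into a linear system for the initial
  value and the multiplier: return after time \<theta>, together with the normalisation by
  \<open>lf\<close>. This system is square, and \<open>nd\<close> says that it is injective, hence
  it is solvable with a bound independent of the right-hand side. The last conclusion is stated for
  differences because that is what a contraction consumes.\<close>

lemma periodic_green_operator:
  fixes A :: "'a::euclidean_space \<Rightarrow>\<^sub>L 'a" and lf :: "'a \<Rightarrow> real" and e :: 'a
  assumes lf: "linear lf" and \<theta>: "\<theta> > 0"
    and nd: "\<And>z l. (\<And>s. (z has_vector_derivative A (z s) + l *\<^sub>R e) (at s)) \<Longrightarrow>
      (\<And>s. z (s + \<theta>) = z s) \<Longrightarrow> lf (z 0) = 0 \<Longrightarrow> l = 0 \<and> (\<forall>s. z s = 0)"
  obtains C Z \<Lambda> where "C \<ge> 0"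
    "\<And>h s. continuous_on UNIV h \<Longrightarrow> (\<And>s. h (s + \<theta>) = h s) \<Longrightarrow>
      (Z h has_vector_derivative A (Z h s) + h s + \<Lambda> h *\<^sub>R e) (at s)"
    "\<And>h s. continuous_on UNIV h \<Longrightarrow> (\<And>s. h (s + \<theta>) = h s) \<Longrightarrow> Z h (s + \<theta>) = Z h s"
    "\<And>h B s. continuous_on UNIV h \<Longrightarrow> (\<And>s. h (s + \<theta>) = h s) \<Longrightarrow> (\<And>s. norm (h s) \<le> B) \<Longrightarrow>
      norm (Z h s) \<le> C * B"
    "\<And>h k B s. continuous_on UNIV h \<Longrightarrow> (\<And>s. h (s + \<theta>) = h s) \<Longrightarrow>
      continuous_on UNIV k \<Longrightarrow> (\<And>s. k (s + \<theta>) = k s) \<Longrightarrow> (\<And>s. norm (h s - k s) \<le> B) \<Longrightarrow>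
      norm (Z h s - Z k s) \<le> C * B"
proof -
  obtain \<Phi> where \<Phi>: "\<Phi> 0 = id_blinfun" "\<And>s. (\<Phi> has_vector_derivative (A o\<^sub>L \<Phi> s)) (at s)"
    "\<And>s. A o\<^sub>L \<Phi> s = \<Phi> s o\<^sub>L A" "\<And>s x. \<Phi> s (\<Phi> (- s) x) = x"
    using linear_flow[of A] by blast
  have c\<Phi>: "continuous_on S \<Phi>" for S
    using \<Phi>(2) by (meson continuous_at_imp_continuous_on has_vector_derivative_continuous)
  have c\<Phi>': "continuous_on UNIV (\<lambda>s. \<Phi> (- s) (h s))" if "continuous_on UNIV h" for h
    using that by (intro continuous_intros continuous_on_compose2[OF c\<Phi>]) auto
  have var: "((\<lambda>s. \<Phi> s (x + H s)) has_vector_derivative A (\<Phi> s (x + H s)) + h s) (at s)"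
    if "\<And>s. (H has_vector_derivative \<Phi> (- s) (h s)) (at s)" for H h x s
  proof -
    have "((\<lambda>s. x + H s) has_vector_derivative \<Phi> (- s) (h s)) (at s)"
      using that by (auto intro!: derivative_eq_intros)
    from bounded_bilinear.has_vector_derivative[OF bounded_bilinear_blinfun_apply \<Phi>(2) this]
    show ?thesis by (simp add: \<Phi>(4) add.commute)
  qed
  \<comment> \<open>A return to the initial value suffices for periodicity: the difference of
    \<open>z\<close> and its translate solves the homogeneous equation and vanishes at 0.\<close>
  have per: "z (s + \<theta>) = z s"
    if z: "\<And>s. (z has_vector_derivative A (z s) + h s) (at s)" "z \<theta> = z 0"
      and h: "\<And>s. h (s + \<theta>) = h s" for z h s
  proof -
    have "((\<lambda>s. z (s + \<theta>) - z s) has_vector_derivative A (z (s + \<theta>) - z s)) (at s)" for s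
    proof -
      have "((z \<circ> (\<lambda>s. s + \<theta>)) has_vector_derivative 1 *\<^sub>R (A (z (s + \<theta>)) + h (s + \<theta>))) (at s)"
        by (rule vector_diff_chain_at)
          (use z(1)[of "s + \<theta>"] in \<open>auto intro!: derivative_eq_intros\<close>)
      then have "((\<lambda>s. z (s + \<theta>)) has_vector_derivative A (z (s + \<theta>)) + h s) (at s)"
        by (simp add: o_def h)
      from has_vector_derivative_diff[OF this z(1)]
      show ?thesis by (simp add: blinfun.bilinear_simps)
    qed
    from linear_ode_unique[OF this] show ?thesis using z(2) by simp
  qed
  \<comment> \<open>\<open>E\<close> is the share of a unit multiplier in the variation of constants
    formula.\<close>
  obtain E where E: "E 0 = 0" "\<And>s. (E has_vector_derivative \<Phi> (- s) e) (at s)"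
    using continuous_antiderivative[OF c\<Phi>'[of "\<lambda>s. e"]] by auto
  have lE: "((\<lambda>s. l *\<^sub>R E s) has_vector_derivative \<Phi> (- s) (l *\<^sub>R e)) (at s)" for l s
    using E(2)[of s] by (auto intro!: derivative_eq_intros simp: blinfun.bilinear_simps)
  \<comment> \<open>The first component is the defect of periodicity of the solution with initial
    value \<open>fst p\<close> and multiplier \<open>snd p\<close>, the second its
    normalisation.\<close>
  define F where "F p = (\<Phi> \<theta> (fst p + snd p *\<^sub>R E \<theta>) - fst p, lf (fst p))" for p :: "'a \<times> real"
  have linF: "linear F"
    unfolding F_def using linear_add[OF lf] linear_scale[OF lf]
    by (intro linearI) (auto simp: blinfun.bilinear_simps algebra_simps)
  have "inj F"
    unfolding linear_injective_0[OF linF]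
  proof safe
    fix x l assume "F (x, l) = 0"
    then have Fx: "\<Phi> \<theta> (x + l *\<^sub>R E \<theta>) = x" "lf x = 0" by (auto simp: F_def zero_prod_def)
    define z where "z s = \<Phi> s (x + l *\<^sub>R E s)" for s
    have z: "(z has_vector_derivative A (z s) + l *\<^sub>R e) (at s)" for s
      unfolding z_def by (rule var[OF lE])
    have z0: "z 0 = x" "z \<theta> = z 0" using Fx E \<Phi>(1) by (auto simp: z_def)
    have "l = 0 \<and> (\<forall>s. z s = 0)"
      using z per[OF z z0(2)] z0 Fx(2) by (intro nd) auto
    then show "(x, l) = 0" using z0 by (auto simp: zero_prod_def)
  qed
  then obtain G where G: "linear G" "\<And>p. F (G p) = p"
    using linear_injective_isomorphism[OF linF] by auto
  obtain K where K: "K \<ge> 0" "\<And>p. norm (G p) \<le> K * norm p"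
    using linear_bounded_pos[OF G(1)] by (metis less_imp_le)
  obtain M where M: "M \<ge> 0" "\<And>s. s \<in> {-\<theta>..\<theta>} \<Longrightarrow> norm (\<Phi> s) \<le> M"
  proof -
    have "bounded (\<Phi> ` {-\<theta>..\<theta>})" by (intro compact_imp_bounded compact_continuous_image c\<Phi>) auto
    then obtain b where "\<forall>x\<in>\<Phi> ` {-\<theta>..\<theta>}. norm x \<le> b" unfolding bounded_iff by blast
    then have "\<And>s. s \<in> {-\<theta>..\<theta>} \<Longrightarrow> norm (\<Phi> s) \<le> max b 0" by (simp add: le_max_iff_disj)
    then show ?thesis using that[of "max b 0"] by auto
  qed
  have MB: "norm (H s) \<le> M * b * \<theta>"
    if "H 0 = 0" "\<And>s. (H has_vector_derivative \<Phi> (- s) (h s)) (at s)" "\<And>s. norm (h s) \<le> b" "s \<in> {0..\<theta>}"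
    for H h b s
  proof -
    have b: "b \<ge> 0" using that(3)[of 0] norm_ge_zero order_trans by blast
    have "norm (H s - H 0) \<le> (M * b) * \<bar>s - 0\<bar>"
    proof (rule bounded_derivative_lipschitz[of 0 \<theta>])
      fix s assume "s \<in> {0..\<theta>}"
      then have "norm (\<Phi> (- s) (h s)) \<le> M * b"
        using \<theta> by (intro order_trans[OF norm_blinfun] mult_mono M that) auto
      then show "norm (\<Phi> (- s) (h s)) \<le> M * b" .
    qed (use that \<theta> in auto)
    also have "\<dots> \<le> (M * b) * \<theta>" using that(4) M b by (intro mult_left_mono) auto
    finally show ?thesis using that(1) by simp
  qed
  \<comment> \<open>Here \<open>M\<close> bounds the flow over one period and \<open>K\<close> the
    inverse of \<open>F\<close>. For a right-hand side of norm at most 1 the three summands bound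
    the initial value, the multiplier times \<open>E\<close>, and the primitive of the transported
    right-hand side.\<close>
  define C where "C = M * (K * (M * (M * \<theta>)) + K * (M * (M * \<theta>)) * (M * norm e * \<theta>) + M * \<theta>)"
  have C: "C \<ge> 0" unfolding C_def using M K \<theta> by (intro mult_nonneg_nonneg add_nonneg_nonneg) auto
  have ex: "\<exists>z l. (\<forall>s. (z has_vector_derivative A (z s) + h s + l *\<^sub>R e) (at s)) \<and>
      (\<forall>s. z (s + \<theta>) = z s) \<and> lf (z 0) = 0 \<and> (\<forall>B. (\<forall>s. norm (h s) \<le> B) \<longrightarrow> (\<forall>s. norm (z s) \<le> C * B))"
    if h: "continuous_on UNIV h" "\<And>s. h (s + \<theta>) = h s" for h
  proof -
    obtain H where H: "H 0 = 0" "\<And>s. (H has_vector_derivative \<Phi> (- s) (h s)) (at s)"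
      using continuous_antiderivative[OF c\<Phi>'[OF h(1)]] by auto
    define x l where "x = fst (G (- \<Phi> \<theta> (H \<theta>), 0))" and "l = snd (G (- \<Phi> \<theta> (H \<theta>), 0))"
    have "F (x, l) = (- \<Phi> \<theta> (H \<theta>), 0)" using G(2) by (simp add: x_def l_def)
    then have xl: "\<Phi> \<theta> (x + (l *\<^sub>R E \<theta> + H \<theta>)) = x" "lf x = 0"
      by (auto simp: F_def blinfun.bilinear_simps algebra_simps)
    have sum: "((\<lambda>s. l *\<^sub>R E s + H s) has_vector_derivative \<Phi> (- s) (h s + l *\<^sub>R e)) (at s)" for s
      using has_vector_derivative_add[OF lE[of l s] H(2)[of s]] by (simp add: blinfun.bilinear_simps add.commute)
    define z where "z s = \<Phi> s (x + (l *\<^sub>R E s + H s))" for s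
    have z: "(z has_vector_derivative A (z s) + (h s + l *\<^sub>R e)) (at s)" for s
      unfolding z_def by (rule var[OF sum])
    have z0: "z 0 = x" "z \<theta> = z 0" using xl E H \<Phi>(1) by (auto simp: z_def)
    have zp: "z (s + \<theta>) = z s" for s by (rule per[OF z z0(2)]) (simp add: h)
    have "norm (z s) \<le> C * B" if B: "\<forall>s. norm (h s) \<le> B" for B s
    proof -
      obtain r where r: "r \<in> {0..\<theta>}" "z s = z r" using periodic_reduce[of \<theta> z s, OF \<theta> zp] by blast
      have Bp: "B \<ge> 0" using B norm_ge_zero order_trans by blast
      have Hr: "norm (H r) \<le> M * B * \<theta>" if "r \<in> {0..\<theta>}" for r
        using MB[OF H _ that] B by auto
      have Er: "norm (E r) \<le> M * norm e * \<theta>" using MB[OF E _ r(1)] by auto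
      have "norm (- \<Phi> \<theta> (H \<theta>)) \<le> M * (M * B * \<theta>)"
        unfolding norm_minus_cancel
        using \<theta> M by (intro order_trans[OF norm_blinfun] mult_mono Hr) auto
      then have "norm (G (- \<Phi> \<theta> (H \<theta>), 0)) \<le> K * (M * (M * B * \<theta>))"
        using K by (intro order_trans[OF K(2)] mult_left_mono) (auto simp: norm_Pair)
      then have x: "norm x \<le> K * (M * (M * B * \<theta>))" and l: "\<bar>l\<bar> \<le> K * (M * (M * B * \<theta>))"
        unfolding x_def l_def
        using norm_fst_le[of "fst (G (- \<Phi> \<theta> (H \<theta>), 0))" "snd (G (- \<Phi> \<theta> (H \<theta>), 0))"]
          norm_snd_le[of "snd (G (- \<Phi> \<theta> (H \<theta>), 0))" "fst (G (- \<Phi> \<theta> (H \<theta>), 0))"]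
        unfolding prod.collapse real_norm_def by linarith+
      have lEr: "norm (l *\<^sub>R E r) \<le> K * (M * (M * B * \<theta>)) * (M * norm e * \<theta>)"
        using l Er unfolding norm_scaleR by (intro mult_mono) auto
      have "norm (x + (l *\<^sub>R E r + H r)) \<le> norm x + (norm (l *\<^sub>R E r) + norm (H r))"
        by (meson norm_triangle_ineq order_trans add_left_mono)
      also have "\<dots> \<le> K * (M * (M * B * \<theta>)) + (K * (M * (M * B * \<theta>)) * (M * norm e * \<theta>) + M * B * \<theta>)"
        by (intro add_mono x lEr Hr r)
      finally have "norm (z r) \<le> M * (K * (M * (M * B * \<theta>)) + (K * (M * (M * B * \<theta>)) * (M * norm e * \<theta>) + M * B * \<theta>))"
        unfolding z_def using r \<theta> M by (intro order_trans[OF norm_blinfun] mult_mono) auto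
      also have "\<dots> = C * B" by (simp add: C_def algebra_simps)
      finally show ?thesis using r by simp
    qed
    then show ?thesis using z zp z0 xl by (intro exI[of _ z] exI[of _ l]) (auto simp: add.assoc)
  qed
  define ok where "ok h \<longleftrightarrow> continuous_on UNIV h \<and> (\<forall>s. h (s + \<theta>) = h s)" for h :: "real \<Rightarrow> 'a"
  have "\<forall>h. \<exists>z l. ok h \<longrightarrow> (\<forall>s. (z has_vector_derivative A (z s) + h s + l *\<^sub>R e) (at s)) \<and>
      (\<forall>s. z (s + \<theta>) = z s) \<and> lf (z 0) = 0 \<and> (\<forall>B. (\<forall>s. norm (h s) \<le> B) \<longrightarrow> (\<forall>s. norm (z s) \<le> C * B))"
    using ex unfolding ok_def by blast
  then obtain Z where "\<forall>h. \<exists>l. ok h \<longrightarrow> (\<forall>s. (Z h has_vector_derivative A (Z h s) + h s + l *\<^sub>R e) (at s)) \<and>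
      (\<forall>s. Z h (s + \<theta>) = Z h s) \<and> lf (Z h 0) = 0 \<and> (\<forall>B. (\<forall>s. norm (h s) \<le> B) \<longrightarrow> (\<forall>s. norm (Z h s) \<le> C * B))"
    unfolding choice_iff by blast
  then obtain \<Lambda> where Z: "\<And>h. ok h \<Longrightarrow> (\<forall>s. (Z h has_vector_derivative A (Z h s) + h s + \<Lambda> h *\<^sub>R e) (at s)) \<and>
      (\<forall>s. Z h (s + \<theta>) = Z h s) \<and> lf (Z h 0) = 0 \<and> (\<forall>B. (\<forall>s. norm (h s) \<le> B) \<longrightarrow> (\<forall>s. norm (Z h s) \<le> C * B))"
    unfolding choice_iff by blast
  have diff: "norm (Z h s - Z k s) \<le> C * B" if "ok h" "ok k" "\<And>s. norm (h s - k s) \<le> B" for h k B s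
  proof -
    let ?d = "\<lambda>s. h s - k s"
    have okd: "ok ?d" using that by (auto simp: ok_def intro!: continuous_intros)
    \<comment> \<open>\<open>Z\<close> is chosen separately for each right-hand side and is not
      known to be linear. The defect of additivity solves the homogeneous problem with some
      multiplier, so \<open>nd\<close> makes it vanish.\<close>
    define w where "w s = Z h s - Z k s - Z ?d s" for s
    have dw: "(w has_vector_derivative A (w s) + (\<Lambda> h - \<Lambda> k - \<Lambda> ?d) *\<^sub>R e) (at s)" for s
    proof -
      have 1: "(Z h has_vector_derivative A (Z h s) + h s + \<Lambda> h *\<^sub>R e) (at s)"
        and 2: "(Z k has_vector_derivative A (Z k s) + k s + \<Lambda> k *\<^sub>R e) (at s)"
        and 3: "(Z ?d has_vector_derivative A (Z ?d s) + ?d s + \<Lambda> ?d *\<^sub>R e) (at s)"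
        using Z that okd by blast+
      have "A (w s) + (\<Lambda> h - \<Lambda> k - \<Lambda> ?d) *\<^sub>R e =
        A (Z h s) + h s + \<Lambda> h *\<^sub>R e - (A (Z k s) + k s + \<Lambda> k *\<^sub>R e) - (A (Z ?d s) + ?d s + \<Lambda> ?d *\<^sub>R e)"
        by (simp add: w_def blinfun.bilinear_simps algebra_simps)
      then show ?thesis
        unfolding w_def using has_vector_derivative_diff[OF has_vector_derivative_diff[OF 1 2] 3]
        by (simp only: w_def)
    qed
    have "w (s + \<theta>) = w s" for s using Z that okd by (simp add: w_def)
    moreover have "lf (w 0) = 0"
      using Z that okd linear_diff[OF lf] by (simp add: w_def)
    ultimately have "w s = 0" using nd[OF dw] by blast
    then have "Z h s - Z k s = Z ?d s" by (simp add: w_def)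
    then show ?thesis using Z[OF okd] that(3) by simp
  qed
  show ?thesis
    by (rule that[OF C, of Z \<Lambda>]) (use Z diff in \<open>auto simp: ok_def\<close>)
qed

text \<open>With a primitive \<open>H\<close>, the difference \<open>H (s + T) - H s\<close> has
  derivative \<open>h (s + T) - h s\<close>, which is 0.\<close>

lemma integral_period_shift:
  fixes h :: "real \<Rightarrow> 'a::euclidean_space"
  assumes h: "continuous_on UNIV h" "\<And>s. h (s + T) = h s" and T: "T > 0"
  shows "integral {0..T} (\<lambda>s. h (s + c)) = integral {0..T} h"
proof -
  obtain H where H: "\<And>s. (H has_vector_derivative h s) (at s)"
    using continuous_antiderivative[OF h(1)] by blast
  have shift: "((\<lambda>s. H (s + d)) has_vector_derivative h (s + d)) (at s)" for d s
  proof -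
    have "((H \<circ> (\<lambda>s. s + d)) has_vector_derivative 1 *\<^sub>R h (s + d)) (at s)"
      by (rule vector_diff_chain_at) (use H in \<open>auto intro!: derivative_eq_intros\<close>)
    then show ?thesis by (simp add: o_def)
  qed
  have "((\<lambda>s. H (s + T) - H s) has_vector_derivative 0) (at s)" for s
    using has_vector_derivative_diff[OF shift[of T s] H[of s]] by (simp add: h)
  then have "H (c + T) - H c = H (0 + T) - H 0" by (rule zero_derivative_const)
  moreover have "((\<lambda>s. h (s + c)) has_integral (H (T + c) - H (0 + c))) {0..T}"
    by (rule has_integral_antiderivative[OF shift]) (use T in auto)
  moreover have "(h has_integral (H T - H 0)) {0..T}"
    by (rule has_integral_antiderivative[OF H]) (use T in auto)
  ultimately show ?thesis by (simp add: integral_unique add.commute)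
qed

subsection \<open>Averaging with a symmetry\<close>

text \<open>In the application \<open>g\<close> rotates and relabels the outer bodies, \<theta> is
  one step of the symmetry and \<open>T\<close> the full period \<open>m * \<theta>\<close>.\<close>

definition symmetric_path :: "('a::real_normed_vector \<Rightarrow> 'a) \<Rightarrow> real \<Rightarrow> real \<Rightarrow> (real \<Rightarrow> 'a) \<Rightarrow> bool" where
  "symmetric_path g \<theta> T h \<longleftrightarrow>
     continuous_on UNIV h \<and> (\<forall>s. h (s + \<theta>) = g (h s)) \<and> (\<forall>s. h (s + T) = h s)"

definition mean :: "real \<Rightarrow> (real \<Rightarrow> 'a::euclidean_space) \<Rightarrow> 'a" where
  "mean T h = (1 / T) *\<^sub>R integral {0..T} h"

lemma continuous_integrable:
  fixes h :: "real \<Rightarrow> 'a::euclidean_space"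
  shows "continuous_on UNIV h \<Longrightarrow> h integrable_on {a..b}"
  by (intro integrable_continuous_real) (auto intro: continuous_on_subset)

lemma mean_diff:
  assumes "continuous_on UNIV h" "continuous_on UNIV k"
  shows "mean T (\<lambda>s. h s - k s) = mean T h - mean T k"
  unfolding mean_def
  using integral_diff[OF continuous_integrable[OF assms(1)] continuous_integrable[OF assms(2)]]
  by (simp add: scaleR_diff_right)

lemma mean_add:
  assumes "continuous_on UNIV h" "continuous_on UNIV k"
  shows "mean T (\<lambda>s. h s + k s) = mean T h + mean T k"
  unfolding mean_def
  using integral_add[OF continuous_integrable[OF assms(1)] continuous_integrable[OF assms(2)]]
  by (simp add: scaleR_add_right)

lemma mean_const: "T > 0 \<Longrightarrow> mean T (\<lambda>s. c) = c"
  by (simp add: mean_def)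

lemma mean_linear:
  fixes L :: "'a::euclidean_space \<Rightarrow> 'b::euclidean_space"
  assumes "linear L" "continuous_on UNIV h"
  shows "mean T (\<lambda>s. L (h s)) = L (mean T h)"
proof -
  have "integral {0..T} (L \<circ> h) = L (integral {0..T} h)"
    by (rule integral_linear[OF continuous_integrable[OF assms(2)]])
      (use assms(1) in \<open>simp add: linear_conv_bounded_linear\<close>)
  then show ?thesis by (simp add: mean_def o_def linear_scale[OF assms(1)])
qed

lemma norm_mean_le:
  assumes "T > 0" "continuous_on UNIV h" "\<And>s. norm (h s) \<le> B"
  shows "norm (mean T h) \<le> B"
proof -
  have "norm (integral {0..T} h) \<le> integral {0..T} (\<lambda>s. B)"
    by (rule integral_norm_bound_integral) (use assms continuous_integrable in auto)
  then show ?thesis using assms(1) by (simp add: mean_def field_simps)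
qed

text \<open>A mean over a full period does not change under a time shift by \<theta>, while on the
  path this shift acts as \<open>g\<close>. So the constant part of the slow equation can be solved
  among the fixed points of \<open>g\<close>.\<close>

lemma mean_symmetric:
  assumes "symmetric_path g \<theta> T h" "T > 0" "linear g"
  shows "g (mean T h) = mean T h"
proof -
  have h: "continuous_on UNIV h" "\<And>s. h (s + T) = h s" "\<And>s. h (s + \<theta>) = g (h s)"
    using assms(1) by (auto simp: symmetric_path_def)
  have "g (mean T h) = mean T (\<lambda>s. h (s + \<theta>))"
    using mean_linear[OF assms(3) h(1)] by (simp add: h(3))
  also have "\<dots> = mean T h"
    using integral_period_shift[OF h(1,2) assms(2), of \<theta>] by (simp add: mean_def)
  finally show ?thesis .
qed

lemma symmetric_path_diff:
  assumes "symmetric_path g \<theta> T h" "symmetric_path g \<theta> T k" "linear g"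
  shows "symmetric_path g \<theta> T (\<lambda>s. h s - k s)"
  using assms by (auto simp: symmetric_path_def linear_diff intro!: continuous_intros)

text \<open>Normalising the primitive by mean zero makes it inherit the symmetry:
  \<open>H (s + \<theta>) - g (H s)\<close> is constant, hence equal to its own mean, which is 0.
  The factor \<open>2 * T\<close> arises because a difference of two primitives varies by at most
  \<open>T * B\<close> from its value at 0, and mean zero then bounds that value by
  \<open>T * B\<close> as well.\<close>

lemma mean_zero_primitive:
  fixes g :: "'a::euclidean_space \<Rightarrow> 'a"
  assumes g: "linear g" and T: "T > 0"
  obtains P where
    "\<And>h s. symmetric_path g \<theta> T h \<Longrightarrow> mean T h = 0 \<Longrightarrow> (P h has_vector_derivative h s) (at s)"
    "\<And>h. symmetric_path g \<theta> T h \<Longrightarrow> mean T h = 0 \<Longrightarrow> symmetric_path g \<theta> T (P h) \<and> mean T (P h) = 0"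
    "\<And>h k B s. symmetric_path g \<theta> T h \<Longrightarrow> mean T h = 0 \<Longrightarrow> symmetric_path g \<theta> T k \<Longrightarrow> mean T k = 0 \<Longrightarrow>
      (\<And>s. norm (h s - k s) \<le> B) \<Longrightarrow> norm (P h s - P k s) \<le> 2 * T * B"
proof -
  let ?ok = "\<lambda>h. symmetric_path g \<theta> T h \<and> mean T h = 0"
  have vcont: "continuous_on UNIV H" if "\<And>s. (H has_vector_derivative (h s :: 'a)) (at s)" for H h
    using that by (meson continuous_at_imp_continuous_on has_vector_derivative_continuous)
  have ex: "\<exists>H. (\<forall>s. (H has_vector_derivative h s) (at s)) \<and> ?ok H" if ok: "?ok h" for h
  proof -
    have h: "continuous_on UNIV h" "\<And>s. h (s + T) = h s" "\<And>s. h (s + \<theta>) = g (h s)" "mean T h = 0"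
      using ok by (auto simp: symmetric_path_def)
    obtain G where G: "\<And>s. (G has_vector_derivative h s) (at s)"
      using continuous_antiderivative[OF h(1)] by blast
    define H where "H s = G s - mean T G" for s
    have H: "(H has_vector_derivative h s) (at s)" for s
      unfolding H_def using G[of s] by (auto intro!: derivative_eq_intros)
    have cH: "continuous_on UNIV H" using vcont[OF H] .
    have mH: "mean T H = 0"
      unfolding H_def using mean_diff[OF vcont[OF G], of "\<lambda>s. mean T G"] T by (simp add: mean_const)
    have shift: "((\<lambda>s. H (s + d)) has_vector_derivative h (s + d)) (at s)" for d s
    proof -
      have "((H \<circ> (\<lambda>s. s + d)) has_vector_derivative 1 *\<^sub>R h (s + d)) (at s)"
        by (rule vector_diff_chain_at) (use H in \<open>auto intro!: derivative_eq_intros\<close>)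
      then show ?thesis by (simp add: o_def)
    qed
    have "((\<lambda>s. H (s + T) - H s) has_vector_derivative 0) (at s)" for s
      using has_vector_derivative_diff[OF shift[of T s] H[of s]] by (simp add: h)
    then have "H (s + T) - H s = H (0 + T) - H 0" for s by (rule zero_derivative_const)
    moreover have "(h has_integral (H T - H 0)) {0..T}"
      by (rule has_integral_antiderivative[OF H]) (use T in auto)
    then have "H T - H 0 = 0" using h(4) T by (simp add: mean_def integral_unique)
    ultimately have HT: "H (s + T) = H s" for s by (metis add.left_neutral eq_iff_diff_eq_0)
    have "((\<lambda>s. H (s + \<theta>) - g (H s)) has_vector_derivative 0) (at s)" for s
    proof -
      have "((\<lambda>s. g (H s)) has_vector_derivative g (h s)) (at s)"
        by (rule bounded_linear.has_vector_derivative[OF _ H])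
          (use g in \<open>simp add: linear_conv_bounded_linear\<close>)
      from has_vector_derivative_diff[OF shift[of \<theta> s] this] show ?thesis by (simp add: h)
    qed
    then have const: "H (s + \<theta>) - g (H s) = H (0 + \<theta>) - g (H 0)" for s by (rule zero_derivative_const)
    have cg: "continuous_on UNIV (\<lambda>s. g (H s))"
      using cH g linear_continuous_on_compose by blast
    have cs: "continuous_on UNIV (\<lambda>s. H (s + \<theta>))" using vcont[OF shift] .
    have "H (0 + \<theta>) - g (H 0) = mean T (\<lambda>s. H (s + \<theta>) - g (H s))"
    proof -
      have "(\<lambda>s. H (s + \<theta>) - g (H s)) = (\<lambda>s. H (0 + \<theta>) - g (H 0))" by (rule ext) (rule const)
      then show ?thesis using mean_const[OF T] by metis
    qed
    also have "\<dots> = mean T (\<lambda>s. H (s + \<theta>)) - mean T (\<lambda>s. g (H s))"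
      by (rule mean_diff[OF cs cg])
    also have "\<dots> = mean T H - g (mean T H)"
      using integral_period_shift[OF cH HT T, of \<theta>] mean_linear[OF g cH] by (simp add: mean_def)
    also have "\<dots> = 0" by (simp add: mH linear_0[OF g])
    finally have "H (s + \<theta>) = g (H s)" for s using const[of s] by simp
    then show ?thesis using H HT cH mH by (auto simp: symmetric_path_def)
  qed
  have "\<forall>h. \<exists>H. ?ok h \<longrightarrow> (\<forall>s. (H has_vector_derivative h s) (at s)) \<and> ?ok H" using ex by blast
  then obtain P where P: "\<And>h. ?ok h \<Longrightarrow> (\<forall>s. (P h has_vector_derivative h s) (at s)) \<and> ?ok (P h)"
    unfolding choice_iff by blast
  have "norm (P h s - P k s) \<le> 2 * T * B"
    if h: "?ok h" and k: "?ok k" and B: "\<And>s. norm (h s - k s) \<le> B" for h k B s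
  proof -
    define D where "D s = P h s - P k s" for s
    have D: "(D has_vector_derivative h s - k s) (at s)" for s
      unfolding D_def using P[OF h] P[OF k] by (intro has_vector_derivative_diff) auto
    have cD: "continuous_on UNIV D" using vcont[OF D] .
    have DT: "D (s + T) = D s" for s
      using P[OF h] P[OF k] by (auto simp: D_def symmetric_path_def)
    have mD: "mean T D = 0"
      unfolding D_def using P[OF h] P[OF k] by (subst mean_diff) (auto simp: symmetric_path_def)
    have B0: "B \<ge> 0" using B norm_ge_zero order_trans by blast
    have near: "norm (D s - D 0) \<le> B * T" for s
    proof -
      obtain r where r: "r \<in> {0..T}" "D s = D r" using periodic_reduce[of T D s, OF T DT] by blast
      have "norm (D r - D 0) \<le> B * \<bar>r - 0\<bar>"
        by (rule bounded_derivative_lipschitz[of 0 T]) (use D B r in auto)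
      also have "\<dots> \<le> B * T" using r B0 by (intro mult_left_mono) auto
      finally show ?thesis using r by simp
    qed
    have "norm (mean T (\<lambda>s. D s - D 0)) \<le> B * T"
      by (rule norm_mean_le[OF T _ near]) (intro continuous_intros cD)
    then have "norm (D 0) \<le> B * T"
      using mean_diff[OF cD, of "\<lambda>s. D 0"] mD mean_const[OF T, of "D 0"] by simp
    then have "norm (D s) \<le> 2 * T * B"
      using near[of s] norm_triangle_sub[of "D s" "D 0"] by (simp add: algebra_simps)
    then show ?thesis by (simp add: D_def)
  qed
  then show ?thesis using that[of P] P by blast
qed

section \<open>Periodic solutions of slow-fast systems\<close>

text \<open>By \<open>nd\<close> the matrix \<open>A\<close>, bordered by the column
  \<open>e\<close> and the row \<open>lf\<close>, is injective; it is square, hence invertible. The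
  right-hand side is \<open>- v\<close> because the solution has to cancel a mean force
  \<open>v\<close>.\<close>

lemma bordered_inverse:
  fixes A :: "'a::euclidean_space \<Rightarrow>\<^sub>L 'a"
  assumes lf: "linear lf"
    and nd: "\<And>x l. A x + l *\<^sub>R e = 0 \<Longrightarrow> lf x = 0 \<Longrightarrow> x = 0 \<and> l = (0::real)"
  obtains K S \<Lambda> where "K \<ge> 0" "linear S" "\<And>v. norm (S v) \<le> K * norm v"
    "\<And>v. A (S v) + \<Lambda> v *\<^sub>R e = - v" "\<And>v. lf (S v) = (0::real)"
proof -
  define F where "F p = (A (fst p) + snd p *\<^sub>R e, lf (fst p))" for p :: "'a \<times> real"
  have linF: "linear F"
    unfolding F_def using linear_add[OF lf] linear_scale[OF lf]
    by (intro linearI) (auto simp: blinfun.bilinear_simps algebra_simps)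
  have "inj F"
    unfolding linear_injective_0[OF linF] using nd by (auto simp: F_def zero_prod_def)
  then obtain G where G: "linear G" "\<And>p. F (G p) = p"
    using linear_injective_isomorphism[OF linF] by auto
  obtain K where K: "K \<ge> 0" "\<And>p. norm (G p) \<le> K * norm p"
    using linear_bounded_pos[OF G(1)] by (metis less_imp_le)
  let ?S = "\<lambda>v. fst (G (- v, 0))"
  show ?thesis
  proof (rule that[of K ?S "\<lambda>v. snd (G (- v, 0))"])
    show "linear ?S"
    proof (rule linearI)
      fix v w :: 'a and c :: real
      have "(- (v + w), 0) = (- v, 0) + (- w, 0 :: real)" by simp
      then show "?S (v + w) = ?S v + ?S w" using linear_add[OF G(1)] by (metis fst_add)
      have "(- (c *\<^sub>R v), 0) = c *\<^sub>R (- v, 0 :: real)" by simp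
      then show "?S (c *\<^sub>R v) = c *\<^sub>R ?S v" using linear_scale[OF G(1)] by (metis fst_scaleR)
    qed
    fix v
    show "norm (?S v) \<le> K * norm v"
      using norm_fst_le[of "fst (G (- v, 0))" "snd (G (- v, 0))"] K(2)[of "(- v, 0)"]
      by (simp add: norm_Pair)
    show "A (?S v) + snd (G (- v, 0)) *\<^sub>R e = - v" "lf (?S v) = 0"
      using G(2)[of "(- v, 0)"] by (auto simp: F_def)
  qed (rule K)
qed

lemma norm_fst_le_norm: "norm (fst p) \<le> norm p" and norm_snd_le_norm: "norm (snd p) \<le> norm p"
  by (metis norm_fst_le prod.collapse, metis norm_snd_le prod.collapse)

lemma norm_diff_triangle_ineq':
  fixes x :: "'a::real_normed_vector"
  shows "norm (x - z) \<le> norm (x - y) + norm (y - z)"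
  by (metis dist_norm dist_triangle)

text \<open>The fixed-point map solves the linear fast equation with its Green operator. In the slow equation
  the mean of the right-hand side is removed by choosing the constant part of the slow component with the
  bordered inverse; what is left has mean zero, so its primitive is periodic and carries the small
  factor \<open>dd\<close>.\<close>

theorem averaging_periodic_solutions:
  fixes A0 :: "'a::euclidean_space \<Rightarrow>\<^sub>L 'a" and A1 :: "'b::euclidean_space \<Rightarrow>\<^sub>L 'b"
    and N :: "real \<Rightarrow> real \<Rightarrow> 'a \<times> 'b \<Rightarrow> 'a \<times> 'b" and g :: "'a \<Rightarrow> 'a" and lfa :: "'a \<Rightarrow> real"
  assumes \<theta>: "\<theta> > 0" and m: "m > 0"
    and g: "linear g" "(g ^^ m) = id" "g a0 = a0" "g e0 = e0" "\<And>x. lfa (g x) = lfa x"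
      "\<And>x. A0 (g x) = g (A0 x)"
    and lf: "linear lfa" "linear lfb"
    and nd0: "\<And>x l. A0 x + l *\<^sub>R e0 = 0 \<Longrightarrow> lfa x = 0 \<Longrightarrow> x = 0 \<and> l = (0::real)"
    and nd1: "\<And>z l. (\<And>s. (z has_vector_derivative A1 (z s) + l *\<^sub>R e1) (at s)) \<Longrightarrow>
      (\<And>s. z (s + \<theta>) = z s) \<Longrightarrow> lfb (z 0) = (0::real) \<Longrightarrow> l = 0 \<and> (\<forall>s. z s = 0)"
    and cont: "\<exists>\<rho>>0. \<forall>\<epsilon> y. 0 < \<epsilon> \<longrightarrow> \<epsilon> < \<rho> \<longrightarrow> continuous_on UNIV y \<longrightarrow>
      (\<forall>s. norm (y s - (a0, a1)) < \<rho>) \<longrightarrow> continuous_on UNIV (\<lambda>s. N \<epsilon> s (y s))"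
    and lip: "\<And>\<eta>. \<eta> > 0 \<Longrightarrow> \<exists>\<rho>>0. \<forall>\<epsilon> s y y'. 0 < \<epsilon> \<longrightarrow> \<epsilon> < \<rho> \<longrightarrow> norm (y - (a0, a1)) < \<rho> \<longrightarrow>
      norm (y' - (a0, a1)) < \<rho> \<longrightarrow> norm (N \<epsilon> s y - N \<epsilon> s y') \<le> \<eta> * norm (y - y')"
    and res: "\<exists>C \<rho>. \<rho> > 0 \<and> (\<forall>\<epsilon> s. 0 < \<epsilon> \<longrightarrow> \<epsilon> < \<rho> \<longrightarrow> norm (N \<epsilon> s (a0, a1)) \<le> C * \<epsilon>)"
    and equiv: "\<And>\<epsilon> s y. N \<epsilon> (s + \<theta>) (g (fst y), snd y) = (g (fst (N \<epsilon> s y)), snd (N \<epsilon> s y))"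
    and dd: "\<And>\<eta>. \<eta> > 0 \<Longrightarrow> \<exists>\<rho>>0. \<forall>\<epsilon>. 0 < \<epsilon> \<longrightarrow> \<epsilon> < \<rho> \<longrightarrow> \<bar>dd \<epsilon>\<bar> \<le> \<eta>"
  shows "\<exists>C \<epsilon>1. \<epsilon>1 > 0 \<and> (\<forall>\<epsilon>. 0 < \<epsilon> \<longrightarrow> \<epsilon> < \<epsilon>1 \<longrightarrow> (\<exists>y l0 l1.
    (\<forall>s. norm (y s - (a0, a1)) \<le> C * \<epsilon>) \<and> (\<forall>s. y (s + \<theta>) = (g (fst (y s)), snd (y s))) \<and>
    (\<forall>s. ((\<lambda>s. fst (y s)) has_vector_derivative
       dd \<epsilon> *\<^sub>R (A0 (fst (y s) - a0) + fst (N \<epsilon> s (y s)) + l0 *\<^sub>R e0)) (at s)) \<and>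
    (\<forall>s. ((\<lambda>s. snd (y s)) has_vector_derivative
       A1 (snd (y s) - a1) + snd (N \<epsilon> s (y s)) + l1 *\<^sub>R e1) (at s))))"
proof -
  define T where "T = real m * \<theta>"
  have T: "T > 0" using m \<theta> by (simp add: T_def)
  obtain K S L0 where S: "K \<ge> 0" "linear S" "\<And>v. norm (S v) \<le> K * norm v"
    "\<And>v. A0 (S v) + L0 v *\<^sub>R e0 = - v" "\<And>v. lfa (S v) = 0"
    using bordered_inverse[OF lf(1) nd0] by blast
  obtain C1 Z L1 where C1: "C1 \<ge> 0" and Z:
    "\<And>h s. continuous_on UNIV h \<Longrightarrow> (\<And>s. h (s + \<theta>) = h s) \<Longrightarrow>
      (Z h has_vector_derivative A1 (Z h s) + h s + L1 h *\<^sub>R e1) (at s)"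
    "\<And>h s. continuous_on UNIV h \<Longrightarrow> (\<And>s. h (s + \<theta>) = h s) \<Longrightarrow> Z h (s + \<theta>) = Z h s"
    "\<And>h B s. continuous_on UNIV h \<Longrightarrow> (\<And>s. h (s + \<theta>) = h s) \<Longrightarrow> (\<And>s. norm (h s) \<le> B) \<Longrightarrow>
      norm (Z h s) \<le> C1 * B"
    "\<And>h k B s. continuous_on UNIV h \<Longrightarrow> (\<And>s. h (s + \<theta>) = h s) \<Longrightarrow>
      continuous_on UNIV k \<Longrightarrow> (\<And>s. k (s + \<theta>) = k s) \<Longrightarrow> (\<And>s. norm (h s - k s) \<le> B) \<Longrightarrow>
      norm (Z h s - Z k s) \<le> C1 * B"
    using periodic_green_operator[OF lf(2) \<theta> nd1] by blast
  let ?sym = "symmetric_path g \<theta> T"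
  obtain P where P:
    "\<And>h s. ?sym h \<Longrightarrow> mean T h = 0 \<Longrightarrow> (P h has_vector_derivative h s) (at s)"
    "\<And>h. ?sym h \<Longrightarrow> mean T h = 0 \<Longrightarrow> ?sym (P h) \<and> mean T (P h) = 0"
    "\<And>h k B s. ?sym h \<Longrightarrow> mean T h = 0 \<Longrightarrow> ?sym k \<Longrightarrow> mean T k = 0 \<Longrightarrow>
      (\<And>s. norm (h s - k s) \<le> B) \<Longrightarrow> norm (P h s - P k s) \<le> 2 * T * B"
    using mean_zero_primitive[OF g(1) T] by blast
  \<comment> \<open>Uniqueness carries the symmetry over: \<open>A0\<close> commutes with
    \<open>g\<close>, and \<open>e0\<close> and \<open>lfa\<close> are invariant, so
    \<open>g (S v)\<close> solves the same bordered equation as \<open>S v\<close>.\<close>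
  have gS: "g (S v) = S v" if "g v = v" for v
  proof -
    have "A0 (g (S v)) + L0 v *\<^sub>R e0 = g (A0 (S v) + L0 v *\<^sub>R e0)"
      by (simp add: linear_add[OF g(1)] linear_scale[OF g(1)] g)
    also have "\<dots> = - v" by (simp add: S(4) linear_neg[OF g(1)] that)
    finally have "A0 (g (S v)) + L0 v *\<^sub>R e0 = A0 (S v) + L0 v *\<^sub>R e0" using S(4)[of v] by simp
    then have "A0 (g (S v) - S v) + 0 *\<^sub>R e0 = 0"
      unfolding add_right_cancel by (simp add: blinfun.bilinear_simps)
    moreover have "lfa (g (S v) - S v) = 0" by (simp add: linear_diff[OF lf(1)] g S(5))
    ultimately show ?thesis using nd0[of "g (S v) - S v" 0] by simp
  qed
  \<comment> \<open>The contraction constant 1/2 is shared out: 1/8 for the constant part of the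
    slow component, 1/8 for the fast component, and 1/4, by the choice of \<delta> below, for the
    slow primitive.\<close>
  define \<eta> where "\<eta> = 1 / (8 * (K + C1 + 1))"
  have \<eta>: "\<eta> > 0" "K * \<eta> \<le> 1/8" "C1 * \<eta> \<le> 1/8" "\<eta> \<le> 1"
    using S(1) C1 by (auto simp: \<eta>_def field_simps)
  define nA where "nA = norm A0"
  \<comment> \<open>The product to be controlled is \<open>4 * T * (nA + 1)\<close>: a factor
    \<open>2 * T\<close> from the primitive, 2 from the subtraction of the mean, and
    \<open>nA + 1\<close> as a Lipschitz constant of the slow right-hand side \<open>F\<close>, the
    1 being a bound for \<eta>.\<close>
  define \<delta> where "\<delta> = 1 / (16 * T * (nA + 1))"
  have nA: "nA \<ge> 0" by (simp add: nA_def)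
  have \<delta>: "\<delta> > 0" "\<delta> * (4 * T * (nA + 1)) \<le> 1/4"
  proof -
    have pos: "16 * T * (nA + 1) > 0" using T nA by (intro mult_pos_pos) auto
    then show "\<delta> > 0" by (simp only: \<delta>_def zero_less_divide_1_iff)
    have "\<delta> * (4 * T * (nA + 1)) = (1 / (16 * T * (nA + 1))) * (16 * T * (nA + 1)) / 4"
      by (simp add: \<delta>_def)
    also have "\<dots> = 1 / 4" using T nA by simp
    finally show "\<delta> * (4 * T * (nA + 1)) \<le> 1/4" by simp
  qed
  obtain \<rho>1 where \<rho>1: "\<rho>1 > 0" "\<And>\<epsilon> y. 0 < \<epsilon> \<Longrightarrow> \<epsilon> < \<rho>1 \<Longrightarrow> continuous_on UNIV y \<Longrightarrow>
      (\<And>s. norm (y s - (a0, a1)) < \<rho>1) \<Longrightarrow> continuous_on UNIV (\<lambda>s. N \<epsilon> s (y s))"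
    using cont by blast
  obtain \<rho>2 where \<rho>2: "\<rho>2 > 0" "\<And>\<epsilon> s y y'. 0 < \<epsilon> \<Longrightarrow> \<epsilon> < \<rho>2 \<Longrightarrow> norm (y - (a0, a1)) < \<rho>2 \<Longrightarrow>
      norm (y' - (a0, a1)) < \<rho>2 \<Longrightarrow> norm (N \<epsilon> s y - N \<epsilon> s y') \<le> \<eta> * norm (y - y')"
    using lip[OF \<eta>(1)] by metis
  obtain Cr' \<rho>3 where \<rho>3: "\<rho>3 > 0" "\<And>\<epsilon> s. 0 < \<epsilon> \<Longrightarrow> \<epsilon> < \<rho>3 \<Longrightarrow> norm (N \<epsilon> s (a0, a1)) \<le> Cr' * \<epsilon>"
    using res by metis
  define Cr where "Cr = max Cr' 0"
  have Cr: "Cr \<ge> 0" "\<And>\<epsilon> s. 0 < \<epsilon> \<Longrightarrow> \<epsilon> < \<rho>3 \<Longrightarrow> norm (N \<epsilon> s (a0, a1)) \<le> Cr * \<epsilon>"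
  proof -
    show "Cr \<ge> 0" by (simp add: Cr_def)
    fix \<epsilon> s :: real assume "0 < \<epsilon>" "\<epsilon> < \<rho>3"
    then have "norm (N \<epsilon> s (a0, a1)) \<le> Cr' * \<epsilon>" "Cr' * \<epsilon> \<le> Cr * \<epsilon>"
      using \<rho>3(2) by (auto simp: Cr_def)
    then show "norm (N \<epsilon> s (a0, a1)) \<le> Cr * \<epsilon>" by linarith
  qed
  obtain \<rho>4 where \<rho>4: "\<rho>4 > 0" "\<And>\<epsilon>. 0 < \<epsilon> \<Longrightarrow> \<epsilon> < \<rho>4 \<Longrightarrow> \<bar>dd \<epsilon>\<bar> \<le> \<delta>"
    using dd[OF \<delta>(1)] by metis
  \<comment> \<open>\<open>C2 * \<epsilon>\<close> bounds the displacement of the constant path at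
    the center under the fixed-point map, with one summand each for the bordered inverse, the
    primitive and the Green operator. Since the map halves distances, the ball of twice this radius
    is mapped into itself.\<close>
  define C2 where "C2 = (K + 1 + C1) * Cr"
  have C2: "C2 \<ge> 0" using S(1) C1 Cr by (simp add: C2_def)
  define \<rho> where "\<rho> = min (min \<rho>1 \<rho>2) (min \<rho>3 \<rho>4)"
  have \<rho>: "\<rho> > 0" "\<rho> \<le> \<rho>1" "\<rho> \<le> \<rho>2" "\<rho> \<le> \<rho>3" "\<rho> \<le> \<rho>4"
    using \<rho>1 \<rho>2 \<rho>3 \<rho>4 by (auto simp: \<rho>_def)
  define \<epsilon>1 where "\<epsilon>1 = min \<rho> (\<rho> / (2 * C2 + 1))"
  have \<epsilon>1: "\<epsilon>1 > 0" using \<rho> C2 by (simp add: \<epsilon>1_def)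
  have main: "\<exists>y l0 l1.
    (\<forall>s. norm (y s - (a0, a1)) \<le> 2 * C2 * \<epsilon>) \<and> (\<forall>s. y (s + \<theta>) = (g (fst (y s)), snd (y s))) \<and>
    (\<forall>s. ((\<lambda>s. fst (y s)) has_vector_derivative
       dd \<epsilon> *\<^sub>R (A0 (fst (y s) - a0) + fst (N \<epsilon> s (y s)) + l0 *\<^sub>R e0)) (at s)) \<and>
    (\<forall>s. ((\<lambda>s. snd (y s)) has_vector_derivative
       A1 (snd (y s) - a1) + snd (N \<epsilon> s (y s)) + l1 *\<^sub>R e1) (at s))"
    if \<epsilon>: "0 < \<epsilon>" "\<epsilon> < \<epsilon>1" for \<epsilon>
  proof -
    define r where "r = 2 * C2 * \<epsilon>"
    have \<epsilon>\<rho>: "\<epsilon> < \<rho>" using \<epsilon> by (simp add: \<epsilon>1_def)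
    have r: "r \<ge> 0" "r < \<rho>"
    proof -
      show "r \<ge> 0" using C2 \<epsilon> by (simp add: r_def)
      have "\<epsilon> * (2 * C2 + 1) < \<rho>" using \<epsilon> C2 by (simp add: \<epsilon>1_def field_simps)
      then show "r < \<rho>" using \<epsilon> by (simp add: r_def algebra_simps)
    qed
    define X where "X = {y :: real \<Rightarrow> 'a \<times> 'b. continuous_on UNIV y \<and>
      (\<forall>s. norm (y s - (a0, a1)) \<le> r) \<and> (\<forall>s. y (s + \<theta>) = (g (fst (y s)), snd (y s)))}"
    define n0 n1 where "n0 y s = fst (N \<epsilon> s (y s))" and "n1 y s = snd (N \<epsilon> s (y s))"
      for y :: "real \<Rightarrow> 'a \<times> 'b" and s
    define F where "F y s = A0 (fst (y s) - a0) + n0 y s" for y :: "real \<Rightarrow> 'a \<times> 'b" and s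
    have XT: "fst (y (s + T)) = fst (y s)" "N \<epsilon> (s + T) (y (s + T)) = N \<epsilon> s (y s)"
      if "y \<in> X" for y s
    proof -
      have "y (s + real n * \<theta>) = ((g ^^ n) (fst (y s)), snd (y s)) \<and>
          N \<epsilon> (s + real n * \<theta>) (y (s + real n * \<theta>)) =
          ((g ^^ n) (fst (N \<epsilon> s (y s))), snd (N \<epsilon> s (y s)))" for n
      proof (induction n)
        case (Suc n)
        define s' where "s' = s + real n * \<theta>"
        have eq: "s + real (Suc n) * \<theta> = s' + \<theta>" by (simp add: s'_def algebra_simps)
        have 1: "y (s' + \<theta>) = (g (fst (y s')), snd (y s'))" using that by (simp add: X_def)
        then have 2: "N \<epsilon> (s' + \<theta>) (y (s' + \<theta>)) = (g (fst (N \<epsilon> s' (y s'))), snd (N \<epsilon> s' (y s')))"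
          by (simp only: equiv)
        note S1 = conjunct1[OF Suc[folded s'_def]] and S2 = conjunct2[OF Suc[folded s'_def]]
        have "y (s' + \<theta>) = ((g ^^ Suc n) (fst (y s)), snd (y s))" unfolding 1 S1 by simp
        moreover have "N \<epsilon> (s' + \<theta>) (y (s' + \<theta>)) = ((g ^^ Suc n) (fst (N \<epsilon> s (y s))), snd (N \<epsilon> s (y s)))"
          unfolding 2 S2 by simp
        ultimately show ?case unfolding eq by blast
      qed simp
      from this[of m] show "fst (y (s + T)) = fst (y s)" "N \<epsilon> (s + T) (y (s + T)) = N \<epsilon> s (y s)"
        unfolding g(2) id_apply prod.collapse by (auto simp only: T_def)
    qed
    have cN: "continuous_on UNIV (\<lambda>s. N \<epsilon> s (y s))" if "y \<in> X" for y
    proof (rule \<rho>1(2))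
      fix s
      have "norm (y s - (a0, a1)) \<le> r" using that by (simp add: X_def)
      then show "norm (y s - (a0, a1)) < \<rho>1" using r \<rho> by linarith
    qed (use \<epsilon> \<epsilon>\<rho> \<rho> that in \<open>auto simp: X_def\<close>)
    have n0: "?sym (n0 y)" and n1: "continuous_on UNIV (n1 y)" "\<And>s. n1 y (s + \<theta>) = n1 y s"
      and Fsym: "?sym (F y)" if y: "y \<in> X" for y
    proof -
      have N: "N \<epsilon> (s + \<theta>) (y (s + \<theta>)) = (g (n0 y s), n1 y s)" for s
        using equiv[of \<epsilon> s "y s"] y by (simp add: X_def n0_def n1_def)
      have c0: "continuous_on UNIV (n0 y)" and c1: "continuous_on UNIV (n1 y)"
        unfolding n0_def[abs_def] n1_def[abs_def] using cN[OF y] by (intro continuous_intros; simp)+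
      show "continuous_on UNIV (n1 y)" by (rule c1)
      show "n1 y (s + \<theta>) = n1 y s" for s using N[of s] by (simp add: n1_def)
      show n0: "?sym (n0 y)" unfolding symmetric_path_def
        using c0 N XT(2)[OF y] by (auto simp: n0_def)
      have cy: "continuous_on UNIV y" using y by (simp add: X_def)
      have "continuous_on UNIV (F y)"
        unfolding F_def[abs_def] by (intro continuous_intros c0 cy)
      moreover have "F y (s + \<theta>) = g (F y s)" for s
      proof -
        have "fst (y (s + \<theta>)) - a0 = g (fst (y s) - a0)"
          using y by (simp add: X_def linear_diff[OF g(1)] g)
        then show ?thesis using n0 by (simp add: F_def g linear_add[OF g(1)] symmetric_path_def)
      qed
      moreover have "F y (s + T) = F y s" for s
        using XT[OF y] n0 by (simp add: F_def symmetric_path_def)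
      ultimately show "?sym (F y)" by (simp add: symmetric_path_def)
    qed
    have F0: "?sym (\<lambda>s. F y s - mean T (F y))" "mean T (\<lambda>s. F y s - mean T (F y)) = 0"
      if y: "y \<in> X" for y
    proof -
      have c: "?sym (\<lambda>s. mean T (F y))"
        using mean_symmetric[OF Fsym[OF y] T g(1)] by (simp add: symmetric_path_def)
      show "?sym (\<lambda>s. F y s - mean T (F y))"
        by (rule symmetric_path_diff[OF Fsym[OF y] c g(1)])
      show "mean T (\<lambda>s. F y s - mean T (F y)) = 0"
        using mean_diff[of "F y" "\<lambda>s. mean T (F y)" T] Fsym[OF y] mean_const[OF T, of "mean T (F y)"]
        by (simp add: symmetric_path_def)
    qed
    define \<Theta> where "\<Theta> y = (\<lambda>s. (a0 + S (mean T (n0 y)) + dd \<epsilon> *\<^sub>R P (\<lambda>s. F y s - mean T (F y)) s,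
      a1 + Z (n1 y) s))" for y
    have d\<epsilon>: "\<bar>dd \<epsilon>\<bar> \<le> \<delta>" using \<rho>4 \<epsilon> \<epsilon>\<rho> \<rho> by auto
    have lip\<Theta>: "norm (\<Theta> y s - \<Theta> y' s) \<le> B / 2"
      if y: "y \<in> X" and y': "y' \<in> X" and B: "\<And>s. norm (y s - y' s) \<le> B" for y y' B s
    proof -
      have B0: "B \<ge> 0" using B norm_ge_zero order_trans by blast
      have dN: "norm (N \<epsilon> s (y s) - N \<epsilon> s (y' s)) \<le> \<eta> * B" for s
      proof -
        have "norm (N \<epsilon> s (y s) - N \<epsilon> s (y' s)) \<le> \<eta> * norm (y s - y' s)"
        proof (rule \<rho>2(2))
          have "norm (y s - (a0, a1)) \<le> r" "norm (y' s - (a0, a1)) \<le> r"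
            using y y' by (simp_all add: X_def)
          then show "norm (y s - (a0, a1)) < \<rho>2" "norm (y' s - (a0, a1)) < \<rho>2"
            using r \<rho> by linarith+
        qed (use \<epsilon> \<epsilon>\<rho> \<rho> in auto)
        also have "\<dots> \<le> \<eta> * B" using B \<eta> by (intro mult_left_mono) auto
        finally show ?thesis .
      qed
      have d0: "norm (n0 y s - n0 y' s) \<le> \<eta> * B" and d1: "norm (n1 y s - n1 y' s) \<le> \<eta> * B" for s
        using dN[of s] norm_fst_le[of "n0 y s - n0 y' s" "n1 y s - n1 y' s"]
          norm_snd_le[of "n1 y s - n1 y' s" "n0 y s - n0 y' s"]
        by (auto simp: n0_def n1_def minus_prod_def intro: order_trans)
      have dF: "norm (F y s - F y' s) \<le> (nA + 1) * B" for s
      proof -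
        have "F y s - F y' s = A0 (fst (y s - y' s)) + (n0 y s - n0 y' s)"
          by (simp add: F_def blinfun.bilinear_simps)
        then have "norm (F y s - F y' s) \<le> norm (A0 (fst (y s - y' s))) + norm (n0 y s - n0 y' s)"
          by (simp only: norm_triangle_ineq)
        moreover have "norm (A0 (fst (y s - y' s))) \<le> nA * B"
          unfolding nA_def
          by (intro order_trans[OF norm_blinfun] mult_left_mono order_trans[OF norm_fst_le_norm B]) auto
        moreover have "\<eta> * B \<le> 1 * B" using \<eta> B0 by (intro mult_right_mono) auto
        ultimately show ?thesis using d0[of s] by (simp add: algebra_simps)
      qed
      have c: "continuous_on UNIV (F y)" "continuous_on UNIV (F y')"
        "continuous_on UNIV (n0 y)" "continuous_on UNIV (n0 y')"
        using Fsym y y' n0 by (auto simp: symmetric_path_def)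
      have dmF: "norm (mean T (F y) - mean T (F y')) \<le> (nA + 1) * B"
        unfolding mean_diff[OF c(1,2), symmetric]
        by (rule norm_mean_le[OF T _ dF]) (intro continuous_intros c)
      have dm0: "norm (mean T (n0 y) - mean T (n0 y')) \<le> \<eta> * B"
        unfolding mean_diff[OF c(3,4), symmetric]
        by (rule norm_mean_le[OF T _ d0]) (intro continuous_intros c)
      have "norm (P (\<lambda>s. F y s - mean T (F y)) s - P (\<lambda>s. F y' s - mean T (F y')) s)
          \<le> 2 * T * (2 * ((nA + 1) * B))"
      proof (rule P(3)[OF F0[OF y] F0[OF y']])
        fix s
        have "norm ((F y s - F y' s) - (mean T (F y) - mean T (F y'))) \<le> (nA + 1) * B + (nA + 1) * B"
          by (rule order_trans[OF norm_triangle_ineq4 add_mono[OF dF dmF]])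
        then show "norm (F y s - mean T (F y) - (F y' s - mean T (F y'))) \<le> 2 * ((nA + 1) * B)"
          by (simp add: algebra_simps)
      qed
      then have "norm (dd \<epsilon> *\<^sub>R (P (\<lambda>s. F y s - mean T (F y)) s - P (\<lambda>s. F y' s - mean T (F y')) s))
          \<le> \<delta> * (2 * T * (2 * ((nA + 1) * B)))"
        unfolding norm_scaleR using d\<epsilon> \<delta> by (intro mult_mono) auto
      also have "\<dots> = \<delta> * (4 * T * (nA + 1)) * B" by (simp add: algebra_simps)
      also have "\<dots> \<le> 1/4 * B" using \<delta>(2) B0 by (rule mult_right_mono)
      finally have t2: "norm (dd \<epsilon> *\<^sub>R (P (\<lambda>s. F y s - mean T (F y)) s - P (\<lambda>s. F y' s - mean T (F y')) s))
          \<le> 1/4 * B" .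
      have "norm (S (mean T (n0 y)) - S (mean T (n0 y'))) \<le> K * (\<eta> * B)"
        unfolding linear_diff[OF S(2), symmetric]
        using dm0 S(1) by (intro order_trans[OF S(3)] mult_left_mono)
      also have "\<dots> = (K * \<eta>) * B" by simp
      also have "\<dots> \<le> 1/8 * B" using \<eta>(2) B0 by (rule mult_right_mono)
      finally have t1: "norm (S (mean T (n0 y)) - S (mean T (n0 y'))) \<le> 1/8 * B" .
      have "norm (Z (n1 y) s - Z (n1 y') s) \<le> C1 * (\<eta> * B)"
        by (rule Z(4)) (use n1 y y' d1 in auto)
      also have "\<dots> = (C1 * \<eta>) * B" by simp
      also have "\<dots> \<le> 1/8 * B" using \<eta>(3) B0 by (rule mult_right_mono)
      finally have t3: "norm (Z (n1 y) s - Z (n1 y') s) \<le> 1/8 * B" .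
      have "\<Theta> y s - \<Theta> y' s = (S (mean T (n0 y)) - S (mean T (n0 y')) +
          dd \<epsilon> *\<^sub>R (P (\<lambda>s. F y s - mean T (F y)) s - P (\<lambda>s. F y' s - mean T (F y')) s),
          Z (n1 y) s - Z (n1 y') s)"
        by (simp add: \<Theta>_def algebra_simps)
      then have "norm (\<Theta> y s - \<Theta> y' s) \<le> norm (S (mean T (n0 y)) - S (mean T (n0 y')) +
          dd \<epsilon> *\<^sub>R (P (\<lambda>s. F y s - mean T (F y)) s - P (\<lambda>s. F y' s - mean T (F y')) s)) +
          norm (Z (n1 y) s - Z (n1 y') s)"
        by (simp only: norm_Pair_le)
      also have "\<dots> \<le> (1/8 * B + 1/4 * B) + 1/8 * B"
        by (intro add_mono order_trans[OF norm_triangle_ineq] t1 t2 t3)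
      finally show ?thesis by simp
    qed
    have aX: "(\<lambda>s. (a0, a1)) \<in> X" using r g by (simp add: X_def)
    have \<Theta>a: "norm (\<Theta> (\<lambda>s. (a0, a1)) s - (a0, a1)) \<le> C2 * \<epsilon>" for s
    proof -
      let ?y = "\<lambda>s::real. (a0, a1)"
      let ?B = "Cr * \<epsilon>"
      have Na: "norm (N \<epsilon> s (a0, a1)) \<le> ?B" for s using Cr \<epsilon> \<epsilon>\<rho> \<rho> by auto
      have B0: "?B \<ge> 0" using Cr \<epsilon> by simp
      have d0: "norm (n0 ?y s) \<le> ?B" and d1: "norm (n1 ?y s) \<le> ?B" for s
        using Na[of s] norm_fst_le[of "n0 ?y s" "n1 ?y s"] norm_snd_le[of "n1 ?y s" "n0 ?y s"]
        by (auto simp: n0_def n1_def intro: order_trans)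
      have Fn: "F ?y = n0 ?y" by (simp add: F_def fun_eq_iff blinfun.bilinear_simps)
      have c: "continuous_on UNIV (n0 ?y)" using n0[OF aX] by (simp add: symmetric_path_def)
      have dm0: "norm (mean T (n0 ?y)) \<le> ?B" by (rule norm_mean_le[OF T c d0])
      \<comment> \<open>\<open>P\<close> is known only by its properties. They determine its value
        at the zero path: it is constant and has mean zero.\<close>
      have z: "?sym (\<lambda>s. 0)" "mean T (\<lambda>s. 0 :: 'a) = 0"
        using linear_0[OF g(1)] by (auto simp: symmetric_path_def mean_def)
      have "((P (\<lambda>s. 0)) has_vector_derivative 0) (at s)" for s using P(1)[OF z] by simp
      then have "P (\<lambda>s. 0) s = P (\<lambda>s. 0) 0" for s by (rule zero_derivative_const)
      then have "P (\<lambda>s. 0) = (\<lambda>s. P (\<lambda>s. 0) 0)" by (rule ext)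
      moreover have "mean T (P (\<lambda>s. 0)) = 0" using P(2)[OF z] by blast
      ultimately have Pz: "P (\<lambda>s. 0) s = 0" for s using mean_const[OF T] by metis
      have "norm (P (\<lambda>s. F ?y s - mean T (F ?y)) s - P (\<lambda>s. 0) s) \<le> 2 * T * (2 * ?B)"
      proof (rule P(3)[OF F0[OF aX] z])
        fix s
        have "norm (n0 ?y s - mean T (n0 ?y)) \<le> ?B + ?B"
          by (rule order_trans[OF norm_triangle_ineq4 add_mono[OF d0 dm0]])
        then show "norm (F ?y s - mean T (F ?y) - 0) \<le> 2 * ?B" by (simp add: Fn)
      qed
      then have "norm (P (\<lambda>s. F ?y s - mean T (F ?y)) s) \<le> 2 * T * (2 * ?B)" by (simp add: Pz)
      then have "norm (dd \<epsilon> *\<^sub>R P (\<lambda>s. F ?y s - mean T (F ?y)) s) \<le> \<delta> * (2 * T * (2 * ?B))"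
        unfolding norm_scaleR using d\<epsilon> \<delta> by (intro mult_mono) auto
      also have "\<dots> = (\<delta> * (4 * T)) * ?B" by simp
      also have "\<dots> \<le> 1 * ?B"
      proof (rule mult_right_mono[OF _ B0])
        have "\<delta> * (4 * T) \<le> \<delta> * (4 * T * (nA + 1))" using \<delta> T nA by (intro mult_left_mono) auto
        then show "\<delta> * (4 * T) \<le> 1" using \<delta>(2) by linarith
      qed
      finally have t2: "norm (dd \<epsilon> *\<^sub>R P (\<lambda>s. F ?y s - mean T (F ?y)) s) \<le> 1 * ?B" .
      have t1: "norm (S (mean T (n0 ?y))) \<le> K * ?B"
        using dm0 S(1) by (intro order_trans[OF S(3)] mult_left_mono)
      have t3: "norm (Z (n1 ?y) s) \<le> C1 * ?B"
        by (rule Z(3)) (use n1 aX d1 in auto)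
      have "\<Theta> ?y s - (a0, a1) = (S (mean T (n0 ?y)) + dd \<epsilon> *\<^sub>R P (\<lambda>s. F ?y s - mean T (F ?y)) s, Z (n1 ?y) s)"
        by (simp add: \<Theta>_def)
      then have "norm (\<Theta> ?y s - (a0, a1)) \<le> norm (S (mean T (n0 ?y)) + dd \<epsilon> *\<^sub>R P (\<lambda>s. F ?y s - mean T (F ?y)) s)
          + norm (Z (n1 ?y) s)"
        by (simp only: norm_Pair_le)
      also have "\<dots> \<le> (K * ?B + 1 * ?B) + C1 * ?B"
        by (intro add_mono order_trans[OF norm_triangle_ineq] t1 t2 t3)
      finally show ?thesis by (simp add: C2_def algebra_simps)
    qed
    have self\<Theta>: "\<Theta> y \<in> X" if y: "y \<in> X" for y
    proof -
      have Pder: "(P (\<lambda>s. F y s - mean T (F y)) has_vector_derivative F y s - mean T (F y)) (at s)" for s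
        using P(1)[OF F0[OF y]] .
      have Psym: "?sym (P (\<lambda>s. F y s - mean T (F y)))" using P(2)[OF F0[OF y]] by blast
      have Zder: "(Z (n1 y) has_vector_derivative A1 (Z (n1 y) s) + n1 y s + L1 (n1 y) *\<^sub>R e1) (at s)" for s
        by (rule Z(1)) (use n1 y in auto)
      have cZ: "continuous_on UNIV (Z (n1 y))"
        using Zder by (meson continuous_at_imp_continuous_on has_vector_derivative_continuous)
      have "continuous_on UNIV (\<Theta> y)"
        unfolding \<Theta>_def using Psym cZ by (intro continuous_intros) (auto simp: symmetric_path_def)
      moreover have "norm (\<Theta> y s - (a0, a1)) \<le> r" for s
      proof -
        have "norm (\<Theta> y s - \<Theta> (\<lambda>s. (a0, a1)) s) \<le> r / 2"
          by (rule lip\<Theta>[OF y aX]) (use y in \<open>auto simp: X_def\<close>)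
        then have "norm (\<Theta> y s - (a0, a1)) \<le> r / 2 + C2 * \<epsilon>"
          by (rule order_trans[OF norm_diff_triangle_ineq' add_mono[OF _ \<Theta>a]])
        then show ?thesis by (simp add: r_def)
      qed
      moreover have "\<Theta> y (s + \<theta>) = (g (fst (\<Theta> y s)), snd (\<Theta> y s))" for s
      proof -
        have "g (S (mean T (n0 y))) = S (mean T (n0 y))"
          by (rule gS[OF mean_symmetric[OF n0[OF y] T g(1)]])
        moreover have "P (\<lambda>s. F y s - mean T (F y)) (s + \<theta>) = g (P (\<lambda>s. F y s - mean T (F y)) s)"
          using Psym by (simp add: symmetric_path_def)
        moreover have "Z (n1 y) (s + \<theta>) = Z (n1 y) s" by (rule Z(2)) (use n1 y in auto)
        ultimately show ?thesis
          by (simp add: \<Theta>_def linear_add[OF g(1)] linear_scale[OF g(1)] g)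
      qed
      ultimately show ?thesis by (simp add: X_def)
    qed
    have closedX: "y \<in> X" if cy: "continuous_on UNIV y"
      and app: "\<And>e. e > 0 \<Longrightarrow> \<exists>x\<in>X. \<forall>s. norm (x s - y s) \<le> e" for y
    proof -
      have "norm (y s - (a0, a1)) \<le> r" for s
      proof (rule field_le_epsilon)
        fix e :: real assume "e > 0"
        then obtain x where x: "x \<in> X" "\<forall>s. norm (x s - y s) \<le> e" using app by blast
        have "norm (y s - (a0, a1)) \<le> norm (y s - x s) + norm (x s - (a0, a1))"
          by (rule norm_diff_triangle_ineq')
        also have "\<dots> \<le> e + r" using x by (intro add_mono) (auto simp: X_def norm_minus_commute)
        finally show "norm (y s - (a0, a1)) \<le> r + e" by simp
      qed
      moreover have "y (s + \<theta>) = (g (fst (y s)), snd (y s))" for s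
      proof -
        obtain Kg where Kg: "Kg > 0" "\<And>x. norm (g x) \<le> Kg * norm x"
          using linear_bounded_pos[OF g(1)] by blast
        have "norm (y (s + \<theta>) - (g (fst (y s)), snd (y s))) \<le> 0 + e" if e: "e > 0" for e
        proof -
          obtain x where x: "x \<in> X" "\<forall>s. norm (x s - y s) \<le> e / (2 + Kg)"
            using app[of "e / (2 + Kg)"] e Kg by auto
          let ?e = "e / (2 + Kg)"
          have xs: "x (s + \<theta>) = (g (fst (x s)), snd (x s))" using x by (simp add: X_def)
          have f: "norm (fst (x s - y s)) \<le> ?e" and sn: "norm (snd (x s - y s)) \<le> ?e"
            using order_trans[OF norm_fst_le_norm x(2)[rule_format]] order_trans[OF norm_snd_le_norm x(2)[rule_format]]
            by blast+
          have "y (s + \<theta>) - (g (fst (y s)), snd (y s)) =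
              - (x (s + \<theta>) - y (s + \<theta>)) + (g (fst (x s - y s)), snd (x s - y s))"
            by (simp add: xs linear_diff[OF g(1)])
          then have "norm (y (s + \<theta>) - (g (fst (y s)), snd (y s))) \<le>
              norm (- (x (s + \<theta>) - y (s + \<theta>))) + norm (g (fst (x s - y s)), snd (x s - y s))"
            by (simp only: norm_triangle_ineq)
          also have "\<dots> \<le> ?e + (Kg * ?e + ?e)"
          proof (intro add_mono order_trans[OF norm_Pair_le])
            show "norm (- (x (s + \<theta>) - y (s + \<theta>))) \<le> ?e"
              unfolding norm_minus_cancel using x by blast
            show "norm (g (fst (x s - y s))) \<le> Kg * ?e"
              using Kg f by (intro order_trans[OF Kg(2)] mult_left_mono) auto
          qed (rule sn)
          also have "\<dots> = (2 + Kg) * ?e" by (simp only: distrib_right mult_2 add_ac mult_ac)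
          also have "\<dots> = e" using Kg by simp
          finally show ?thesis by simp
        qed
        then have "norm (y (s + \<theta>) - (g (fst (y s)), snd (y s))) \<le> 0" by (rule field_le_epsilon)
        then show ?thesis by simp
      qed
      ultimately show ?thesis using cy by (simp add: X_def)
    qed
    have bX: "norm (y s) \<le> norm (a0, a1) + r" if "y \<in> X" for y s
    proof -
      have "norm (y s - (a0, a1)) \<le> r" using that by (simp add: X_def)
      then show ?thesis using norm_triangle_ineq[of "y s - (a0, a1)" "(a0, a1)"]
        unfolding diff_add_cancel by linarith
    qed
    have cX: "continuous_on UNIV y" if "y \<in> X" for y using that by (simp add: X_def)
    obtain y where y: "y \<in> X" "\<Theta> y = y"
    proof (rule sup_norm_contraction[of "\<lambda>s. (a0, a1)" X "norm (a0, a1) + r" \<Theta>])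
      show "(\<lambda>s. (a0, a1)) \<in> X" by (rule aX)
      show "norm (\<Theta> y s - \<Theta> y' s) \<le> B / 2" if "y \<in> X" "y' \<in> X" "\<And>s. norm (y s - y' s) \<le> B" for y y' B s
        by (rule lip\<Theta>[OF that])
      show "y \<in> X" if "continuous_on UNIV y" "\<And>e. e > 0 \<Longrightarrow> \<exists>x\<in>X. \<forall>s. norm (x s - y s) \<le> e" for y
        by (rule closedX[OF that])
    qed (rule cX bX self\<Theta> that; assumption)+
    \<comment> \<open>At a fixed point the primitive drops out of the mean, so \<open>b\<close> is
      the mean of the slow component. The equation of the bordered inverse then says that the mean
      of \<open>F y\<close> is a multiple of \<open>e0\<close>; the mean subtracted in the
      fixed-point map is thus exactly the multiplier term of the claim.\<close>
    define b where "b = a0 + S (mean T (n0 y))"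
    let ?P = "P (\<lambda>s. F y s - mean T (F y))"
    have fy: "fst (y s) = b + dd \<epsilon> *\<^sub>R ?P s" and sy: "snd (y s) = a1 + Z (n1 y) s" for s
      using arg_cong[OF fun_cong[OF y(2), of s], of fst] arg_cong[OF fun_cong[OF y(2), of s], of snd]
      unfolding \<Theta>_def b_def fst_conv snd_conv by simp_all
    have cy: "continuous_on UNIV y" using y by (simp add: X_def)
    have cP: "continuous_on UNIV ?P" using P(2)[OF F0[OF y(1)]] by (simp add: symmetric_path_def)
    have "mean T (\<lambda>s. fst (y s)) = mean T (\<lambda>s. b) + mean T (\<lambda>s. dd \<epsilon> *\<^sub>R ?P s)"
      unfolding fy by (rule mean_add) (intro continuous_intros cP)+
    also have "mean T (\<lambda>s. dd \<epsilon> *\<^sub>R ?P s) = dd \<epsilon> *\<^sub>R mean T ?P"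
      by (rule mean_linear[OF _ cP]) (simp add: linear_scaleR)
    also have "mean T ?P = 0" using P(2)[OF F0[OF y(1)]] by blast
    finally have my: "mean T (\<lambda>s. fst (y s)) = b" using mean_const[OF T] by simp
    have cn0: "continuous_on UNIV (n0 y)" using n0[OF y(1)] by (simp add: symmetric_path_def)
    have "mean T (F y) = mean T (\<lambda>s. A0 (fst (y s) - a0)) + mean T (n0 y)"
      unfolding F_def[abs_def] by (rule mean_add) (intro continuous_intros cn0 cy)+
    also have "mean T (\<lambda>s. A0 (fst (y s) - a0)) = A0 (mean T (\<lambda>s. fst (y s) - a0))"
      by (rule mean_linear) (auto intro!: continuous_intros cy blinfun.bounded_linear_right bounded_linear.linear)
    also have "mean T (\<lambda>s. fst (y s) - a0) = b - a0"
      using mean_diff[of "\<lambda>s. fst (y s)" "\<lambda>s. a0" T] my mean_const[OF T, of a0]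
      by (simp add: continuous_on_fst[OF cy])
    also have "A0 (b - a0) + mean T (n0 y) = - (L0 (mean T (n0 y)) *\<^sub>R e0)"
      using S(4)[of "mean T (n0 y)"] unfolding b_def
      by (simp add: eq_neg_iff_add_eq_0 algebra_simps)
    finally have mF: "mean T (F y) = - (L0 (mean T (n0 y)) *\<^sub>R e0)" .
    have "((\<lambda>s. fst (y s)) has_vector_derivative dd \<epsilon> *\<^sub>R (F y s + L0 (mean T (n0 y)) *\<^sub>R e0)) (at s)" for s
    proof -
      have "((\<lambda>s. b + dd \<epsilon> *\<^sub>R ?P s) has_vector_derivative 0 + dd \<epsilon> *\<^sub>R (F y s - mean T (F y))) (at s)"
        by (intro has_vector_derivative_add has_vector_derivative_const
            bounded_linear.has_vector_derivative[OF bounded_linear_scaleR_right] P(1)[OF F0[OF y(1)]])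
      then show ?thesis unfolding fy mF by simp
    qed
    moreover have "((\<lambda>s. snd (y s)) has_vector_derivative
        A1 (snd (y s) - a1) + n1 y s + L1 (n1 y) *\<^sub>R e1) (at s)" for s
    proof -
      have "(Z (n1 y) has_vector_derivative A1 (Z (n1 y) s) + n1 y s + L1 (n1 y) *\<^sub>R e1) (at s)"
        by (rule Z(1)) (use n1 y in auto)
      from has_vector_derivative_add[OF has_vector_derivative_const this]
      show ?thesis unfolding sy by simp
    qed
    ultimately show ?thesis
      using y(1) by (intro exI[of _ y] exI[of _ "L0 (mean T (n0 y))"] exI[of _ "L1 (n1 y)"])
        (auto simp: X_def r_def F_def n0_def n1_def)
  qed
  show ?thesis using \<epsilon>1 main by blast
qed

subsection \<open>Rotations of the plane\<close>

lemma J_apply: "J *v x = vector [- x $ 2, x $ 1]"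
  by (simp add: vec_eq_iff forall_2 matrix_vector_mult_def J_def sum_2 vector_2)

lemma J_J [simp]: "J *v (J *v x) = - x"
  by (simp add: vec_eq_iff forall_2 J_apply vector_2)

lemma inner_J_J [simp]: "(J *v x) \<bullet> (J *v y) = x \<bullet> y"
  by (simp add: inner_vec_def sum_2 J_apply vector_2)

lemma inner_J_left: "(J *v x) \<bullet> y = - (x \<bullet> (J *v y))"
  by (simp add: inner_vec_def sum_2 J_apply vector_2)

lemma inner_J_self [simp]: "x \<bullet> (J *v x) = 0" "(J *v x) \<bullet> x = 0"
  by (simp_all add: inner_vec_def sum_2 J_apply vector_2)

lemma norm_J [simp]: "norm (J *v x) = norm x"
  by (simp add: norm_eq_sqrt_inner)

lemma rot_apply: "rot t *v x = cos t *\<^sub>R x + sin t *\<^sub>R (J *v x)"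
  unfolding J_apply by (simp add: vec_eq_iff forall_2 rot_eq matrix_vector_mult_def sum_2 vector_2)

lemmas J_linear_simps = matrix_vector_right_distrib matrix_vector_mult_diff_distrib
  matrix_vector_mult_scaleR

lemma J_minus [simp]: "J *v (- x) = - (J *v x)"
  by (simp add: vec_eq_iff forall_2 J_apply vector_2)

lemma J_sum: "J *v (\<Sum>i\<in>I. f i) = (\<Sum>i\<in>I. J *v f i)"
  by (rule linear_sum[OF matrix_vector_mul_linear])

lemma rot_0 [simp]: "rot 0 *v x = x" by (simp add: rot_apply)

lemma rot_add: "rot (s + t) *v x = rot s *v (rot t *v x)"
  by (simp add: rot_apply cos_add sin_add J_linear_simps algebra_simps)

lemma rot_J: "rot t *v (J *v x) = J *v (rot t *v x)"
  by (simp add: rot_apply J_linear_simps)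

lemma rot_minus_cancel [simp]: "rot (- t) *v (rot t *v x) = x" "rot t *v (rot (- t) *v x) = x"
  using rot_add[of "- t" t x] rot_add[of t "- t" x] by simp_all

lemma rot_inner [simp]: "(rot t *v x) \<bullet> (rot t *v y) = x \<bullet> y"
proof -
  have "(rot t *v x) \<bullet> (rot t *v y) = cos t * cos t * (x \<bullet> y) + sin t * sin t * (x \<bullet> y)"
    by (simp add: rot_apply inner_add_left inner_add_right inner_J_left algebra_simps)
  also have "\<dots> = (cos t * cos t + sin t * sin t) * (x \<bullet> y)" by (simp only: distrib_right)
  finally show ?thesis by simp
qed

lemma rot_norm [simp]: "norm (rot t *v x) = norm x"
  by (simp add: norm_eq_sqrt_inner)

lemma rot_scaleR: "rot t *v (c *\<^sub>R x) = c *\<^sub>R (rot t *v x)"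
  and rot_plus: "rot t *v (x + y) = rot t *v x + rot t *v y"
  and rot_diff: "rot t *v (x - y) = rot t *v x - rot t *v y"
  by (simp_all add: J_linear_simps)

lemma rot_minus: "rot t *v (- x) = - (rot t *v x)"
  using rot_scaleR[of t "-1" x] by simp

lemma rot_sum: "rot t *v (\<Sum>i\<in>I. f i) = (\<Sum>i\<in>I. rot t *v f i)"
  by (rule linear_sum[OF matrix_vector_mul_linear])

lemma rot_two_pi: "rot (2 * pi) *v x = x"
  by (simp add: rot_apply)

lemma norm_diff_rot: "(norm (x - rot t *v x))\<^sup>2 = 2 * (1 - cos t) * (norm x)\<^sup>2"
  and norm_add_rot: "(norm (x + rot t *v x))\<^sup>2 = 2 * (1 + cos t) * (norm x)\<^sup>2"
proof -
  have c: "x \<bullet> (rot t *v x) = cos t * (norm x)\<^sup>2"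
    by (simp add: rot_apply inner_add_right power2_norm_eq_inner)
  show "(norm (x - rot t *v x))\<^sup>2 = 2 * (1 - cos t) * (norm x)\<^sup>2"
    using c by (simp add: power2_norm_eq_inner inner_diff_left inner_diff_right inner_commute algebra_simps)
  show "(norm (x + rot t *v x))\<^sup>2 = 2 * (1 + cos t) * (norm x)\<^sup>2"
    using c by (simp add: power2_norm_eq_inner inner_add_left inner_add_right inner_commute algebra_simps)
qed

lemma rot_fixed_point:
  assumes "rot t *v x = x" "cos t \<noteq> 1"
  shows "x = 0"
  using norm_diff_rot[of x t] assms by simp

lemma J_has_vector_derivative:
  "(u has_vector_derivative u') F \<Longrightarrow> ((\<lambda>s. J *v u s) has_vector_derivative J *v u') F"
  by (rule bounded_linear.has_vector_derivative[OF matrix_vector_mul_bounded_linear])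

lemma rot_has_vector_derivative:
  assumes "(u has_vector_derivative u') (at s)"
  shows "((\<lambda>s. rot (b * s) *v u s) has_vector_derivative rot (b * s) *v (b *\<^sub>R (J *v u s) + u')) (at s)"
proof -
  have "((\<lambda>s. cos (b * s) *\<^sub>R u s + sin (b * s) *\<^sub>R (J *v u s)) has_vector_derivative
      (cos (b * s) *\<^sub>R u' + (- (sin (b * s) * b)) *\<^sub>R u s) +
      (sin (b * s) *\<^sub>R (J *v u') + (cos (b * s) * b) *\<^sub>R (J *v u s))) (at s)"
    by (intro has_vector_derivative_add has_vector_derivative_scaleR assms J_has_vector_derivative)
      (auto intro!: derivative_eq_intros)
  then show ?thesis by (simp add: rot_apply J_linear_simps algebra_simps)
qed

lemma vector_derivative_scaled_argument:
  assumes "(u has_vector_derivative u') (at (c * t))"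
  shows "((\<lambda>t. u (c * t)) has_vector_derivative c *\<^sub>R u') (at t)"
proof -
  have "((u \<circ> (\<lambda>t. c * t)) has_vector_derivative c *\<^sub>R u') (at t)"
    by (rule vector_diff_chain_at)
      (use assms in \<open>auto intro!: derivative_eq_intros simp: has_real_derivative_iff_has_vector_derivative[symmetric]\<close>)
  then show ?thesis by (simp add: o_def)
qed

lemma vector_derivative_shifted_argument:
  fixes u :: "real \<Rightarrow> 'a::real_normed_vector"
  assumes "(u has_vector_derivative u') (at (t + c))"
  shows "((\<lambda>t. u (t + c)) has_vector_derivative u') (at t)"
proof -
  have "((u \<circ> (\<lambda>t. t + c)) has_vector_derivative 1 *\<^sub>R u') (at t)"
    by (rule vector_diff_chain_at) (use assms in \<open>auto intro!: derivative_eq_intros\<close>)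
  then show ?thesis by (simp add: o_def)
qed

text \<open>Turned by the angle \<open>b * s\<close>, the path moves without acceleration, hence
  along \<open>w 0 + s *\<^sub>R v 0\<close>. Periodicity of \<open>c\<close> makes a time step
  \<theta> act on this motion as the rotation by \<open>b * \<theta>\<close>; first the velocity and
  then the position is fixed by that rotation. Absence of resonance leaves only 0. The lemma is
  applied to centers of mass.\<close>

lemma rotating_free_motion_zero:
  fixes c e :: "real \<Rightarrow> real^2"
  assumes c: "\<And>s. (c has_vector_derivative e s) (at s)"
    and e: "\<And>s. (e has_vector_derivative (b\<^sup>2 *\<^sub>R c s - (2 * b) *\<^sub>R (J *v e s))) (at s)"
    and per: "\<And>s. c (s + \<theta>) = c s" and b: "cos (b * \<theta>) \<noteq> 1"
  shows "c s = 0"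
proof -
  define w where "w s = rot (b * s) *v c s" for s
  define v where "v s = rot (b * s) *v (b *\<^sub>R (J *v c s) + e s)" for s
  have w: "(w has_vector_derivative v s) (at s)" for s
    unfolding w_def v_def by (rule rot_has_vector_derivative[OF c])
  have "(v has_vector_derivative rot (b * s) *v (b *\<^sub>R (J *v (b *\<^sub>R (J *v c s) + e s)) +
      (b *\<^sub>R (J *v e s) + (b\<^sup>2 *\<^sub>R c s - (2 * b) *\<^sub>R (J *v e s))))) (at s)" for s
    unfolding v_def
    by (rule rot_has_vector_derivative, rule has_vector_derivative_add[OF _ e],
      rule bounded_linear.has_vector_derivative[OF bounded_linear_scaleR_right], rule J_has_vector_derivative[OF c])
  moreover have "b *\<^sub>R (J *v (b *\<^sub>R (J *v c s) + e s)) +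
      (b *\<^sub>R (J *v e s) + (b\<^sup>2 *\<^sub>R c s - (2 * b) *\<^sub>R (J *v e s))) = 0" for s
    by (simp add: vec_eq_iff J_apply forall_2 vector_2 algebra_simps power2_eq_square)
  ultimately have "(v has_vector_derivative 0) (at s)" for s by simp
  then have v0: "v s = v 0" for s by (rule zero_derivative_const)
  have "((\<lambda>s. w s - s *\<^sub>R v 0) has_vector_derivative v s - v 0) (at s)" for s
    using has_vector_derivative_diff[OF w has_vector_derivative_scaleR[OF DERIV_ident has_vector_derivative_const]]
    by simp
  then have "((\<lambda>s. w s - s *\<^sub>R v 0) has_vector_derivative 0) (at s)" for s using v0[of s] by (metis diff_self)
  then have w0: "w s - s *\<^sub>R v 0 = w 0 - 0 *\<^sub>R v 0" for s by (rule zero_derivative_const)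
  have ws: "w s = w 0 + s *\<^sub>R v 0" for s using w0[of s] by (simp add: diff_eq_eq)
  have shift: "w (s + \<theta>) = rot (b * \<theta>) *v w s" for s
    using rot_add[of "b * \<theta>" "b * s" "c s"] per[of s] by (simp add: w_def algebra_simps)
  have "rot (b * \<theta>) *v v 0 = v 0"
  proof -
    have "rot (b * \<theta>) *v (w 1 - w 0) = w (1 + \<theta>) - w (0 + \<theta>)" unfolding shift by (rule rot_diff)
    moreover have "w 1 - w 0 = v 0" "w (1 + \<theta>) - w (0 + \<theta>) = v 0"
      using ws[of 1] ws[of "1 + \<theta>"] ws[of \<theta>] by (simp_all add: algebra_simps)
    ultimately show ?thesis by simp
  qed
  then have "v 0 = 0" using b by (rule rot_fixed_point)
  then have "w (0 + \<theta>) = w 0" using ws[of \<theta>] by simp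
  then have "rot (b * \<theta>) *v w 0 = w 0" unfolding shift .
  then have "w 0 = 0" using b by (rule rot_fixed_point)
  then have "w s = 0" using ws[of s] \<open>v 0 = 0\<close> by simp
  then have "norm (w s) = 0" by simp
  then show ?thesis by (simp add: w_def)
qed

subsection \<open>The Newtonian kernel\<close>

text \<open>The junk values at \<open>0\<close> are harmless: \<open>grav 0 = 0\<close> and \<open>dgrav 0 = (\<lambda>h. 0)\<close>, so that sums over
  pairs of distinct bodies may be extended to the diagonal.\<close>

definition grav :: "real^2 \<Rightarrow> real^2" where
  "grav x = (1 / norm x ^ 3) *\<^sub>R x"

definition dgrav :: "real^2 \<Rightarrow> real^2 \<Rightarrow> real^2" where
  "dgrav x h = (1 / norm x ^ 3) *\<^sub>R h - (3 * (x \<bullet> h) / norm x ^ 5) *\<^sub>R x"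

lemma grav_0 [simp]: "grav 0 = 0" and dgrav_0 [simp]: "dgrav 0 h = 0" and dgrav_zero_right [simp]: "dgrav x 0 = 0"
  by (simp_all add: grav_def dgrav_def)

lemma grav_minus: "grav (- x) = - grav x"
  by (simp add: grav_def)

lemma grav_commute: "grav (x - y) = - grav (y - x)"
  using grav_minus[of "y - x"] by simp

lemma dgrav_commute: "dgrav (x - y) (h - k) = - dgrav (y - x) (k - h)"
proof -
  have "(x - y) \<bullet> (h - k) = (y - x) \<bullet> (k - h)" by (simp add: inner_diff_left inner_diff_right)
  moreover have "norm (x - y) = norm (y - x)" by (rule norm_minus_commute)
  ultimately show ?thesis by (simp add: dgrav_def algebra_simps)
qed

lemma grav_rot: "grav (rot t *v x) = rot t *v grav x"
  by (simp add: grav_def rot_scaleR)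

lemma grav_scaleR: "c > 0 \<Longrightarrow> grav (c *\<^sub>R x) = (1 / c\<^sup>2) *\<^sub>R grav x"
  by (simp add: grav_def power_mult_distrib power2_eq_square power3_eq_cube)

lemma dgrav_J: "dgrav x (J *v x) = J *v grav x"
  by (simp add: dgrav_def grav_def J_linear_simps)

lemma dgrav_sym: "dgrav x h \<bullet> k = dgrav x k \<bullet> h"
  by (simp add: dgrav_def inner_diff_left inner_diff_right inner_commute)

lemma linear_dgrav: "linear (dgrav x)"
  by (rule linearI) (simp_all add: dgrav_def inner_add_right algebra_simps add_divide_distrib)

lemma has_derivative_inverse_norm:
  fixes x :: "real^2"
  assumes "x \<noteq> 0"
  shows "((\<lambda>x. 1 / norm x) has_derivative (\<lambda>h. - (grav x \<bullet> h))) (at x)"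
proof -
  have "(norm has_derivative (\<lambda>h. x \<bullet> h / norm x)) (at x)"
    using has_derivative_norm[OF assms]
    by (simp add: sgn_div_norm divide_inverse mult.commute inner_commute)
  then show ?thesis
    using assms by (auto intro!: derivative_eq_intros simp: grav_def fun_eq_iff field_simps eval_nat_numeral)
qed

lemma has_derivative_grav:
  assumes "x \<noteq> 0"
  shows "(grav has_derivative dgrav x) (at x)"
proof -
  have "(norm has_derivative (\<lambda>h. x \<bullet> h / norm x)) (at x)"
    using has_derivative_norm[OF assms]
    by (simp add: sgn_div_norm divide_inverse mult.commute inner_commute)
  then have n: "((\<lambda>x. 1 / norm x ^ 3) has_derivative (\<lambda>h. - (3 * (x \<bullet> h)) / norm x ^ 5)) (at x)"
    using assms
    by (auto intro!: derivative_eq_intros simp: fun_eq_iff field_simps eval_nat_numeral)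
  have "((\<lambda>x. (1 / norm x ^ 3) *\<^sub>R x) has_derivative
      (\<lambda>h. (1 / norm x ^ 3) *\<^sub>R h + (- (3 * (x \<bullet> h)) / norm x ^ 5) *\<^sub>R x)) (at x)"
    by (rule has_derivative_scaleR[OF n has_derivative_ident])
  then show ?thesis unfolding grav_def[abs_def] by (simp add: dgrav_def[abs_def])
qed

definition accel :: "('k::finite \<Rightarrow> real) \<Rightarrow> (real^2)^'k \<Rightarrow> 'k \<Rightarrow> real^2" where
  "accel \<mu> u i = - (\<Sum>j\<in>UNIV. \<mu> j *\<^sub>R grav (u $ i - u $ j))"

definition daccel :: "('k::finite \<Rightarrow> real) \<Rightarrow> (real^2)^'k \<Rightarrow> (real^2)^'k \<Rightarrow> 'k \<Rightarrow> real^2" where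
  "daccel \<mu> u h i = - (\<Sum>j\<in>UNIV. \<mu> j *\<^sub>R dgrav (u $ i - u $ j) (h $ i - h $ j))"

lemma has_real_derivativeI:
  "(f has_derivative D) F \<Longrightarrow> (\<And>h. D h = h * c) \<Longrightarrow> (f has_real_derivative c) F"
  unfolding has_field_derivative_def by (metis (no_types, lifting) ext mult.commute)

lemma antisymmetric_double_sum:
  fixes f :: "'k::finite \<Rightarrow> 'k \<Rightarrow> 'a::real_vector"
  assumes "\<And>i j. f i j = - f j i"
  shows "(\<Sum>i\<in>UNIV. \<Sum>j\<in>UNIV. f i j) = 0"
proof -
  have "(\<Sum>i\<in>UNIV. \<Sum>j\<in>UNIV. f i j) = (\<Sum>i\<in>UNIV. \<Sum>j\<in>UNIV. f j i)"
    by (rule sum.swap)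
  also have "\<dots> = (\<Sum>i\<in>UNIV. \<Sum>j\<in>UNIV. - f i j)"
    by (intro sum.cong refl assms)
  also have "\<dots> = - (\<Sum>i\<in>UNIV. \<Sum>j\<in>UNIV. f i j)"
    by (simp add: sum_negf)
  finally have "(\<Sum>i\<in>UNIV. \<Sum>j\<in>UNIV. f i j) + (\<Sum>i\<in>UNIV. \<Sum>j\<in>UNIV. f i j) = 0"
    unfolding eq_neg_iff_add_eq_0 .
  then have "2 *\<^sub>R (\<Sum>i\<in>UNIV. \<Sum>j\<in>UNIV. f i j) = 0" unfolding scaleR_2 .
  then show ?thesis by simp
qed

text \<open>Exchanging the names of the indices turns the \<open>k j\<close> half of the sum into
  the \<open>k i\<close> half. It is the passage from forces paired with relative displacements to
  forces paired with displacements of single bodies.\<close>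

lemma antisymmetric_pairing:
  fixes f :: "'k::finite \<Rightarrow> 'k \<Rightarrow> 'a::real_inner"
  assumes "\<And>i j. f i j = - f j i"
  shows "(\<Sum>i\<in>UNIV. \<Sum>j\<in>UNIV. f i j \<bullet> (k i - k j)) = 2 * (\<Sum>i\<in>UNIV. (\<Sum>j\<in>UNIV. f i j) \<bullet> k i)"
proof -
  have "(\<Sum>i\<in>UNIV. \<Sum>j\<in>UNIV. f i j \<bullet> k j) = (\<Sum>i\<in>UNIV. \<Sum>j\<in>UNIV. f j i \<bullet> k i)"
    by (rule sum.swap)
  also have "\<dots> = (\<Sum>i\<in>UNIV. \<Sum>j\<in>UNIV. - (f i j \<bullet> k i))"
    by (intro sum.cong refl) (metis assms inner_minus_left)
  also have "\<dots> = - (\<Sum>i\<in>UNIV. \<Sum>j\<in>UNIV. f i j \<bullet> k i)"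
    by (simp add: sum_negf)
  finally show ?thesis
    by (simp add: inner_diff_right sum_subtractf inner_sum_left)
qed

lemma sum_accel: "(\<Sum>i\<in>UNIV. \<mu> i *\<^sub>R accel \<mu> u i) = 0"
proof -
  have "(\<Sum>i\<in>UNIV. \<Sum>j\<in>UNIV. (\<mu> i * \<mu> j) *\<^sub>R grav (u $ i - u $ j)) = 0"
  proof (rule antisymmetric_double_sum)
    fix i j
    show "(\<mu> i * \<mu> j) *\<^sub>R grav (u $ i - u $ j) = - ((\<mu> j * \<mu> i) *\<^sub>R grav (u $ j - u $ i))"
      unfolding grav_commute[of "u $ i" "u $ j"] by (simp add: mult.commute)
  qed
  then show ?thesis by (simp add: accel_def scaleR_right.sum sum_negf)
qed

lemma sum_daccel: "(\<Sum>i\<in>UNIV. \<mu> i *\<^sub>R daccel \<mu> u h i) = 0"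
proof -
  have "(\<Sum>i\<in>UNIV. \<Sum>j\<in>UNIV. (\<mu> i * \<mu> j) *\<^sub>R dgrav (u $ i - u $ j) (h $ i - h $ j)) = 0"
  proof (rule antisymmetric_double_sum)
    fix i j
    show "(\<mu> i * \<mu> j) *\<^sub>R dgrav (u $ i - u $ j) (h $ i - h $ j) =
        - ((\<mu> j * \<mu> i) *\<^sub>R dgrav (u $ j - u $ i) (h $ j - h $ i))"
      unfolding dgrav_commute[of "u $ i" "u $ j" "h $ i" "h $ j"] by (simp add: mult.commute)
  qed
  then show ?thesis by (simp add: daccel_def scaleR_right.sum sum_negf)
qed

lemma daccel_pairing:
  "(\<Sum>i\<in>UNIV. \<mu> i * (daccel \<mu> u h i \<bullet> k $ i)) =
    - (1/2) * (\<Sum>i\<in>UNIV. \<Sum>j\<in>UNIV. \<mu> i * \<mu> j * (dgrav (u $ i - u $ j) (h $ i - h $ j) \<bullet> (k $ i - k $ j)))"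
proof -
  let ?f = "\<lambda>i j. (\<mu> i * \<mu> j) *\<^sub>R dgrav (u $ i - u $ j) (h $ i - h $ j)"
  have "(\<Sum>i\<in>UNIV. \<Sum>j\<in>UNIV. ?f i j \<bullet> (k $ i - k $ j)) = 2 * (\<Sum>i\<in>UNIV. (\<Sum>j\<in>UNIV. ?f i j) \<bullet> k $ i)"
  proof (rule antisymmetric_pairing)
    fix i j show "?f i j = - ?f j i"
      unfolding dgrav_commute[of "u $ i" "u $ j" "h $ i" "h $ j"] by (simp add: mult.commute)
  qed
  moreover have "(\<Sum>j\<in>UNIV. ?f i j) \<bullet> k $ i = - (\<mu> i * (daccel \<mu> u h i \<bullet> k $ i))" for i
    by (simp add: daccel_def inner_sum_left sum_distrib_left inner_minus_left mult.assoc)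
  ultimately show ?thesis by (simp add: sum_negf)
qed

lemma daccel_sym:
  "(\<Sum>i\<in>UNIV. \<mu> i * (daccel \<mu> u h i \<bullet> k $ i)) = (\<Sum>i\<in>UNIV. \<mu> i * (daccel \<mu> u k i \<bullet> h $ i))"
proof -
  have "dgrav x (h $ i - h $ j) \<bullet> (k $ i - k $ j) = dgrav x (k $ i - k $ j) \<bullet> (h $ i - h $ j)" for x i j
    by (rule dgrav_sym)
  then show ?thesis unfolding daccel_pairing by presburger
qed

text \<open>The derivative of the rotation equivariance of the force at the identity.\<close>

lemma daccel_J: "daccel \<mu> u (J_all u) i = J *v accel \<mu> u i"
proof -
  have "dgrav (u $ i - u $ j) (J_all u $ i - J_all u $ j) = J *v grav (u $ i - u $ j)" for j
    using dgrav_J[of "u $ i - u $ j"] by (simp add: J_all_def J_linear_simps)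
  then show ?thesis by (simp add: daccel_def accel_def J_sum J_linear_simps)
qed

lemma daccel_linear_right:
  "daccel \<mu> u (h + k) i = daccel \<mu> u h i + daccel \<mu> u k i"
  "daccel \<mu> u (c *\<^sub>R h) i = c *\<^sub>R daccel \<mu> u h i"
proof -
  have "dgrav x ((h + k) $ i - (h + k) $ j) = dgrav x (h $ i - h $ j) + dgrav x (k $ i - k $ j)" for x j
    unfolding vector_add_component add_diff_add by (rule linear_add[OF linear_dgrav])
  then show "daccel \<mu> u (h + k) i = daccel \<mu> u h i + daccel \<mu> u k i"
    by (simp add: daccel_def scaleR_add_right sum.distrib del: vector_add_component)
  show "daccel \<mu> u (c *\<^sub>R h) i = c *\<^sub>R daccel \<mu> u h i"
    by (simp add: daccel_def linear_scale[OF linear_dgrav] scaleR_right_diff_distrib[symmetric] scaleR_right.sum mult.commute)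
qed

lemma open_collision_free: "open {u :: (real^2)^'k::finite. collision_free u}"
proof -
  have "{u :: (real^2)^'k. collision_free u} = (\<Inter>i. \<Inter>j. {u. i = j \<or> u $ i \<noteq> u $ j})"
    by (auto simp: collision_free_def)
  moreover have "open {u :: (real^2)^'k. i = j \<or> u $ i \<noteq> u $ j}" for i j
  proof (cases "i = j")
    case False
    have "open {u :: (real^2)^'k. u $ i \<noteq> u $ j}"
      by (intro open_Collect_neq continuous_intros)
    then show ?thesis using False by simp
  qed simp
  ultimately show ?thesis by (auto intro!: open_INT)
qed

lemma collision_free_ball:
  assumes "collision_free a"
  obtains r where "r > 0" "\<And>u. norm (u - a) < r \<Longrightarrow> collision_free u"
proof -
  obtain r where "r > 0" "ball a r \<subseteq> {u. collision_free u}"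
    using open_collision_free assms open_contains_ball by blast
  then show ?thesis using that[of r] by (force simp: dist_norm norm_minus_commute)
qed

lemma newton_U_altdef:
  "newton_U \<mu> u = 1/2 * (\<Sum>i\<in>UNIV. \<Sum>j\<in>UNIV. \<mu> i * \<mu> j / norm (u $ i - u $ j))"
proof -
  have "(\<Sum>j\<in>UNIV - {i}. \<mu> i * \<mu> j / norm (u $ i - u $ j)) = (\<Sum>j\<in>UNIV. \<mu> i * \<mu> j / norm (u $ i - u $ j))" for i
    by (rule sum.mono_neutral_left) auto
  then show ?thesis by (simp add: newton_U_def)
qed

text \<open>Only pairs with nonzero mass product have to be apart. This admits configurations with
  an auxiliary point of mass zero, which may coincide with bodies, as in the energy balance of the
  whole system.\<close>

lemma newton_U_derivative_weighted:
  fixes w :: "real \<Rightarrow> (real^2)^'k::finite"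
  assumes w: "(w has_vector_derivative w') (at t)"
    and cf: "\<And>i j. i \<noteq> j \<Longrightarrow> \<mu> i * \<mu> j \<noteq> 0 \<Longrightarrow> w t $ i \<noteq> w t $ j"
  shows "((\<lambda>t. newton_U \<mu> (w t)) has_real_derivative (\<Sum>i\<in>UNIV. \<mu> i * (accel \<mu> (w t) i \<bullet> w' $ i))) (at t)"
proof -
  have d: "((\<lambda>t. w t $ i - w t $ j) has_vector_derivative (w' $ i - w' $ j)) (at t)" for i j
    using has_vector_derivative_diff[OF bounded_linear.has_vector_derivative[OF bounded_linear_vec_nth w, of i]
        bounded_linear.has_vector_derivative[OF bounded_linear_vec_nth w, of j]] .
  have p: "((\<lambda>t. \<mu> i * \<mu> j * (1 / norm (w t $ i - w t $ j))) has_real_derivative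
      \<mu> i * \<mu> j * - (grav (w t $ i - w t $ j) \<bullet> (w' $ i - w' $ j))) (at t)" for i j
  proof (cases "i = j \<or> \<mu> i * \<mu> j = 0")
    case False
    then have "w t $ i - w t $ j \<noteq> 0" using cf by auto
    from has_derivative_compose[OF d[unfolded has_vector_derivative_def] has_derivative_inverse_norm[OF this]]
    show ?thesis by (intro DERIV_cmult, rule has_real_derivativeI) simp
  qed auto
  have "((\<lambda>t. 1/2 * (\<Sum>i\<in>UNIV. \<Sum>j\<in>UNIV. \<mu> i * \<mu> j * (1 / norm (w t $ i - w t $ j)))) has_real_derivative
      1/2 * (\<Sum>i\<in>UNIV. \<Sum>j\<in>UNIV. \<mu> i * \<mu> j * - (grav (w t $ i - w t $ j) \<bullet> (w' $ i - w' $ j)))) (at t)"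
    by (intro DERIV_cmult DERIV_sum p)
  moreover have "(\<Sum>i\<in>UNIV. \<Sum>j\<in>UNIV. ((\<mu> i * \<mu> j) *\<^sub>R grav (w t $ i - w t $ j)) \<bullet> (w' $ i - w' $ j)) =
      2 * (\<Sum>i\<in>UNIV. (\<Sum>j\<in>UNIV. (\<mu> i * \<mu> j) *\<^sub>R grav (w t $ i - w t $ j)) \<bullet> w' $ i)"
  proof (rule antisymmetric_pairing)
    fix i j
    show "(\<mu> i * \<mu> j) *\<^sub>R grav (w t $ i - w t $ j) = - ((\<mu> j * \<mu> i) *\<^sub>R grav (w t $ j - w t $ i))"
      unfolding grav_commute[of "w t $ i" "w t $ j"] by (simp add: mult.commute)
  qed
  moreover have "(\<Sum>j\<in>UNIV. (\<mu> i * \<mu> j) *\<^sub>R grav (w t $ i - w t $ j)) \<bullet> w' $ i = - (\<mu> i * (accel \<mu> (w t) i \<bullet> w' $ i))" for i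
    by (simp add: accel_def inner_sum_left sum_distrib_left inner_minus_left mult.assoc)
  ultimately show ?thesis unfolding newton_U_altdef by (simp add: sum_negf)
qed

lemma newton_U_derivative:
  fixes w :: "real \<Rightarrow> (real^2)^'k::finite"
  assumes "(w has_vector_derivative w') (at t)" "collision_free (w t)"
  shows "((\<lambda>t. newton_U \<mu> (w t)) has_real_derivative (\<Sum>i\<in>UNIV. \<mu> i * (accel \<mu> (w t) i \<bullet> w' $ i))) (at t)"
  using assms by (intro newton_U_derivative_weighted) (auto simp: collision_free_def)

lemma accel_has_vector_derivative:
  fixes w :: "real \<Rightarrow> (real^2)^'k::finite"
  assumes w: "(w has_vector_derivative w') (at t)" and cf: "collision_free (w t)"
  shows "((\<lambda>t. accel \<mu> (w t) i) has_vector_derivative daccel \<mu> (w t) w' i) (at t)"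
proof -
  have d: "((\<lambda>t. w t $ i - w t $ j) has_vector_derivative (w' $ i - w' $ j)) (at t)" for i j
    using has_vector_derivative_diff[OF bounded_linear.has_vector_derivative[OF bounded_linear_vec_nth w, of i]
        bounded_linear.has_vector_derivative[OF bounded_linear_vec_nth w, of j]] .
  have p: "((\<lambda>t. grav (w t $ i - w t $ j)) has_vector_derivative
      dgrav (w t $ i - w t $ j) (w' $ i - w' $ j)) (at t)" for j
  proof (cases "i = j")
    case False
    then have "w t $ i - w t $ j \<noteq> 0" using cf by (auto simp: collision_free_def)
    from has_derivative_compose[OF d[unfolded has_vector_derivative_def] has_derivative_grav[OF this]]
    show ?thesis by (simp add: has_vector_derivative_def o_def linear_scale[OF linear_dgrav])
  qed simp
  show ?thesis
    unfolding accel_def daccel_def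
    by (intro has_vector_derivative_minus has_vector_derivative_sum
        bounded_linear.has_vector_derivative[OF bounded_linear_scaleR_right] p)
qed

subsection \<open>Hessians as iterated directional derivatives\<close>

lemma derivative_within_subspace_directional:
  fixes f :: "'a::real_normed_vector \<Rightarrow> real"
  assumes f: "(f has_derivative f') (at u within S)" and S: "subspace S" "u \<in> S" "k \<in> S"
    and D: "((\<lambda>\<sigma>. f (u + \<sigma> *\<^sub>R k)) has_real_derivative D) (at 0)"
  shows "f' k = D"
proof -
  have "((\<lambda>\<sigma>. u + \<sigma> *\<^sub>R k) has_derivative (\<lambda>\<sigma>. \<sigma> *\<^sub>R k)) (at 0)"
    by (auto intro!: derivative_eq_intros)
  moreover have "range (\<lambda>\<sigma>. u + \<sigma> *\<^sub>R k) \<subseteq> S"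
    using S by (auto intro: subspace_add subspace_scale)
  ultimately have "((\<lambda>\<sigma>. f (u + \<sigma> *\<^sub>R k)) has_derivative (\<lambda>\<sigma>. f' (\<sigma> *\<^sub>R k))) (at 0)"
    using has_derivative_in_compose[of "\<lambda>\<sigma>. u + \<sigma> *\<^sub>R k" "\<lambda>\<sigma>. \<sigma> *\<^sub>R k" 0 UNIV f f']
      has_derivative_subset[OF f] by simp
  then have "((\<lambda>\<sigma>. f (u + \<sigma> *\<^sub>R k)) has_real_derivative f' k) (at 0)"
    by (rule has_real_derivativeI) (simp add: linear_scale[OF has_derivative_linear[OF f]])
  then show ?thesis using D by (rule DERIV_unique)
qed

text \<open>The derivative \<open>F\<close> in \<open>has_hessian_on\<close> is given only by its
  existence and determined only on \<open>S\<close>. Testing it along the lines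
  \<open>u + \<sigma> *\<^sub>R k\<close> and then \<open>a + \<tau> *\<^sub>R h\<close>, which stay
  in \<open>S\<close>, identifies the value of the Hessian with an iterated derivative that can be
  computed.\<close>

lemma hessian_eq_directional:
  assumes hess: "has_hessian_on S f a B" and S: "subspace S" "a \<in> S" "h \<in> S" "k \<in> S"
    and G: "\<And>\<tau>. \<bar>\<tau>\<bar> < r \<Longrightarrow> ((\<lambda>\<sigma>. f (a + \<tau> *\<^sub>R h + \<sigma> *\<^sub>R k)) has_real_derivative G \<tau>) (at 0)" and r: "r > 0"
    and D: "(G has_real_derivative D) (at 0)"
  shows "blinfun_apply (B h) k = D"
proof -
  obtain F d where d: "d > 0" and
    F: "\<And>u. u \<in> S \<Longrightarrow> dist u a < d \<Longrightarrow> (f has_derivative blinfun_apply (F u)) (at u within S)" and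
    B: "(F has_derivative B) (at a within S)"
    using hess unfolding has_hessian_on_def by blast
  have inS: "a + \<tau> *\<^sub>R h \<in> S" for \<tau> using S by (auto intro: subspace_add subspace_scale)
  define r' where "r' = min r (d / (norm h + 1))"
  have r': "r' > 0" using r d by (simp add: r'_def add_nonneg_pos)
  have GF: "blinfun_apply (F (a + \<tau> *\<^sub>R h)) k = G \<tau>" if "\<bar>\<tau>\<bar> < r'" for \<tau>
  proof (rule derivative_within_subspace_directional[OF F[OF inS] S(1) inS S(4) G])
    have "\<bar>\<tau>\<bar> * (norm h + 1) < d" using that by (simp add: r'_def pos_less_divide_eq add_nonneg_pos)
    moreover have "\<bar>\<tau>\<bar> * norm h \<le> \<bar>\<tau>\<bar> * (norm h + 1)" by (intro mult_left_mono) auto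
    ultimately show "dist (a + \<tau> *\<^sub>R h) a < d" by (simp add: dist_norm)
    show "\<bar>\<tau>\<bar> < r" using that by (simp add: r'_def)
  qed
  have "((\<lambda>\<tau>. a + \<tau> *\<^sub>R h) has_derivative (\<lambda>\<tau>. \<tau> *\<^sub>R h)) (at 0)"
    by (auto intro!: derivative_eq_intros)
  then have "((\<lambda>\<tau>. F (a + \<tau> *\<^sub>R h)) has_derivative (\<lambda>\<tau>. B (\<tau> *\<^sub>R h))) (at 0)"
    using has_derivative_in_compose[of "\<lambda>\<tau>. a + \<tau> *\<^sub>R h" "\<lambda>\<tau>. \<tau> *\<^sub>R h" 0 UNIV F B]
      has_derivative_subset[OF B] inS by (simp add: image_subset_iff)
  then have "((\<lambda>\<tau>. blinfun_apply (F (a + \<tau> *\<^sub>R h)) k) has_derivative (\<lambda>\<tau>. blinfun_apply (B (\<tau> *\<^sub>R h)) k)) (at 0)"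
    by (auto intro!: derivative_eq_intros)
  moreover have "(\<lambda>\<tau>. blinfun_apply (B (\<tau> *\<^sub>R h)) k) = (\<lambda>\<tau>. \<tau> * blinfun_apply (B h) k)"
    using linear_scale[OF has_derivative_linear[OF B]] by (simp add: fun_eq_iff blinfun.scaleR_left)
  ultimately have 1: "((\<lambda>\<tau>. blinfun_apply (F (a + \<tau> *\<^sub>R h)) k) has_real_derivative blinfun_apply (B h) k) (at 0)"
    by (auto intro: has_real_derivativeI)
  have "(G has_real_derivative blinfun_apply (B h) k) (at 0)"
    by (rule has_field_derivative_transform_within[OF 1 r']) (use GF in \<open>auto simp: dist_norm\<close>)
  then show ?thesis using D by (rule DERIV_unique)
qed

subsection \<open>Central configurations\<close>

lemma norm_sqrt_mass:
  assumes "\<And>i. \<mu> i > 0"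
  shows "(norm (sqrt_mass \<mu> u))\<^sup>2 = (\<Sum>i\<in>UNIV. \<mu> i * (u $ i \<bullet> u $ i))"
  using assms unfolding power2_norm_eq_inner inner_vec_def[of "sqrt_mass \<mu> u"]
  by (simp add: sqrt_mass_def mult.assoc[symmetric] less_imp_le)

lemma subspace_E_red: "subspace (E_red \<mu>)"
proof (rule subspaceI)
  show "0 \<in> E_red \<mu>" by (simp add: E_red_def)
  fix x y :: "(real^2)^'a" and c :: real
  assume "x \<in> E_red \<mu>"
  then have x: "(\<Sum>i\<in>UNIV. \<mu> i *\<^sub>R x $ i) = 0" by (simp add: E_red_def)
  have "(\<Sum>i\<in>UNIV. \<mu> i *\<^sub>R c *\<^sub>R x $ i) = c *\<^sub>R (\<Sum>i\<in>UNIV. \<mu> i *\<^sub>R x $ i)"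
    by (simp add: scaleR_right.sum mult.commute)
  then show "c *\<^sub>R x \<in> E_red \<mu>" by (simp add: E_red_def x)
  assume "y \<in> E_red \<mu>"
  with x show "x + y \<in> E_red \<mu>" by (simp add: E_red_def scaleR_add_right sum.distrib)
qed

lemma amended_V_directional:
  assumes \<mu>: "\<And>i. \<mu> i > 0" and cf: "collision_free u"
  shows "((\<lambda>\<sigma>. amended_V \<mu> (u + \<sigma> *\<^sub>R k)) has_real_derivative
    (\<Sum>i\<in>UNIV. \<mu> i * ((u $ i + accel \<mu> u i) \<bullet> k $ i))) (at 0)"
proof -
  have w: "((\<lambda>\<sigma>. u + \<sigma> *\<^sub>R k) has_vector_derivative k) (at 0)"
    by (auto intro!: derivative_eq_intros)
  have U: "((\<lambda>\<sigma>. newton_U \<mu> (u + \<sigma> *\<^sub>R k)) has_real_derivative (\<Sum>i\<in>UNIV. \<mu> i * (accel \<mu> u i \<bullet> k $ i))) (at 0)"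
    using newton_U_derivative[OF w, of \<mu>] cf by simp
  have n: "(norm (sqrt_mass \<mu> (u + \<sigma> *\<^sub>R k)))\<^sup>2 = (\<Sum>i\<in>UNIV. \<mu> i * (u $ i \<bullet> u $ i + 2 * \<sigma> * (u $ i \<bullet> k $ i) + \<sigma>\<^sup>2 * (k $ i \<bullet> k $ i)))" for \<sigma>
    unfolding norm_sqrt_mass[OF \<mu>]
    by (simp add: inner_add_left inner_add_right inner_commute power2_eq_square algebra_simps)
  have "((\<lambda>\<sigma>. 1/2 * (\<Sum>i\<in>UNIV. \<mu> i * (u $ i \<bullet> u $ i + 2 * \<sigma> * (u $ i \<bullet> k $ i) + \<sigma>\<^sup>2 * (k $ i \<bullet> k $ i)))) has_real_derivative
      1/2 * (\<Sum>i\<in>UNIV. \<mu> i * (2 * (u $ i \<bullet> k $ i)))) (at 0)"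
    by (intro DERIV_cmult DERIV_sum) (auto intro!: derivative_eq_intros)
  from DERIV_add[OF this U] show ?thesis
    unfolding amended_V_def n
    by (simp add: sum_distrib_left inner_add_left distrib_left sum.distrib mult.assoc)
qed

text \<open>Criticality within \<open>E_red\<close> tests the vector field \<open>w\<close> only
  against displacements with center of mass at 0. As \<open>w\<close> itself has weighted sum zero,
  because the internal forces balance, nothing is lost.\<close>

lemma central_configuration_eq:
  fixes a :: "(real^2)^'k::finite"
  assumes \<mu>: "\<And>i. \<mu> i > 0" and cc: "central_configuration \<mu> a"
  shows "a $ i + accel \<mu> a i = 0"
proof -
  have cf: "collision_free a" and a: "a \<in> E_red \<mu>"
    and crit: "(amended_V \<mu> has_derivative (\<lambda>h. 0)) (at a within E_red \<mu>)"
    using cc by (auto simp: central_configuration_def critical_point_on_def)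
  define w where "w i = a $ i + accel \<mu> a i" for i
  have zero: "(\<Sum>i\<in>UNIV. \<mu> i * (w i \<bullet> k $ i)) = 0" if "k \<in> E_red \<mu>" for k
    using derivative_within_subspace_directional[OF crit subspace_E_red a that amended_V_directional[OF \<mu> cf]]
    by (simp add: w_def)
  have sw: "(\<Sum>i\<in>UNIV. \<mu> i *\<^sub>R w i) = 0"
    using a sum_accel[of \<mu> a] by (simp add: w_def E_red_def scaleR_add_right sum.distrib)
  let ?M = "\<Sum>i\<in>UNIV. \<mu> i"
  have M: "?M > 0" by (rule sum_pos) (use \<mu> in auto)
  \<comment> \<open>The displacement of the single body \<open>i\<close> by \<open>w i\<close>,
    corrected by a common translation that brings it into \<open>E_red\<close>. The pairing of the
    translation with \<open>w\<close> vanishes, so \<open>\<mu> i * (w i \<bullet> w i)\<close>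
    remains.\<close>
  define k :: "(real^2)^'k" where "k = (\<chi> j. (if j = i then w i else 0) - (\<mu> i / ?M) *\<^sub>R w i)"
  have "(\<Sum>j\<in>UNIV. \<mu> j *\<^sub>R k $ j) = (\<Sum>j\<in>UNIV. (if j = i then \<mu> j *\<^sub>R w i else 0)) - (\<Sum>j\<in>UNIV. (\<mu> j * (\<mu> i / ?M)) *\<^sub>R w i)"
    by (subst sum_subtractf[symmetric], rule sum.cong) (auto simp: k_def scaleR_diff_right)
  also have "(\<Sum>j\<in>UNIV. (\<mu> j * (\<mu> i / ?M)) *\<^sub>R w i) = (?M * (\<mu> i / ?M)) *\<^sub>R w i"
    by (simp only: sum_distrib_right scaleR_left.sum)
  also have "\<dots> = \<mu> i *\<^sub>R w i" using M by simp
  finally have "k \<in> E_red \<mu>" by (simp add: E_red_def sum.delta)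
  then have "0 = (\<Sum>j\<in>UNIV. \<mu> j * (w j \<bullet> k $ j))" using zero by simp
  also have "\<dots> = (\<Sum>j\<in>UNIV. (if j = i then \<mu> j * (w j \<bullet> w i) else 0)) - (\<Sum>j\<in>UNIV. (\<mu> i / ?M) * ((\<mu> j *\<^sub>R w j) \<bullet> w i))"
    by (subst sum_subtractf[symmetric], rule sum.cong) (auto simp: k_def inner_diff_right algebra_simps)
  also have "(\<Sum>j\<in>UNIV. (\<mu> i / ?M) * ((\<mu> j *\<^sub>R w j) \<bullet> w i)) = (\<mu> i / ?M) * ((\<Sum>j\<in>UNIV. \<mu> j *\<^sub>R w j) \<bullet> w i)"
    by (simp only: sum_distrib_left inner_sum_left)
  also have "\<dots> = 0" by (simp add: sw)
  finally have "\<mu> i * (w i \<bullet> w i) = 0" by (simp add: sum.delta)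
  then show ?thesis using \<mu>[of i] by (simp add: w_def)
qed

lemma mass_norm_pos:
  fixes a :: "(real^2)^'k::finite"
  assumes \<mu>: "\<And>i. \<mu> i > 0" and cf: "collision_free a" and card: "CARD('k) \<ge> 2"
  shows "(\<Sum>i\<in>UNIV. \<mu> i * (a $ i \<bullet> a $ i)) > 0"
proof -
  obtain i j :: 'k where "i \<noteq> j"
    using card by (metis (full_types) UNIV_I card_2_iff' card_le_Suc0_iff_eq finite not_less_eq_eq numeral_2_eq_2)
  then have "a $ i \<noteq> 0 \<or> a $ j \<noteq> 0" using cf by (metis collision_free_def)
  then obtain l where "a $ l \<noteq> 0" by blast
  then have "\<mu> l * (a $ l \<bullet> a $ l) > 0" using \<mu> by simp
  then show ?thesis
    by (intro sum_pos2[of UNIV l]) (use \<mu> in \<open>auto intro!: mult_nonneg_nonneg simp: less_imp_le\<close>)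
qed

lemma daccel_central_J:
  assumes "\<And>i. a $ i + accel \<mu> a i = 0"
  shows "daccel \<mu> a (J_all a) i = - (J *v (a $ i))"
proof -
  have "accel \<mu> a i = - (a $ i)" using assms[of i] by (simp add: eq_neg_iff_add_eq_0 add.commute)
  then show ?thesis by (simp add: daccel_J)
qed

text \<open>The linearisation is symmetric for the mass inner product and annihilates the
  infinitesimal rotation \<open>J_all a\<close>; so its range is orthogonal to
  \<open>J_all a\<close>. This orthogonality is what isolates the multiplier in the kernel
  lemmas.\<close>

lemma linearised_pairing_J:
  assumes eq: "\<And>i. a $ i + accel \<mu> a i = 0"
  shows "(\<Sum>i\<in>UNIV. \<mu> i * ((h $ i + daccel \<mu> a h i) \<bullet> (J *v (a $ i)))) = 0"
proof -
  have "(\<Sum>i\<in>UNIV. \<mu> i * ((h $ i + daccel \<mu> a h i) \<bullet> (J *v (a $ i)))) =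
      (\<Sum>i\<in>UNIV. \<mu> i * (h $ i \<bullet> (J *v (a $ i)))) + (\<Sum>i\<in>UNIV. \<mu> i * (daccel \<mu> a h i \<bullet> J_all a $ i))"
    by (simp add: J_all_def inner_add_left distrib_left sum.distrib)
  also have "(\<Sum>i\<in>UNIV. \<mu> i * (daccel \<mu> a h i \<bullet> J_all a $ i)) = (\<Sum>i\<in>UNIV. \<mu> i * (daccel \<mu> a (J_all a) i \<bullet> h $ i))"
    by (rule daccel_sym)
  also have "\<dots> = - (\<Sum>i\<in>UNIV. \<mu> i * (h $ i \<bullet> (J *v (a $ i))))"
    by (simp add: daccel_central_J[OF eq] inner_commute sum_negf)
  finally show ?thesis by simp
qed

text \<open>Injectivity of the bordered Hessian. Pairing the equation with \<open>J_all a\<close>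
  leaves only the multiplier, which therefore vanishes. The rest says that \<open>h\<close> lies in
  the kernel of the Hessian, hence is an infinitesimal rotation, and \<open>perp\<close> excludes
  all of these but 0.\<close>

lemma nondegenerate_cc_kernel:
  fixes a :: "(real^2)^'k::finite"
  assumes \<mu>: "\<And>i. \<mu> i > 0" and card: "CARD('k) \<ge> 2" and nd: "nondegenerate_cc \<mu> a"
    and eq: "\<And>i. h $ i + daccel \<mu> a h i + l *\<^sub>R (J *v (a $ i)) = 0"
    and perp: "(\<Sum>i\<in>UNIV. \<mu> i * (h $ i \<bullet> (J *v (a $ i)))) = 0"
  shows "h = 0 \<and> l = 0"
proof -
  have cc: "central_configuration \<mu> a" and ker: "hessian_has_kernel (E_red \<mu>) (amended_V \<mu>) a (span {J_all a})"
    using nd by (auto simp: nondegenerate_cc_def)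
  have cf: "collision_free a" and a: "a \<in> E_red \<mu>"
    using cc by (auto simp: central_configuration_def critical_point_on_def)
  note cceq = central_configuration_eq[OF \<mu> cc]
  have "0 = (\<Sum>i\<in>UNIV. \<mu> i * ((h $ i + daccel \<mu> a h i + l *\<^sub>R (J *v (a $ i))) \<bullet> (J *v (a $ i))))"
    by (simp add: eq)
  also have "\<dots> = (\<Sum>i\<in>UNIV. \<mu> i * ((h $ i + daccel \<mu> a h i) \<bullet> (J *v (a $ i)))) + l * (\<Sum>i\<in>UNIV. \<mu> i * (a $ i \<bullet> a $ i))"
    by (simp add: inner_add_left[of "h $ i + daccel \<mu> a h i" for i] distrib_left sum.distrib sum_distrib_left mult.left_commute)
  finally have l: "l = 0" using mass_norm_pos[of \<mu> a, OF \<mu> cf card] linearised_pairing_J[OF cceq] by simp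
  have eq0: "h $ i + daccel \<mu> a h i = 0" for i using eq[of i] l by simp
  have "(\<Sum>i\<in>UNIV. \<mu> i *\<^sub>R (h $ i + daccel \<mu> a h i)) = 0" by (simp add: eq0)
  \<comment> \<open>The kernel hypothesis speaks about \<open>E_red\<close> only. Membership follows
    from the equation itself: in its weighted sum the force terms cancel and the weighted sum of
    \<open>h\<close> remains.\<close>
  then have hE: "h \<in> E_red \<mu>" by (simp add: scaleR_add_right sum.distrib sum_daccel E_red_def)
  obtain B where B: "has_hessian_on (E_red \<mu>) (amended_V \<mu>) a B"
    "{h \<in> E_red \<mu>. \<forall>k\<in>E_red \<mu>. blinfun_apply (B h) k = 0} = span {J_all a}"
    using ker unfolding hessian_has_kernel_def by blast
  obtain r0 where r0: "r0 > 0" "\<And>u. norm (u - a) < r0 \<Longrightarrow> collision_free u"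
    using collision_free_ball[OF cf] by blast
  define r where "r = r0 / (norm h + 1)"
  have r: "r > 0" using r0 by (simp add: r_def add_nonneg_pos)
  have cfr: "collision_free (a + \<tau> *\<^sub>R h)" if "\<bar>\<tau>\<bar> < r" for \<tau>
  proof (rule r0(2))
    have "\<bar>\<tau>\<bar> * (norm h + 1) < r0" using that by (simp add: r_def pos_less_divide_eq add_nonneg_pos)
    moreover have "\<bar>\<tau>\<bar> * norm h \<le> \<bar>\<tau>\<bar> * (norm h + 1)" by (intro mult_left_mono) auto
    ultimately show "norm (a + \<tau> *\<^sub>R h - a) < r0" by simp
  qed
  have "blinfun_apply (B h) k = 0" if k: "k \<in> E_red \<mu>" for k
  proof -
    have w: "((\<lambda>\<tau>. a + \<tau> *\<^sub>R h) has_vector_derivative h) (at 0)" by (auto intro!: derivative_eq_intros)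
    have "((\<lambda>\<tau>. (a + \<tau> *\<^sub>R h) $ i + accel \<mu> (a + \<tau> *\<^sub>R h) i) has_vector_derivative h $ i + daccel \<mu> a h i) (at 0)" for i
      using has_vector_derivative_add[OF bounded_linear.has_vector_derivative[OF bounded_linear_vec_nth w]
          accel_has_vector_derivative[OF w]] cf by simp
    then have "((\<lambda>\<tau>. ((a + \<tau> *\<^sub>R h) $ i + accel \<mu> (a + \<tau> *\<^sub>R h) i) \<bullet> k $ i) has_real_derivative
        (h $ i + daccel \<mu> a h i) \<bullet> k $ i) (at 0)" for i
      unfolding has_real_derivative_iff_has_vector_derivative
      by (rule bounded_linear.has_vector_derivative[OF bounded_linear_inner_left])
    then have "((\<lambda>\<tau>. \<Sum>i\<in>UNIV. \<mu> i * (((a + \<tau> *\<^sub>R h) $ i + accel \<mu> (a + \<tau> *\<^sub>R h) i) \<bullet> k $ i)) has_real_derivative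
        (\<Sum>i\<in>UNIV. \<mu> i * ((h $ i + daccel \<mu> a h i) \<bullet> k $ i))) (at 0)"
      by (intro DERIV_sum DERIV_cmult)
    then have G0: "((\<lambda>\<tau>. \<Sum>i\<in>UNIV. \<mu> i * (((a + \<tau> *\<^sub>R h) $ i + accel \<mu> (a + \<tau> *\<^sub>R h) i) \<bullet> k $ i)) has_real_derivative 0) (at 0)"
      by (simp add: eq0)
    show ?thesis
      by (rule hessian_eq_directional[OF B(1) subspace_E_red a hE k amended_V_directional[OF \<mu> cfr] r G0])
  qed
  then have "h \<in> span {J_all a}" using B(2) hE by blast
  then obtain c where c: "h = c *\<^sub>R J_all a" by (auto simp: span_singleton)
  have "0 = (\<Sum>i\<in>UNIV. \<mu> i * (h $ i \<bullet> (J *v (a $ i))))" using perp by simp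
  also have "\<dots> = c * (\<Sum>i\<in>UNIV. \<mu> i * (a $ i \<bullet> a $ i))"
    by (simp add: c J_all_def sum_distrib_left mult.left_commute)
  finally have "c = 0" using mass_norm_pos[of \<mu> a, OF \<mu> cf card] by simp
  with c l show ?thesis by simp
qed

subsection \<open>Square-integrable paths\<close>

definition square_integrable :: "(real \<Rightarrow> 'a::euclidean_space) \<Rightarrow> bool" where
  "square_integrable v \<longleftrightarrow> v \<in> borel_measurable borel \<and>
     set_integrable lborel {0..2*pi} (\<lambda>s. (norm (v s))\<^sup>2)"

lemma square_integrable_inner:
  "square_integrable v \<Longrightarrow> square_integrable w \<Longrightarrow> set_integrable lborel {0..2*pi} (\<lambda>s. v s \<bullet> w s)"
  unfolding square_integrable_def by (intro set_integrable_inner_sq) auto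

lemma square_integrable_add:
  assumes v: "square_integrable v" and w: "square_integrable w"
  shows "square_integrable (\<lambda>s. v s + w s)"
proof -
  have "(\<lambda>s. (norm (v s + w s))\<^sup>2) = (\<lambda>s. (norm (v s))\<^sup>2 + (norm (w s))\<^sup>2 + 2 *\<^sub>R (v s \<bullet> w s))"
    by (auto simp: power2_norm_eq_inner inner_add_left inner_add_right inner_commute)
  then show ?thesis
    using v w square_integrable_inner[OF v w] unfolding square_integrable_def by auto
qed

lemma square_integrable_continuous:
  assumes "continuous_on UNIV v"
  shows "square_integrable v"
  unfolding square_integrable_def
  by (intro conjI borel_measurable_continuous_onI borel_integrable_atLeastAtMost' continuous_intros
      continuous_on_subset[OF assms] assms) auto

lemma square_integrable_linear:
  fixes L :: "'a::euclidean_space \<Rightarrow> 'b::euclidean_space"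
  assumes L: "linear L" and v: "square_integrable v"
  shows "square_integrable (\<lambda>s. L (v s))"
proof -
  have vm [measurable]: "v \<in> borel_measurable borel" using v by (simp add: square_integrable_def)
  have Lm [measurable]: "L \<in> borel_measurable borel"
    using L by (intro borel_measurable_continuous_onI linear_continuous_on) (simp add: linear_conv_bounded_linear)
  obtain K where K: "K > 0" "\<And>x. norm (L x) \<le> K * norm x" using linear_bounded_pos[OF L] by blast
  have "set_integrable lborel {0..2*pi} (\<lambda>s. (norm (L (v s)))\<^sup>2)"
  proof (rule set_integrable_bound)
    show "set_integrable lborel {0..2*pi} (\<lambda>s. K\<^sup>2 * (norm (v s))\<^sup>2)"
      using v by (simp add: square_integrable_def)
    show "set_borel_measurable lborel {0..2*pi} (\<lambda>s. (norm (L (v s)))\<^sup>2)"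
      unfolding set_borel_measurable_def by measurable
    have "(norm (L (v s)))\<^sup>2 \<le> K\<^sup>2 * (norm (v s))\<^sup>2" for s
      using power_mono[OF K(2), of "v s" 2] by (simp add: power_mult_distrib)
    then show "AE s in lborel. s \<in> {0..2*pi} \<longrightarrow> norm ((norm (L (v s)))\<^sup>2) \<le> norm (K\<^sup>2 * (norm (v s))\<^sup>2)"
      by (auto intro!: AE_I2)
  qed
  then show ?thesis by (simp add: square_integrable_def)
qed

lemma square_integrable_wderiv: "square_integrable (wderiv u)"
  and square_integrable_path: "square_integrable (h1_path u)"
  using wderiv_measurable wderiv_sq path_measurable_sq by (auto simp: square_integrable_def)

lemma set_lebesgue_integral_continuous:
  fixes f :: "real \<Rightarrow> 'a::euclidean_space"
  assumes "continuous_on {a..b} f"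
  shows "(LINT s:{a..b}|lborel. f s) = integral {a..b} f"
  by (rule set_borel_integral_eq_integral(2)[OF borel_integrable_atLeastAtMost'[OF assms]])

lemma has_weak_deriv_classical:
  fixes h :: "real \<Rightarrow> 'a::euclidean_space"
  assumes h: "\<And>s. (h has_vector_derivative p s) (at s)" and p: "continuous_on UNIV p"
  shows "has_weak_deriv h p"
proof (rule has_weak_derivI)
  show "p \<in> borel_measurable borel" "set_integrable lborel {0..2*pi} (\<lambda>s. (norm (p s))\<^sup>2)"
    using square_integrable_continuous[OF p] by (auto simp: square_integrable_def)
  fix t :: real assume t: "t \<in> {0..2*pi}"
  have "(LINT s:{0..t}|lborel. p s) = integral {0..t} p"
    by (rule set_lebesgue_integral_continuous) (rule continuous_on_subset[OF p], simp)
  also have "\<dots> = h t - h 0"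
    using has_integral_antiderivative[OF h, of 0 t] t by (simp add: integral_unique)
  finally show "h t = h 0 + (LINT s:{0..t}|lborel. p s)" by simp
qed

lemma h1_path_Abs_h1:
  assumes "has_weak_deriv h p" "\<And>s. h (s + 2*pi) = h s"
  shows "h1_path (Abs_h1 h) = h"
  using assms by (intro Abs_h1_inverse) auto

text \<open>Only \<open>f\<close> is differentiable in the classical sense; \<open>k\<close> is just
  the integral of \<open>v\<close>. Fubini on the triangle \<open>s \<le> t\<close> replaces the
  product rule, and periodicity of both functions removes the boundary terms.\<close>

lemma integration_by_parts_weak:
  fixes f k v :: "real \<Rightarrow> 'a::euclidean_space"
  assumes k: "has_weak_deriv k v" "k (2*pi) = k 0"
    and f: "\<And>s. (f has_vector_derivative f' s) (at s)" "f (2*pi) = f 0" and f': "continuous_on UNIV f'"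
  shows "(LINT s:{0..2*pi}|lborel. f s \<bullet> v s) = - (LINT s:{0..2*pi}|lborel. f' s \<bullet> k s)"
proof -
  let ?T = "2 * pi"
  note kd = has_weak_derivD[OF k(1)]
  have vm [measurable]: "v \<in> borel_measurable borel" by (rule kd)
  have f'm [measurable]: "f' \<in> borel_measurable borel" by (rule borel_measurable_continuous_onI[OF f'])
  have vi: "set_integrable lborel {0..?T} v" by (rule set_integrable_sq_imp[OF kd(1,2)])
  have cf: "continuous_on UNIV f"
    using f by (meson continuous_at_imp_continuous_on has_vector_derivative_continuous)
  have f'i: "set_integrable lborel {a..b} f'" for a b
    by (rule borel_integrable_atLeastAtMost') (rule continuous_on_subset[OF f'], simp)
  obtain M where M: "M > 0" "\<And>s. s \<in> {0..?T} \<Longrightarrow> norm (f' s) \<le> M"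
  proof -
    have "compact (f' ` {0..?T})" by (intro compact_continuous_image continuous_on_subset[OF f']) auto
    then obtain b where "\<forall>x\<in>f' ` {0..?T}. norm x \<le> b" using compact_imp_bounded bounded_iff by metis
    then show ?thesis using that[of "max b 1"] by (simp add: le_max_iff_disj)
  qed
  \<comment> \<open>The integrand \<open>f' t \<bullet> v s\<close> on the triangle. Integrating out
    \<open>t\<close> gives an increment of \<open>f\<close> up to the end of the period, integrating
    out \<open>s\<close> an increment of \<open>k\<close> from its beginning.\<close>
  define F where "F s t = indicator {0..?T} s * (indicator {0..?T} t * (indicator {s..} t * (f' t \<bullet> v s)))"
    for s t :: real
  have Fb: "norm (F s t) \<le> indicator {0..?T} s * norm (v s) * (M * indicator {0..?T} t)" for s t
  proof (cases "s \<in> {0..?T} \<and> t \<in> {0..?T}")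
    case True
    then have "\<bar>f' t \<bullet> v s\<bar> \<le> M * norm (v s)"
      using Cauchy_Schwarz_ineq2[of "f' t" "v s"] mult_right_mono[OF M(2)[of t], of "norm (v s)"] by simp
    moreover have "0 \<le> M * norm (v s)" using M by simp
    ultimately show ?thesis using True by (auto simp: F_def indicator_def mult.commute)
  qed (auto simp: F_def indicator_def)
  have Fm: "case_prod F \<in> borel_measurable (lborel \<Otimes>\<^sub>M lborel)"
  proof -
    have "(\<lambda>p. indicator {0..?T} (fst p) * (indicator {0..?T} (snd p) *
        (indicator {p. fst p \<le> snd p} p * (f' (snd p) \<bullet> v (fst p))))) \<in> borel_measurable (lborel \<Otimes>\<^sub>M lborel)"
      by measurable
    moreover have "(\<lambda>p. indicator {0..?T} (fst p) * (indicator {0..?T} (snd p) *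
        (indicator {p. fst p \<le> snd p} p * (f' (snd p) \<bullet> v (fst p))))) = case_prod F"
      by (auto simp: F_def indicator_def fun_eq_iff)
    ultimately show ?thesis by simp
  qed
  have Fs: "F s \<in> borel_measurable lborel" for s unfolding F_def by measurable
  have it: "integrable lborel (\<lambda>t. M * indicator {0..?T} t :: real)" by simp
  have Fint: "integrable lborel (F s)" for s
  proof (rule Bochner_Integration.integrable_bound)
    show "integrable lborel (\<lambda>t. indicator {0..?T} s * norm (v s) * (M * indicator {0..?T} t))"
      using it by (intro integrable_mult_right) simp
    show "AE t in lborel. norm (F s t) \<le> norm (indicator {0..?T} s * norm (v s) * (M * indicator {0..?T} t))"
      unfolding real_norm_def
      by (rule AE_I2) (rule order_trans[OF Fb[unfolded real_norm_def] abs_ge_self])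
  qed (rule Fs)
  have "integrable (lborel \<Otimes>\<^sub>M lborel) (case_prod F)"
  proof (rule lborel_pair.Fubini_integrable[OF Fm])
    have "integrable lborel (\<lambda>s. norm (indicator {0..?T} s *\<^sub>R v s) * (M * ?T))"
      using vi unfolding set_integrable_def by (intro integrable_mult_left integrable_norm)
    then show "integrable lborel (\<lambda>s. LINT t|lborel. norm (case (s, t) of (s, t) \<Rightarrow> F s t))"
    proof (rule Bochner_Integration.integrable_bound)
      have "(\<lambda>p. norm (case_prod F p)) \<in> borel_measurable (lborel \<Otimes>\<^sub>M lborel)" using Fm by measurable
      then show "(\<lambda>s. LINT t|lborel. norm (case (s, t) of (s, t) \<Rightarrow> F s t)) \<in> borel_measurable lborel"
        by (intro lborel.borel_measurable_lebesgue_integral) (simp add: case_prod_beta')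
      have "(LINT t|lborel. norm (F s t)) \<le> (LINT t|lborel. indicator {0..?T} s * norm (v s) * (M * indicator {0..?T} t))" for s
        using it by (intro integral_mono integrable_norm Fint Fb integrable_mult_right) simp
      moreover have "(LINT t|lborel. indicator {0..?T} s * norm (v s) * (M * indicator {0..?T} t)) =
          norm (indicator {0..?T} s *\<^sub>R v s) * (M * ?T)" for s
        by (cases "s \<in> {0..?T}") auto
      ultimately have "(LINT t|lborel. norm (F s t)) \<le> norm (indicator {0..?T} s *\<^sub>R v s) * (M * ?T)" for s
        by metis
      moreover have "0 \<le> (LINT t|lborel. norm (F s t))" for s by simp
      ultimately show "AE s in lborel. norm (LINT t|lborel. norm (case (s, t) of (s, t) \<Rightarrow> F s t))
          \<le> norm (norm (indicator {0..?T} s *\<^sub>R v s) * (M * ?T))"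
        by (intro AE_I2) (simp add: order_trans[OF _ abs_ge_self])
    qed
    show "AE s in lborel. integrable lborel (\<lambda>t. case (s, t) of (s, t) \<Rightarrow> F s t)"
      using Fint by simp
  qed
  from lborel_pair.Fubini_integral[OF this]
  have fub: "(LINT t|lborel. LINT s|lborel. F s t) = (LINT s|lborel. LINT t|lborel. F s t)" .
  have inner1: "(LINT t|lborel. F s t) = indicator {0..?T} s *\<^sub>R ((f 0 - f s) \<bullet> v s)" for s
  proof (cases "s \<in> {0..?T}")
    case True
    then have "F s t = indicator {s..?T} t *\<^sub>R (f' t \<bullet> v s)" for t
      by (auto simp: F_def indicator_def)
    then have "(LINT t|lborel. F s t) = (LINT t:{s..?T}|lborel. f' t \<bullet> v s)"
      by (simp add: set_lebesgue_integral_def)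
    also have "\<dots> = (LINT t:{s..?T}|lborel. f' t) \<bullet> v s"
      unfolding set_lebesgue_integral_def real_scaleR_def inner_scaleR_left[symmetric]
      by (rule integral_inner_left) (use f'i[of s ?T] in \<open>simp add: set_integrable_def\<close>)
    also have "(LINT t:{s..?T}|lborel. f' t) = integral {s..?T} f'"
      by (rule set_lebesgue_integral_continuous) (rule continuous_on_subset[OF f'], simp)
    also have "\<dots> = f ?T - f s"
      using has_integral_antiderivative[OF f(1), of s ?T] True by (simp add: integral_unique)
    finally show ?thesis using True f(2) by simp
  qed (simp add: F_def)
  have inner2: "(LINT s|lborel. F s t) = indicator {0..?T} t *\<^sub>R (f' t \<bullet> (k t - k 0))" for t
  proof (cases "t \<in> {0..?T}")
    case True
    then have "F s t = indicator {0..t} s *\<^sub>R (f' t \<bullet> v s)" for s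
      by (auto simp: F_def indicator_def)
    then have "(LINT s|lborel. F s t) = (LINT s:{0..t}|lborel. f' t \<bullet> v s)"
      by (simp add: set_lebesgue_integral_def)
    also have "\<dots> = f' t \<bullet> (LINT s:{0..t}|lborel. v s)"
      unfolding set_lebesgue_integral_def real_scaleR_def inner_scaleR_right[symmetric]
      by (rule integral_inner_right) (use set_integrable_sub[OF vi, of t] True in \<open>simp add: set_integrable_def\<close>)
    also have "(LINT s:{0..t}|lborel. v s) = k t - k 0" using kd(3)[OF True] by simp
    finally show ?thesis using True by simp
  qed (simp add: F_def)
  have sqv: "square_integrable v" using kd(1,2) by (simp add: square_integrable_def)
  have ck: "continuous_on {0..?T} k" by (rule has_weak_deriv_continuous[OF k(1)])
  have cf': "continuous_on {0..?T} f'" by (rule continuous_on_subset[OF f']) simp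
  have i1: "set_integrable lborel {0..?T} (\<lambda>s. f 0 \<bullet> v s)" "set_integrable lborel {0..?T} (\<lambda>s. f s \<bullet> v s)"
    by (intro square_integrable_inner square_integrable_continuous sqv cf continuous_on_const)+
  have i2: "set_integrable lborel {0..?T} (\<lambda>s. f' s \<bullet> k s)" "set_integrable lborel {0..?T} (\<lambda>s. f' s \<bullet> k 0)"
    by (intro borel_integrable_atLeastAtMost' continuous_intros ck cf')+
  have "(LINT s:{0..?T}|lborel. (f 0 - f s) \<bullet> v s) = (LINT t:{0..?T}|lborel. f' t \<bullet> (k t - k 0))"
    using fub unfolding inner1 inner2 set_lebesgue_integral_def by simp
  \<comment> \<open>Of the four integrals those with the constants \<open>f 0\<close> and
    \<open>k 0\<close> vanish, because \<open>v\<close> and \<open>f'\<close> have integral zero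
    over a period.\<close>
  then have "(LINT s:{0..?T}|lborel. f 0 \<bullet> v s) - (LINT s:{0..?T}|lborel. f s \<bullet> v s) =
      (LINT s:{0..?T}|lborel. f' s \<bullet> k s) - (LINT s:{0..?T}|lborel. f' s \<bullet> k 0)"
    unfolding inner_diff_left inner_diff_right set_integral_diff(2)[OF i1] set_integral_diff(2)[OF i2] .
  moreover have "(LINT s:{0..?T}|lborel. f 0 \<bullet> v s) = f 0 \<bullet> (LINT s:{0..?T}|lborel. v s)"
    unfolding set_lebesgue_integral_def real_scaleR_def inner_scaleR_right[symmetric]
    by (rule integral_inner_right) (use vi in \<open>simp add: set_integrable_def\<close>)
  moreover have "(LINT s:{0..?T}|lborel. v s) = 0" using kd(3)[of ?T] k(2) by simp
  moreover have "(LINT s:{0..?T}|lborel. f' s \<bullet> k 0) = (LINT s:{0..?T}|lborel. f' s) \<bullet> k 0"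
    unfolding set_lebesgue_integral_def real_scaleR_def inner_scaleR_left[symmetric]
    by (rule integral_inner_left) (use f'i[of 0 ?T] in \<open>simp add: set_integrable_def\<close>)
  moreover have "(LINT s:{0..?T}|lborel. f' s) = 0"
    using set_lebesgue_integral_continuous[OF cf'] has_integral_antiderivative[OF f(1), of 0 ?T] f(2)
    by (simp add: integral_unique)
  ultimately show ?thesis by simp
qed

subsection \<open>The Hessian of the action at a central configuration\<close>

text \<open>The mass matrix; pairing with \<open>mass_weight \<mu> y\<close> is the mass inner
  product with \<open>y\<close>.\<close>

definition mass_weight :: "('k \<Rightarrow> real) \<Rightarrow> (real^2)^'k::finite \<Rightarrow> (real^2)^'k" where
  "mass_weight \<mu> u = (\<chi> i. \<mu> i *\<^sub>R u $ i)"

lemma inner_mass_weight: "x \<bullet> mass_weight \<mu> y = (\<Sum>i\<in>UNIV. \<mu> i * (x $ i \<bullet> y $ i))"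
  unfolding inner_vec_def[of x] by (simp add: mass_weight_def)

lemma inner_mass_weight_commute: "x \<bullet> mass_weight \<mu> y = y \<bullet> mass_weight \<mu> x"
  by (simp add: inner_mass_weight inner_commute)

lemma linear_mass_weight: "linear (mass_weight \<mu>)"
  by (rule linearI) (simp_all add: mass_weight_def vec_eq_iff scaleR_add_right)

lemma linear_J_all: "linear J_all"
  by (rule linearI) (simp_all add: J_all_def vec_eq_iff J_linear_simps)

lemma J_all_nth [simp]: "J_all u $ i = J *v (u $ i)"
  by (simp add: J_all_def)

lemma inner_J_all_mass_weight: "J_all x \<bullet> mass_weight \<mu> y = - (x \<bullet> mass_weight \<mu> (J_all y))"
  by (simp add: inner_mass_weight inner_J_left sum_negf)

lemma norm_sqrt_mass_add:
  assumes "\<And>i. \<mu> i > 0"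
  shows "1/2 * (norm (sqrt_mass \<mu> (x + \<sigma> *\<^sub>R y)))\<^sup>2 =
    1/2 * (x \<bullet> mass_weight \<mu> x) + (\<sigma> * (y \<bullet> mass_weight \<mu> x) + \<sigma>\<^sup>2 * (1/2 * (y \<bullet> mass_weight \<mu> y)))"
proof -
  have "(norm (sqrt_mass \<mu> (x + \<sigma> *\<^sub>R y)))\<^sup>2 = (x + \<sigma> *\<^sub>R y) \<bullet> mass_weight \<mu> (x + \<sigma> *\<^sub>R y)"
    by (simp only: norm_sqrt_mass[OF assms] inner_mass_weight)
  also have "\<dots> = x \<bullet> mass_weight \<mu> x + 2 * \<sigma> * (y \<bullet> mass_weight \<mu> x) + \<sigma>\<^sup>2 * (y \<bullet> mass_weight \<mu> y)"
    using inner_mass_weight_commute[of x \<mu> y]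
    by (simp add: linear_add[OF linear_mass_weight] linear_scale[OF linear_mass_weight]
        inner_add_left inner_add_right power2_eq_square algebra_simps)
  finally show ?thesis by (simp add: algebra_simps)
qed

lemma continuous_on_grav: "continuous_on {x. x \<noteq> 0} grav"
  unfolding grav_def by (intro continuous_intros) auto

lemma continuous_on_accel:
  assumes "continuous_on S w" "\<And>x. x \<in> S \<Longrightarrow> collision_free (w x)"
  shows "continuous_on S (\<lambda>x. accel \<mu> (w x) i)"
  unfolding accel_def
proof (intro continuous_intros)
  fix j
  show "continuous_on S (\<lambda>x. grav (w x $ i - w x $ j))"
  proof (cases "i = j")
    case False
    then show ?thesis
      using assms by (intro continuous_on_compose2[OF continuous_on_grav] continuous_intros)
        (auto simp: collision_free_def)
  qed simp
qed

lemma continuous_on_newton_U: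
  assumes "continuous_on S w" "\<And>x. x \<in> S \<Longrightarrow> collision_free (w x)"
  shows "continuous_on S (\<lambda>x. newton_U \<mu> (w x))"
proof -
  have "continuous_on S (\<lambda>x. \<mu> i * \<mu> j / norm (w x $ i - w x $ j))" for i j
  proof (cases "i = j")
    case False
    then show ?thesis using assms by (intro continuous_intros) (auto simp: collision_free_def)
  qed simp
  then show ?thesis unfolding newton_U_altdef by (intro continuous_on_mult_left continuous_on_sum)
qed

lemma borel_measurable_newton_U: "newton_U \<mu> \<in> borel_measurable borel"
proof -
  have [measurable]: "(\<lambda>u :: (real^2)^'a. u $ i - u $ j) \<in> borel_measurable borel" for i j
    by (intro borel_measurable_continuous_onI continuous_intros)
  have "newton_U \<mu> = (\<lambda>u. 1/2 * (\<Sum>i\<in>UNIV. \<Sum>j\<in>UNIV. \<mu> i * \<mu> j / norm (u $ i - u $ j)))"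
    by (rule ext) (rule newton_U_altdef)
  then show ?thesis by simp
qed

lemma linear_sqrt_mass: "linear (sqrt_mass \<mu> :: (real^2)^'k::finite \<Rightarrow> _)"
  by (rule linearI) (simp_all add: sqrt_mass_def vec_eq_iff scaleR_add_right)

lemma continuous_on_daccel:
  assumes "continuous_on S w" "\<And>x. x \<in> S \<Longrightarrow> collision_free (w x)" "continuous_on S h"
  shows "continuous_on S (\<lambda>x. daccel \<mu> (w x) (h x) i)"
  unfolding daccel_def
proof (intro continuous_intros)
  fix j
  show "continuous_on S (\<lambda>x. dgrav (w x $ i - w x $ j) (h x $ i - h x $ j))"
  proof (cases "i = j")
    case False
    then show ?thesis unfolding dgrav_def
      using assms by (intro continuous_intros) (auto simp: collision_free_def)
  qed simp
qed

text \<open>The kinetic part is a polynomial of degree two in \<sigma>; the potential part is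
  differentiated under the integral, which is legitimate as long as the perturbed path stays free of
  collisions. The base path has a continuous derivative, whereas the direction \<open>k\<close>
  ranges over all of the Sobolev space.\<close>

lemma action_directional:
  fixes a :: "(real^2)^'k::finite" and u k :: "((real^2)^'k) h1"
  assumes \<mu>: "\<And>i. \<mu> i > 0"
    and u: "has_weak_deriv (h1_path u) p" "continuous_on UNIV (h1_path u)" "continuous_on UNIV p"
    and cf: "\<And>\<sigma> s. \<bar>\<sigma>\<bar> < r \<Longrightarrow> s \<in> {0..2*pi} \<Longrightarrow> collision_free (h1_path u s + \<sigma> *\<^sub>R h1_path k s)" and r: "r > 0"
  shows "((\<lambda>\<sigma>. action_A \<mu> (u + \<sigma> *\<^sub>R k)) has_real_derivative
    (LINT s:{0..2*pi}|lborel. (wderiv k s + J_all (h1_path k s)) \<bullet> mass_weight \<mu> (p s + J_all (h1_path u s))) +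
    integral {0..2*pi} (\<lambda>s. \<Sum>i\<in>UNIV. \<mu> i * (accel \<mu> (h1_path u s) i \<bullet> h1_path k s $ i))) (at 0)"
proof -
  let ?T = "2 * pi"
  define V where "V s = p s + J_all (h1_path u s)" for s
  define W where "W s = wderiv k s + J_all (h1_path k s)" for s
  have sqV: "square_integrable V" unfolding V_def
    by (intro square_integrable_add square_integrable_continuous square_integrable_linear[OF linear_J_all] u)
  have sqW: "square_integrable W" unfolding W_def
    by (intro square_integrable_add square_integrable_wderiv square_integrable_linear[OF linear_J_all] square_integrable_path)
  have iVV: "set_integrable lborel {0..?T} (\<lambda>s. V s \<bullet> mass_weight \<mu> (V s))"
    and iWV: "set_integrable lborel {0..?T} (\<lambda>s. W s \<bullet> mass_weight \<mu> (V s))"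
    and iWW: "set_integrable lborel {0..?T} (\<lambda>s. W s \<bullet> mass_weight \<mu> (W s))"
    by (intro square_integrable_inner square_integrable_linear[OF linear_mass_weight] sqV sqW)+
  have ck: "continuous_on {0..?T} (h1_path k)"
    by (rule has_weak_deriv_continuous[OF has_weak_deriv_wderiv])
  have cu: "continuous_on {0..?T} (h1_path u)" by (rule continuous_on_subset[OF u(2)]) simp
  define cVV cWV cWW where "cVV = (LINT s:{0..?T}|lborel. V s \<bullet> mass_weight \<mu> (V s))"
    and "cWV = (LINT s:{0..?T}|lborel. W s \<bullet> mass_weight \<mu> (V s))"
    and "cWW = (LINT s:{0..?T}|lborel. W s \<bullet> mass_weight \<mu> (W s))"
  define I where "I \<sigma> = integral {0..?T} (\<lambda>s. newton_U \<mu> (h1_path u s + \<sigma> *\<^sub>R h1_path k s))" for \<sigma>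
  have A: "action_A \<mu> (u + \<sigma> *\<^sub>R k) = 1/2 * cVV + (\<sigma> * cWV + \<sigma>\<^sup>2 * (1/2 * cWW)) + I \<sigma>" if \<sigma>: "\<bar>\<sigma>\<bar> < r" for \<sigma>
  proof -
    let ?w = "u + \<sigma> *\<^sub>R k"
    have wd: "has_weak_deriv (h1_path ?w) (\<lambda>s. p s + \<sigma> *\<^sub>R wderiv k s)"
      unfolding path_add path_scaleR
      by (intro has_weak_deriv_add has_weak_deriv_scaleR u has_weak_deriv_wderiv)
    have cU: "continuous_on {0..?T} (\<lambda>s. newton_U \<mu> (h1_path u s + \<sigma> *\<^sub>R h1_path k s))"
      by (intro continuous_on_newton_U cf[OF \<sigma>] continuous_intros cu ck) auto
    have iU: "set_integrable lborel {0..?T} (\<lambda>s. newton_U \<mu> (h1_path u s + \<sigma> *\<^sub>R h1_path k s))"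
      by (rule borel_integrable_atLeastAtMost'[OF cU])
    have iall: "set_integrable lborel {0..?T} (\<lambda>s. 1/2 * (V s \<bullet> mass_weight \<mu> (V s)) +
        (\<sigma> * (W s \<bullet> mass_weight \<mu> (V s)) + \<sigma>\<^sup>2 * (1/2 * (W s \<bullet> mass_weight \<mu> (W s)))))"
      by (intro set_integral_add(1) set_integrable_mult_right iVV iWV iWW impI)
    have "action_A \<mu> ?w = (LINT s:{0..?T}|lborel.
        1/2 * (V s \<bullet> mass_weight \<mu> (V s)) + (\<sigma> * (W s \<bullet> mass_weight \<mu> (V s)) + \<sigma>\<^sup>2 * (1/2 * (W s \<bullet> mass_weight \<mu> (W s))))
        + newton_U \<mu> (h1_path u s + \<sigma> *\<^sub>R h1_path k s))"
      unfolding action_A_def set_lebesgue_integral_def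
    proof (rule integral_cong_AE)
      note [measurable] = wderiv_measurable[of ?w] path_measurable_sq(1)[of ?w] borel_measurable_newton_U[of \<mu>]
        borel_measurable_continuous_onI[OF linear_continuous_on[of "sqrt_mass \<mu> :: (real^2)^'k \<Rightarrow> _"]]
      have [measurable]: "(sqrt_mass \<mu> :: (real^2)^'k \<Rightarrow> _) \<in> borel_measurable borel"
        "(J_all :: (real^2)^'k \<Rightarrow> _) \<in> borel_measurable borel"
        using linear_sqrt_mass linear_J_all
        by (auto intro!: borel_measurable_continuous_onI linear_continuous_on simp: linear_conv_bounded_linear)
      show "(\<lambda>s. indicator {0..?T} s *\<^sub>R (1/2 * (norm (sqrt_mass \<mu> (wderiv ?w s + J_all (h1_path ?w s))))\<^sup>2
          + newton_U \<mu> (h1_path ?w s))) \<in> borel_measurable lborel"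
        by measurable
      have "integrable lborel (\<lambda>s. indicator {0..?T} s *\<^sub>R (1/2 * (V s \<bullet> mass_weight \<mu> (V s)) +
        (\<sigma> * (W s \<bullet> mass_weight \<mu> (V s)) + \<sigma>\<^sup>2 * (1/2 * (W s \<bullet> mass_weight \<mu> (W s))))
        + newton_U \<mu> (h1_path u s + \<sigma> *\<^sub>R h1_path k s)))"
        using set_integral_add(1)[OF iall iU] by (simp add: set_integrable_def)
      then show "(\<lambda>s. indicator {0..?T} s *\<^sub>R (1/2 * (V s \<bullet> mass_weight \<mu> (V s)) +
        (\<sigma> * (W s \<bullet> mass_weight \<mu> (V s)) + \<sigma>\<^sup>2 * (1/2 * (W s \<bullet> mass_weight \<mu> (W s))))
        + newton_U \<mu> (h1_path u s + \<sigma> *\<^sub>R h1_path k s))) \<in> borel_measurable lborel"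
        by (rule borel_measurable_integrable)
      \<comment> \<open>\<open>wderiv\<close> is a choice of a representative, so it respects sums
        and multiples only up to null sets.\<close>
      have "AE s in lborel. s \<in> {0..?T} \<longrightarrow> wderiv ?w s = p s + \<sigma> *\<^sub>R wderiv k s"
        by (rule weak_deriv_unique[OF has_weak_deriv_wderiv wd])
      then show "AE s in lborel. indicator {0..?T} s *\<^sub>R (1/2 * (norm (sqrt_mass \<mu> (wderiv ?w s + J_all (h1_path ?w s))))\<^sup>2
          + newton_U \<mu> (h1_path ?w s)) = indicator {0..?T} s *\<^sub>R (1/2 * (V s \<bullet> mass_weight \<mu> (V s)) +
        (\<sigma> * (W s \<bullet> mass_weight \<mu> (V s)) + \<sigma>\<^sup>2 * (1/2 * (W s \<bullet> mass_weight \<mu> (W s))))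
        + newton_U \<mu> (h1_path u s + \<sigma> *\<^sub>R h1_path k s))"
      proof eventually_elim
        case (elim s)
        show ?case
        proof (cases "s \<in> {0..?T}")
          case True
          then have "wderiv ?w s + J_all (h1_path ?w s) = V s + \<sigma> *\<^sub>R W s"
            using elim
            by (simp add: V_def W_def path_add path_scaleR linear_add[OF linear_J_all] linear_scale[OF linear_J_all] scaleR_add_right)
          then show ?thesis
            by (simp only: norm_sqrt_mass_add[OF \<mu>]) (simp add: path_add path_scaleR)
        qed simp
      qed
    qed
    also have "\<dots> = (1/2 * cVV + (\<sigma> * cWV + \<sigma>\<^sup>2 * (1/2 * cWW))) + (LINT s:{0..?T}|lborel. newton_U \<mu> (h1_path u s + \<sigma> *\<^sub>R h1_path k s))"
      unfolding cVV_def cWV_def cWW_def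
      by (subst set_integral_add(2)[OF iall iU], subst set_integral_add(2), (intro set_integrable_mult_right set_integral_add(1) iVV iWV iWW impI)+,
          subst set_integral_add(2), (intro set_integrable_mult_right iVV iWV iWW impI)+) simp
    finally show ?thesis by (simp add: I_def set_lebesgue_integral_continuous[OF cU])
  qed
  have I: "(I has_real_derivative integral (cbox 0 ?T) (\<lambda>s. \<Sum>i\<in>UNIV. \<mu> i * (accel \<mu> (h1_path u s + 0 *\<^sub>R h1_path k s) i \<bullet> h1_path k s $ i)))
      (at 0 within ball 0 r)"
    unfolding I_def box_real(2)[symmetric]
  proof (rule leibniz_rule_field_derivative)
    fix \<sigma> s :: real assume *: "\<sigma> \<in> ball 0 r" "s \<in> cbox 0 ?T"
    have "((\<lambda>\<sigma>. h1_path u s + \<sigma> *\<^sub>R h1_path k s) has_vector_derivative h1_path k s) (at \<sigma>)"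
      by (auto intro!: derivative_eq_intros)
    from has_field_derivative_at_within[OF newton_U_derivative[OF this, of \<mu>]] cf[of \<sigma> s] *
    show "((\<lambda>\<sigma>. newton_U \<mu> (h1_path u s + \<sigma> *\<^sub>R h1_path k s)) has_real_derivative
        (\<Sum>i\<in>UNIV. \<mu> i * (accel \<mu> (h1_path u s + \<sigma> *\<^sub>R h1_path k s) i \<bullet> h1_path k s $ i))) (at \<sigma> within ball 0 r)"
      by auto
  next
    fix \<sigma> :: real assume *: "\<sigma> \<in> ball 0 r"
    show "(\<lambda>s. newton_U \<mu> (h1_path u s + \<sigma> *\<^sub>R h1_path k s)) integrable_on cbox 0 ?T"
      using * by (intro integrable_continuous continuous_on_newton_U cf continuous_intros) (use cu ck in auto)
  next
    have c: "continuous_on (ball 0 r \<times> cbox 0 ?T) (\<lambda>x. h1_path k (snd x))"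
      "continuous_on (ball 0 r \<times> cbox 0 ?T) (\<lambda>x. h1_path u (snd x))"
      by (rule continuous_on_compose2[OF ck] continuous_on_compose2[OF cu]; auto intro!: continuous_intros)+
    have "continuous_on (ball 0 r \<times> cbox 0 ?T) (\<lambda>x. \<Sum>i\<in>UNIV. \<mu> i *
        (accel \<mu> (h1_path u (snd x) + fst x *\<^sub>R h1_path k (snd x)) i \<bullet> h1_path k (snd x) $ i))"
      by (intro continuous_intros continuous_on_accel c) (use cf in auto)
    then show "continuous_on (ball 0 r \<times> cbox 0 ?T) (\<lambda>(\<sigma>, s). \<Sum>i\<in>UNIV. \<mu> i *
        (accel \<mu> (h1_path u s + \<sigma> *\<^sub>R h1_path k s) i \<bullet> h1_path k s $ i))"
      by (simp add: case_prod_beta')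
  qed (use r in auto)
  then have I': "(I has_real_derivative integral {0..?T} (\<lambda>s. \<Sum>i\<in>UNIV. \<mu> i * (accel \<mu> (h1_path u s) i \<bullet> h1_path k s $ i))) (at 0)"
    using r by (simp add: at_within_open[of 0 "ball 0 r"])
  have "((\<lambda>\<sigma>. 1/2 * cVV + (\<sigma> * cWV + \<sigma>\<^sup>2 * (1/2 * cWW)) + I \<sigma>) has_real_derivative
      cWV + integral {0..?T} (\<lambda>s. \<Sum>i\<in>UNIV. \<mu> i * (accel \<mu> (h1_path u s) i \<bullet> h1_path k s $ i))) (at 0)"
    using I' by (auto intro!: derivative_eq_intros)
  then have "((\<lambda>\<sigma>. action_A \<mu> (u + \<sigma> *\<^sub>R k)) has_real_derivative
      cWV + integral {0..?T} (\<lambda>s. \<Sum>i\<in>UNIV. \<mu> i * (accel \<mu> (h1_path u s) i \<bullet> h1_path k s $ i))) (at 0)"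
    by (rule has_field_derivative_transform_within[OF _ r]) (use A in \<open>auto simp: dist_norm\<close>)
  then show ?thesis by (simp add: cWV_def W_def V_def)
qed

lemma subspace_H1_red_periodic: "subspace (H1_red_periodic \<mu> m)"
  using subspace_E_red[of \<mu>]
  by (intro subspaceI) (auto simp: H1_red_periodic_def path_zero path_add path_scaleR subspace_0 subspace_add subspace_scale)

text \<open>In \<tau> the kinetic part of the first derivative is affine, and the force part is
  differentiated under the integral. Differentiable \<open>u\<close> are enough, since only
  solutions of a differential equation will be inserted; the test path \<open>k\<close> has to stay
  arbitrary.\<close>

lemma action_hessian:
  fixes a :: "(real^2)^'k::finite" and u k :: "((real^2)^'k) h1"
  assumes \<mu>: "\<And>i. \<mu> i > 0" and cf: "collision_free a"
    and hess: "has_hessian_on (H1_red_periodic \<mu> m) (action_A \<mu>) (h1_const a) B"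
    and mem: "h1_const a \<in> H1_red_periodic \<mu> m" "u \<in> H1_red_periodic \<mu> m" "k \<in> H1_red_periodic \<mu> m"
    and u: "\<And>s. (h1_path u has_vector_derivative p s) (at s)" "continuous_on UNIV p"
  shows "blinfun_apply (B u) k =
    (LINT s:{0..2*pi}|lborel. (wderiv k s + J_all (h1_path k s)) \<bullet> mass_weight \<mu> (p s + J_all (h1_path u s))) +
    integral {0..2*pi} (\<lambda>s. \<Sum>i\<in>UNIV. \<mu> i * (daccel \<mu> a (h1_path u s) i \<bullet> h1_path k s $ i))"
proof -
  let ?T = "2 * pi"
  have cU: "continuous_on UNIV (h1_path u)"
    using u(1) by (meson continuous_at_imp_continuous_on has_vector_derivative_continuous)
  have cu: "continuous_on {0..?T} (h1_path u)" by (rule continuous_on_subset[OF cU]) simp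
  have ck: "continuous_on {0..?T} (h1_path k)"
    by (rule has_weak_deriv_continuous[OF has_weak_deriv_wderiv])
  obtain r0 where r0: "r0 > 0" "\<And>u. norm (u - a) < r0 \<Longrightarrow> collision_free u"
    using collision_free_ball[OF cf] by blast
  obtain M where M: "M > 0" "\<And>s. s \<in> {0..?T} \<Longrightarrow> norm (h1_path u s) \<le> M" "\<And>s. s \<in> {0..?T} \<Longrightarrow> norm (h1_path k s) \<le> M"
  proof -
    have "bounded (h1_path u ` {0..?T})" "bounded (h1_path k ` {0..?T})"
      by (intro compact_imp_bounded compact_continuous_image cu ck; simp)+
    then obtain b1 b2 where "\<forall>x\<in>h1_path u ` {0..?T}. norm x \<le> b1" "\<forall>x\<in>h1_path k ` {0..?T}. norm x \<le> b2"
      unfolding bounded_iff by blast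
    then show ?thesis using that[of "max 1 (max b1 b2)"] by (simp add: le_max_iff_disj)
  qed
  \<comment> \<open>Each of the two perturbations then moves the configuration by less than half of
    the collision-free radius \<open>r0\<close>.\<close>
  define r where "r = r0 / (2 * M)"
  have r: "r > 0" using r0 M by (simp add: r_def)
  have cfr: "collision_free (a + \<tau> *\<^sub>R h1_path u s + \<sigma> *\<^sub>R h1_path k s)"
    if "\<bar>\<tau>\<bar> < r" "\<bar>\<sigma>\<bar> < r" "s \<in> {0..?T}" for \<tau> \<sigma> s
  proof (rule r0(2))
    have "norm (\<tau> *\<^sub>R h1_path u s) \<le> \<bar>\<tau>\<bar> * M" "norm (\<sigma> *\<^sub>R h1_path k s) \<le> \<bar>\<sigma>\<bar> * M"
      using M that by (simp_all add: mult_left_mono)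
    moreover have "\<bar>\<tau>\<bar> * M < r0 / 2" "\<bar>\<sigma>\<bar> * M < r0 / 2"
      using that M by (simp_all add: r_def field_simps)
    moreover have "norm (\<tau> *\<^sub>R h1_path u s + \<sigma> *\<^sub>R h1_path k s) \<le> norm (\<tau> *\<^sub>R h1_path u s) + norm (\<sigma> *\<^sub>R h1_path k s)"
      by (rule norm_triangle_ineq)
    ultimately show "norm (a + \<tau> *\<^sub>R h1_path u s + \<sigma> *\<^sub>R h1_path k s - a) < r0" by (simp add: add.assoc)
  qed
  define D1 where "D1 \<tau> = (LINT s:{0..?T}|lborel. (wderiv k s + J_all (h1_path k s)) \<bullet>
      mass_weight \<mu> (\<tau> *\<^sub>R p s + J_all (a + \<tau> *\<^sub>R h1_path u s)))" for \<tau>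
  define D2 where "D2 \<tau> = integral {0..?T} (\<lambda>s. \<Sum>i\<in>UNIV. \<mu> i * (accel \<mu> (a + \<tau> *\<^sub>R h1_path u s) i \<bullet> h1_path k s $ i))" for \<tau>
  have path\<tau>: "h1_path (h1_const a + \<tau> *\<^sub>R u) = (\<lambda>s. a + \<tau> *\<^sub>R h1_path u s)" for \<tau>
    by (simp add: path_add path_scaleR h1_path_const)
  have G: "((\<lambda>\<sigma>. action_A \<mu> (h1_const a + \<tau> *\<^sub>R u + \<sigma> *\<^sub>R k)) has_real_derivative D1 \<tau> + D2 \<tau>) (at 0)" if \<tau>: "\<bar>\<tau>\<bar> < r" for \<tau>
  proof -
    have "((\<lambda>\<sigma>. action_A \<mu> ((h1_const a + \<tau> *\<^sub>R u) + \<sigma> *\<^sub>R k)) has_real_derivative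
      (LINT s:{0..2*pi}|lborel. (wderiv k s + J_all (h1_path k s)) \<bullet> mass_weight \<mu> (\<tau> *\<^sub>R p s + J_all (h1_path (h1_const a + \<tau> *\<^sub>R u) s))) +
      integral {0..2*pi} (\<lambda>s. \<Sum>i\<in>UNIV. \<mu> i * (accel \<mu> (h1_path (h1_const a + \<tau> *\<^sub>R u) s) i \<bullet> h1_path k s $ i))) (at 0)"
    proof (rule action_directional[OF \<mu> _ _ _ _ r])
      have "has_weak_deriv (\<lambda>s. a + \<tau> *\<^sub>R h1_path u s) (\<lambda>s. 0 + \<tau> *\<^sub>R p s)"
        by (intro has_weak_deriv_add has_weak_deriv_const has_weak_deriv_scaleR has_weak_deriv_classical u)
      then show "has_weak_deriv (h1_path (h1_const a + \<tau> *\<^sub>R u)) (\<lambda>s. \<tau> *\<^sub>R p s)" by (simp add: path\<tau>)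
      show "continuous_on UNIV (h1_path (h1_const a + \<tau> *\<^sub>R u))" "continuous_on UNIV (\<lambda>s. \<tau> *\<^sub>R p s)"
        unfolding path\<tau> by (intro continuous_intros cU u)+
      show "collision_free (h1_path (h1_const a + \<tau> *\<^sub>R u) s + \<sigma> *\<^sub>R h1_path k s)"
        if "\<bar>\<sigma>\<bar> < r" "s \<in> {0..2*pi}" for \<sigma> s
        using cfr[OF \<tau> that] by (simp add: path\<tau>)
    qed
    then show ?thesis by (simp add: D1_def D2_def path\<tau>)
  qed
  define W where "W s = wderiv k s + J_all (h1_path k s)" for s
  have sqW: "square_integrable W" unfolding W_def
    by (intro square_integrable_add square_integrable_wderiv square_integrable_linear[OF linear_J_all] square_integrable_path)
  have sqV: "square_integrable (\<lambda>s. p s + J_all (h1_path u s))"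
    by (intro square_integrable_add square_integrable_continuous square_integrable_linear[OF linear_J_all] u cU)
  have i1: "set_integrable lborel {0..?T} (\<lambda>s. W s \<bullet> mass_weight \<mu> (J_all a))"
    by (intro square_integrable_inner sqW square_integrable_continuous continuous_on_const)
  have i2: "set_integrable lborel {0..?T} (\<lambda>s. W s \<bullet> mass_weight \<mu> (p s + J_all (h1_path u s)))"
    by (intro square_integrable_inner sqW square_integrable_linear[OF linear_mass_weight] sqV)
  have D1eq: "D1 \<tau> = (LINT s:{0..?T}|lborel. W s \<bullet> mass_weight \<mu> (J_all a)) +
      \<tau> * (LINT s:{0..?T}|lborel. W s \<bullet> mass_weight \<mu> (p s + J_all (h1_path u s)))" for \<tau>
  proof -
    have "W s \<bullet> mass_weight \<mu> (\<tau> *\<^sub>R p s + J_all (a + \<tau> *\<^sub>R h1_path u s)) =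
        W s \<bullet> mass_weight \<mu> (J_all a) + \<tau> * (W s \<bullet> mass_weight \<mu> (p s + J_all (h1_path u s)))" for s
      by (simp add: linear_add[OF linear_mass_weight] linear_scale[OF linear_mass_weight]
          linear_add[OF linear_J_all] linear_scale[OF linear_J_all] inner_add_right algebra_simps)
    then show ?thesis unfolding D1_def W_def[symmetric]
      using set_integral_add(2)[OF i1 set_integrable_mult_right[of \<tau>, OF i2]] by simp
  qed
  have dD1: "(D1 has_real_derivative (LINT s:{0..?T}|lborel. W s \<bullet> mass_weight \<mu> (p s + J_all (h1_path u s)))) (at 0)"
    unfolding D1eq[abs_def] by (auto intro!: derivative_eq_intros)
  have "(D2 has_real_derivative integral (cbox 0 ?T) (\<lambda>s. \<Sum>i\<in>UNIV. \<mu> i *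
      (daccel \<mu> (a + 0 *\<^sub>R h1_path u s) (h1_path u s) i \<bullet> h1_path k s $ i))) (at 0 within ball 0 r)"
    unfolding D2_def box_real(2)[symmetric]
  proof (rule leibniz_rule_field_derivative)
    fix \<tau> s :: real assume *: "\<tau> \<in> ball 0 r" "s \<in> cbox 0 ?T"
    have "((\<lambda>\<tau>. a + \<tau> *\<^sub>R h1_path u s) has_vector_derivative h1_path u s) (at \<tau>)"
      by (auto intro!: derivative_eq_intros)
    moreover have "collision_free (a + \<tau> *\<^sub>R h1_path u s)"
      using cfr[of \<tau> 0 s] * r by (simp add: dist_norm)
    ultimately have "((\<lambda>\<tau>. accel \<mu> (a + \<tau> *\<^sub>R h1_path u s) i) has_vector_derivative
        daccel \<mu> (a + \<tau> *\<^sub>R h1_path u s) (h1_path u s) i) (at \<tau>)" for i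
      by (rule accel_has_vector_derivative)
    then have "((\<lambda>\<tau>. accel \<mu> (a + \<tau> *\<^sub>R h1_path u s) i \<bullet> h1_path k s $ i) has_real_derivative
        daccel \<mu> (a + \<tau> *\<^sub>R h1_path u s) (h1_path u s) i \<bullet> h1_path k s $ i) (at \<tau>)" for i
      unfolding has_real_derivative_iff_has_vector_derivative
      by (rule bounded_linear.has_vector_derivative[OF bounded_linear_inner_left])
    then have "((\<lambda>\<tau>. \<Sum>i\<in>UNIV. \<mu> i * (accel \<mu> (a + \<tau> *\<^sub>R h1_path u s) i \<bullet> h1_path k s $ i)) has_real_derivative
        (\<Sum>i\<in>UNIV. \<mu> i * (daccel \<mu> (a + \<tau> *\<^sub>R h1_path u s) (h1_path u s) i \<bullet> h1_path k s $ i))) (at \<tau>)"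
      by (intro DERIV_sum DERIV_cmult)
    from has_field_derivative_at_within[OF this]
    show "((\<lambda>\<tau>. \<Sum>i\<in>UNIV. \<mu> i * (accel \<mu> (a + \<tau> *\<^sub>R h1_path u s) i \<bullet> h1_path k s $ i)) has_real_derivative
        (\<Sum>i\<in>UNIV. \<mu> i * (daccel \<mu> (a + \<tau> *\<^sub>R h1_path u s) (h1_path u s) i \<bullet> h1_path k s $ i))) (at \<tau> within ball 0 r)" .
  next
    fix \<tau> :: real assume *: "\<tau> \<in> ball 0 r"
    show "(\<lambda>s. \<Sum>i\<in>UNIV. \<mu> i * (accel \<mu> (a + \<tau> *\<^sub>R h1_path u s) i \<bullet> h1_path k s $ i)) integrable_on cbox 0 ?T"
    proof (intro integrable_continuous continuous_intros continuous_on_accel)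
      fix s assume "s \<in> cbox 0 ?T"
      then show "collision_free (a + \<tau> *\<^sub>R h1_path u s)"
        using cfr[of \<tau> 0 s] * r by (simp add: dist_norm)
    qed (use cu ck in auto)
  next
    have c: "continuous_on (ball 0 r \<times> cbox 0 ?T) (\<lambda>x. h1_path k (snd x))"
      "continuous_on (ball 0 r \<times> cbox 0 ?T) (\<lambda>x. h1_path u (snd x))"
      by (rule continuous_on_compose2[OF ck] continuous_on_compose2[OF cu]; auto intro!: continuous_intros)+
    have "continuous_on (ball 0 r \<times> cbox 0 ?T) (\<lambda>x. \<Sum>i\<in>UNIV. \<mu> i *
        (daccel \<mu> (a + fst x *\<^sub>R h1_path u (snd x)) (h1_path u (snd x)) i \<bullet> h1_path k (snd x) $ i))"
    proof (intro continuous_intros continuous_on_daccel c)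
      fix x :: "real \<times> real" assume "x \<in> ball 0 r \<times> cbox 0 ?T"
      then show "collision_free (a + fst x *\<^sub>R h1_path u (snd x))"
        using cfr[of "fst x" 0 "snd x"] r by (auto simp: dist_norm)
    qed
    then show "continuous_on (ball 0 r \<times> cbox 0 ?T) (\<lambda>(\<tau>, s). \<Sum>i\<in>UNIV. \<mu> i *
        (daccel \<mu> (a + \<tau> *\<^sub>R h1_path u s) (h1_path u s) i \<bullet> h1_path k s $ i))"
      by (simp add: case_prod_beta')
  qed (use r in auto)
  then have dD2: "(D2 has_real_derivative integral {0..?T} (\<lambda>s. \<Sum>i\<in>UNIV. \<mu> i *
      (daccel \<mu> a (h1_path u s) i \<bullet> h1_path k s $ i))) (at 0)"
    using r by (simp add: at_within_open[of 0 "ball 0 r"])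
  show ?thesis
    using hessian_eq_directional[OF hess subspace_H1_red_periodic mem(1,2,3) G r DERIV_add[OF dD1 dD2]]
    by (simp add: W_def)
qed

lemma cos_neq_1: "0 < x \<Longrightarrow> x < 2 * pi \<Longrightarrow> cos x \<noteq> 1"
proof
  assume x: "0 < x" "x < 2 * pi" "cos x = 1"
  then obtain n :: int where n: "x = of_int n * 2 * pi" using cos_one_2pi_int by blast
  with x have "0 < real_of_int n * (2 * pi)" "real_of_int n * (2 * pi) < 1 * (2 * pi)" by simp_all
  then have "0 < n" "n < 1"
    using pi_gt_zero by (simp_all add: zero_less_mult_iff)
  then show False by linarith
qed

text \<open>The equation for \<open>p\<close> is the Jacobi equation of the action at the constant
  path, with a multiplier force. Once the multiplier is zero and the path lies in
  \<open>E_red\<close>, integration by parts shows that the path is in the kernel of the Hessian.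
  Hence it is a constant infinitesimal rotation, and the normalisation at time 0 excludes
  that.\<close>

theorem periodic_nondegenerate_kernel:
  fixes a :: "(real^2)^'k::finite"
  assumes \<mu>: "\<And>i. \<mu> i > 0" and card: "CARD('k) \<ge> 2" and m: "m \<ge> 2"
    and nd: "periodic_nondegenerate_cc m \<mu> a"
    and h: "\<And>s. (h has_vector_derivative p s) (at s)"
    and p: "\<And>s. (p has_vector_derivative (\<chi> i. h s $ i + daccel \<mu> a (h s) i - 2 *\<^sub>R (J *v (p s $ i)) + l *\<^sub>R (J *v (a $ i)))) (at s)"
    and per: "\<And>s. h (s + 2*pi / real m) = h s" "\<And>s. p (s + 2*pi / real m) = p s"
    and perp: "(\<Sum>i\<in>UNIV. \<mu> i * (h 0 $ i \<bullet> (J *v (a $ i)))) = 0"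
  shows "l = 0 \<and> (\<forall>s. h s = 0 \<and> p s = 0)"
proof -
  let ?T = "2 * pi" and ?\<theta> = "2 * pi / real m"
  define p' where "p' s = (\<chi> i. h s $ i + daccel \<mu> a (h s) i - 2 *\<^sub>R (J *v (p s $ i)) + l *\<^sub>R (J *v (a $ i)))" for s
  note p = p[folded p'_def]
  have \<theta>: "0 < ?\<theta>" "?\<theta> < 2 * pi" using m by (simp_all add: field_simps)
  have cc: "central_configuration \<mu> a"
    and ker: "hessian_has_kernel (H1_red_periodic \<mu> m) (action_A \<mu>) (h1_const a) (span {h1_const (J_all a)})"
    using nd by (auto simp: periodic_nondegenerate_cc_def)
  have cf: "collision_free a" and a: "a \<in> E_red \<mu>"
    using cc by (auto simp: central_configuration_def critical_point_on_def)
  note cceq = central_configuration_eq[of \<mu> a, OF \<mu> cc]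
  note pos = mass_norm_pos[of \<mu> a, OF \<mu> cf card]
  have ch: "continuous_on UNIV h" and cp: "continuous_on UNIV p"
    using h p by (meson continuous_at_imp_continuous_on has_vector_derivative_continuous)+
  have cp': "continuous_on UNIV p'"
    unfolding p'_def
    by (intro continuous_intros continuous_on_daccel ch cp cf matrix_vector_mul_bounded_linear[THEN bounded_linear.continuous_on])
  have l: "l = 0"
  proof -
    \<comment> \<open>The linearisation at \<open>a\<close> of the angular momentum in the rotating
      frame. Its rate of change is the constant torque of the multiplier force, so periodicity
      forces that torque to vanish.\<close>
    define Z where "Z s = (p s + 2 *\<^sub>R J_all (h s)) \<bullet> mass_weight \<mu> (J_all a)" for s
    have bJ: "bounded_linear J_all" using linear_J_all by (simp add: linear_conv_bounded_linear)
    have "((\<lambda>s. p s + 2 *\<^sub>R J_all (h s)) has_vector_derivative p' s + 2 *\<^sub>R J_all (p s)) (at s)" for s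
      by (intro has_vector_derivative_add p bounded_linear.has_vector_derivative[OF bounded_linear_scaleR_right]
          bounded_linear.has_vector_derivative[OF bJ] h)
    then have dZ: "(Z has_vector_derivative (p' s + 2 *\<^sub>R J_all (p s)) \<bullet> mass_weight \<mu> (J_all a)) (at s)" for s
      unfolding Z_def by (rule bounded_linear.has_vector_derivative[OF bounded_linear_inner_left])
    have val: "(p' s + 2 *\<^sub>R J_all (p s)) \<bullet> mass_weight \<mu> (J_all a) = l * (\<Sum>i\<in>UNIV. \<mu> i * (a $ i \<bullet> a $ i))" for s
    proof -
      have "(p' s + 2 *\<^sub>R J_all (p s)) \<bullet> mass_weight \<mu> (J_all a) =
          (\<Sum>i\<in>UNIV. \<mu> i * ((h s $ i + daccel \<mu> a (h s) i + l *\<^sub>R (J *v (a $ i))) \<bullet> (J *v (a $ i))))"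
        by (simp add: inner_mass_weight p'_def add.assoc)
      also have "\<dots> = (\<Sum>i\<in>UNIV. \<mu> i * ((h s $ i + daccel \<mu> a (h s) i) \<bullet> (J *v (a $ i)))) + l * (\<Sum>i\<in>UNIV. \<mu> i * (a $ i \<bullet> a $ i))"
        by (simp add: inner_add_left[of "h s $ i + daccel \<mu> a (h s) i" for i] distrib_left sum.distrib sum_distrib_left mult.left_commute)
      finally show ?thesis using linearised_pairing_J[of a \<mu> "h s", OF cceq] by simp
    qed
    define c where "c = l * (\<Sum>i\<in>UNIV. \<mu> i * (a $ i \<bullet> a $ i))"
    have "((\<lambda>s. Z s - s *\<^sub>R c) has_vector_derivative c - c) (at s)" for s
      using has_vector_derivative_diff[OF dZ[of s] has_vector_derivative_scaleR[OF DERIV_ident has_vector_derivative_const[of c]]]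
      by (simp add: val c_def)
    then have "Z s - s *\<^sub>R c = Z r - r *\<^sub>R c" for s r by (intro zero_derivative_const) simp
    from this[of "0 + ?\<theta>" 0] have "c * ?\<theta> = 0"
      using per(1)[of 0] per(2)[of 0] by (simp add: Z_def)
    then have "c = 0" using m by simp
    then show ?thesis using pos by (simp add: c_def)
  qed
  have hE: "h s \<in> E_red \<mu>" for s
  proof -
    define b where "b v = (\<Sum>i\<in>UNIV. \<mu> i *\<^sub>R v $ i)" for v :: "(real^2)^'k"
    have lb: "linear b" unfolding b_def
      by (rule linearI) (simp_all add: scaleR_add_right sum.distrib scaleR_right.sum mult.commute)
    then have bb: "bounded_linear b" by (simp add: linear_conv_bounded_linear)
    have bp': "b (p' s) = 1\<^sup>2 *\<^sub>R b (h s) - (2 * 1) *\<^sub>R (J *v b (p s))" for s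
    proof -
      have "b (p' s) = (\<Sum>i\<in>UNIV. \<mu> i *\<^sub>R h s $ i) + (\<Sum>i\<in>UNIV. \<mu> i *\<^sub>R daccel \<mu> a (h s) i) - 2 *\<^sub>R (\<Sum>i\<in>UNIV. J *v (\<mu> i *\<^sub>R p s $ i))"
        by (simp add: b_def p'_def l scaleR_add_right scaleR_diff_right sum.distrib sum_subtractf scaleR_right.sum J_linear_simps mult.commute)
      then show ?thesis by (simp add: sum_daccel b_def J_sum)
    qed
    have "b (h s) = 0"
    proof (rule rotating_free_motion_zero)
      show "((\<lambda>s. b (h s)) has_vector_derivative b (p s)) (at s)" for s
        by (rule bounded_linear.has_vector_derivative[OF bb h])
      show "((\<lambda>s. b (p s)) has_vector_derivative 1\<^sup>2 *\<^sub>R b (h s) - (2 * 1) *\<^sub>R (J *v b (p s))) (at s)" for s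
        using bounded_linear.has_vector_derivative[OF bb p] unfolding bp' .
      show "b (h (s + ?\<theta>)) = b (h s)" for s by (simp add: per)
      \<comment> \<open>Because \<open>m \<ge> 2\<close>, the period is shorter than a full turn of
        the frame, so a drifting or resting free particle cannot appear periodic unless it sits at
        the origin.\<close>
      show "cos (1 * ?\<theta>) \<noteq> 1" using cos_neq_1[OF \<theta>] by simp
    qed
    then show ?thesis by (simp add: E_red_def b_def)
  qed
  have perT: "f (s + ?T) = f s" if f: "\<And>s. f (s + ?\<theta>) = f s" for f :: "real \<Rightarrow> (real^2)^'k" and s
  proof -
    have "f (s + real n * ?\<theta>) = f s" for n
    proof (induction n)
      case (Suc n)
      have eq: "s + real (Suc n) * ?\<theta> = (s + real n * ?\<theta>) + ?\<theta>" by (simp add: algebra_simps add_divide_distrib)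
      show ?case unfolding eq f by (rule Suc)
    qed simp
    from this[of m] show ?thesis using m by simp
  qed
  define u where "u = Abs_h1 h"
  have pu: "h1_path u = h"
    unfolding u_def by (rule h1_path_Abs_h1[OF has_weak_deriv_classical[OF h cp] perT[of h, OF per(1)]])
  have um: "u \<in> H1_red_periodic \<mu> m" by (simp add: H1_red_periodic_def pu hE per)
  have am: "h1_const a \<in> H1_red_periodic \<mu> m" using a by (simp add: H1_red_periodic_def h1_path_const)
  obtain B where B: "has_hessian_on (H1_red_periodic \<mu> m) (action_A \<mu>) (h1_const a) B"
    "{u \<in> H1_red_periodic \<mu> m. \<forall>k\<in>H1_red_periodic \<mu> m. blinfun_apply (B u) k = 0} = span {h1_const (J_all a)}"
    using ker unfolding hessian_has_kernel_def by blast
  have "blinfun_apply (B u) k = 0" if k: "k \<in> H1_red_periodic \<mu> m" for k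
  proof -
    define f where "f s = mass_weight \<mu> (p s + J_all (h s))" for s
    define f' where "f' s = mass_weight \<mu> (p' s + J_all (p s))" for s
    have bJ: "bounded_linear J_all" and bm: "bounded_linear (mass_weight \<mu> :: (real^2)^'k \<Rightarrow> _)"
      using linear_J_all linear_mass_weight by (simp_all add: linear_conv_bounded_linear)
    have df: "(f has_vector_derivative f' s) (at s)" for s
      unfolding f_def f'_def
      by (intro bounded_linear.has_vector_derivative[OF bm] has_vector_derivative_add p
          bounded_linear.has_vector_derivative[OF bJ] h)
    have cf': "continuous_on UNIV f'" unfolding f'_def
      by (intro bounded_linear.continuous_on[OF bm] continuous_on_add cp' bounded_linear.continuous_on[OF bJ] cp)
    have cf: "continuous_on UNIV f" unfolding f_def
      by (intro bounded_linear.continuous_on[OF bm] continuous_on_add cp bounded_linear.continuous_on[OF bJ] ch)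
    have fT: "f ?T = f 0" using perT[of h, OF per(1), of 0] perT[of p, OF per(2), of 0] by (simp add: f_def)
    have kT: "h1_path k ?T = h1_path k 0" using path_periodic[of k 0] by simp
    have ck: "continuous_on {0..?T} (h1_path k)"
      by (rule has_weak_deriv_continuous[OF has_weak_deriv_wderiv])
    have ibp: "(LINT s:{0..?T}|lborel. f s \<bullet> wderiv k s) = - (LINT s:{0..?T}|lborel. f' s \<bullet> h1_path k s)"
      by (rule integration_by_parts_weak[OF has_weak_deriv_wderiv kT df fT cf'])
    have i1: "set_integrable lborel {0..?T} (\<lambda>s. f s \<bullet> wderiv k s)"
      by (intro square_integrable_inner square_integrable_wderiv square_integrable_continuous cf)
    have cJk: "continuous_on {0..?T} (\<lambda>s. J_all (h1_path k s) \<bullet> f s)"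
      by (intro continuous_intros bounded_linear.continuous_on[OF bJ] ck continuous_on_subset[OF cf]) simp
    have i2: "set_integrable lborel {0..?T} (\<lambda>s. J_all (h1_path k s) \<bullet> f s)"
      by (rule borel_integrable_atLeastAtMost'[OF cJk])
    have cf'k: "continuous_on {0..?T} (\<lambda>s. f' s \<bullet> h1_path k s)"
      by (intro continuous_intros ck continuous_on_subset[OF cf']) simp
    have cd: "continuous_on {0..?T} (\<lambda>s. \<Sum>i\<in>UNIV. \<mu> i * (daccel \<mu> a (h s) i \<bullet> h1_path k s $ i))"
      by (intro continuous_intros ck continuous_on_daccel \<open>collision_free a\<close> continuous_on_subset[OF ch]) simp
    have "blinfun_apply (B u) k =
      (LINT s:{0..?T}|lborel. f s \<bullet> wderiv k s + J_all (h1_path k s) \<bullet> f s) +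
      integral {0..?T} (\<lambda>s. \<Sum>i\<in>UNIV. \<mu> i * (daccel \<mu> a (h s) i \<bullet> h1_path k s $ i))"
      using action_hessian[OF \<mu> \<open>collision_free a\<close> B(1) am um k _ cp] h
      by (simp add: pu f_def inner_add_left inner_commute)
    also have "(LINT s:{0..?T}|lborel. f s \<bullet> wderiv k s + J_all (h1_path k s) \<bullet> f s) =
        - integral {0..?T} (\<lambda>s. f' s \<bullet> h1_path k s) + integral {0..?T} (\<lambda>s. J_all (h1_path k s) \<bullet> f s)"
      by (simp add: set_integral_add(2)[OF i1 i2] ibp set_lebesgue_integral_continuous[OF cJk] set_lebesgue_integral_continuous[OF cf'k])
    also have "\<dots> + integral {0..?T} (\<lambda>s. \<Sum>i\<in>UNIV. \<mu> i * (daccel \<mu> a (h s) i \<bullet> h1_path k s $ i)) =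
        integral {0..?T} (\<lambda>s. - (f' s \<bullet> h1_path k s) + J_all (h1_path k s) \<bullet> f s + (\<Sum>i\<in>UNIV. \<mu> i * (daccel \<mu> a (h s) i \<bullet> h1_path k s $ i)))"
      by (rule integral_unique[symmetric])
        (intro has_integral_add has_integral_neg integrable_integral integrable_continuous_real cf'k cJk cd)
    \<comment> \<open>After the integration by parts the integrand vanishes pointwise: this is the
      differential equation paired with \<open>k\<close>.\<close>
    also have "(\<lambda>s. - (f' s \<bullet> h1_path k s) + J_all (h1_path k s) \<bullet> f s + (\<Sum>i\<in>UNIV. \<mu> i * (daccel \<mu> a (h s) i \<bullet> h1_path k s $ i))) = (\<lambda>s. 0)"
    proof
      fix s
      let ?k = "h1_path k s"
      have "f' s \<bullet> ?k = (\<Sum>i\<in>UNIV. \<mu> i * (?k $ i \<bullet> (p' s $ i + J *v p s $ i)))"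
        unfolding f'_def inner_commute[of _ ?k] inner_mass_weight by simp
      moreover have "J_all ?k \<bullet> f s = - (\<Sum>i\<in>UNIV. \<mu> i * (?k $ i \<bullet> (J *v (p s $ i) - h s $ i)))"
        unfolding f_def inner_J_all_mass_weight by (simp add: inner_mass_weight J_linear_simps)
      ultimately have "- (f' s \<bullet> ?k) + J_all ?k \<bullet> f s = - (\<Sum>i\<in>UNIV. \<mu> i * (?k $ i \<bullet> (p' s $ i + J *v p s $ i))) -
          (\<Sum>i\<in>UNIV. \<mu> i * (?k $ i \<bullet> (J *v (p s $ i) - h s $ i)))" by simp
      also have "\<dots> = - (\<Sum>i\<in>UNIV. \<mu> i * (daccel \<mu> a (h s) i \<bullet> ?k $ i))"
        unfolding sum_negf[symmetric] sum_subtractf[symmetric]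
        by (intro sum.cong refl)
          (simp add: p'_def l inner_add_right inner_diff_right inner_commute algebra_simps)
      finally show "- (f' s \<bullet> ?k) + J_all ?k \<bullet> f s + (\<Sum>i\<in>UNIV. \<mu> i * (daccel \<mu> a (h s) i \<bullet> ?k $ i)) = 0"
        by simp
    qed
    finally show ?thesis by simp
  qed
  then have "u \<in> span {h1_const (J_all a)}" using B(2) um by blast
  then obtain c where c: "u = c *\<^sub>R h1_const (J_all a)" by (auto simp: span_singleton)
  have hc: "h s = c *\<^sub>R J_all a" for s
    using arg_cong[OF c, of h1_path] by (simp add: pu path_scaleR h1_path_const fun_eq_iff)
  have "0 = (\<Sum>i\<in>UNIV. \<mu> i * (h 0 $ i \<bullet> (J *v (a $ i))))" using perp by simp
  also have "\<dots> = c * (\<Sum>i\<in>UNIV. \<mu> i * (a $ i \<bullet> a $ i))"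
    by (simp add: hc sum_distrib_left mult.left_commute)
  finally have "c = 0" using pos by simp
  then have h0: "h s = 0" for s by (simp add: hc)
  have "(h has_vector_derivative 0) (at s)" for s
    unfolding h0[abs_def] by simp
  then have "p s = 0" for s using h vector_derivative_unique_at by blast
  with h0 l show ?thesis by blast
qed

subsection \<open>Functions that are asymptotically linear at a point\<close>

text \<open>The parameter tends to zero from the right and everything is uniform in the time variable. The
  expansion is required for differences of two states, since the contraction argument needs a small
  Lipschitz constant.\<close>

definition asymptotically_linear ::
  "'a::euclidean_space \<Rightarrow> (real \<Rightarrow> real \<Rightarrow> 'a \<Rightarrow> 'b::euclidean_space) \<Rightarrow> ('a \<Rightarrow> 'b) \<Rightarrow> 'b \<Rightarrow> bool" where
  "asymptotically_linear a f D v \<longleftrightarrow> linear D \<and>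
     (\<forall>\<eta>>0. \<forall>\<^sub>F p in at_right 0 \<times>\<^sub>F (nhds a \<times>\<^sub>F nhds a). \<forall>s.
        norm (f (fst p) s (fst (snd p)) - f (fst p) s (snd (snd p)) - D (fst (snd p) - snd (snd p)))
          \<le> \<eta> * norm (fst (snd p) - snd (snd p))) \<and>
     (\<exists>C. \<forall>\<^sub>F \<epsilon> in at_right 0. \<forall>s. norm (f \<epsilon> s a - v) \<le> C * \<epsilon>) \<and>
     (\<forall>\<^sub>F p in at_right 0 \<times>\<^sub>F nhds a. \<forall>s. isCont (\<lambda>q. f (fst p) (fst q) (snd q)) (s, snd p))"

lemma asymptotically_linearD:
  assumes "asymptotically_linear a f D v"
  shows "linear D"
    and "\<eta> > 0 \<Longrightarrow> \<forall>\<^sub>F p in at_right 0 \<times>\<^sub>F (nhds a \<times>\<^sub>F nhds a). \<forall>s.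
        norm (f (fst p) s (fst (snd p)) - f (fst p) s (snd (snd p)) - D (fst (snd p) - snd (snd p)))
          \<le> \<eta> * norm (fst (snd p) - snd (snd p))"
    and "\<exists>C. \<forall>\<^sub>F \<epsilon> in at_right 0. \<forall>s. norm (f \<epsilon> s a - v) \<le> C * \<epsilon>"
    and "\<forall>\<^sub>F p in at_right 0 \<times>\<^sub>F nhds a. \<forall>s. isCont (\<lambda>q. f (fst p) (fst q) (snd q)) (s, snd p)"
  using assms unfolding asymptotically_linear_def by blast+

lemma asymptotically_linearI:
  assumes "linear D"
    and "\<And>\<eta>. \<eta> > 0 \<Longrightarrow> \<forall>\<^sub>F p in at_right 0 \<times>\<^sub>F (nhds a \<times>\<^sub>F nhds a). \<forall>s.
        norm (f (fst p) s (fst (snd p)) - f (fst p) s (snd (snd p)) - D (fst (snd p) - snd (snd p)))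
          \<le> \<eta> * norm (fst (snd p) - snd (snd p))"
    and "\<forall>\<^sub>F \<epsilon> in at_right 0. \<forall>s. norm (f \<epsilon> s a - v) \<le> C * \<epsilon>"
    and "\<forall>\<^sub>F p in at_right 0 \<times>\<^sub>F nhds a. \<forall>s. isCont (\<lambda>q. f (fst p) (fst q) (snd q)) (s, snd p)"
  shows "asymptotically_linear a f D v"
  using assms unfolding asymptotically_linear_def by blast

lemma eventually_parameter_small:
  "c > 0 \<Longrightarrow> \<forall>\<^sub>F p in at_right (0::real) \<times>\<^sub>F F. 0 < fst p \<and> fst p < c"
  unfolding eventually_prod_filter
  by (rule exI[of _ "\<lambda>\<epsilon>. 0 < \<epsilon> \<and> \<epsilon> < c"], rule exI[of _ "\<lambda>_. True"]) (auto simp: eventually_at_right)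

lemma eventually_parameter_small':
  "c > 0 \<Longrightarrow> \<forall>\<^sub>F \<epsilon> in at_right (0::real). 0 < \<epsilon> \<and> \<epsilon> < c"
  by (auto simp: eventually_at_right)

lemma eventually_state_near:
  fixes a :: "'a::real_normed_vector"
  assumes "c > 0"
  shows "\<forall>\<^sub>F p in G \<times>\<^sub>F nhds a. norm (snd p - a) < c"
    "\<forall>\<^sub>F p in G \<times>\<^sub>F (nhds a \<times>\<^sub>F nhds a). norm (fst (snd p) - a) < c \<and> norm (snd (snd p) - a) < c"
proof -
  have n: "\<forall>\<^sub>F y in nhds a. norm (y - a) < c"
    using assms unfolding eventually_nhds_metric by (auto simp: dist_norm)
  show "\<forall>\<^sub>F p in G \<times>\<^sub>F nhds a. norm (snd p - a) < c"
    unfolding eventually_prod_filter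
    by (rule exI[of _ "\<lambda>_. True"], rule exI[of _ "\<lambda>y. norm (y - a) < c"]) (use n in auto)
  have n2: "\<forall>\<^sub>F q in nhds a \<times>\<^sub>F nhds a. norm (fst q - a) < c \<and> norm (snd q - a) < c"
    unfolding eventually_prod_filter
    by (rule exI[of _ "\<lambda>y. norm (y - a) < c"], rule exI[of _ "\<lambda>y. norm (y - a) < c"]) (use n in auto)
  show "\<forall>\<^sub>F p in G \<times>\<^sub>F (nhds a \<times>\<^sub>F nhds a). norm (fst (snd p) - a) < c \<and> norm (snd (snd p) - a) < c"
    unfolding eventually_prod_filter[of _ G]
    by (rule exI[of _ "\<lambda>_. True"], rule exI[of _ "\<lambda>q. norm (fst q - a) < c \<and> norm (snd q - a) < c"]) (use n2 in auto)
qed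

lemma asymptotically_linear_linear:
  assumes L: "linear L"
  shows "asymptotically_linear a (\<lambda>\<epsilon> s y. L y) L (L a)"
proof (rule asymptotically_linearI[where C = 0])
  have cL: "isCont (\<lambda>q. L (snd q)) (s, y)" for s :: real and y
    using L by (intro bounded_linear.isCont[of L]) (auto simp: linear_conv_bounded_linear)
  show "\<forall>\<^sub>F p in at_right (0::real) \<times>\<^sub>F nhds a. \<forall>s::real. isCont (\<lambda>q. L (snd q)) (s, snd p)"
    by (intro always_eventually allI cL)
qed (use L in \<open>auto simp: linear_diff\<close>)

lemma asymptotically_linear_const: "asymptotically_linear a (\<lambda>\<epsilon> s y. v) (\<lambda>_. 0) v"
  by (rule asymptotically_linearI[where C = 0]) (auto simp: linear_zero)

lemma asymptotically_linear_add:
  assumes f: "asymptotically_linear a f D v" and g: "asymptotically_linear a g E w"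
  shows "asymptotically_linear a (\<lambda>\<epsilon> s y. f \<epsilon> s y + g \<epsilon> s y) (\<lambda>h. D h + E h) (v + w)"
proof -
  obtain C1 C2 where C1: "\<forall>\<^sub>F \<epsilon> in at_right 0. \<forall>s. norm (f \<epsilon> s a - v) \<le> C1 * \<epsilon>"
    and C2: "\<forall>\<^sub>F \<epsilon> in at_right 0. \<forall>s. norm (g \<epsilon> s a - w) \<le> C2 * \<epsilon>"
    using asymptotically_linearD(3)[OF f] asymptotically_linearD(3)[OF g] by blast
  show ?thesis
  proof (rule asymptotically_linearI[where C = "C1 + C2"])
    show "linear (\<lambda>h. D h + E h)"
      using asymptotically_linearD(1)[OF f] asymptotically_linearD(1)[OF g] by (rule linear_compose_add)
    show "\<forall>\<^sub>F \<epsilon> in at_right 0. \<forall>s. norm (f \<epsilon> s a + g \<epsilon> s a - (v + w)) \<le> (C1 + C2) * \<epsilon>"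
      using C1 C2
    proof eventually_elim
      case (elim \<epsilon>)
      show ?case
      proof
        fix s
        have "norm (f \<epsilon> s a + g \<epsilon> s a - (v + w)) \<le> norm (f \<epsilon> s a - v) + norm (g \<epsilon> s a - w)"
          by (metis add_diff_add norm_triangle_ineq)
        then show "norm (f \<epsilon> s a + g \<epsilon> s a - (v + w)) \<le> (C1 + C2) * \<epsilon>"
          using elim(1)[rule_format, of s] elim(2)[rule_format, of s] by (simp add: distrib_right)
      qed
    qed
    show "\<forall>\<^sub>F p in at_right 0 \<times>\<^sub>F nhds a. \<forall>s. isCont (\<lambda>q. f (fst p) (fst q) (snd q) + g (fst p) (fst q) (snd q)) (s, snd p)"
      using asymptotically_linearD(4)[OF f] asymptotically_linearD(4)[OF g]
      by eventually_elim (auto intro!: continuous_intros)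
    fix \<eta> :: real assume "\<eta> > 0"
    then have "\<eta> / 2 > 0" by simp
    from asymptotically_linearD(2)[OF f this] asymptotically_linearD(2)[OF g this]
    show "\<forall>\<^sub>F p in at_right 0 \<times>\<^sub>F (nhds a \<times>\<^sub>F nhds a). \<forall>s.
        norm (f (fst p) s (fst (snd p)) + g (fst p) s (fst (snd p)) - (f (fst p) s (snd (snd p)) + g (fst p) s (snd (snd p)))
          - (D (fst (snd p) - snd (snd p)) + E (fst (snd p) - snd (snd p))))
          \<le> \<eta> * norm (fst (snd p) - snd (snd p))"
    proof eventually_elim
      case (elim p)
      show ?case
      proof
        fix s
        have eq: "(a + b - (c + d) - (e + f)) = (a - c - e) + (b - d - f)" for a b c d e f :: 'b by simp
        show "norm (f (fst p) s (fst (snd p)) + g (fst p) s (fst (snd p)) - (f (fst p) s (snd (snd p)) + g (fst p) s (snd (snd p)))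
          - (D (fst (snd p) - snd (snd p)) + E (fst (snd p) - snd (snd p))))
          \<le> \<eta> * norm (fst (snd p) - snd (snd p))"
          unfolding eq
          using add_mono[OF elim(1)[rule_format, of s] elim(2)[rule_format, of s]]
          by (intro order_trans[OF norm_triangle_ineq]) (simp add: field_simps)
      qed
    qed
  qed
qed

lemma asymptotically_linear_linear_image:
  assumes f: "asymptotically_linear a f D v" and L: "linear L"
  shows "asymptotically_linear a (\<lambda>\<epsilon> s y. L (f \<epsilon> s y)) (\<lambda>h. L (D h)) (L v)"
proof -
  obtain K where K: "K > 0" "\<And>x. norm (L x) \<le> K * norm x" using linear_bounded_pos[OF L] by blast
  obtain C where C: "\<forall>\<^sub>F \<epsilon> in at_right 0. \<forall>s. norm (f \<epsilon> s a - v) \<le> C * \<epsilon>"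
    using asymptotically_linearD(3)[OF f] by blast
  have bL: "bounded_linear L" using L by (simp add: linear_conv_bounded_linear)
  show ?thesis
  proof (rule asymptotically_linearI[where C = "K * C"])
    show "linear (\<lambda>h. L (D h))"
      using linear_compose[OF asymptotically_linearD(1)[OF f] L] by (simp add: o_def)
    show "\<forall>\<^sub>F \<epsilon> in at_right 0. \<forall>s. norm (L (f \<epsilon> s a) - L v) \<le> K * C * \<epsilon>"
      using C
    proof eventually_elim
      case (elim \<epsilon>)
      show ?case
      proof
        fix s
        have "norm (L (f \<epsilon> s a) - L v) \<le> K * norm (f \<epsilon> s a - v)"
          unfolding linear_diff[OF L, symmetric] by (rule K)
        also have "\<dots> \<le> K * (C * \<epsilon>)" using elim K by (intro mult_left_mono) auto
        finally show "norm (L (f \<epsilon> s a) - L v) \<le> K * C * \<epsilon>" by simp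
      qed
    qed
    show "\<forall>\<^sub>F p in at_right 0 \<times>\<^sub>F nhds a. \<forall>s. isCont (\<lambda>q. L (f (fst p) (fst q) (snd q))) (s, snd p)"
      using asymptotically_linearD(4)[OF f]
      by eventually_elim (auto intro: bounded_linear.isCont[OF bL])
    fix \<eta> :: real assume "\<eta> > 0"
    then have "\<eta> / K > 0" using K by simp
    from asymptotically_linearD(2)[OF f this]
    show "\<forall>\<^sub>F p in at_right 0 \<times>\<^sub>F (nhds a \<times>\<^sub>F nhds a). \<forall>s.
        norm (L (f (fst p) s (fst (snd p))) - L (f (fst p) s (snd (snd p))) - L (D (fst (snd p) - snd (snd p))))
          \<le> \<eta> * norm (fst (snd p) - snd (snd p))"
    proof eventually_elim
      case (elim p)
      show ?case
        unfolding linear_diff[OF L, symmetric]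
      proof
        fix s
        have "norm (L (f (fst p) s (fst (snd p)) - f (fst p) s (snd (snd p)) - D (fst (snd p) - snd (snd p))))
            \<le> K * (\<eta> / K * norm (fst (snd p) - snd (snd p)))"
          using elim K by (intro order_trans[OF K(2)] mult_left_mono) auto
        then show "norm (L (f (fst p) s (fst (snd p)) - f (fst p) s (snd (snd p)) - D (fst (snd p) - snd (snd p))))
            \<le> \<eta> * norm (fst (snd p) - snd (snd p))" using K by simp
      qed
    qed
  qed
qed

lemma asymptotically_linear_scaleR:
  "asymptotically_linear a f D v \<Longrightarrow>
    asymptotically_linear a (\<lambda>\<epsilon> s y. c *\<^sub>R f \<epsilon> s y) (\<lambda>h. c *\<^sub>R D h) (c *\<^sub>R v)"
  by (rule asymptotically_linear_linear_image[where L = "\<lambda>x. c *\<^sub>R x"]) (simp_all add: linear_scaleR)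

lemma asymptotically_linear_minus:
  "asymptotically_linear a f D v \<Longrightarrow>
    asymptotically_linear a (\<lambda>\<epsilon> s y. - f \<epsilon> s y) (\<lambda>h. - D h) (- v)"
  using asymptotically_linear_scaleR[of a f D v "-1"] by simp

lemma asymptotically_linear_diff:
  "asymptotically_linear a f D v \<Longrightarrow> asymptotically_linear a g E w \<Longrightarrow>
    asymptotically_linear a (\<lambda>\<epsilon> s y. f \<epsilon> s y - g \<epsilon> s y) (\<lambda>h. D h - E h) (v - w)"
  using asymptotically_linear_add[OF _ asymptotically_linear_minus, of a f D v g E w] by simp

lemma asymptotically_linear_sum:
  assumes "finite I" "\<And>i. i \<in> I \<Longrightarrow> asymptotically_linear a (f i) (D i) (v i)"
  shows "asymptotically_linear a (\<lambda>\<epsilon> s y. \<Sum>i\<in>I. f i \<epsilon> s y) (\<lambda>h. \<Sum>i\<in>I. D i h) (\<Sum>i\<in>I. v i)"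
  using assms
proof (induction I rule: finite_induct)
  case empty
  then show ?case by (simp add: asymptotically_linear_const)
next
  case (insert i I)
  then show ?case by (simp add: asymptotically_linear_add)
qed

lemma asymptotically_linear_vec:
  fixes f :: "'i::finite \<Rightarrow> real \<Rightarrow> real \<Rightarrow> 'a::euclidean_space \<Rightarrow> 'b::euclidean_space"
  assumes "\<And>i. asymptotically_linear a (f i) (D i) (v i)"
  shows "asymptotically_linear a (\<lambda>\<epsilon> s y. \<chi> i. f i \<epsilon> s y) (\<lambda>h. \<chi> i. D i h) (\<chi> i. v i)"
proof -
  have lin: "linear (axis i :: 'b \<Rightarrow> 'b^'i)" for i
    by (rule linearI) (auto simp: axis_def vec_eq_iff)
  have eq: "(\<chi> i. w i) = (\<Sum>i\<in>UNIV. axis i (w i))" for w :: "'i \<Rightarrow> 'b"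
    by (simp add: vec_eq_iff axis_def sum.delta')
  show ?thesis
    unfolding eq
    by (rule asymptotically_linear_sum) (simp, rule asymptotically_linear_linear_image[OF assms lin])
qed

lemma asymptotically_linear_lipschitz:
  assumes f: "asymptotically_linear a f D v"
  obtains K where "K > 0" "\<forall>\<^sub>F p in at_right 0 \<times>\<^sub>F (nhds a \<times>\<^sub>F nhds a). \<forall>s.
    norm (f (fst p) s (fst (snd p)) - f (fst p) s (snd (snd p))) \<le> K * norm (fst (snd p) - snd (snd p))"
proof -
  obtain K where K: "K > 0" "\<And>x. norm (D x) \<le> K * norm x"
    using linear_bounded_pos[OF asymptotically_linearD(1)[OF f]] by blast
  show ?thesis
  proof (rule that[of "K + 1"])
    show "\<forall>\<^sub>F p in at_right 0 \<times>\<^sub>F (nhds a \<times>\<^sub>F nhds a). \<forall>s.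
      norm (f (fst p) s (fst (snd p)) - f (fst p) s (snd (snd p))) \<le> (K + 1) * norm (fst (snd p) - snd (snd p))"
      using asymptotically_linearD(2)[OF f zero_less_one]
    proof eventually_elim
      case (elim p)
      show ?case
      proof
        fix s
        have "norm (f (fst p) s (fst (snd p)) - f (fst p) s (snd (snd p))) \<le>
            norm (f (fst p) s (fst (snd p)) - f (fst p) s (snd (snd p)) - D (fst (snd p) - snd (snd p)))
            + norm (D (fst (snd p) - snd (snd p)))"
          using norm_triangle_sub[of "f (fst p) s (fst (snd p)) - f (fst p) s (snd (snd p))" "D (fst (snd p) - snd (snd p))"]
          by (simp only: add.commute)
        then show "norm (f (fst p) s (fst (snd p)) - f (fst p) s (snd (snd p))) \<le> (K + 1) * norm (fst (snd p) - snd (snd p))"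
          using elim[rule_format, of s] K(2)[of "fst (snd p) - snd (snd p)"] by (simp add: distrib_right)
      qed
    qed
  qed (use K in simp)
qed

text \<open>A factor of order \<epsilon> makes both the value and the Lipschitz constant small, so
  no linear part survives. The time-dependent isometry \<open>R\<close> stands for a rotation by an
  angle depending on \<open>s\<close>, which is uniformly bounded but has no limit.\<close>

lemma asymptotically_linear_vanishing_factor:
  fixes R :: "real \<Rightarrow> 'b::euclidean_space \<Rightarrow> 'b"
  assumes f: "asymptotically_linear a f D v"
    and \<kappa>: "\<forall>\<^sub>F \<epsilon> in at_right 0. \<bar>\<kappa> \<epsilon>\<bar> \<le> C\<kappa> * \<epsilon>"
    and R: "\<And>s x. norm (R s x) = norm x" "\<And>s x y. R s (x - y) = R s x - R s y"
      "\<And>s x. isCont (\<lambda>q. R (fst q) (snd q)) (s, x)"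
  shows "asymptotically_linear a (\<lambda>\<epsilon> s y. \<kappa> \<epsilon> *\<^sub>R R s (f \<epsilon> s y)) (\<lambda>_. 0) 0"
proof -
  obtain C where C: "\<forall>\<^sub>F \<epsilon> in at_right 0. \<forall>s. norm (f \<epsilon> s a - v) \<le> C * \<epsilon>"
    using asymptotically_linearD(3)[OF f] by blast
  obtain K where K: "K > 0" "\<forall>\<^sub>F p in at_right 0 \<times>\<^sub>F (nhds a \<times>\<^sub>F nhds a). \<forall>s.
    norm (f (fst p) s (fst (snd p)) - f (fst p) s (snd (snd p))) \<le> K * norm (fst (snd p) - snd (snd p))"
    using asymptotically_linear_lipschitz[OF f] by blast
  define c where "c = \<bar>C\<kappa>\<bar>"
  have \<kappa>': "\<forall>\<^sub>F \<epsilon> in at_right 0. \<bar>\<kappa> \<epsilon>\<bar> \<le> c * \<epsilon>"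
    using \<kappa> eventually_parameter_small'[OF zero_less_one]
    by eventually_elim (auto simp: c_def intro: order_trans[OF _ mult_right_mono])
  show ?thesis
  proof (rule asymptotically_linearI[where C = "c * (norm v + \<bar>C\<bar>)"])
    show "\<forall>\<^sub>F \<epsilon> in at_right 0. \<forall>s. norm (\<kappa> \<epsilon> *\<^sub>R R s (f \<epsilon> s a) - 0) \<le> c * (norm v + \<bar>C\<bar>) * \<epsilon>"
      using C \<kappa>' eventually_parameter_small'[OF zero_less_one]
    proof eventually_elim
      case (elim \<epsilon>)
      show ?case
      proof
        fix s
        have "norm (f \<epsilon> s a) \<le> norm v + C * \<epsilon>"
          using elim(1)[rule_format, of s] norm_triangle_sub[of "f \<epsilon> s a" v] by linarith
        also have "C * \<epsilon> \<le> \<bar>C\<bar> * 1" using elim by (intro mult_mono) auto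
        finally have "norm (f \<epsilon> s a) \<le> norm v + \<bar>C\<bar>" by simp
        then have "\<bar>\<kappa> \<epsilon>\<bar> * norm (f \<epsilon> s a) \<le> (c * \<epsilon>) * (norm v + \<bar>C\<bar>)"
          using elim(2) by (intro mult_mono) (auto simp: c_def elim(3) less_imp_le)
        then show "norm (\<kappa> \<epsilon> *\<^sub>R R s (f \<epsilon> s a) - 0) \<le> c * (norm v + \<bar>C\<bar>) * \<epsilon>"
          by (simp add: R mult_ac)
      qed
    qed
    show "\<forall>\<^sub>F p in at_right 0 \<times>\<^sub>F nhds a. \<forall>s. isCont (\<lambda>q. \<kappa> (fst p) *\<^sub>R R (fst q) (f (fst p) (fst q) (snd q))) (s, snd p)"
      using asymptotically_linearD(4)[OF f]
    proof eventually_elim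
      case (elim p)
      show ?case
      proof
        fix s
        have 1: "isCont (\<lambda>q. (fst q, f (fst p) (fst q) (snd q))) (s, snd p)"
          using elim by (intro continuous_intros) auto
        have "isCont (\<lambda>q. R (fst q) (f (fst p) (fst q) (snd q))) (s, snd p)"
          using isCont_o2[OF 1, of "\<lambda>q. R (fst q) (snd q)"] R(3) by simp
        then show "isCont (\<lambda>q. \<kappa> (fst p) *\<^sub>R R (fst q) (f (fst p) (fst q) (snd q))) (s, snd p)"
          by (intro continuous_intros)
      qed
    qed
    fix \<eta> :: real assume \<eta>: "\<eta> > 0"
    define e where "e = \<eta> / ((c + 1) * K)"
    have e: "e > 0" using \<eta> K by (simp add: e_def c_def add_nonneg_pos)
    have \<kappa>'': "\<forall>\<^sub>F p in at_right 0 \<times>\<^sub>F (nhds a \<times>\<^sub>F nhds a). \<bar>\<kappa> (fst p)\<bar> \<le> c * fst p"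
      unfolding eventually_prod_filter[of _ "at_right 0" "nhds a \<times>\<^sub>F nhds a"]
      by (rule exI[of _ "\<lambda>\<epsilon>. \<bar>\<kappa> \<epsilon>\<bar> \<le> c * \<epsilon>"], rule exI[of _ "\<lambda>_. True"]) (use \<kappa>' in simp)
    show "\<forall>\<^sub>F p in at_right 0 \<times>\<^sub>F (nhds a \<times>\<^sub>F nhds a). \<forall>s.
        norm (\<kappa> (fst p) *\<^sub>R R s (f (fst p) s (fst (snd p))) - \<kappa> (fst p) *\<^sub>R R s (f (fst p) s (snd (snd p))) - 0)
          \<le> \<eta> * norm (fst (snd p) - snd (snd p))"
      using K(2) \<kappa>'' eventually_parameter_small[OF e]
    proof eventually_elim
      case (elim p)
      show ?case
      proof
        fix s
        let ?n = "norm (fst (snd p) - snd (snd p))"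
        have "c * fst p \<le> (c + 1) * e" using elim by (intro mult_mono) (auto simp: c_def)
        then have "\<bar>\<kappa> (fst p)\<bar> \<le> (c + 1) * e" using elim by linarith
        then have "\<bar>\<kappa> (fst p)\<bar> * norm (f (fst p) s (fst (snd p)) - f (fst p) s (snd (snd p))) \<le> ((c + 1) * e) * (K * ?n)"
          using elim by (intro mult_mono) (auto simp: c_def)
        also have "\<dots> = ((c + 1) * K * e) * ?n" by simp
        also have "(c + 1) * K * e = \<eta>" using K by (simp add: e_def c_def add_nonneg_pos)
        finally have "norm (\<kappa> (fst p) *\<^sub>R R s (f (fst p) s (fst (snd p)) - f (fst p) s (snd (snd p)))) \<le> \<eta> * ?n"
          by (simp add: R(1))
        then show "norm (\<kappa> (fst p) *\<^sub>R R s (f (fst p) s (fst (snd p))) - \<kappa> (fst p) *\<^sub>R R s (f (fst p) s (snd (snd p))) - 0) \<le> \<eta> * ?n"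
          by (simp add: R(2) scaleR_diff_right)
      qed
    qed
  qed (simp add: linear_zero)
qed

lemma asymptotically_linear_vanishing_scaleR:
  assumes "asymptotically_linear a f D v" "\<forall>\<^sub>F \<epsilon> in at_right 0. \<bar>\<kappa> \<epsilon>\<bar> \<le> C * \<epsilon>"
  shows "asymptotically_linear a (\<lambda>\<epsilon> s y. \<kappa> \<epsilon> *\<^sub>R f \<epsilon> s y) (\<lambda>_. 0) 0"
  by (rule asymptotically_linear_vanishing_factor[OF assms, of "\<lambda>_ x. x"]) (auto intro!: continuous_intros)

subsection \<open>Strict differentiability of the Newtonian kernel\<close>

text \<open>The factor of \<open>norm h\<close> tends to 0 as \<open>x\<close> tends to
  \<open>x0\<close>: an explicit form of the continuity of the derivative in operator norm.\<close>

lemma norm_dgrav_diff_le: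
  "norm (dgrav x h - dgrav x0 h) \<le> norm h * (\<bar>1 / norm x ^ 3 - 1 / norm x0 ^ 3\<bar> +
    3 * norm ((1 / norm x ^ 5) *\<^sub>R x - (1 / norm x0 ^ 5) *\<^sub>R x0) * norm x + 3 * norm x0 * norm (x - x0) / norm x0 ^ 5)"
proof -
  let ?w = "(1 / norm x ^ 5) *\<^sub>R x" and ?wo = "(1 / norm x0 ^ 5) *\<^sub>R x0"
  have "dgrav x h - dgrav x0 h = (1 / norm x ^ 3 - 1 / norm x0 ^ 3) *\<^sub>R h
      - ((3 * (x \<bullet> h)) *\<^sub>R (?w - ?wo) + (3 * ((x - x0) \<bullet> h)) *\<^sub>R ?wo)"
  proof -
    have "\<alpha> *\<^sub>R h - (3 * q) *\<^sub>R w - (\<alpha>0 *\<^sub>R h - (3 * q0) *\<^sub>R w0) =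
        (\<alpha> - \<alpha>0) *\<^sub>R h - ((3 * q) *\<^sub>R (w - w0) + (3 * (q - q0)) *\<^sub>R w0)" for \<alpha> \<alpha>0 q q0 :: real and w w0 :: "real^2"
      by (simp add: algebra_simps)
    from this[of "1 / norm x ^ 3" "x \<bullet> h" ?w "1 / norm x0 ^ 3" "x0 \<bullet> h" ?wo]
    show ?thesis by (simp only: dgrav_def inner_diff_left scaleR_scaleR times_divide_eq_right mult_1_right)
  qed
  then have "norm (dgrav x h - dgrav x0 h) = norm ((1 / norm x ^ 3 - 1 / norm x0 ^ 3) *\<^sub>R h
      - ((3 * (x \<bullet> h)) *\<^sub>R (?w - ?wo) + (3 * ((x - x0) \<bullet> h)) *\<^sub>R ?wo))" by (rule arg_cong)
  also have "\<dots> \<le> norm ((1 / norm x ^ 3 - 1 / norm x0 ^ 3) *\<^sub>R h)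
      + (norm ((3 * (x \<bullet> h)) *\<^sub>R (?w - ?wo)) + norm ((3 * ((x - x0) \<bullet> h)) *\<^sub>R ?wo))"
    by (rule order_trans[OF norm_triangle_ineq4 add_left_mono[OF norm_triangle_ineq]])
  also have "\<dots> \<le> \<bar>1 / norm x ^ 3 - 1 / norm x0 ^ 3\<bar> * norm h
      + ((3 * (norm x * norm h)) * norm (?w - ?wo) + (3 * (norm (x - x0) * norm h)) * norm ?wo)"
    unfolding norm_scaleR abs_mult
    by (intro add_mono mult_right_mono order_refl) (auto intro: Cauchy_Schwarz_ineq2)
  finally show ?thesis by (simp add: algebra_simps)
qed

text \<open>Mean value inequality on a small ball for \<open>grav\<close> minus its linearisation at
  \<open>x0\<close>; the ball avoids the singularity and is convex. Both points vary, since
  differentiability at \<open>x0\<close> alone would not bound a Lipschitz constant nearby.\<close>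

lemma grav_strict_derivative:
  assumes x0: "x0 \<noteq> 0" and \<eta>: "\<eta> > 0"
  obtains d where "d > 0" "\<And>x x'. norm (x - x0) < d \<Longrightarrow> norm (x' - x0) < d \<Longrightarrow>
    norm (grav x - grav x' - dgrav x0 (x - x')) \<le> \<eta> * norm (x - x')"
    "\<And>x. norm (x - x0) < d \<Longrightarrow> x \<noteq> 0"
proof -
  define \<psi> where "\<psi> x = \<bar>1 / norm x ^ 3 - 1 / norm x0 ^ 3\<bar> +
    3 * norm ((1 / norm x ^ 5) *\<^sub>R x - (1 / norm x0 ^ 5) *\<^sub>R x0) * norm x + 3 * norm x0 * norm (x - x0) / norm x0 ^ 5" for x
  have "isCont \<psi> x0" unfolding \<psi>_def using x0 by (intro continuous_intros) auto
  moreover have "\<psi> x0 < \<eta>" using \<eta> by (simp add: \<psi>_def)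
  ultimately have "\<forall>\<^sub>F x in nhds x0. \<psi> x < \<eta>"
    by (metis isCont_def tendsto_at_iff_tendsto_nhds order_tendstoD(2))
  then obtain d1 where d1: "d1 > 0" "\<And>x. norm (x - x0) < d1 \<Longrightarrow> \<psi> x < \<eta>"
    unfolding eventually_nhds_metric by (auto simp: dist_norm)
  define d where "d = min d1 (norm x0)"
  have d: "d > 0" using d1 x0 by (simp add: d_def)
  have nz: "x \<noteq> 0" if "norm (x - x0) < d" for x using that by (auto simp: d_def)
  show ?thesis
  proof (rule that[OF d _ nz])
    fix x x' assume xx: "norm (x - x0) < d" "norm (x' - x0) < d"
    have "norm (grav x - grav x' - dgrav x0 (x - x')) \<le> norm (x - x') * \<eta>"
    proof (rule differentiable_bound_linearization[where S = "ball x0 d" and f' = dgrav])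
      fix t :: real assume t: "t \<in> {0..1}"
      have eq: "x' + t *\<^sub>R (x - x') = (1 - t) *\<^sub>R x' + t *\<^sub>R x" by (simp add: algebra_simps)
      have "x \<in> ball x0 d" "x' \<in> ball x0 d" using xx by (simp_all add: dist_norm norm_minus_commute)
      then show "x' + t *\<^sub>R (x - x') \<in> ball x0 d"
        unfolding eq using t by (intro convexD[OF convex_ball]) auto
    next
      fix x assume "x \<in> ball x0 d"
      then have x: "norm (x - x0) < d" by (simp add: dist_norm norm_minus_commute)
      show "(grav has_derivative dgrav x) (at x within ball x0 d)"
        by (rule has_derivative_at_withinI[OF has_derivative_grav[OF nz[OF x]]])
      show "onorm (dgrav x - dgrav x0) \<le> \<eta>"
      proof (rule onorm_le)
        fix h :: "real^2"
        have "\<psi> x < \<eta>" using d1(2)[of x] x by (simp add: d_def)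
        then have "norm h * \<psi> x \<le> norm h * \<eta>" by (intro mult_left_mono) auto
        then show "norm ((dgrav x - dgrav x0) h) \<le> \<eta> * norm h"
          using norm_dgrav_diff_le[of x h x0] by (simp add: \<psi>_def mult.commute)
      qed
    qed (use d in auto)
    then show "norm (grav x - grav x' - dgrav x0 (x - x')) \<le> \<eta> * norm (x - x')" by (simp add: mult.commute)
  qed
qed

text \<open>The perturbation \<epsilon> \<open>Q s y\<close> changes the argument by a multiple of
  \<epsilon> uniformly in \<open>s\<close>. It therefore affects the value only to first order in
  \<epsilon>, and its share in the difference of two states is absorbed into \<eta>.\<close>

lemma asymptotically_linear_grav:
  fixes L :: "'a::euclidean_space \<Rightarrow> real^2" and Q :: "real \<Rightarrow> 'a \<Rightarrow> real^2"
  assumes L: "linear L" "L a \<noteq> 0" and Q: "\<And>s. linear (Q s)" "\<And>s y. norm (Q s y) \<le> KQ * norm y"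
      "\<And>s y. isCont (\<lambda>q. Q (fst q) (snd q)) (s, y)"
  shows "asymptotically_linear a (\<lambda>\<epsilon> s y. grav (L y + \<epsilon> *\<^sub>R Q s y)) (\<lambda>h. dgrav (L a) (L h)) (grav (L a))"
proof -
  let ?xo = "L a"
  obtain KL where KL: "KL > 0" "\<And>x. norm (L x) \<le> KL * norm x" using linear_bounded_pos[OF L(1)] by blast
  obtain Kd where Kd: "Kd > 0" "\<And>x. norm (dgrav ?xo x) \<le> Kd * norm x"
    using linear_bounded_pos[OF linear_dgrav] by blast
  define K where "K = max KQ 1"
  have K: "K \<ge> 1" "norm (Q s y) \<le> K * norm y" for s y
    using order_trans[OF Q(2) mult_right_mono[of KQ K "norm y"]] by (simp_all add: K_def)
  \<comment> \<open>Half of the radius \<open>d\<close> is left to the deviation of the state and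
    half to the perturbation of size \<epsilon>.\<close>
  have near: "norm (L y + \<epsilon> *\<^sub>R Q s y - ?xo) < d"
    if "0 < \<epsilon>" "\<epsilon> < d / (2 * K * (norm a + 1))" "norm (y - a) < min 1 (d / (2 * KL))" for \<epsilon> s y d
  proof -
    have "norm (L y - L a) \<le> KL * norm (y - a)" unfolding linear_diff[OF L(1), symmetric] by (rule KL)
    also have "\<dots> < KL * (d / (2 * KL))" using KL that by (intro mult_strict_left_mono) auto
    also have "\<dots> = d / 2" using KL by simp
    finally have 1: "norm (L y - L a) < d / 2" .
    have "norm y \<le> norm a + 1" using that(3) norm_triangle_sub[of y a] by simp
    then have "norm (Q s y) \<le> K * (norm a + 1)" using K by (intro order_trans[OF K(2)] mult_left_mono) auto
    then have "\<epsilon> * norm (Q s y) \<le> \<epsilon> * (K * (norm a + 1))" using that by (intro mult_left_mono) auto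
    also have "\<dots> < d / (2 * K * (norm a + 1)) * (K * (norm a + 1))"
      using that K by (intro mult_strict_right_mono) (auto intro!: mult_pos_pos add_nonneg_pos)
    also have "\<dots> = d / 2"
    proof -
      have "K * (norm a + 1) \<noteq> 0" using K norm_ge_zero[of a] by (smt (verit) mult_eq_0_iff)
      then show ?thesis by (simp add: mult.assoc)
    qed
    finally have 2: "norm (\<epsilon> *\<^sub>R Q s y) < d / 2" using that by simp
    have "norm (L y + \<epsilon> *\<^sub>R Q s y - ?xo) \<le> norm (L y - L a) + norm (\<epsilon> *\<^sub>R Q s y)"
      using norm_triangle_ineq[of "L y - L a" "\<epsilon> *\<^sub>R Q s y"] by (simp add: algebra_simps)
    with 1 2 show ?thesis by linarith
  qed
  have pos: "d > 0 \<Longrightarrow> d / (2 * K * (norm a + 1)) > 0" "d > 0 \<Longrightarrow> min 1 (d / (2 * KL)) > 0" for d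
    using K KL by (auto intro!: divide_pos_pos mult_pos_pos add_nonneg_pos)
  obtain d1 where d1: "d1 > 0" "\<And>x x'. norm (x - ?xo) < d1 \<Longrightarrow> norm (x' - ?xo) < d1 \<Longrightarrow>
    norm (grav x - grav x' - dgrav ?xo (x - x')) \<le> 1 * norm (x - x')" "\<And>x. norm (x - ?xo) < d1 \<Longrightarrow> x \<noteq> 0"
    using grav_strict_derivative[OF L(2) zero_less_one] by blast
  show ?thesis
  proof (rule asymptotically_linearI[where C = "(1 + Kd) * (K * norm a)"])
    show "linear (\<lambda>h. dgrav ?xo (L h))"
      using linear_compose[OF L(1) linear_dgrav] by (simp add: o_def)
    show "\<forall>\<^sub>F \<epsilon> in at_right 0. \<forall>s. norm (grav (L a + \<epsilon> *\<^sub>R Q s a) - grav ?xo) \<le> (1 + Kd) * (K * norm a) * \<epsilon>"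
      using eventually_parameter_small'[OF pos(1)[OF d1(1)]]
    proof eventually_elim
      case (elim \<epsilon>)
      show ?case
      proof
        fix s
        let ?x = "L a + \<epsilon> *\<^sub>R Q s a"
        have "norm (?x - ?xo) < d1" using near[of \<epsilon> d1 a s] elim pos(2)[OF d1(1)] by simp
        then have "norm (grav ?x - grav ?xo - dgrav ?xo (?x - ?xo)) \<le> 1 * norm (?x - ?xo)"
          using d1 by (intro d1(2)) auto
        then have "norm (grav ?x - grav ?xo) \<le> (1 + Kd) * norm (?x - ?xo)"
          using norm_triangle_sub[of "grav ?x - grav ?xo" "dgrav ?xo (?x - ?xo)"] Kd(2)[of "?x - ?xo"]
          by (simp add: distrib_right)
        also have "norm (?x - ?xo) \<le> \<epsilon> * (K * norm a)" using elim K(2)[of s a] by simp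
        finally show "norm (grav ?x - grav ?xo) \<le> (1 + Kd) * (K * norm a) * \<epsilon>"
          using Kd by (simp add: mult_ac mult_left_mono)
      qed
    qed
    show "\<forall>\<^sub>F p in at_right 0 \<times>\<^sub>F nhds a. \<forall>s. isCont (\<lambda>q. grav (L (snd q) + fst p *\<^sub>R Q (fst q) (snd q))) (s, snd p)"
      using eventually_parameter_small[OF pos(1)[OF d1(1)], of "nhds a"]
        eventually_state_near(1)[OF pos(2)[OF d1(1)], of a "at_right 0"]
    proof eventually_elim
      case (elim p)
      show ?case
      proof
        fix s
        have nz: "L (snd p) + fst p *\<^sub>R Q s (snd p) \<noteq> 0"
          using d1(3) near[of "fst p" d1 "snd p" s] elim by blast
        have cL: "isCont (\<lambda>q. L (snd q)) (s, snd p)"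
          using L by (intro bounded_linear.isCont[of L]) (auto simp: linear_conv_bounded_linear)
        have 1: "isCont (\<lambda>q. L (snd q) + fst p *\<^sub>R Q (fst q) (snd q)) (s, snd p)"
          by (intro continuous_add cL continuous_scaleR continuous_const Q(3))
        have "isCont grav (L (snd p) + fst p *\<^sub>R Q s (snd p))"
          by (rule has_derivative_continuous[OF has_derivative_grav[OF nz]])
        then show "isCont (\<lambda>q. grav (L (snd q) + fst p *\<^sub>R Q (fst q) (snd q))) (s, snd p)"
          using isCont_o2[OF 1, of grav] by simp
      qed
    qed
    fix \<eta> :: real assume \<eta>: "\<eta> > 0"
    define e where "e = \<eta> / (2 * (KL + K))"
    have e: "e > 0" using \<eta> KL K by (simp add: e_def)
    obtain d where d: "d > 0" "\<And>x x'. norm (x - ?xo) < d \<Longrightarrow> norm (x' - ?xo) < d \<Longrightarrow>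
      norm (grav x - grav x' - dgrav ?xo (x - x')) \<le> e * norm (x - x')" "\<And>x. norm (x - ?xo) < d \<Longrightarrow> x \<noteq> 0"
      using grav_strict_derivative[OF L(2) e] by blast
    define e2 where "e2 = min 1 (\<eta> / (2 * (Kd * K)))"
    have e2: "e2 > 0" using \<eta> Kd K by (simp add: e2_def)
    show "\<forall>\<^sub>F p in at_right 0 \<times>\<^sub>F (nhds a \<times>\<^sub>F nhds a). \<forall>s.
        norm (grav (L (fst (snd p)) + fst p *\<^sub>R Q s (fst (snd p))) - grav (L (snd (snd p)) + fst p *\<^sub>R Q s (snd (snd p)))
          - dgrav ?xo (L (fst (snd p) - snd (snd p)))) \<le> \<eta> * norm (fst (snd p) - snd (snd p))"
      using eventually_parameter_small[OF pos(1)[OF d(1)], of "nhds a \<times>\<^sub>F nhds a"]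
        eventually_parameter_small[OF e2, of "nhds a \<times>\<^sub>F nhds a"]
        eventually_state_near(2)[OF pos(2)[OF d(1)], of a "at_right 0"]
    proof eventually_elim
      case (elim p)
      show ?case
      proof
        fix s
        obtain \<epsilon> y y' where p: "p = (\<epsilon>, y, y')" by (cases p) auto
        let ?x = "L y + \<epsilon> *\<^sub>R Q s y" and ?x' = "L y' + \<epsilon> *\<^sub>R Q s y'" and ?n = "norm (y - y')"
        have el: "0 < \<epsilon>" "\<epsilon> < e2" using elim by (auto simp: p)
        have xd: "?x - ?x' = L (y - y') + \<epsilon> *\<^sub>R Q s (y - y')"
          by (simp add: linear_diff[OF L(1)] linear_diff[OF Q(1)] algebra_simps)
        have Qn: "norm (\<epsilon> *\<^sub>R Q s (y - y')) \<le> \<epsilon> * (K * ?n)"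
          using el K(2)[of s "y - y'"] by (simp add: mult_left_mono)
        have "\<epsilon> * (K * ?n) \<le> 1 * (K * ?n)" using el K by (intro mult_right_mono) (auto simp: e2_def)
        then have xn: "norm (?x - ?x') \<le> (KL + K) * ?n"
          unfolding xd using Qn KL(2)[of "y - y'"]
          by (intro order_trans[OF norm_triangle_ineq]) (simp add: distrib_right)
        have "norm (?x - ?xo) < d" "norm (?x' - ?xo) < d"
          using near[of \<epsilon> d y s] near[of \<epsilon> d y' s] elim by (auto simp: p)
        then have "norm (grav ?x - grav ?x' - dgrav ?xo (?x - ?x')) \<le> e * norm (?x - ?x')" by (rule d(2))
        also have "\<dots> \<le> e * ((KL + K) * ?n)" using xn e by (intro mult_left_mono) auto
        also have "\<dots> = (e * (KL + K)) * ?n" by simp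
        also have "e * (KL + K) = \<eta> / 2"
        proof -
          have *: "\<eta> / (2 * S) * S = \<eta> / 2" if "S \<noteq> 0" for S :: real using that by simp
          have "KL + K \<noteq> 0" using KL K by simp
          from *[OF this] show ?thesis by (simp only: e_def)
        qed
        finally have 1: "norm (grav ?x - grav ?x' - dgrav ?xo (?x - ?x')) \<le> \<eta> / 2 * ?n" .
        have "norm (dgrav ?xo (\<epsilon> *\<^sub>R Q s (y - y'))) \<le> Kd * (\<epsilon> * (K * ?n))"
          using Qn Kd by (intro order_trans[OF Kd(2)] mult_left_mono) auto
        also have "\<dots> = (\<epsilon> * (Kd * K)) * ?n" by simp
        also have "\<dots> \<le> (e2 * (Kd * K)) * ?n" using el Kd K by (intro mult_right_mono) auto
        also have "\<dots> \<le> (\<eta> / (2 * (Kd * K)) * (Kd * K)) * ?n"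
          using Kd K by (intro mult_right_mono) (auto simp: e2_def)
        also have "\<eta> / (2 * (Kd * K)) * (Kd * K) = \<eta> / 2" using Kd K by simp
        finally have 2: "norm (dgrav ?xo (\<epsilon> *\<^sub>R Q s (y - y'))) \<le> \<eta> / 2 * ?n" .
        have "grav ?x - grav ?x' - dgrav ?xo (L (y - y')) =
            (grav ?x - grav ?x' - dgrav ?xo (?x - ?x')) + dgrav ?xo (\<epsilon> *\<^sub>R Q s (y - y'))"
          unfolding xd linear_add[OF linear_dgrav] by simp
        then have "norm (grav ?x - grav ?x' - dgrav ?xo (L (y - y'))) \<le> \<eta> / 2 * ?n + \<eta> / 2 * ?n"
          by (simp only:) (rule order_trans[OF norm_triangle_ineq add_mono[OF 1 2]])
        then show "norm (grav (L (fst (snd p)) + fst p *\<^sub>R Q s (fst (snd p))) - grav (L (snd (snd p)) + fst p *\<^sub>R Q s (snd (snd p)))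
          - dgrav ?xo (L (fst (snd p) - snd (snd p)))) \<le> \<eta> * norm (fst (snd p) - snd (snd p))"
          by (simp add: p)
      qed
    qed
  qed
qed

subsection \<open>The equations of motion in rotating coordinates\<close>

lemma isCont_rot:
  assumes "isCont f x" "isCont g x"
  shows "isCont (\<lambda>q. rot (f q) *v g q) x"
proof -
  have "isCont (\<lambda>q. J *v g q) x"
    by (rule bounded_linear.isCont[OF matrix_vector_mul_bounded_linear assms(2)])
  with assms show ?thesis unfolding rot_apply by (intro continuous_intros) auto
qed

text \<open>The second alternative is the diagonal term of a force sum, where \<open>L\<close> is
  identically zero and \<open>grav 0 = 0\<close>.\<close>

lemma asymptotically_linear_grav_difference:
  fixes L :: "'a::euclidean_space \<Rightarrow> real^2"
  assumes L: "linear L" "L a \<noteq> 0 \<or> (\<forall>y. L y = 0)"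
  shows "asymptotically_linear a (\<lambda>\<epsilon> s y. grav (L y)) (\<lambda>h. dgrav (L a) (L h)) (grav (L a))"
proof (cases "\<forall>y. L y = 0")
  case True
  then show ?thesis using asymptotically_linear_const[of a "0 :: real^2"] by simp
next
  case False
  then have "L a \<noteq> 0" using L(2) by blast
  with L(1) show ?thesis
    using asymptotically_linear_grav[of L a "\<lambda>_ _. 0" 0] by (simp add: linear_zero)
qed

text \<open>A state consists of the outer positions and velocities and of the cluster positions and
  velocities. The outer velocities are with respect to physical time \<open>t\<close>, those of the cluster with
  respect to \<open>s = \<nu> t\<close>: in this scaling the outer equations carry the factor \<open>1 / \<nu>\<close> and the cluster
  equations are of order one.\<close>

type_synonym ('n, 'k) state = "(((real^2)^'n) \<times> ((real^2)^'n)) \<times> (((real^2)^'k) \<times> ((real^2)^'k))"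

locale planar_cluster =
  fixes m1 :: "'k::finite \<Rightarrow> real" and mo :: "'n::finite \<Rightarrow> real" and c :: 'n
    and a0 :: "(real^2)^'n" and a1 :: "(real^2)^'k"
  assumes m1_pos: "m1 k > 0" and mo_pos: "j \<noteq> c \<Longrightarrow> mo j > 0"
    and cf0: "collision_free a0" and cf1: "collision_free a1"
    and cc0: "a0 $ j + accel (total_masses c m1 mo) a0 j = 0"
    and cc1: "a1 $ k + accel m1 a1 k = 0"
begin

abbreviation M :: "'n \<Rightarrow> real" where "M \<equiv> total_masses c m1 mo"

lemma M_c: "M c = (\<Sum>k\<in>UNIV. m1 k)" and M_other: "j \<noteq> c \<Longrightarrow> M j = mo j"
  by (simp_all add: total_masses_def)

lemma M_pos: "M j > 0"
  by (cases "j = c") (auto simp: M_c M_other mo_pos m1_pos intro!: sum_pos)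

lemma sum_M:
  fixes f :: "'n \<Rightarrow> real^2"
  shows "(\<Sum>j\<in>UNIV. M j *\<^sub>R f j) = (\<Sum>j\<in>- {c}. mo j *\<^sub>R f j) + (\<Sum>k\<in>UNIV. m1 k *\<^sub>R f c)"
proof -
  have "(\<Sum>j\<in>UNIV. M j *\<^sub>R f j) = M c *\<^sub>R f c + (\<Sum>j\<in>- {c}. M j *\<^sub>R f j)"
    by (subst sum.remove[of UNIV c]) (auto simp: Compl_eq_Diff_UNIV)
  also have "(\<Sum>j\<in>- {c}. M j *\<^sub>R f j) = (\<Sum>j\<in>- {c}. mo j *\<^sub>R f j)"
    by (rule sum.cong) (auto simp: M_other)
  finally show ?thesis unfolding M_c scaleR_left.sum by (simp only: add.commute)
qed

text \<open>All positions are taken in the frame rotating with frequency one. There the body \<open>k\<close> of the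
  cluster is at \<open>member\<close>; \<open>tidal\<close> is its acceleration due to the bodies outside the cluster.\<close>

definition member :: "real \<Rightarrow> real \<Rightarrow> ('n, 'k) state \<Rightarrow> 'k \<Rightarrow> real^2" where
  "member \<epsilon> s y k = fst (fst y) $ c + \<epsilon> *\<^sub>R (rot s *v (fst (snd y) $ k))"

definition tidal :: "real \<Rightarrow> real \<Rightarrow> ('n, 'k) state \<Rightarrow> 'k \<Rightarrow> real^2" where
  "tidal \<epsilon> s y k = - (\<Sum>j\<in>- {c}. mo j *\<^sub>R grav (member \<epsilon> s y k - fst (fst y) $ j))"

definition mean_tidal :: "real \<Rightarrow> real \<Rightarrow> ('n, 'k) state \<Rightarrow> real^2" where
  "mean_tidal \<epsilon> s y = (1 / M c) *\<^sub>R (\<Sum>k\<in>UNIV. m1 k *\<^sub>R tidal \<epsilon> s y k)"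

text \<open>At position \<open>c\<close> stands the acceleration of the center of mass of the
  cluster. With the masses \<open>total_masses\<close> these accelerations balance exactly, although
  the other bodies feel each member of the cluster separately.\<close>

definition outer :: "real \<Rightarrow> real \<Rightarrow> ('n, 'k) state \<Rightarrow> 'n \<Rightarrow> real^2" where
  "outer \<epsilon> s y j = (if j = c then mean_tidal \<epsilon> s y
     else - (\<Sum>i\<in>- {c}. mo i *\<^sub>R grav (fst (fst y) $ j - fst (fst y) $ i))
       - (\<Sum>k\<in>UNIV. m1 k *\<^sub>R grav (fst (fst y) $ j - member \<epsilon> s y k)))"

text \<open>This is \<open>\<omega> / \<nu>\<close> for \<open>\<omega> = \<epsilon> powr (-3/2)\<close> and \<open>\<nu> = \<omega> - 1\<close>; below, \<open>slowness\<close> is \<open>1 / \<nu>\<close>.\<close>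

definition stretch :: "real \<Rightarrow> real" where
  "stretch \<epsilon> = 1 / (1 - \<epsilon> powr (3/2))"

abbreviation center :: "('n, 'k) state" where
  "center \<equiv> ((a0, 0), (a1, 0))"

text \<open>The right-hand side of the equations of motion minus its linearisation at \<open>center\<close>. Subtracting
  \<open>mean_tidal\<close>, the acceleration of the center of mass of the cluster, keeps that center of mass at
  \<open>fst (fst y) $ c\<close>.\<close>

definition remainder :: "real \<Rightarrow> real \<Rightarrow> ('n, 'k) state \<Rightarrow> ('n, 'k) state" where
  "remainder \<epsilon> s y =
     ((0, \<chi> j. a0 $ j + outer \<epsilon> s y j - daccel M a0 (fst (fst y) - a0) j),
      (0, \<chi> k. (stretch \<epsilon>)\<^sup>2 *\<^sub>R (fst (snd y) $ k + accel m1 (fst (snd y)) k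
            + \<epsilon>\<^sup>2 *\<^sub>R (rot (- s) *v (tidal \<epsilon> s y k - mean_tidal \<epsilon> s y)))
          - (2 * stretch \<epsilon>) *\<^sub>R (J *v (snd (snd y) $ k))
          - ((fst (snd y) - a1) $ k + daccel m1 a1 (fst (snd y) - a1) k - 2 *\<^sub>R (J *v (snd (snd y) $ k)))))"

lemma linear_coords:
  "linear (\<lambda>y :: ('n, 'k) state. fst (fst y))" "linear (\<lambda>y :: ('n, 'k) state. fst (snd y))"
  "linear (\<lambda>y :: ('n, 'k) state. fst (fst y) $ i - fst (fst y) $ j)"
  "linear (\<lambda>y :: ('n, 'k) state. fst (snd y) $ k - fst (snd y) $ l)"
  "linear (\<lambda>y :: ('n, 'k) state. fst (snd y) $ k)"
  "linear (\<lambda>y :: ('n, 'k) state. J *v (snd (snd y) $ k))"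
  by (auto intro!: linearI simp: algebra_simps)

lemma linear_daccel: "linear (\<lambda>h. daccel \<mu> u h i)"
  by (rule linearI) (simp_all add: daccel_linear_right)

lemma linear_daccel_coords:
  "linear (\<lambda>y :: ('n, 'k) state. daccel M a0 (fst (fst y)) j)"
  "linear (\<lambda>y :: ('n, 'k) state. daccel m1 a1 (fst (snd y)) k)"
  using linear_compose[OF linear_coords(1) linear_daccel] linear_compose[OF linear_coords(2) linear_daccel]
  by (simp_all add: o_def)

lemma norm_fst_snd_nth_le: "norm (fst (snd y) $ k) \<le> norm (y :: ('n, 'k) state)"
  by (rule order_trans[OF Finite_Cartesian_Product.norm_nth_le order_trans[OF norm_fst_le_norm norm_snd_le_norm]])

lemma grav_member:
  assumes "j \<noteq> c"
  shows "asymptotically_linear center (\<lambda>\<epsilon> s y. grav (member \<epsilon> s y k - fst (fst y) $ j))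
      (\<lambda>h. dgrav (a0 $ c - a0 $ j) (fst (fst h) $ c - fst (fst h) $ j)) (grav (a0 $ c - a0 $ j))"
    and "asymptotically_linear center (\<lambda>\<epsilon> s y. grav (fst (fst y) $ j - member \<epsilon> s y k))
      (\<lambda>h. dgrav (a0 $ j - a0 $ c) (fst (fst h) $ j - fst (fst h) $ c)) (grav (a0 $ j - a0 $ c))"
proof -
  have nz: "a0 $ c - a0 $ j \<noteq> 0" "a0 $ j - a0 $ c \<noteq> 0" using cf0 assms by (auto simp: collision_free_def)
  have Q: "isCont (\<lambda>q :: real \<times> ('n, 'k) state. rot (fst q) *v (b *\<^sub>R fst (snd (snd q)) $ k)) (s, y)" for s y b
    by (intro isCont_rot continuous_intros)
  have lin: "linear (\<lambda>y :: ('n, 'k) state. rot s *v (b *\<^sub>R fst (snd y) $ k))" for s b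
    by (auto intro!: linearI simp: rot_plus rot_scaleR algebra_simps)
  have 1: "asymptotically_linear center
      (\<lambda>\<epsilon> s y. grav ((fst (fst y) $ c - fst (fst y) $ j) + \<epsilon> *\<^sub>R (rot s *v (1 *\<^sub>R fst (snd y) $ k))))
      (\<lambda>h. dgrav (fst (fst center) $ c - fst (fst center) $ j) (fst (fst h) $ c - fst (fst h) $ j))
      (grav (fst (fst center) $ c - fst (fst center) $ j))"
    by (rule asymptotically_linear_grav[where KQ = 1, OF linear_coords(3) _ lin _ Q])
      (use nz norm_fst_snd_nth_le in simp_all)
  have 2: "asymptotically_linear center
      (\<lambda>\<epsilon> s y. grav ((fst (fst y) $ j - fst (fst y) $ c) + \<epsilon> *\<^sub>R (rot s *v ((-1) *\<^sub>R fst (snd y) $ k))))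
      (\<lambda>h. dgrav (fst (fst center) $ j - fst (fst center) $ c) (fst (fst h) $ j - fst (fst h) $ c))
      (grav (fst (fst center) $ j - fst (fst center) $ c))"
    by (rule asymptotically_linear_grav[where KQ = 1, OF linear_coords(3) _ lin _ Q])
      (use nz norm_fst_snd_nth_le in simp_all)
  have e1: "(fst (fst y) $ c - fst (fst y) $ j) + \<epsilon> *\<^sub>R (rot s *v (1 *\<^sub>R fst (snd y) $ k)) = member \<epsilon> s y k - fst (fst y) $ j"
    and e2: "(fst (fst y) $ j - fst (fst y) $ c) + \<epsilon> *\<^sub>R (rot s *v ((-1) *\<^sub>R fst (snd y) $ k)) = fst (fst y) $ j - member \<epsilon> s y k"
    for \<epsilon> s and y :: "('n, 'k) state"
    by (simp_all add: member_def rot_minus)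
  show "asymptotically_linear center (\<lambda>\<epsilon> s y. grav (member \<epsilon> s y k - fst (fst y) $ j))
      (\<lambda>h. dgrav (a0 $ c - a0 $ j) (fst (fst h) $ c - fst (fst h) $ j)) (grav (a0 $ c - a0 $ j))"
    using 1 by (simp only: e1 fst_conv snd_conv)
  show "asymptotically_linear center (\<lambda>\<epsilon> s y. grav (fst (fst y) $ j - member \<epsilon> s y k))
      (\<lambda>h. dgrav (a0 $ j - a0 $ c) (fst (fst h) $ j - fst (fst h) $ c)) (grav (a0 $ j - a0 $ c))"
    using 2 by (simp only: e2 fst_conv snd_conv)
qed

text \<open>As \<epsilon> tends to 0 every member of the cluster sits at the position
  \<open>c\<close>, and its external force becomes that of the outer problem. The sum over all
  positions may be used in the limit because the term of \<open>c\<close> itself is zero.\<close>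

lemma tidal_asymptotics:
  "asymptotically_linear center (\<lambda>\<epsilon> s y. tidal \<epsilon> s y k) (\<lambda>h. daccel M a0 (fst (fst h)) c) (accel M a0 c)"
proof -
  have "asymptotically_linear center (\<lambda>\<epsilon> s y. - (\<Sum>j\<in>- {c}. mo j *\<^sub>R grav (member \<epsilon> s y k - fst (fst y) $ j)))
     (\<lambda>h. - (\<Sum>j\<in>- {c}. mo j *\<^sub>R dgrav (a0 $ c - a0 $ j) (fst (fst h) $ c - fst (fst h) $ j)))
     (- (\<Sum>j\<in>- {c}. mo j *\<^sub>R grav (a0 $ c - a0 $ j)))"
    by (rule asymptotically_linear_minus, rule asymptotically_linear_sum)
      (auto intro!: asymptotically_linear_scaleR grav_member)
  moreover have "- (\<Sum>j\<in>- {c}. mo j *\<^sub>R dgrav (a0 $ c - a0 $ j) (h $ c - h $ j)) = daccel M a0 h c" for h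
    unfolding daccel_def sum_M by simp
  moreover have "- (\<Sum>j\<in>- {c}. mo j *\<^sub>R grav (a0 $ c - a0 $ j)) = accel M a0 c"
    unfolding accel_def sum_M by simp
  ultimately show ?thesis by (simp add: tidal_def)
qed

lemma mean_tidal_asymptotics:
  "asymptotically_linear center mean_tidal (\<lambda>h. daccel M a0 (fst (fst h)) c) (accel M a0 c)"
proof -
  have "asymptotically_linear center (\<lambda>\<epsilon> s y. (1 / M c) *\<^sub>R (\<Sum>k\<in>UNIV. m1 k *\<^sub>R tidal \<epsilon> s y k))
     (\<lambda>h. (1 / M c) *\<^sub>R (\<Sum>k\<in>UNIV. m1 k *\<^sub>R daccel M a0 (fst (fst h)) c)) ((1 / M c) *\<^sub>R (\<Sum>k\<in>UNIV. m1 k *\<^sub>R accel M a0 c))"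
    by (rule asymptotically_linear_scaleR, rule asymptotically_linear_sum)
      (auto intro!: asymptotically_linear_scaleR tidal_asymptotics)
  moreover have "(1 / M c) *\<^sub>R (\<Sum>k\<in>UNIV. m1 k *\<^sub>R x) = x" for x :: "real^2"
    using M_pos[of c] by (simp add: scaleR_sum_left[symmetric] M_c)
  ultimately show ?thesis by (simp add: mean_tidal_def[abs_def])
qed

lemma outer_asymptotics:
  "asymptotically_linear center (\<lambda>\<epsilon> s y. outer \<epsilon> s y j) (\<lambda>h. daccel M a0 (fst (fst h)) j) (accel M a0 j)"
proof (cases "j = c")
  case True
  then show ?thesis using mean_tidal_asymptotics by (simp add: outer_def)
next
  case False
  have g: "asymptotically_linear center (\<lambda>\<epsilon> s y. grav (fst (fst y) $ j - fst (fst y) $ i))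
      (\<lambda>h. dgrav (a0 $ j - a0 $ i) (fst (fst h) $ j - fst (fst h) $ i)) (grav (a0 $ j - a0 $ i))" for i
    using asymptotically_linear_grav_difference[OF linear_coords(3)[of j i], of center] cf0
    by (cases "i = j") (auto simp: collision_free_def)
  have "asymptotically_linear center (\<lambda>\<epsilon> s y. - (\<Sum>i\<in>- {c}. mo i *\<^sub>R grav (fst (fst y) $ j - fst (fst y) $ i))
       - (\<Sum>k\<in>UNIV. m1 k *\<^sub>R grav (fst (fst y) $ j - member \<epsilon> s y k)))
     (\<lambda>h. - (\<Sum>i\<in>- {c}. mo i *\<^sub>R dgrav (a0 $ j - a0 $ i) (fst (fst h) $ j - fst (fst h) $ i))
        - (\<Sum>k\<in>UNIV. m1 k *\<^sub>R dgrav (a0 $ j - a0 $ c) (fst (fst h) $ j - fst (fst h) $ c)))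
     (- (\<Sum>i\<in>- {c}. mo i *\<^sub>R grav (a0 $ j - a0 $ i)) - (\<Sum>k\<in>UNIV. m1 k *\<^sub>R grav (a0 $ j - a0 $ c)))"
  proof (rule asymptotically_linear_diff)
    show "asymptotically_linear center (\<lambda>\<epsilon> s y. - (\<Sum>i\<in>- {c}. mo i *\<^sub>R grav (fst (fst y) $ j - fst (fst y) $ i)))
     (\<lambda>h. - (\<Sum>i\<in>- {c}. mo i *\<^sub>R dgrav (a0 $ j - a0 $ i) (fst (fst h) $ j - fst (fst h) $ i)))
     (- (\<Sum>i\<in>- {c}. mo i *\<^sub>R grav (a0 $ j - a0 $ i)))"
      by (rule asymptotically_linear_minus, rule asymptotically_linear_sum)
        (auto intro!: asymptotically_linear_scaleR g)
    show "asymptotically_linear center (\<lambda>\<epsilon> s y. \<Sum>k\<in>UNIV. m1 k *\<^sub>R grav (fst (fst y) $ j - member \<epsilon> s y k))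
     (\<lambda>h. \<Sum>k\<in>UNIV. m1 k *\<^sub>R dgrav (a0 $ j - a0 $ c) (fst (fst h) $ j - fst (fst h) $ c))
     (\<Sum>k\<in>UNIV. m1 k *\<^sub>R grav (a0 $ j - a0 $ c))"
      by (rule asymptotically_linear_sum) (auto intro!: asymptotically_linear_scaleR grav_member False)
  qed
  moreover have "- (\<Sum>i\<in>- {c}. mo i *\<^sub>R dgrav (a0 $ j - a0 $ i) (h $ j - h $ i))
        - (\<Sum>k\<in>UNIV. m1 k *\<^sub>R dgrav (a0 $ j - a0 $ c) (h $ j - h $ c)) = daccel M a0 h j" for h
    unfolding daccel_def sum_M by simp
  moreover have "- (\<Sum>i\<in>- {c}. mo i *\<^sub>R grav (a0 $ j - a0 $ i)) - (\<Sum>k\<in>UNIV. m1 k *\<^sub>R grav (a0 $ j - a0 $ c)) = accel M a0 j"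
    unfolding accel_def sum_M by simp
  ultimately show ?thesis using False by (simp add: outer_def)
qed

lemma accel_asymptotics:
  "asymptotically_linear center (\<lambda>\<epsilon> s y. accel m1 (fst (snd y)) k) (\<lambda>h. daccel m1 a1 (fst (snd h)) k) (accel m1 a1 k)"
proof -
  have g: "asymptotically_linear center (\<lambda>\<epsilon> s y. grav (fst (snd y) $ k - fst (snd y) $ i))
      (\<lambda>h. dgrav (a1 $ k - a1 $ i) (fst (snd h) $ k - fst (snd h) $ i)) (grav (a1 $ k - a1 $ i))" for i
    using asymptotically_linear_grav_difference[OF linear_coords(4)[of k i], of center] cf1
    by (cases "i = k") (auto simp: collision_free_def)
  show ?thesis unfolding accel_def daccel_def
    by (rule asymptotically_linear_minus, rule asymptotically_linear_sum)
      (auto intro!: asymptotically_linear_scaleR g)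
qed

lemma powr_three_halves:
  fixes \<epsilon> :: real
  assumes "0 < \<epsilon>" "\<epsilon> < 1"
  shows "0 < \<epsilon> powr (3/2)" "\<epsilon> powr (3/2) \<le> \<epsilon>"
proof -
  have "\<epsilon> powr (3/2) \<le> \<epsilon> powr 1" using assms by (intro powr_mono') auto
  then show "0 < \<epsilon> powr (3/2)" "\<epsilon> powr (3/2) \<le> \<epsilon>" using assms by simp_all
qed

lemma stretch_bounds:
  assumes "0 < \<epsilon>" "\<epsilon> < 1/2"
  shows "1 \<le> stretch \<epsilon>" "stretch \<epsilon> \<le> 2" "stretch \<epsilon> - 1 \<le> 2 * \<epsilon>"
proof -
  define d where "d = \<epsilon> powr (3/2)"
  have d: "0 < d" "d \<le> \<epsilon>" using powr_three_halves[of \<epsilon>] assms by (auto simp: d_def)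
  then have "d < 1/2" using assms by linarith
  then show b: "1 \<le> stretch \<epsilon>" "stretch \<epsilon> \<le> 2" using d by (simp_all add: stretch_def d_def[symmetric] field_simps)
  have "stretch \<epsilon> - 1 = d * stretch \<epsilon>" using \<open>d < 1/2\<close> by (simp add: stretch_def d_def[symmetric] field_simps)
  also have "\<dots> \<le> \<epsilon> * 2" using d b assms by (intro mult_mono) auto
  finally show "stretch \<epsilon> - 1 \<le> 2 * \<epsilon>" by simp
qed

text \<open>The coefficients of three perturbations of the cluster equation: of the deviation of its
  time scale from 1, of the tidal force, and of the change of the Coriolis term.\<close>

lemma stretch_factors:
  "\<forall>\<^sub>F \<epsilon> in at_right 0. \<bar>(stretch \<epsilon>)\<^sup>2 - 1\<bar> \<le> 6 * \<epsilon>"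
  "\<forall>\<^sub>F \<epsilon> in at_right 0. \<bar>(stretch \<epsilon>)\<^sup>2 * \<epsilon>\<^sup>2\<bar> \<le> 4 * \<epsilon>"
  "\<forall>\<^sub>F \<epsilon> in at_right 0. \<bar>2 * (stretch \<epsilon> - 1)\<bar> \<le> 4 * \<epsilon>"
proof -
  have ev: "\<forall>\<^sub>F \<epsilon> in at_right (0::real). 0 < \<epsilon> \<and> \<epsilon> < 1/2" by (rule eventually_parameter_small') simp
  show "\<forall>\<^sub>F \<epsilon> in at_right 0. \<bar>(stretch \<epsilon>)\<^sup>2 - 1\<bar> \<le> 6 * \<epsilon>"
    using ev
  proof eventually_elim
    case (elim \<epsilon>)
    note b = stretch_bounds[of \<epsilon>]
    have "(stretch \<epsilon>)\<^sup>2 - 1 = (stretch \<epsilon> - 1) * (stretch \<epsilon> + 1)" by (simp add: power2_eq_square algebra_simps)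
    moreover have "(stretch \<epsilon> - 1) * (stretch \<epsilon> + 1) \<le> (2 * \<epsilon>) * 3" using elim b by (intro mult_mono) auto
    moreover have "0 \<le> (stretch \<epsilon> - 1) * (stretch \<epsilon> + 1)" using elim b by (intro mult_nonneg_nonneg) auto
    ultimately show ?case by simp
  qed
  show "\<forall>\<^sub>F \<epsilon> in at_right 0. \<bar>(stretch \<epsilon>)\<^sup>2 * \<epsilon>\<^sup>2\<bar> \<le> 4 * \<epsilon>"
    using ev
  proof eventually_elim
    case (elim \<epsilon>)
    note b = stretch_bounds[of \<epsilon>]
    have "(stretch \<epsilon>)\<^sup>2 * \<epsilon>\<^sup>2 \<le> 2\<^sup>2 * (1 * \<epsilon>)"
      unfolding power2_eq_square[of \<epsilon>] using elim b by (intro mult_mono power_mono) auto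
    then show ?case by simp
  qed
  show "\<forall>\<^sub>F \<epsilon> in at_right 0. \<bar>2 * (stretch \<epsilon> - 1)\<bar> \<le> 4 * \<epsilon>"
    using ev
  proof eventually_elim
    case (elim \<epsilon>)
    then show ?case using stretch_bounds[of \<epsilon>] by simp
  qed
qed

text \<open>Derivative zero means an arbitrarily small Lipschitz constant near
  \<open>center\<close>, value zero a residual of order \<epsilon> there. These are the smallness
  conditions under which the averaging theorem applies.\<close>

lemma remainder_asymptotics: "asymptotically_linear center remainder (\<lambda>_. 0) 0"
proof -
  have r0: "asymptotically_linear center (\<lambda>\<epsilon> s y. a0 $ j + outer \<epsilon> s y j - daccel M a0 (fst (fst y) - a0) j) (\<lambda>_. 0) 0" for j
  proof -
    have "asymptotically_linear center (\<lambda>\<epsilon> s y. (a0 $ j + daccel M a0 a0 j) + (outer \<epsilon> s y j - daccel M a0 (fst (fst y)) j))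
       (\<lambda>h. 0 + (daccel M a0 (fst (fst h)) j - daccel M a0 (fst (fst h)) j))
       ((a0 $ j + daccel M a0 a0 j) + (accel M a0 j - daccel M a0 (fst (fst center)) j))"
      by (intro asymptotically_linear_add asymptotically_linear_const asymptotically_linear_diff
          outer_asymptotics asymptotically_linear_linear linear_daccel_coords)
    moreover have "daccel M a0 (u - a0) j = daccel M a0 u j - daccel M a0 a0 j" for u
      by (rule linear_diff[OF linear_daccel])
    ultimately have A: "asymptotically_linear center (\<lambda>\<epsilon> s y. (a0 $ j + daccel M a0 a0 j) + (outer \<epsilon> s y j - daccel M a0 (fst (fst y)) j))
       (\<lambda>h. 0) ((a0 $ j + daccel M a0 a0 j) + (accel M a0 j - daccel M a0 (fst (fst center)) j))"
      by (simp only: diff_self add_0_left)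
    have "(a0 $ j + daccel M a0 a0 j) + (outer \<epsilon> s y j - daccel M a0 (fst (fst y)) j) =
        a0 $ j + outer \<epsilon> s y j - daccel M a0 (fst (fst y) - a0) j" for \<epsilon> s y
      by (simp add: linear_diff[OF linear_daccel])
    moreover have "(a0 $ j + daccel M a0 a0 j) + (accel M a0 j - daccel M a0 (fst (fst center)) j) = 0"
      using cc0[of j] by simp
    ultimately show ?thesis using A by (simp only:)
  qed
  have r1: "asymptotically_linear center (\<lambda>\<epsilon> s y. (stretch \<epsilon>)\<^sup>2 *\<^sub>R (fst (snd y) $ k + accel m1 (fst (snd y)) k
            + \<epsilon>\<^sup>2 *\<^sub>R (rot (- s) *v (tidal \<epsilon> s y k - mean_tidal \<epsilon> s y)))
          - (2 * stretch \<epsilon>) *\<^sub>R (J *v (snd (snd y) $ k))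
          - ((fst (snd y) - a1) $ k + daccel m1 a1 (fst (snd y) - a1) k - 2 *\<^sub>R (J *v (snd (snd y) $ k)))) (\<lambda>_. 0) 0" for k
  proof -
    \<comment> \<open>The cluster component is split into the nonlinearity at \<epsilon> = 0 minus
      its linearisation, which is \<open>w - L\<close> up to a constant, and three terms with
      vanishing factors. The value at \<open>center\<close> is 0 by the equation of central
      configurations.\<close>
    define w where "w \<epsilon> s y = fst (snd y) $ k + accel m1 (fst (snd y)) k" for \<epsilon> s :: real and y :: "('n, 'k) state"
    have w: "asymptotically_linear center w (\<lambda>h. fst (snd h) $ k + daccel m1 a1 (fst (snd h)) k)
        (fst (snd center) $ k + accel m1 a1 k)"
      unfolding w_def
      by (rule asymptotically_linear_add[OF asymptotically_linear_linear[OF linear_coords(5)] accel_asymptotics])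
    define z where "z \<epsilon> s y = tidal \<epsilon> s y k - mean_tidal \<epsilon> s y" for \<epsilon> s and y :: "('n, 'k) state"
    have z: "asymptotically_linear center z (\<lambda>h. daccel M a0 (fst (fst h)) c - daccel M a0 (fst (fst h)) c) (accel M a0 c - accel M a0 c)"
      unfolding z_def by (rule asymptotically_linear_diff[OF tidal_asymptotics mean_tidal_asymptotics])
    define L where "L y = fst (snd y) $ k + daccel m1 a1 (fst (snd y)) k" for y :: "('n, 'k) state"
    have L: "linear L" unfolding L_def by (rule linear_compose_add[OF linear_coords(5) linear_daccel_coords(2)])
    have P1: "asymptotically_linear center (\<lambda>\<epsilon> s y. (w \<epsilon> s y - L y) + (a1 $ k + daccel m1 a1 a1 k)) (\<lambda>h. (L h - L h) + 0)
        ((fst (snd center) $ k + accel m1 a1 k) - L center + (a1 $ k + daccel m1 a1 a1 k))"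
      by (rule asymptotically_linear_add[OF asymptotically_linear_diff[OF w[folded L_def] asymptotically_linear_linear[OF L]] asymptotically_linear_const])
    have P2: "asymptotically_linear center (\<lambda>\<epsilon> s y. ((stretch \<epsilon>)\<^sup>2 - 1) *\<^sub>R w \<epsilon> s y) (\<lambda>_. 0) 0"
      by (rule asymptotically_linear_vanishing_scaleR[OF w stretch_factors(1)])
    have P3: "asymptotically_linear center (\<lambda>\<epsilon> s y. ((stretch \<epsilon>)\<^sup>2 * \<epsilon>\<^sup>2) *\<^sub>R (rot (- s) *v z \<epsilon> s y)) (\<lambda>_. 0) 0"
      by (rule asymptotically_linear_vanishing_factor[OF z stretch_factors(2), of "\<lambda>s x. rot (- s) *v x"])
        (intro isCont_rot continuous_intros | simp add: rot_diff)+
    have P4: "asymptotically_linear center (\<lambda>\<epsilon> s y. (2 * (stretch \<epsilon> - 1)) *\<^sub>R (J *v (snd (snd y) $ k))) (\<lambda>_. 0) 0"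
      by (rule asymptotically_linear_vanishing_scaleR[OF asymptotically_linear_linear[OF linear_coords(6)] stretch_factors(3)])
    have "asymptotically_linear center (\<lambda>\<epsilon> s y. ((w \<epsilon> s y - L y) + (a1 $ k + daccel m1 a1 a1 k))
        + ((stretch \<epsilon>)\<^sup>2 - 1) *\<^sub>R w \<epsilon> s y + ((stretch \<epsilon>)\<^sup>2 * \<epsilon>\<^sup>2) *\<^sub>R (rot (- s) *v z \<epsilon> s y) - (2 * (stretch \<epsilon> - 1)) *\<^sub>R (J *v (snd (snd y) $ k)))
      (\<lambda>h. (L h - L h) + 0 + 0 + 0 - 0) (((fst (snd center) $ k + accel m1 a1 k) - L center + (a1 $ k + daccel m1 a1 a1 k)) + 0 + 0 - 0)"
      by (rule asymptotically_linear_diff[OF asymptotically_linear_add[OF asymptotically_linear_add[OF P1 P2] P3] P4])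
    moreover have "((w \<epsilon> s y - L y) + (a1 $ k + daccel m1 a1 a1 k))
        + ((stretch \<epsilon>)\<^sup>2 - 1) *\<^sub>R w \<epsilon> s y + ((stretch \<epsilon>)\<^sup>2 * \<epsilon>\<^sup>2) *\<^sub>R (rot (- s) *v z \<epsilon> s y) - (2 * (stretch \<epsilon> - 1)) *\<^sub>R (J *v (snd (snd y) $ k)) =
        (stretch \<epsilon>)\<^sup>2 *\<^sub>R (fst (snd y) $ k + accel m1 (fst (snd y)) k
            + \<epsilon>\<^sup>2 *\<^sub>R (rot (- s) *v (tidal \<epsilon> s y k - mean_tidal \<epsilon> s y)))
          - (2 * stretch \<epsilon>) *\<^sub>R (J *v (snd (snd y) $ k))
          - ((fst (snd y) - a1) $ k + daccel m1 a1 (fst (snd y) - a1) k - 2 *\<^sub>R (J *v (snd (snd y) $ k)))"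
      for \<epsilon> s and y :: "('n, 'k) state"
    proof -
      have "daccel m1 a1 (fst (snd y) - a1) k = daccel m1 a1 (fst (snd y)) k - daccel m1 a1 a1 k"
        by (rule linear_diff[OF linear_daccel])
      then show ?thesis
        by (simp add: L_def z_def[symmetric] w_def[of \<epsilon> s y, symmetric] scaleR_diff_left scaleR_diff_right scaleR_add_right)
    qed
    moreover have "((fst (snd center) $ k + accel m1 a1 k) - L center + (a1 $ k + daccel m1 a1 a1 k)) + 0 + 0 - 0 = 0"
      using cc1[of k] by (simp add: L_def)
    ultimately show ?thesis by (simp only: diff_self add_0_left)
  qed
  have p0: "linear (\<lambda>v :: (real^2)^'n. ((0, v), 0) :: ('n, 'k) state)"
    and p1: "linear (\<lambda>v :: (real^2)^'k. (0, (0, v)) :: ('n, 'k) state)"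
    by (auto intro!: linearI simp: zero_prod_def)
  define f0 where "f0 \<epsilon> s y = (\<chi> j. a0 $ j + outer \<epsilon> s y j - daccel M a0 (fst (fst y) - a0) j)"
    for \<epsilon> s and y :: "('n, 'k) state"
  define f1 where "f1 \<epsilon> s y = (\<chi> k. (stretch \<epsilon>)\<^sup>2 *\<^sub>R (fst (snd y) $ k + accel m1 (fst (snd y)) k
            + \<epsilon>\<^sup>2 *\<^sub>R (rot (- s) *v (tidal \<epsilon> s y k - mean_tidal \<epsilon> s y)))
          - (2 * stretch \<epsilon>) *\<^sub>R (J *v (snd (snd y) $ k))
          - ((fst (snd y) - a1) $ k + daccel m1 a1 (fst (snd y) - a1) k - 2 *\<^sub>R (J *v (snd (snd y) $ k))))"
    for \<epsilon> s and y :: "('n, 'k) state"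
  have "asymptotically_linear center f0 (\<lambda>h. \<chi> j. 0) (\<chi> j. 0)"
    unfolding f0_def by (rule asymptotically_linear_vec) (rule r0)
  from asymptotically_linear_linear_image[OF this p0]
  have A: "asymptotically_linear center (\<lambda>\<epsilon> s y. ((0, f0 \<epsilon> s y), 0) :: ('n, 'k) state)
    (\<lambda>h. ((0, \<chi> j. 0), 0)) ((0, \<chi> j. 0), 0)" .
  have "asymptotically_linear center f1 (\<lambda>h. \<chi> k. 0) (\<chi> k. 0)"
    unfolding f1_def by (rule asymptotically_linear_vec) (rule r1)
  from asymptotically_linear_linear_image[OF this p1]
  have B: "asymptotically_linear center (\<lambda>\<epsilon> s y. (0, (0, f1 \<epsilon> s y)) :: ('n, 'k) state)
    (\<lambda>h. (0, (0, \<chi> k. 0))) (0, (0, \<chi> k. 0))" .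
  have "remainder = (\<lambda>\<epsilon> s y. ((0, f0 \<epsilon> s y), 0) + (0, (0, f1 \<epsilon> s y)))"
    by (simp add: remainder_def f0_def f1_def fun_eq_iff)
  moreover have "(\<chi> j. 0) = (0 :: (real^2)^'n)" "(\<chi> j. 0) = (0 :: (real^2)^'k)" by (simp_all add: vec_eq_iff)
  ultimately show ?thesis using asymptotically_linear_add[OF A B] by (simp add: zero_prod_def[symmetric])
qed

end

subsection \<open>Solutions up to multipliers\<close>

lemma dgrav_rot: "dgrav (rot t *v x) (rot t *v h) = rot t *v dgrav x h"
  by (simp add: dgrav_def rot_diff rot_scaleR)

text \<open>Converts product filters into a single radius that serves for the parameter and for both
  states.\<close>

lemma eventually_extract_radius:
  assumes "\<forall>\<^sub>F p in at_right (0::real) \<times>\<^sub>F (nhds (a :: 'a::real_normed_vector) \<times>\<^sub>F nhds a). P p"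
  shows "\<exists>\<rho>>0. \<forall>\<epsilon> y y'. 0 < \<epsilon> \<longrightarrow> \<epsilon> < \<rho> \<longrightarrow> norm (y - a) < \<rho> \<longrightarrow> norm (y' - a) < \<rho> \<longrightarrow> P (\<epsilon>, y, y')"
proof -
  obtain Pf Pg where Pf: "eventually Pf (at_right 0)" and Pg: "eventually Pg (nhds a \<times>\<^sub>F nhds a)"
    and P: "\<And>x y. Pf x \<Longrightarrow> Pg y \<Longrightarrow> P (x, y)"
    using assms unfolding eventually_prod_filter[of _ "at_right 0"] by blast
  obtain Qf Qg where Q: "eventually Qf (nhds a)" "eventually Qg (nhds a)" "\<And>x y. Qf x \<Longrightarrow> Qg y \<Longrightarrow> Pg (x, y)"
    using Pg unfolding eventually_prod_filter by blast
  obtain b where b: "b > 0" "\<And>x. 0 < x \<Longrightarrow> x < b \<Longrightarrow> Pf x"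
    using Pf unfolding eventually_at_right_field by auto
  obtain d1 d2 where d: "d1 > 0" "\<And>y. norm (y - a) < d1 \<Longrightarrow> Qf y" "d2 > 0" "\<And>y. norm (y - a) < d2 \<Longrightarrow> Qg y"
    using Q(1,2) unfolding eventually_nhds_metric dist_norm by blast
  show ?thesis
    by (rule exI[of _ "min b (min d1 d2)"]) (use b d P Q(3) in auto)
qed

lemma eventually_extract_radius':
  assumes "\<forall>\<^sub>F p in at_right (0::real) \<times>\<^sub>F nhds (a :: 'a::real_normed_vector). P p"
  shows "\<exists>\<rho>>0. \<forall>\<epsilon> y. 0 < \<epsilon> \<longrightarrow> \<epsilon> < \<rho> \<longrightarrow> norm (y - a) < \<rho> \<longrightarrow> P (\<epsilon>, y)"
proof -
  obtain Pf Qf where Pf: "eventually Pf (at_right 0)" and Q: "eventually Qf (nhds a)"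
    and P: "\<And>x y. Pf x \<Longrightarrow> Qf y \<Longrightarrow> P (x, y)"
    using assms unfolding eventually_prod_filter by blast
  obtain b where b: "b > 0" "\<And>x. 0 < x \<Longrightarrow> x < b \<Longrightarrow> Pf x"
    using Pf unfolding eventually_at_right_field by auto
  obtain d where d: "d > 0" "\<And>y. norm (y - a) < d \<Longrightarrow> Qf y"
    using Q unfolding eventually_nhds_metric dist_norm by blast
  show ?thesis
    by (rule exI[of _ "min b d"]) (use b d P in auto)
qed

text \<open>The first-order form of \<open>u'' = u + daccel \<mu> a u - 2 J u'\<close>, the
  linearisation at an equilibrium of the equations in a frame rotating with frequency one. It is
  used for the outer bodies in the time \<open>t\<close> and for the cluster in the time
  \<open>s\<close>.\<close>

definition linearised_flow :: "('k::finite \<Rightarrow> real) \<Rightarrow> (real^2)^'k \<Rightarrow> ((real^2)^'k) \<times> ((real^2)^'k) \<Rightarrow> ((real^2)^'k) \<times> ((real^2)^'k)" where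
  "linearised_flow \<mu> a z = (snd z, \<chi> i. fst z $ i + daccel \<mu> a (fst z) i - 2 *\<^sub>R (J *v (snd z $ i)))"

lemma bounded_linear_linearised_flow: "bounded_linear (linearised_flow \<mu> a)"
  unfolding linear_conv_bounded_linear[symmetric]
  by (rule linearI) (simp_all add: linearised_flow_def vec_eq_iff daccel_linear_right algebra_simps)

text \<open>From here on \<open>'a\<close> indexes the cluster and \<open>'b\<close> the outer
  positions.\<close>

locale symmetric_cluster = planar_cluster +
  fixes m :: nat and \<theta> :: real and \<sigma> :: "'b \<Rightarrow> 'b"
  assumes m: "m \<ge> 2" and \<theta>: "\<theta> = 2 * pi / real m"
    and card_k: "CARD('a) \<ge> 2" and card_n: "CARD('b) \<ge> 2"
    and \<sigma>: "bij \<sigma>" "(\<sigma> ^^ m) = id" "\<sigma> c = c" "\<And>j. j \<noteq> c \<Longrightarrow> mo (\<sigma> j) = mo j"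
    and a0_sym: "\<And>j. a0 $ (\<sigma> j) = rot \<theta> *v (a0 $ j)"
    and nd0: "nondegenerate_cc (total_masses c m1 mo) a0" and nd1: "periodic_nondegenerate_cc m m1 a1"
begin

text \<open>The prescribed symmetry as a linear map of configurations: a path satisfies
  \<open>u0 (s + \<theta>) = symm (u0 s)\<close> if and only if the component \<open>j\<close> at
  time \<open>s\<close> is the component \<open>\<sigma> j\<close> at time
  \<open>s + \<theta>\<close> turned back by \<theta>.\<close>

definition symm :: "(real^2)^'b \<Rightarrow> (real^2)^'b" where
  "symm u = (\<chi> i. rot \<theta> *v (u $ inv \<sigma> i))"

lemma symm_\<sigma> [simp]: "symm u $ (\<sigma> j) = rot \<theta> *v (u $ j)"
  using \<sigma>(1) by (simp add: symm_def bij_is_inj)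

lemma vec_eq_\<sigma>I: "(\<And>j. u $ (\<sigma> j) = v $ (\<sigma> j)) \<Longrightarrow> u = v"
  using \<sigma>(1) by (metis bij_pointE vec_eq_iff)

lemma symm_c: "symm u $ c = rot \<theta> *v (u $ c)"
  using symm_\<sigma>[of u c] \<sigma>(3) by simp

lemma linear_symm: "linear symm"
  by (rule linearI) (simp_all add: symm_def vec_eq_iff rot_plus rot_scaleR)

lemma symm_a0: "symm a0 = a0"
  by (rule vec_eq_\<sigma>I) (simp add: a0_sym)

lemma symm_J: "symm (J_all u) = J_all (symm u)"
  by (rule vec_eq_\<sigma>I) (simp add: rot_J)

lemma \<sigma>_ne_c: "\<sigma> j = c \<longleftrightarrow> j = c"
  using \<sigma> by (metis bij_pointE)

lemma M_\<sigma>: "M (\<sigma> j) = M j"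
  using \<sigma> \<sigma>_ne_c[of j] by (cases "j = c") (auto simp: M_other)

lemma sum_\<sigma>: "(\<Sum>j\<in>UNIV. f (\<sigma> j)) = (\<Sum>j\<in>UNIV. f j)"
  by (rule sum.reindex_bij_betw[OF \<sigma>(1)])

lemma sum_\<sigma>': "(\<Sum>j\<in>- {c}. f (\<sigma> j)) = (\<Sum>j\<in>- {c}. f j)"
proof (rule sum.reindex_bij_betw)
  show "bij_betw \<sigma> (- {c}) (- {c})"
    unfolding bij_betw_def
  proof
    show "inj_on \<sigma> (- {c})" using \<sigma>(1) by (meson bij_is_inj inj_on_subset subset_UNIV)
    show "\<sigma> ` (- {c}) = - {c}"
      using bij_image_Compl_eq[OF \<sigma>(1), of "{c}"] \<sigma>(3) by simp
  qed
qed

lemma symm_funpow: "(symm ^^ n) u $ ((\<sigma> ^^ n) j) = rot (real n * \<theta>) *v (u $ j)"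
proof (induction n)
  case (Suc n)
  have "real (Suc n) * \<theta> = \<theta> + real n * \<theta>" by (simp add: algebra_simps)
  then show ?case by (simp add: Suc rot_add)
qed simp

lemma symm_m: "(symm ^^ m) u = u"
proof -
  have "real m * \<theta> = 2 * pi" using m by (simp add: \<theta>)
  then have "(symm ^^ m) u $ j = u $ j" for j
    using symm_funpow[of m u j] by (simp add: \<sigma>(2) rot_two_pi)
  then show ?thesis by (simp add: vec_eq_iff)
qed

lemma daccel_symm: "daccel M a0 (symm h) (\<sigma> j) = rot \<theta> *v daccel M a0 h j"
proof -
  have "daccel M a0 (symm h) (\<sigma> j) = - (\<Sum>i\<in>UNIV. M (\<sigma> i) *\<^sub>R dgrav (a0 $ \<sigma> j - a0 $ \<sigma> i) (symm h $ \<sigma> j - symm h $ \<sigma> i))"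
    unfolding daccel_def by (subst sum_\<sigma>[symmetric]) (rule refl)
  also have "\<dots> = - (\<Sum>i\<in>UNIV. M i *\<^sub>R (rot \<theta> *v dgrav (a0 $ j - a0 $ i) (h $ j - h $ i)))"
    by (simp add: M_\<sigma> a0_sym rot_diff[symmetric] dgrav_rot)
  finally show ?thesis by (simp add: daccel_def rot_minus rot_sum rot_scaleR)
qed

text \<open>The cluster coordinates stay untouched because their placement already contains
  \<open>rot s\<close>: the time shift by \<theta> turns the whole cluster by \<theta>, as the
  symmetry demands. Thus the members only have to be \<theta>-periodic in their own frame.\<close>

definition act :: "('b, 'a) state \<Rightarrow> ('b, 'a) state" where
  "act y = ((symm (fst (fst y)), symm (snd (fst y))), snd y)"

lemma member_act: "member \<epsilon> (s + \<theta>) (act y) k = rot \<theta> *v member \<epsilon> s y k"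
  using rot_add[of \<theta> s "fst (snd y) $ k"]
  by (simp add: member_def act_def symm_c rot_plus rot_scaleR add.commute)

lemma tidal_act: "tidal \<epsilon> (s + \<theta>) (act y) k = rot \<theta> *v tidal \<epsilon> s y k"
proof -
  have "tidal \<epsilon> (s + \<theta>) (act y) k = - (\<Sum>j\<in>- {c}. mo (\<sigma> j) *\<^sub>R grav (rot \<theta> *v member \<epsilon> s y k - fst (fst (act y)) $ \<sigma> j))"
    unfolding tidal_def member_act by (subst sum_\<sigma>'[symmetric]) (rule refl)
  also have "\<dots> = - (\<Sum>j\<in>- {c}. mo j *\<^sub>R (rot \<theta> *v grav (member \<epsilon> s y k - fst (fst y) $ j)))"
    by (intro arg_cong[where f = uminus] sum.cong) (auto simp: \<sigma> act_def rot_diff[symmetric] grav_rot)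
  finally show ?thesis by (simp add: tidal_def rot_minus rot_sum rot_scaleR)
qed

lemma mean_tidal_act: "mean_tidal \<epsilon> (s + \<theta>) (act y) = rot \<theta> *v mean_tidal \<epsilon> s y"
  by (simp add: mean_tidal_def tidal_act rot_sum rot_scaleR)

lemma outer_act: "outer \<epsilon> (s + \<theta>) (act y) (\<sigma> j) = rot \<theta> *v outer \<epsilon> s y j"
proof (cases "j = c")
  case True
  then show ?thesis using \<sigma>(3) by (simp add: outer_def mean_tidal_act)
next
  case False
  have "(\<Sum>i\<in>- {c}. mo i *\<^sub>R grav (fst (fst (act y)) $ \<sigma> j - fst (fst (act y)) $ i)) =
      (\<Sum>i\<in>- {c}. mo (\<sigma> i) *\<^sub>R grav (fst (fst (act y)) $ \<sigma> j - fst (fst (act y)) $ \<sigma> i))"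
    by (subst sum_\<sigma>'[symmetric]) (rule refl)
  also have "\<dots> = (\<Sum>i\<in>- {c}. mo i *\<^sub>R (rot \<theta> *v grav (fst (fst y) $ j - fst (fst y) $ i)))"
    by (intro sum.cong) (auto simp: \<sigma> act_def rot_diff[symmetric] grav_rot)
  finally have "(\<Sum>i\<in>- {c}. mo i *\<^sub>R grav (fst (fst (act y)) $ \<sigma> j - fst (fst (act y)) $ i)) =
      rot \<theta> *v (\<Sum>i\<in>- {c}. mo i *\<^sub>R grav (fst (fst y) $ j - fst (fst y) $ i))"
    by (simp add: rot_sum rot_scaleR)
  moreover have "(\<Sum>k\<in>UNIV. m1 k *\<^sub>R grav (fst (fst (act y)) $ \<sigma> j - member \<epsilon> (s + \<theta>) (act y) k)) =
      rot \<theta> *v (\<Sum>k\<in>UNIV. m1 k *\<^sub>R grav (fst (fst y) $ j - member \<epsilon> s y k))"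
    unfolding member_act by (simp add: act_def rot_diff[symmetric] grav_rot rot_sum rot_scaleR)
  ultimately show ?thesis using False \<sigma>_ne_c[of j] by (simp add: outer_def rot_diff rot_minus)
qed

lemma remainder_act: "remainder \<epsilon> (s + \<theta>) (act y) = act (remainder \<epsilon> s y)"
proof -
  have "(\<chi> j. a0 $ j + outer \<epsilon> (s + \<theta>) (act y) j - daccel M a0 (symm (fst (fst y)) - a0) j) =
      symm (\<chi> j. a0 $ j + outer \<epsilon> s y j - daccel M a0 (fst (fst y) - a0) j)"
  proof (rule vec_eq_\<sigma>I)
    fix j
    have "symm (fst (fst y)) - a0 = symm (fst (fst y) - a0)"
      by (simp add: linear_diff[OF linear_symm] symm_a0)
    then show "(\<chi> j. a0 $ j + outer \<epsilon> (s + \<theta>) (act y) j - daccel M a0 (symm (fst (fst y)) - a0) j) $ \<sigma> j =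
      symm (\<chi> j. a0 $ j + outer \<epsilon> s y j - daccel M a0 (fst (fst y) - a0) j) $ \<sigma> j"
      by (simp add: outer_act daccel_symm a0_sym rot_plus rot_diff)
  qed
  moreover have "rot (- s - \<theta>) *v (tidal \<epsilon> (s + \<theta>) (act y) k - mean_tidal \<epsilon> (s + \<theta>) (act y)) =
      rot (- s) *v (tidal \<epsilon> s y k - mean_tidal \<epsilon> s y)" for k
    unfolding tidal_act mean_tidal_act rot_diff[symmetric] rot_add[symmetric] by simp
  ultimately show ?thesis
    by (simp add: remainder_def act_def linear_0[OF linear_symm])
qed

definition slowness :: "real \<Rightarrow> real" where
  "slowness \<epsilon> = \<epsilon> powr (3/2) * stretch \<epsilon>"

text \<open>The rotations make both linearisations degenerate; the multipliers \<open>l0\<close> and \<open>l1\<close> fill up the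
  missing directions of the ranges, and the linear functionals fix the phases.\<close>

lemma projected_solutions:
  "\<exists>C \<epsilon>1. \<epsilon>1 > 0 \<and> (\<forall>\<epsilon>. 0 < \<epsilon> \<longrightarrow> \<epsilon> < \<epsilon>1 \<longrightarrow> (\<exists>u0 p0 u1 p1 l0 l1.
    (\<forall>s. norm (u0 s - a0) \<le> C * \<epsilon> \<and> norm (p0 s) \<le> C * \<epsilon> \<and> norm (u1 s - a1) \<le> C * \<epsilon> \<and> norm (p1 s) \<le> C * \<epsilon>) \<and>
    (\<forall>s. u0 (s + \<theta>) = symm (u0 s) \<and> p0 (s + \<theta>) = symm (p0 s) \<and> u1 (s + \<theta>) = u1 s \<and> p1 (s + \<theta>) = p1 s) \<and>
    (\<forall>s. (u0 has_vector_derivative slowness \<epsilon> *\<^sub>R p0 s) (at s)) \<and>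
    (\<forall>s. (p0 has_vector_derivative slowness \<epsilon> *\<^sub>R (\<chi> j. u0 s $ j + outer \<epsilon> s ((u0 s, p0 s), (u1 s, p1 s)) j
         - 2 *\<^sub>R (J *v (p0 s $ j)) + l0 *\<^sub>R (J *v (a0 $ j)))) (at s)) \<and>
    (\<forall>s. (u1 has_vector_derivative p1 s) (at s)) \<and>
    (\<forall>s. (p1 has_vector_derivative (\<chi> k. (stretch \<epsilon>)\<^sup>2 *\<^sub>R (u1 s $ k + accel m1 (u1 s) k
            + \<epsilon>\<^sup>2 *\<^sub>R (rot (- s) *v (tidal \<epsilon> s ((u0 s, p0 s), (u1 s, p1 s)) k - mean_tidal \<epsilon> s ((u0 s, p0 s), (u1 s, p1 s)))))
          - (2 * stretch \<epsilon>) *\<^sub>R (J *v (p1 s $ k)) + l1 *\<^sub>R (J *v (a1 $ k)))) (at s))))"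
proof -
  define A0 where "A0 = Blinfun (linearised_flow M a0)"
  define A1 where "A1 = Blinfun (linearised_flow m1 a1)"
  have A0: "blinfun_apply A0 = linearised_flow M a0" and A1: "blinfun_apply A1 = linearised_flow m1 a1"
    unfolding A0_def A1_def by (rule bounded_linear_Blinfun_apply[OF bounded_linear_linearised_flow])+
  define g where "g z = (symm (fst z), symm (snd z))" for z :: "((real^2)^'b) \<times> ((real^2)^'b)"
  \<comment> \<open>The mass inner product with the infinitesimal rotation \<open>J_all a0\<close>.
    It is invariant under the symmetry because rotations commute with \<open>J\<close> and the
    masses are preserved by \<sigma>.\<close>
  define lf0 where "lf0 z = fst z \<bullet> mass_weight M (J_all a0)" for z :: "((real^2)^'b) \<times> ((real^2)^'b)"
  define lf1 where "lf1 z = fst z \<bullet> mass_weight m1 (J_all a1)" for z :: "((real^2)^'a) \<times> ((real^2)^'a)"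
  let ?e0 = "(0, J_all a0)" and ?e1 = "(0, J_all a1)"
  note AL = remainder_asymptotics
  have \<theta>0: "\<theta> > 0" using m by (simp add: \<theta>)
  have "\<exists>C \<epsilon>1. \<epsilon>1 > 0 \<and> (\<forall>\<epsilon>. 0 < \<epsilon> \<longrightarrow> \<epsilon> < \<epsilon>1 \<longrightarrow> (\<exists>y l0 l1.
    (\<forall>s. norm (y s - center) \<le> C * \<epsilon>) \<and> (\<forall>s. y (s + \<theta>) = (g (fst (y s)), snd (y s))) \<and>
    (\<forall>s. ((\<lambda>s. fst (y s)) has_vector_derivative
       slowness \<epsilon> *\<^sub>R (A0 (fst (y s) - (a0, 0)) + fst (remainder \<epsilon> s (y s)) + l0 *\<^sub>R ?e0)) (at s)) \<and>
    (\<forall>s. ((\<lambda>s. snd (y s)) has_vector_derivative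
       A1 (snd (y s) - (a1, 0)) + snd (remainder \<epsilon> s (y s)) + l1 *\<^sub>R ?e1) (at s))))"
  proof (rule averaging_periodic_solutions[where g = g and lfa = lf0 and lfb = lf1 and m = m])
    show "\<theta> > 0" by (rule \<theta>0)
    show "m > 0" using m by simp
    show "linear g"
      by (rule linearI) (simp_all add: g_def linear_add[OF linear_symm] linear_scale[OF linear_symm])
    have "(g ^^ n) z = ((symm ^^ n) (fst z), (symm ^^ n) (snd z))" for n z
      by (induction n) (simp_all add: g_def)
    then show "(g ^^ m) = id" by (auto simp: symm_m)
    show "g (a0, 0) = (a0, 0)" by (simp add: g_def symm_a0 linear_0[OF linear_symm])
    show "g ?e0 = ?e0" by (simp add: g_def symm_J symm_a0 linear_0[OF linear_symm])
    show "lf0 (g x) = lf0 x" for x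
    proof -
      have "lf0 (g x) = (\<Sum>i\<in>UNIV. M (\<sigma> i) * (symm (fst x) $ \<sigma> i \<bullet> J_all a0 $ \<sigma> i))"
        unfolding lf0_def g_def inner_mass_weight fst_conv
        by (subst sum_\<sigma>[symmetric]) (rule refl)
      also have "\<dots> = lf0 x"
        by (simp add: lf0_def inner_mass_weight M_\<sigma> a0_sym rot_J[symmetric])
      finally show ?thesis .
    qed
    show "blinfun_apply A0 (g x) = g (blinfun_apply A0 x)" for x
    proof -
      have "(\<chi> i. symm (fst x) $ i + daccel M a0 (symm (fst x)) i - 2 *\<^sub>R (J *v (symm (snd x) $ i))) =
          symm (\<chi> i. fst x $ i + daccel M a0 (fst x) i - 2 *\<^sub>R (J *v (snd x $ i)))"
        by (rule vec_eq_\<sigma>I) (simp add: daccel_symm rot_plus rot_diff rot_scaleR rot_J)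
      then show ?thesis by (simp add: A0 linearised_flow_def g_def)
    qed
    show "linear lf0" "linear lf1"
      unfolding lf0_def lf1_def by (rule linearI; simp add: inner_add_left)+
    show "x = 0 \<and> l = 0" if "blinfun_apply A0 x + l *\<^sub>R ?e0 = 0" "lf0 x = 0" for x and l :: real
    proof -
      \<comment> \<open>For a constant solution the velocity vanishes, the Coriolis term disappears,
        and what remains is the bordered Hessian of the amended potential.\<close>
      have x: "snd x = 0" "(\<chi> i. fst x $ i + daccel M a0 (fst x) i - 2 *\<^sub>R (J *v (snd x $ i))) + l *\<^sub>R J_all a0 = 0"
        using arg_cong[OF that(1), of fst] arg_cong[OF that(1), of snd]
        by (simp_all only: A0 linearised_flow_def fst_add snd_add fst_conv snd_conv fst_scaleR snd_scaleR
            fst_zero snd_zero scaleR_zero_right add_0_right)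
      have "fst x = 0 \<and> l = 0"
      proof (rule nondegenerate_cc_kernel[of M a0, OF M_pos card_n nd0])
        show "fst x $ i + daccel M a0 (fst x) i + l *\<^sub>R (J *v (a0 $ i)) = 0" for i
          using arg_cong[OF x(2), of "\<lambda>v. v $ i"] x(1) by simp
        show "(\<Sum>i\<in>UNIV. M i * (fst x $ i \<bullet> (J *v (a0 $ i)))) = 0"
          using that(2) by (simp add: lf0_def inner_mass_weight)
      qed
      with x show ?thesis by (simp add: prod_eq_iff)
    qed
    show "l = 0 \<and> (\<forall>s. z s = 0)"
      if z: "\<And>s. (z has_vector_derivative blinfun_apply A1 (z s) + l *\<^sub>R ?e1) (at s)"
        "\<And>s. z (s + \<theta>) = z s" "lf1 (z 0) = 0" for z and l :: real
    proof -
      have "l = 0 \<and> (\<forall>s. fst (z s) = 0 \<and> snd (z s) = 0)"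
      proof (rule periodic_nondegenerate_kernel[of m1 m a1, OF m1_pos card_k m nd1])
        show "((\<lambda>s. fst (z s)) has_vector_derivative snd (z s)) (at s)" for s
          using bounded_linear.has_vector_derivative[OF bounded_linear_fst z(1)[of s]]
          by (simp add: A1 linearised_flow_def)
        have eq: "snd (blinfun_apply A1 (z s) + l *\<^sub>R ?e1) =
            (\<chi> i. fst (z s) $ i + daccel m1 a1 (fst (z s)) i - 2 *\<^sub>R (J *v (snd (z s) $ i)) + l *\<^sub>R (J *v (a1 $ i)))" for s
          by (simp add: A1 linearised_flow_def vec_eq_iff)
        show "((\<lambda>s. snd (z s)) has_vector_derivative (\<chi> i. fst (z s) $ i + daccel m1 a1 (fst (z s)) i
            - 2 *\<^sub>R (J *v (snd (z s) $ i)) + l *\<^sub>R (J *v (a1 $ i)))) (at s)" for s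
          using bounded_linear.has_vector_derivative[OF bounded_linear_snd z(1)[of s]] unfolding eq .
        show "fst (z (s + 2 * pi / real m)) = fst (z s)" "snd (z (s + 2 * pi / real m)) = snd (z s)" for s
          using z(2)[of s] by (simp_all add: \<theta>)
        show "(\<Sum>i\<in>UNIV. m1 i * (fst (z 0) $ i \<bullet> (J *v (a1 $ i)))) = 0"
          using z(3) by (simp add: lf1_def inner_mass_weight)
      qed
      then show ?thesis by (simp add: prod_eq_iff)
    qed
    obtain \<rho> where \<rho>: "\<rho> > 0" "\<And>\<epsilon> y s. 0 < \<epsilon> \<Longrightarrow> \<epsilon> < \<rho> \<Longrightarrow> norm (y - center) < \<rho> \<Longrightarrow>
        isCont (\<lambda>q. remainder \<epsilon> (fst q) (snd q)) (s, y)"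
      using eventually_extract_radius'[OF asymptotically_linearD(4)[OF AL]] by auto
    have "continuous_on UNIV (\<lambda>s. remainder \<epsilon> s (y s))"
      if "0 < \<epsilon>" "\<epsilon> < \<rho>" and y: "continuous_on UNIV y" "\<forall>s. norm (y s - center) < \<rho>" for \<epsilon> y
      unfolding continuous_on_eq_continuous_at[OF open_UNIV]
    proof
      fix s :: real
      have "isCont y s" using y(1) by (simp add: continuous_on_eq_continuous_at)
      then have "isCont (\<lambda>s. (s, y s)) s" by (intro continuous_intros)
      from isCont_o2[OF this, of "\<lambda>q. remainder \<epsilon> (fst q) (snd q)"] \<rho>(2)[OF that(1,2) y(2)[rule_format, of s]]
      show "isCont (\<lambda>s. remainder \<epsilon> s (y s)) s" by simp
    qed
    then show "\<exists>\<rho>>0. \<forall>\<epsilon> y. 0 < \<epsilon> \<longrightarrow> \<epsilon> < \<rho> \<longrightarrow> continuous_on UNIV y \<longrightarrow>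
      (\<forall>s. norm (y s - ((a0, 0), a1, 0)) < \<rho>) \<longrightarrow> continuous_on UNIV (\<lambda>s. remainder \<epsilon> s (y s))"
      using \<rho>(1) by blast
    show "\<exists>\<rho>>0. \<forall>\<epsilon> s y y'. 0 < \<epsilon> \<longrightarrow> \<epsilon> < \<rho> \<longrightarrow> norm (y - ((a0, 0), a1, 0)) < \<rho> \<longrightarrow>
      norm (y' - ((a0, 0), a1, 0)) < \<rho> \<longrightarrow> norm (remainder \<epsilon> s y - remainder \<epsilon> s y') \<le> \<eta> * norm (y - y')"
      if "\<eta> > 0" for \<eta>
      using eventually_extract_radius[OF asymptotically_linearD(2)[OF AL that]]
      unfolding fst_conv snd_conv diff_zero by blast
    obtain C where C: "\<forall>\<^sub>F \<epsilon> in at_right 0. \<forall>s. norm (remainder \<epsilon> s center - 0) \<le> C * \<epsilon>"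
      using asymptotically_linearD(3)[OF AL] by blast
    then show "\<exists>C \<rho>. \<rho> > 0 \<and> (\<forall>\<epsilon> s. 0 < \<epsilon> \<longrightarrow> \<epsilon> < \<rho> \<longrightarrow> norm (remainder \<epsilon> s ((a0, 0), a1, 0)) \<le> C * \<epsilon>)"
      unfolding eventually_at_right_field by auto
    show "remainder \<epsilon> (s + \<theta>) (g (fst y), snd y) = (g (fst (remainder \<epsilon> s y)), snd (remainder \<epsilon> s y))" for \<epsilon> s y
      using remainder_act[of \<epsilon> s y] by (simp add: act_def g_def)
    show "\<exists>\<rho>>0. \<forall>\<epsilon>. 0 < \<epsilon> \<longrightarrow> \<epsilon> < \<rho> \<longrightarrow> \<bar>slowness \<epsilon>\<bar> \<le> \<eta>" if "\<eta> > 0" for \<eta>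
    proof (intro exI[of _ "min (1/2) (\<eta> / 2)"] conjI allI impI)
      fix \<epsilon> :: real assume \<epsilon>: "0 < \<epsilon>" "\<epsilon> < min (1/2) (\<eta> / 2)"
      have "\<epsilon> powr (3/2) * stretch \<epsilon> \<le> \<epsilon> * 2"
        using powr_three_halves[of \<epsilon>] stretch_bounds[of \<epsilon>] \<epsilon> by (intro mult_mono) auto
      moreover have "0 \<le> \<epsilon> powr (3/2) * stretch \<epsilon>"
        using stretch_bounds[of \<epsilon>] \<epsilon> by (intro mult_nonneg_nonneg) auto
      ultimately show "\<bar>slowness \<epsilon>\<bar> \<le> \<eta>" using \<epsilon> by (simp add: slowness_def)
    qed (use that in simp)
  qed
  then obtain C \<epsilon>1 where \<epsilon>1: "\<epsilon>1 > 0" and sol: "\<And>\<epsilon>. 0 < \<epsilon> \<Longrightarrow> \<epsilon> < \<epsilon>1 \<Longrightarrow> (\<exists>y l0 l1.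
    (\<forall>s. norm (y s - center) \<le> C * \<epsilon>) \<and> (\<forall>s. y (s + \<theta>) = (g (fst (y s)), snd (y s))) \<and>
    (\<forall>s. ((\<lambda>s. fst (y s)) has_vector_derivative
       slowness \<epsilon> *\<^sub>R (A0 (fst (y s) - (a0, 0)) + fst (remainder \<epsilon> s (y s)) + l0 *\<^sub>R ?e0)) (at s)) \<and>
    (\<forall>s. ((\<lambda>s. snd (y s)) has_vector_derivative
       A1 (snd (y s) - (a1, 0)) + snd (remainder \<epsilon> s (y s)) + l1 *\<^sub>R ?e1) (at s)))"
    by blast
  show ?thesis
  proof (rule exI[of _ C], rule exI[of _ \<epsilon>1], intro conjI \<epsilon>1 allI impI)
    fix \<epsilon> :: real assume "0 < \<epsilon>" "\<epsilon> < \<epsilon>1"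
    from sol[OF this] obtain y l0 l1 where y: "\<And>s. norm (y s - center) \<le> C * \<epsilon>"
      "\<And>s. y (s + \<theta>) = (g (fst (y s)), snd (y s))"
      and d0: "\<And>s. ((\<lambda>s. fst (y s)) has_vector_derivative
       slowness \<epsilon> *\<^sub>R (A0 (fst (y s) - (a0, 0)) + fst (remainder \<epsilon> s (y s)) + l0 *\<^sub>R ?e0)) (at s)"
      and d1: "\<And>s. ((\<lambda>s. snd (y s)) has_vector_derivative
       A1 (snd (y s) - (a1, 0)) + snd (remainder \<epsilon> s (y s)) + l1 *\<^sub>R ?e1) (at s)"
      by blast
    define u0 p0 u1 p1 where "u0 s = fst (fst (y s))" and "p0 s = snd (fst (y s))"
      and "u1 s = fst (snd (y s))" and "p1 s = snd (snd (y s))" for s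
    have ys: "y s = ((u0 s, p0 s), (u1 s, p1 s))" for s by (simp add: u0_def p0_def u1_def p1_def)
    have bnd: "norm (u0 s - a0) \<le> C * \<epsilon> \<and> norm (p0 s) \<le> C * \<epsilon> \<and> norm (u1 s - a1) \<le> C * \<epsilon> \<and> norm (p1 s) \<le> C * \<epsilon>" for s
    proof -
      have "norm (((u0 s - a0, p0 s), (u1 s - a1, p1 s))) \<le> C * \<epsilon>" using y(1)[of s] by (simp add: ys)
      then have 1: "norm (u0 s - a0, p0 s) \<le> C * \<epsilon>" "norm (u1 s - a1, p1 s) \<le> C * \<epsilon>"
        by (meson norm_fst_le norm_snd_le order_trans)+
      show ?thesis
        using order_trans[OF norm_fst_le 1(1)] order_trans[OF norm_snd_le 1(1)]
          order_trans[OF norm_fst_le 1(2)] order_trans[OF norm_snd_le 1(2)] by blast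
    qed
    have sym: "u0 (s + \<theta>) = symm (u0 s) \<and> p0 (s + \<theta>) = symm (p0 s) \<and> u1 (s + \<theta>) = u1 s \<and> p1 (s + \<theta>) = p1 s" for s
      using y(2)[of s] by (simp add: ys g_def)
    have f0: "A0 (fst (y s) - (a0, 0)) + fst (remainder \<epsilon> s (y s)) + l0 *\<^sub>R ?e0 =
        (p0 s, \<chi> j. u0 s $ j + outer \<epsilon> s ((u0 s, p0 s), (u1 s, p1 s)) j
         - 2 *\<^sub>R (J *v (p0 s $ j)) + l0 *\<^sub>R (J *v (a0 $ j)))" for s
      by (simp add: A0 linearised_flow_def remainder_def ys vec_eq_iff)
    have f1: "A1 (snd (y s) - (a1, 0)) + snd (remainder \<epsilon> s (y s)) + l1 *\<^sub>R ?e1 =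
        (p1 s, \<chi> k. (stretch \<epsilon>)\<^sup>2 *\<^sub>R (u1 s $ k + accel m1 (u1 s) k
            + \<epsilon>\<^sup>2 *\<^sub>R (rot (- s) *v (tidal \<epsilon> s ((u0 s, p0 s), (u1 s, p1 s)) k - mean_tidal \<epsilon> s ((u0 s, p0 s), (u1 s, p1 s)))))
          - (2 * stretch \<epsilon>) *\<^sub>R (J *v (p1 s $ k)) + l1 *\<^sub>R (J *v (a1 $ k)))" for s
      by (simp add: A1 linearised_flow_def remainder_def ys vec_eq_iff)
    show "\<exists>u0 p0 u1 p1 l0 l1.
    (\<forall>s. norm (u0 s - a0) \<le> C * \<epsilon> \<and> norm (p0 s) \<le> C * \<epsilon> \<and> norm (u1 s - a1) \<le> C * \<epsilon> \<and> norm (p1 s) \<le> C * \<epsilon>) \<and>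
    (\<forall>s. u0 (s + \<theta>) = symm (u0 s) \<and> p0 (s + \<theta>) = symm (p0 s) \<and> u1 (s + \<theta>) = u1 s \<and> p1 (s + \<theta>) = p1 s) \<and>
    (\<forall>s. (u0 has_vector_derivative slowness \<epsilon> *\<^sub>R p0 s) (at s)) \<and>
    (\<forall>s. (p0 has_vector_derivative slowness \<epsilon> *\<^sub>R (\<chi> j. u0 s $ j + outer \<epsilon> s ((u0 s, p0 s), (u1 s, p1 s)) j
         - 2 *\<^sub>R (J *v (p0 s $ j)) + l0 *\<^sub>R (J *v (a0 $ j)))) (at s)) \<and>
    (\<forall>s. (u1 has_vector_derivative p1 s) (at s)) \<and>
    (\<forall>s. (p1 has_vector_derivative (\<chi> k. (stretch \<epsilon>)\<^sup>2 *\<^sub>R (u1 s $ k + accel m1 (u1 s) k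
            + \<epsilon>\<^sup>2 *\<^sub>R (rot (- s) *v (tidal \<epsilon> s ((u0 s, p0 s), (u1 s, p1 s)) k - mean_tidal \<epsilon> s ((u0 s, p0 s), (u1 s, p1 s)))))
          - (2 * stretch \<epsilon>) *\<^sub>R (J *v (p1 s $ k)) + l1 *\<^sub>R (J *v (a1 $ k)))) (at s))"
    proof (rule exI[of _ u0], rule exI[of _ p0], rule exI[of _ u1], rule exI[of _ p1],
        rule exI[of _ l0], rule exI[of _ l1], intro conjI allI)
      fix s
      show "(u0 has_vector_derivative slowness \<epsilon> *\<^sub>R p0 s) (at s)"
        using bounded_linear.has_vector_derivative[OF bounded_linear_fst d0[of s, unfolded f0]]
        by (simp add: u0_def[abs_def])
      show "(p0 has_vector_derivative slowness \<epsilon> *\<^sub>R (\<chi> j. u0 s $ j + outer \<epsilon> s ((u0 s, p0 s), (u1 s, p1 s)) j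
         - 2 *\<^sub>R (J *v (p0 s $ j)) + l0 *\<^sub>R (J *v (a0 $ j)))) (at s)"
        using bounded_linear.has_vector_derivative[OF bounded_linear_snd d0[of s, unfolded f0]]
        unfolding p0_def[abs_def, symmetric] by simp
      show "(u1 has_vector_derivative p1 s) (at s)"
        using bounded_linear.has_vector_derivative[OF bounded_linear_fst d1[of s, unfolded f1]]
        by (simp add: u1_def[abs_def])
      show "(p1 has_vector_derivative (\<chi> k. (stretch \<epsilon>)\<^sup>2 *\<^sub>R (u1 s $ k + accel m1 (u1 s) k
            + \<epsilon>\<^sup>2 *\<^sub>R (rot (- s) *v (tidal \<epsilon> s ((u0 s, p0 s), (u1 s, p1 s)) k - mean_tidal \<epsilon> s ((u0 s, p0 s), (u1 s, p1 s)))))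
          - (2 * stretch \<epsilon>) *\<^sub>R (J *v (p1 s $ k)) + l1 *\<^sub>R (J *v (a1 $ k)))) (at s)"
        using bounded_linear.has_vector_derivative[OF bounded_linear_snd d1[of s, unfolded f1]]
        unfolding p1_def[abs_def, symmetric] by simp
    qed (use bnd sym in auto)
  qed
qed

end

subsection \<open>Energy and angular momentum\<close>

text \<open>Each force acts along the line joining its two bodies, so the torques cancel in
  pairs.\<close>

lemma accel_torque: "(\<Sum>i\<in>UNIV. \<mu> i * (accel \<mu> u i \<bullet> (J *v (u $ i)))) = 0"
proof -
  have "(\<Sum>i\<in>UNIV. \<Sum>j\<in>UNIV. ((\<mu> i * \<mu> j) *\<^sub>R grav (u $ i - u $ j)) \<bullet> (J *v (u $ i) - J *v (u $ j))) =
      2 * (\<Sum>i\<in>UNIV. (\<Sum>j\<in>UNIV. (\<mu> i * \<mu> j) *\<^sub>R grav (u $ i - u $ j)) \<bullet> (J *v (u $ i)))"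
  proof (rule antisymmetric_pairing)
    fix i j
    show "(\<mu> i * \<mu> j) *\<^sub>R grav (u $ i - u $ j) = - ((\<mu> j * \<mu> i) *\<^sub>R grav (u $ j - u $ i))"
      unfolding grav_commute[of "u $ i" "u $ j"] by (simp add: mult.commute)
  qed
  moreover have "grav (u $ i - u $ j) \<bullet> (J *v (u $ i) - J *v (u $ j)) = 0" for i j
    unfolding matrix_vector_mult_diff_distrib[symmetric] by (simp add: grav_def)
  moreover have "(\<Sum>j\<in>UNIV. (\<mu> i * \<mu> j) *\<^sub>R grav (u $ i - u $ j)) \<bullet> (J *v (u $ i)) = - (\<mu> i * (accel \<mu> u i \<bullet> (J *v (u $ i))))" for i
    by (simp add: accel_def inner_sum_left sum_distrib_left inner_minus_left mult.assoc)
  ultimately show ?thesis by (simp add: sum_negf)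
qed

definition angular_momentum :: "('k::finite \<Rightarrow> real) \<Rightarrow> (real^2)^'k \<Rightarrow> (real^2)^'k \<Rightarrow> real" where
  "angular_momentum \<mu> w v = (\<Sum>i\<in>UNIV. \<mu> i * ((J *v (w $ i)) \<bullet> v $ i))"

definition energy :: "('k::finite \<Rightarrow> real) \<Rightarrow> (real^2)^'k \<Rightarrow> (real^2)^'k \<Rightarrow> real" where
  "energy \<mu> w v = 1/2 * (\<Sum>i\<in>UNIV. \<mu> i * (v $ i \<bullet> v $ i)) - newton_U \<mu> w"

text \<open>The equation of motion enters multiplied by the mass, so that a label of mass zero need
  not satisfy any. \<open>X\<close> is an external force per unit mass; only its torque is
  left.\<close>

lemma angular_momentum_balance:
  fixes w v :: "real \<Rightarrow> (real^2)^'k::finite"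
  assumes w: "(w has_vector_derivative v t) (at t)" and v: "(v has_vector_derivative A) (at t)"
    and A: "\<And>i. \<mu> i *\<^sub>R A $ i = \<mu> i *\<^sub>R (accel \<mu> (w t) i + X i)"
  shows "((\<lambda>t. angular_momentum \<mu> (w t) (v t)) has_real_derivative
    (\<Sum>i\<in>UNIV. \<mu> i * ((J *v (w t $ i)) \<bullet> X i))) (at t)"
proof -
  have "((\<lambda>t. (J *v (w t $ i)) \<bullet> v t $ i) has_real_derivative (J *v (w t $ i)) \<bullet> A $ i + (J *v (v t $ i)) \<bullet> v t $ i) (at t)" for i
    unfolding has_real_derivative_iff_has_vector_derivative
    by (rule bounded_bilinear.has_vector_derivative[OF bounded_bilinear_inner])
      (intro J_has_vector_derivative bounded_linear.has_vector_derivative[OF bounded_linear_vec_nth] w v)+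
  then have "((\<lambda>t. (J *v (w t $ i)) \<bullet> v t $ i) has_real_derivative (J *v (w t $ i)) \<bullet> A $ i) (at t)" for i by simp
  then have "((\<lambda>t. angular_momentum \<mu> (w t) (v t)) has_real_derivative (\<Sum>i\<in>UNIV. \<mu> i * ((J *v (w t $ i)) \<bullet> A $ i))) (at t)"
    unfolding angular_momentum_def by (intro DERIV_sum DERIV_cmult)
  moreover have "\<mu> i * ((J *v (w t $ i)) \<bullet> A $ i) = \<mu> i * (accel \<mu> (w t) i \<bullet> (J *v (w t $ i))) + \<mu> i * ((J *v (w t $ i)) \<bullet> X i)" for i
    using arg_cong[OF A[of i], of "\<lambda>x. (J *v (w t $ i)) \<bullet> x"]
    by (simp add: inner_add_right distrib_left inner_commute)
  ultimately show ?thesis by (simp add: sum.distrib accel_torque)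
qed

lemma energy_balance:
  fixes w v :: "real \<Rightarrow> (real^2)^'k::finite"
  assumes w: "(w has_vector_derivative v t) (at t)" and v: "(v has_vector_derivative A) (at t)"
    and cf: "\<And>i j. i \<noteq> j \<Longrightarrow> \<mu> i * \<mu> j \<noteq> 0 \<Longrightarrow> w t $ i \<noteq> w t $ j"
    and A: "\<And>i. \<mu> i *\<^sub>R A $ i = \<mu> i *\<^sub>R (accel \<mu> (w t) i + X i)"
  shows "((\<lambda>t. energy \<mu> (w t) (v t)) has_real_derivative (\<Sum>i\<in>UNIV. \<mu> i * (v t $ i \<bullet> X i))) (at t)"
proof -
  have "((\<lambda>t. v t $ i \<bullet> v t $ i) has_real_derivative v t $ i \<bullet> A $ i + A $ i \<bullet> v t $ i) (at t)" for i
    unfolding has_real_derivative_iff_has_vector_derivative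
    by (rule bounded_bilinear.has_vector_derivative[OF bounded_bilinear_inner])
      (intro bounded_linear.has_vector_derivative[OF bounded_linear_vec_nth] v)+
  then have "((\<lambda>t. 1/2 * (\<Sum>i\<in>UNIV. \<mu> i * (v t $ i \<bullet> v t $ i))) has_real_derivative
      1/2 * (\<Sum>i\<in>UNIV. \<mu> i * (v t $ i \<bullet> A $ i + A $ i \<bullet> v t $ i))) (at t)"
    by (intro DERIV_sum DERIV_cmult)
  from DERIV_diff[OF this newton_U_derivative_weighted[OF w cf, of \<mu>]]
  have "((\<lambda>t. energy \<mu> (w t) (v t)) has_real_derivative
      1/2 * (\<Sum>i\<in>UNIV. \<mu> i * (v t $ i \<bullet> A $ i + A $ i \<bullet> v t $ i)) - (\<Sum>i\<in>UNIV. \<mu> i * (accel \<mu> (w t) i \<bullet> v t $ i))) (at t)"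
    unfolding energy_def by simp
  moreover have "\<mu> i * (v t $ i \<bullet> A $ i + A $ i \<bullet> v t $ i) = 2 * (\<mu> i * (accel \<mu> (w t) i \<bullet> v t $ i) + \<mu> i * (v t $ i \<bullet> X i))" for i
    using arg_cong[OF A[of i], of "\<lambda>x. v t $ i \<bullet> x"]
    by (simp add: inner_add_right distrib_left inner_commute)
  ultimately show ?thesis by (simp add: sum.distrib sum_distrib_left[symmetric] add_divide_distrib)
qed

lemma angular_momentum_rot:
  assumes "\<And>i. w' $ i = rot \<phi> *v (w $ i)" "\<And>i. v' $ i = rot \<phi> *v (v $ i)"
  shows "angular_momentum \<mu> w' v' = angular_momentum \<mu> w v"
  using assms by (simp add: angular_momentum_def rot_J[symmetric])

lemma energy_rot:
  assumes "\<And>i. w' $ i = rot \<phi> *v (w $ i)" "\<And>i. v' $ i = rot \<phi> *v (v $ i)"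
  shows "energy \<mu> w' v' = energy \<mu> w v"
  using assms by (simp add: energy_def newton_U_def rot_diff[symmetric])

text \<open>Rolle's theorem. If the derivative is a multiplier times a function without zeros, the
  multiplier must be 0.\<close>

lemma periodic_derivative_zero:
  fixes F :: "real \<Rightarrow> real"
  assumes "T > 0" "F T = F 0" "\<And>t. (F has_real_derivative F' t) (at t)"
  obtains z where "F' z = 0"
proof -
  have "\<exists>z>0. z < T \<and> F T - F 0 = (T - 0) * F' z"
    using MVT2[of 0 T F F'] assms by auto
  then show ?thesis using that assms by auto
qed

subsection \<open>Vanishing of the multipliers\<close>

text \<open>A path that solves the equations up to the multipliers and stays near the central
  configurations. The closeness is recorded by what it is good for: freedom from collisions, and the
  positive pairings that keep the torques of the multiplier forces of one sign.\<close>

locale projected_path = symmetric_cluster +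
  fixes \<epsilon> :: real and u0 p0 :: "real \<Rightarrow> (real^2)^'b" and u1 p1 :: "real \<Rightarrow> (real^2)^'a" and l0 l1 :: real
  assumes eps: "0 < \<epsilon>" "\<epsilon> < 1/2"
    and sym_u0: "\<And>s. u0 (s + \<theta>) = symm (u0 s)" and sym_p0: "\<And>s. p0 (s + \<theta>) = symm (p0 s)"
    and per_u1: "\<And>s. u1 (s + \<theta>) = u1 s" and per_p1: "\<And>s. p1 (s + \<theta>) = p1 s"
    and u0': "\<And>s. (u0 has_vector_derivative slowness \<epsilon> *\<^sub>R p0 s) (at s)"
    and p0': "\<And>s. (p0 has_vector_derivative slowness \<epsilon> *\<^sub>R (\<chi> j. u0 s $ j + outer \<epsilon> s ((u0 s, p0 s), (u1 s, p1 s)) j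
         - 2 *\<^sub>R (J *v (p0 s $ j)) + l0 *\<^sub>R (J *v (a0 $ j)))) (at s)"
    and u1': "\<And>s. (u1 has_vector_derivative p1 s) (at s)"
    and p1': "\<And>s. (p1 has_vector_derivative (\<chi> k. (stretch \<epsilon>)\<^sup>2 *\<^sub>R (u1 s $ k + accel m1 (u1 s) k
            + \<epsilon>\<^sup>2 *\<^sub>R (rot (- s) *v (tidal \<epsilon> s ((u0 s, p0 s), (u1 s, p1 s)) k - mean_tidal \<epsilon> s ((u0 s, p0 s), (u1 s, p1 s)))))
          - (2 * stretch \<epsilon>) *\<^sub>R (J *v (p1 s $ k)) + l1 *\<^sub>R (J *v (a1 $ k)))) (at s)"
    and cf_u0: "\<And>s. collision_free (u0 s)" and cf_u1: "\<And>s. collision_free (u1 s)"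
    and cf_member: "\<And>s k j. j \<noteq> c \<Longrightarrow> u0 s $ c + \<epsilon> *\<^sub>R (rot s *v (u1 s $ k)) \<noteq> u0 s $ j"
    and pos0: "\<And>s. u0 s \<bullet> mass_weight (total_masses c m1 mo) a0 > 0"
    and pos1: "\<And>s. u1 s \<bullet> mass_weight m1 a1 > 0"
begin

abbreviation st :: "real \<Rightarrow> ('b, 'a) state" where "st s \<equiv> ((u0 s, p0 s), (u1 s, p1 s))"

definition \<omega> :: real where "\<omega> = \<epsilon> powr (-3/2)"
definition \<nu> :: real where "\<nu> = \<epsilon> powr (-3/2) - 1"

text \<open>\<open>\<omega>\<^sup>2 * \<epsilon> ^ 3 = 1\<close> is Kepler's third law for a cluster
  of size \<epsilon>; \<nu> is the frequency of the cluster relative to the frame of the outer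
  bodies.\<close>

lemma frequencies:
  "\<omega> = \<nu> + 1" "\<nu> > 0" "slowness \<epsilon> = 1 / \<nu>" "stretch \<epsilon> = \<omega> / \<nu>" "\<omega>\<^sup>2 * \<epsilon> ^ 3 = 1"
  "0 < slowness \<epsilon>" "slowness \<epsilon> < 1" "0 < stretch \<epsilon>" "stretch \<epsilon> < 2"
proof -
  define d where "d = \<epsilon> powr (3/2)"
  have d: "0 < d" "d \<le> \<epsilon>" using powr_three_halves[of \<epsilon>] eps by (auto simp: d_def)
  have w: "\<omega> = 1 / d"
    using eps by (simp add: \<omega>_def d_def powr_minus field_simps)
  show "\<omega> = \<nu> + 1" by (simp add: \<omega>_def \<nu>_def)
  then have n: "\<nu> = 1 / d - 1" using w by simp
  have "1 < 1 / d" using d eps by simp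
  then show "\<nu> > 0" using n by linarith
  have b: "stretch \<epsilon> = 1 / (1 - d)" by (simp add: stretch_def d_def)
  show s: "stretch \<epsilon> = \<omega> / \<nu>" using d eps unfolding b n w by (simp add: field_simps)
  show sl: "slowness \<epsilon> = 1 / \<nu>" using d eps unfolding slowness_def b n d_def[symmetric] by (simp add: field_simps)
  have "d\<^sup>2 = \<epsilon> powr 3" unfolding d_def power2_eq_square powr_add[symmetric] by simp
  also have "\<dots> = \<epsilon> ^ 3" using eps by (simp add: powr_numeral)
  finally show "\<omega>\<^sup>2 * \<epsilon> ^ 3 = 1" using d by (simp add: w power_divide)
  show "0 < slowness \<epsilon>" using \<open>\<nu> > 0\<close> sl by simp
  have "d < 1/2" using d eps by linarith
  then show "0 < stretch \<epsilon>" "stretch \<epsilon> < 2" using d by (simp_all add: b field_simps)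
  have "d * (1 / (1 - d)) < 1" using d \<open>d < 1/2\<close> by (simp add: field_simps)
  then show "slowness \<epsilon> < 1" by (simp add: slowness_def b d_def)
qed

text \<open>The position fixed by \<sigma> is invariant under a nontrivial rotation. Consequently
  the multiplier force along \<open>J_all a0\<close> does not act on the cluster.\<close>

lemma a0_c: "a0 $ c = 0"
proof -
  have "rot \<theta> *v (a0 $ c) = a0 $ c" using a0_sym[of c] \<sigma>(3) by simp
  moreover have "cos \<theta> \<noteq> 1" using m by (intro cos_neq_1) (simp_all add: \<theta> field_simps)
  ultimately show ?thesis by (rule rot_fixed_point)
qed

lemma E_red_a: "(\<Sum>j\<in>UNIV. M j *\<^sub>R a0 $ j) = 0" "(\<Sum>k\<in>UNIV. m1 k *\<^sub>R a1 $ k) = 0"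
  using nd0 nd1
  by (simp_all add: nondegenerate_cc_def periodic_nondegenerate_cc_def central_configuration_def
      critical_point_on_def E_red_def)

lemma per_u0: "u0 (s + 2 * pi) = u0 s" and per_p0: "p0 (s + 2 * pi) = p0 s"
proof -
  have "u0 (s + real n * \<theta>) = (symm ^^ n) (u0 s) \<and> p0 (s + real n * \<theta>) = (symm ^^ n) (p0 s)" for n
  proof (induction n)
    case (Suc n)
    have eq: "s + real (Suc n) * \<theta> = (s + real n * \<theta>) + \<theta>" by (simp add: algebra_simps)
    show ?case unfolding eq sym_u0 sym_p0 using Suc by simp
  qed simp
  moreover have "real m * \<theta> = 2 * pi" using m by (simp add: \<theta>)
  ultimately show "u0 (s + 2 * pi) = u0 s" "p0 (s + 2 * pi) = p0 s"
    by (metis symm_m)+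
qed

lemma per_u1': "u1 (s + 2 * pi) = u1 s" and per_p1': "p1 (s + 2 * pi) = p1 s"
proof -
  have "u1 (s + real n * \<theta>) = u1 s \<and> p1 (s + real n * \<theta>) = p1 s" for n
  proof (induction n)
    case (Suc n)
    have eq: "s + real (Suc n) * \<theta> = (s + real n * \<theta>) + \<theta>" by (simp add: algebra_simps)
    show ?case unfolding eq per_u1 per_p1 using Suc by simp
  qed simp
  from this[of m] show "u1 (s + 2 * pi) = u1 s" "p1 (s + 2 * pi) = p1 s"
    using m by (simp_all add: \<theta>)
qed

lemma sum_tidal: "(\<Sum>k\<in>UNIV. m1 k *\<^sub>R (tidal \<epsilon> s y k - mean_tidal \<epsilon> s y)) = 0"
proof -
  have "(\<Sum>k\<in>UNIV. m1 k *\<^sub>R mean_tidal \<epsilon> s y) = M c *\<^sub>R mean_tidal \<epsilon> s y"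
    by (simp add: M_c scaleR_left.sum)
  also have "\<dots> = (\<Sum>k\<in>UNIV. m1 k *\<^sub>R tidal \<epsilon> s y k)" using M_pos[of c] by (simp add: mean_tidal_def)
  finally show ?thesis by (simp add: scaleR_diff_right sum_subtractf)
qed

text \<open>The outer bodies balance among themselves, and their total force on the members of the
  cluster is, by definition of \<open>mean_tidal\<close>, the mass of the cluster times the
  acceleration at \<open>c\<close>.\<close>

lemma sum_outer: "(\<Sum>j\<in>UNIV. M j *\<^sub>R outer \<epsilon> s y j) = 0"
proof -
  let ?u = "fst (fst y)"
  define f where "f i j = (if i = c \<or> j = c then 0 else (mo i * mo j) *\<^sub>R grav (?u $ i - ?u $ j))" for i j
  have "(\<Sum>j\<in>- {c}. mo j *\<^sub>R (\<Sum>i\<in>- {c}. mo i *\<^sub>R grav (?u $ j - ?u $ i))) = (\<Sum>j\<in>- {c}. \<Sum>i\<in>- {c}. f j i)"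
    by (intro sum.cong) (auto simp: f_def scaleR_right.sum intro!: sum.cong)
  also have "\<dots> = (\<Sum>j\<in>UNIV. \<Sum>i\<in>- {c}. f j i)"
    by (rule sum.mono_neutral_left) (auto simp: f_def)
  also have "\<dots> = (\<Sum>j\<in>UNIV. \<Sum>i\<in>UNIV. f j i)"
    by (intro sum.cong refl sum.mono_neutral_left) (auto simp: f_def)
  also have "\<dots> = 0"
  proof (rule antisymmetric_double_sum)
    fix i j show "f i j = - f j i"
      unfolding f_def grav_commute[of "?u $ i" "?u $ j"] by (auto simp: mult.commute)
  qed
  finally have 1: "(\<Sum>j\<in>- {c}. mo j *\<^sub>R (\<Sum>i\<in>- {c}. mo i *\<^sub>R grav (?u $ j - ?u $ i))) = 0" .
  have "(\<Sum>j\<in>- {c}. mo j *\<^sub>R (\<Sum>k\<in>UNIV. m1 k *\<^sub>R grav (?u $ j - member \<epsilon> s y k))) =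
      (\<Sum>j\<in>- {c}. \<Sum>k\<in>UNIV. (mo j * m1 k) *\<^sub>R grav (?u $ j - member \<epsilon> s y k))"
    by (simp add: scaleR_right.sum)
  also have "\<dots> = (\<Sum>k\<in>UNIV. \<Sum>j\<in>- {c}. (mo j * m1 k) *\<^sub>R grav (?u $ j - member \<epsilon> s y k))" by (rule sum.swap)
  also have "\<dots> = (\<Sum>k\<in>UNIV. m1 k *\<^sub>R tidal \<epsilon> s y k)"
  proof (rule sum.cong[OF refl])
    fix k
    have "grav (?u $ j - member \<epsilon> s y k) = - grav (member \<epsilon> s y k - ?u $ j)" for j by (rule grav_commute)
    then show "(\<Sum>j\<in>- {c}. (mo j * m1 k) *\<^sub>R grav (?u $ j - member \<epsilon> s y k)) = m1 k *\<^sub>R tidal \<epsilon> s y k"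
      by (simp add: tidal_def scaleR_right.sum sum_negf mult.commute)
  qed
  also have "\<dots> = M c *\<^sub>R mean_tidal \<epsilon> s y" using M_pos[of c] by (simp add: mean_tidal_def)
  finally have 2: "(\<Sum>j\<in>- {c}. mo j *\<^sub>R (\<Sum>k\<in>UNIV. m1 k *\<^sub>R grav (?u $ j - member \<epsilon> s y k))) = M c *\<^sub>R mean_tidal \<epsilon> s y" .
  have "(\<Sum>j\<in>- {c}. mo j *\<^sub>R outer \<epsilon> s y j) = (\<Sum>j\<in>- {c}. - (mo j *\<^sub>R (\<Sum>i\<in>- {c}. mo i *\<^sub>R grav (?u $ j - ?u $ i)))
      - mo j *\<^sub>R (\<Sum>k\<in>UNIV. m1 k *\<^sub>R grav (?u $ j - member \<epsilon> s y k)))"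
    by (intro sum.cong) (auto simp: outer_def scaleR_diff_right)
  also have "\<dots> = - (M c *\<^sub>R mean_tidal \<epsilon> s y)" by (simp add: sum_subtractf sum_negf 1 2)
  finally show ?thesis
    unfolding sum_M by (simp add: outer_def M_c scaleR_left.sum)
qed

text \<open>In the weighted sum the internal forces, the tidal forces reduced by their mean, and the
  multiplier force all cancel. What is left is a free motion in a frame rotating at the rate
  \<open>stretch \<epsilon>\<close>.\<close>

lemma center_of_mass_u1: "(\<Sum>k\<in>UNIV. m1 k *\<^sub>R u1 s $ k) = 0"
proof -
  define b where "b v = (\<Sum>k\<in>UNIV. m1 k *\<^sub>R v $ k)" for v :: "(real^2)^'a"
  have "linear b" unfolding b_def
    by (rule linearI) (simp_all add: scaleR_add_right sum.distrib scaleR_right.sum mult.commute)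
  then have bb: "bounded_linear b" by (simp add: linear_conv_bounded_linear)
  let ?p' = "\<lambda>s. (\<chi> k. (stretch \<epsilon>)\<^sup>2 *\<^sub>R (u1 s $ k + accel m1 (u1 s) k
            + \<epsilon>\<^sup>2 *\<^sub>R (rot (- s) *v (tidal \<epsilon> s (st s) k - mean_tidal \<epsilon> s (st s))))
          - (2 * stretch \<epsilon>) *\<^sub>R (J *v (p1 s $ k)) + l1 *\<^sub>R (J *v (a1 $ k)))"
  have bp': "b (?p' s) = (stretch \<epsilon>)\<^sup>2 *\<^sub>R b (u1 s) - (2 * stretch \<epsilon>) *\<^sub>R (J *v b (p1 s))" for s
  proof -
    have t: "m1 k *\<^sub>R ((stretch \<epsilon>)\<^sup>2 *\<^sub>R (x + y + \<epsilon>\<^sup>2 *\<^sub>R (rot (- s) *v z)) - (2 * stretch \<epsilon>) *\<^sub>R (J *v p) + l1 *\<^sub>R (J *v a)) =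
        (stretch \<epsilon>)\<^sup>2 *\<^sub>R (m1 k *\<^sub>R x + m1 k *\<^sub>R y + \<epsilon>\<^sup>2 *\<^sub>R (rot (- s) *v (m1 k *\<^sub>R z)))
          - (2 * stretch \<epsilon>) *\<^sub>R (J *v (m1 k *\<^sub>R p)) + l1 *\<^sub>R (J *v (m1 k *\<^sub>R a))" for k x y z p a
      by (simp add: rot_scaleR J_linear_simps scaleR_add_right scaleR_diff_right mult_ac)
    have "b (?p' s) = (\<Sum>k\<in>UNIV. (stretch \<epsilon>)\<^sup>2 *\<^sub>R (m1 k *\<^sub>R (u1 s $ k) + m1 k *\<^sub>R accel m1 (u1 s) k
            + \<epsilon>\<^sup>2 *\<^sub>R (rot (- s) *v (m1 k *\<^sub>R (tidal \<epsilon> s (st s) k - mean_tidal \<epsilon> s (st s)))))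
          - (2 * stretch \<epsilon>) *\<^sub>R (J *v (m1 k *\<^sub>R (p1 s $ k))) + l1 *\<^sub>R (J *v (m1 k *\<^sub>R (a1 $ k))))"
      unfolding b_def vec_lambda_beta t ..
    also have "\<dots> = (stretch \<epsilon>)\<^sup>2 *\<^sub>R ((\<Sum>k\<in>UNIV. m1 k *\<^sub>R (u1 s $ k)) + (\<Sum>k\<in>UNIV. m1 k *\<^sub>R accel m1 (u1 s) k)
            + \<epsilon>\<^sup>2 *\<^sub>R (rot (- s) *v (\<Sum>k\<in>UNIV. m1 k *\<^sub>R (tidal \<epsilon> s (st s) k - mean_tidal \<epsilon> s (st s)))))
          - (2 * stretch \<epsilon>) *\<^sub>R (J *v (\<Sum>k\<in>UNIV. m1 k *\<^sub>R (p1 s $ k))) + l1 *\<^sub>R (J *v (\<Sum>k\<in>UNIV. m1 k *\<^sub>R (a1 $ k)))"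
      by (simp only: sum.distrib sum_subtractf scaleR_right.sum[symmetric] rot_sum[symmetric] J_sum[symmetric])
    finally show ?thesis by (simp add: sum_tidal sum_accel E_red_a b_def)
  qed
  have "b (u1 s) = 0"
  proof (rule rotating_free_motion_zero)
    show "((\<lambda>s. b (u1 s)) has_vector_derivative b (p1 s)) (at s)" for s
      by (rule bounded_linear.has_vector_derivative[OF bb u1'])
    show "((\<lambda>s. b (p1 s)) has_vector_derivative (stretch \<epsilon>)\<^sup>2 *\<^sub>R b (u1 s) - (2 * stretch \<epsilon>) *\<^sub>R (J *v b (p1 s))) (at s)" for s
      using bounded_linear.has_vector_derivative[OF bb p1'] unfolding bp' .
    show "b (u1 (s + \<theta>)) = b (u1 s)" for s by (simp add: per_u1)
    \<comment> \<open>Absence of resonance: \<open>m \<ge> 2\<close> gives a period of at most pi,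
      and the rotation rate \<open>stretch \<epsilon>\<close> is below 2.\<close>
    have "\<theta> \<le> pi" "\<theta> > 0" using m by (simp_all add: \<theta> field_simps)
    then have "stretch \<epsilon> * \<theta> < 2 * pi"
      using frequencies(8,9) mult_strict_mono'[of "stretch \<epsilon>" 2 \<theta> "pi + 1"]
      by (metis less_le_trans mult_le_cancel_left_pos mult_strict_right_mono zero_less_numeral)
    then show "cos (stretch \<epsilon> * \<theta>) \<noteq> 1"
      using frequencies(8) \<open>\<theta> > 0\<close> by (intro cos_neq_1) auto
  qed
  then show ?thesis by (simp add: b_def)
qed

text \<open>The same argument in the slow time, at the rotation rate
  \<open>slowness \<epsilon>\<close>, which is below 1. The full period is used, since one step of
  the symmetry also rotates the outer configuration.\<close>

lemma center_of_mass_u0: "(\<Sum>j\<in>UNIV. M j *\<^sub>R u0 s $ j) = 0"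
proof -
  let ?a = "slowness \<epsilon>"
  define b where "b v = (\<Sum>k\<in>UNIV. M k *\<^sub>R v $ k)" for v :: "(real^2)^'b"
  have lb: "linear b" unfolding b_def
    by (rule linearI) (simp_all add: scaleR_add_right sum.distrib scaleR_right.sum mult.commute)
  then have bb: "bounded_linear b" by (simp add: linear_conv_bounded_linear)
  let ?p' = "\<lambda>s. (\<chi> j. u0 s $ j + outer \<epsilon> s (st s) j - 2 *\<^sub>R (J *v (p0 s $ j)) + l0 *\<^sub>R (J *v (a0 $ j)))"
  have bp': "b (?p' s) = b (u0 s) - 2 *\<^sub>R (J *v b (p0 s))" for s
  proof -
    have t: "M k *\<^sub>R (x + y - 2 *\<^sub>R (J *v p) + l0 *\<^sub>R (J *v a)) =
        M k *\<^sub>R x + M k *\<^sub>R y - 2 *\<^sub>R (J *v (M k *\<^sub>R p)) + l0 *\<^sub>R (J *v (M k *\<^sub>R a))" for k x y p a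
      by (simp add: J_linear_simps scaleR_add_right scaleR_diff_right mult_ac)
    have "b (?p' s) = (\<Sum>k\<in>UNIV. M k *\<^sub>R (u0 s $ k) + M k *\<^sub>R outer \<epsilon> s (st s) k
          - 2 *\<^sub>R (J *v (M k *\<^sub>R (p0 s $ k))) + l0 *\<^sub>R (J *v (M k *\<^sub>R (a0 $ k))))"
      unfolding b_def vec_lambda_beta t ..
    also have "\<dots> = (\<Sum>k\<in>UNIV. M k *\<^sub>R (u0 s $ k)) + (\<Sum>k\<in>UNIV. M k *\<^sub>R outer \<epsilon> s (st s) k)
          - 2 *\<^sub>R (J *v (\<Sum>k\<in>UNIV. M k *\<^sub>R (p0 s $ k))) + l0 *\<^sub>R (J *v (\<Sum>k\<in>UNIV. M k *\<^sub>R (a0 $ k)))"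
      by (simp only: sum.distrib sum_subtractf scaleR_right.sum[symmetric] J_sum[symmetric])
    finally show ?thesis by (simp add: sum_outer E_red_a b_def)
  qed
  have "b (u0 s) = 0"
  proof (rule rotating_free_motion_zero)
    show "((\<lambda>s. b (u0 s)) has_vector_derivative ?a *\<^sub>R b (p0 s)) (at s)" for s
      using bounded_linear.has_vector_derivative[OF bb u0'] by (simp add: linear_scale[OF lb])
    have "((\<lambda>s. ?a *\<^sub>R b (p0 s)) has_vector_derivative ?a *\<^sub>R (?a *\<^sub>R (b (u0 s) - 2 *\<^sub>R (J *v b (p0 s))))) (at s)" for s
      using bounded_linear.has_vector_derivative[OF bounded_linear_scaleR_right bounded_linear.has_vector_derivative[OF bb p0'], of ?a]
      unfolding linear_scale[OF lb] bp' .
    then show "((\<lambda>s. ?a *\<^sub>R b (p0 s)) has_vector_derivative ?a\<^sup>2 *\<^sub>R b (u0 s) - (2 * ?a) *\<^sub>R (J *v (?a *\<^sub>R b (p0 s)))) (at s)" for s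
      by (simp add: J_linear_simps scaleR_diff_right power2_eq_square mult_ac)
    show "b (u0 (s + 2 * pi)) = b (u0 s)" for s by (simp add: per_u0)
    show "cos (?a * (2 * pi)) \<noteq> 1"
      using frequencies(6,7) by (intro cos_neq_1) (auto simp: mult_less_cancel_right1)
  qed
  then show ?thesis by (simp add: b_def)
qed

end

section \<open>Return to the inertial frame and physical time\<close>

lemma has_vector_derivative_vec:
  fixes f :: "'i::finite \<Rightarrow> real \<Rightarrow> 'a::euclidean_space"
  assumes "\<And>i. (f i has_vector_derivative f' i) (at t)"
  shows "((\<lambda>t. \<chi> i. f i t) has_vector_derivative (\<chi> i. f' i)) (at t)"
proof -
  have lin: "bounded_linear (axis i :: 'a \<Rightarrow> 'a^'i)" for i
    unfolding linear_conv_bounded_linear[symmetric] by (rule linearI) (auto simp: axis_def vec_eq_iff)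
  have eq: "(\<chi> i. w i) = (\<Sum>i\<in>UNIV. axis i (w i))" for w :: "'i \<Rightarrow> 'a"
    by (simp add: vec_eq_iff axis_def sum.delta')
  show ?thesis
    unfolding eq by (intro has_vector_derivative_sum bounded_linear.has_vector_derivative[OF lin] assms)
qed

lemma rotating_path_derivative:
  assumes "(u has_vector_derivative u') (at (\<nu> * t))"
  shows "((\<lambda>t. rot (b * t) *v u (\<nu> * t)) has_vector_derivative
    rot (b * t) *v (b *\<^sub>R (J *v u (\<nu> * t)) + \<nu> *\<^sub>R u')) (at t)"
  by (rule rot_has_vector_derivative[OF vector_derivative_scaled_argument[OF assms]])

context projected_path
begin

text \<open>The force \<open>l1\<close> of the equations in the variable \<open>s\<close>, converted to physical time.\<close>

definition \<kappa> :: real where "\<kappa> = \<epsilon> * \<nu>\<^sup>2 * l1"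

text \<open>The label \<open>Inr c\<close> receives the center of the cluster, which is not a body;
  it will be given weight zero.\<close>

fun body :: "'a + 'b \<Rightarrow> real \<Rightarrow> real^2" where
  "body (Inl k) t = rot t *v (u0 (\<nu> * t) $ c) + \<epsilon> *\<^sub>R (rot (\<omega> * t) *v (u1 (\<nu> * t) $ k))"
| "body (Inr j) t = rot t *v (u0 (\<nu> * t) $ j)"

fun vel :: "'a + 'b \<Rightarrow> real \<Rightarrow> real^2" where
  "vel (Inl k) t = rot t *v (J *v (u0 (\<nu> * t) $ c) + p0 (\<nu> * t) $ c)
     + \<epsilon> *\<^sub>R (rot (\<omega> * t) *v (\<omega> *\<^sub>R (J *v (u1 (\<nu> * t) $ k)) + \<nu> *\<^sub>R (p1 (\<nu> * t) $ k)))"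
| "vel (Inr j) t = rot t *v (J *v (u0 (\<nu> * t) $ j) + p0 (\<nu> * t) $ j)"

text \<open>The multiplier forces per unit mass in the inertial frame. Each one turns with the
  configuration on which it acts: the cluster with \<omega>, the outer bodies with frequency
  one.\<close>

fun extra :: "'a + 'b \<Rightarrow> real \<Rightarrow> real^2" where
  "extra (Inl k) t = \<kappa> *\<^sub>R (rot (\<omega> * t) *v (J *v (a1 $ k)))"
| "extra (Inr j) t = l0 *\<^sub>R (rot t *v (J *v (a0 $ j)))"

fun acc :: "'a + 'b \<Rightarrow> real \<Rightarrow> real^2" where
  "acc (Inl k) t = rot t *v tidal \<epsilon> (\<nu> * t) (st (\<nu> * t)) k
     + (1 / \<epsilon>\<^sup>2) *\<^sub>R (rot (\<omega> * t) *v accel m1 (u1 (\<nu> * t)) k) + extra (Inl k) t"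
| "acc (Inr j) t = rot t *v outer \<epsilon> (\<nu> * t) (st (\<nu> * t)) j + extra (Inr j) t"

lemma body_vel_fun:
  "body (Inl k) = (\<lambda>t. rot t *v (u0 (\<nu> * t) $ c) + \<epsilon> *\<^sub>R (rot (\<omega> * t) *v (u1 (\<nu> * t) $ k)))"
  "body (Inr j) = (\<lambda>t. rot t *v (u0 (\<nu> * t) $ j))"
  "vel (Inl k) = (\<lambda>t. rot t *v (J *v (u0 (\<nu> * t) $ c) + p0 (\<nu> * t) $ c)
     + \<epsilon> *\<^sub>R (rot (\<omega> * t) *v (\<omega> *\<^sub>R (J *v (u1 (\<nu> * t) $ k)) + \<nu> *\<^sub>R (p1 (\<nu> * t) $ k))))"
  "vel (Inr j) = (\<lambda>t. rot t *v (J *v (u0 (\<nu> * t) $ j) + p0 (\<nu> * t) $ j))"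
  by (rule ext; rule body.simps vel.simps)+

lemma rot_\<omega>: "rot (\<omega> * t) *v x = rot t *v (rot (\<nu> * t) *v x)"
  using rot_add[of t "\<nu> * t" x] by (simp add: frequencies(1) algebra_simps)

lemma outer_body_derivatives:
  "((\<lambda>t. rot t *v (u0 (\<nu> * t) $ j)) has_vector_derivative rot t *v (J *v (u0 (\<nu> * t) $ j) + p0 (\<nu> * t) $ j)) (at t)"
  "((\<lambda>t. rot t *v (J *v (u0 (\<nu> * t) $ j) + p0 (\<nu> * t) $ j)) has_vector_derivative
     rot t *v (outer \<epsilon> (\<nu> * t) (st (\<nu> * t)) j + l0 *\<^sub>R (J *v (a0 $ j)))) (at t)"
proof -
  have \<nu>s: "\<nu> * slowness \<epsilon> = 1" using frequencies(2,3) by simp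
  have u: "((\<lambda>s. u0 s $ j) has_vector_derivative slowness \<epsilon> *\<^sub>R p0 s $ j) (at s)" for s
    using bounded_linear.has_vector_derivative[OF bounded_linear_vec_nth u0'] by simp
  from rotating_path_derivative[OF u, where \<nu> = \<nu> and t = t and b = 1] show
    "((\<lambda>t. rot t *v (u0 (\<nu> * t) $ j)) has_vector_derivative rot t *v (J *v (u0 (\<nu> * t) $ j) + p0 (\<nu> * t) $ j)) (at t)"
    by (simp add: \<nu>s)
  have p: "((\<lambda>s. p0 s $ j) has_vector_derivative slowness \<epsilon> *\<^sub>R (u0 s $ j + outer \<epsilon> s (st s) j
         - 2 *\<^sub>R (J *v (p0 s $ j)) + l0 *\<^sub>R (J *v (a0 $ j)))) (at s)" for s
    using bounded_linear.has_vector_derivative[OF bounded_linear_vec_nth[of j] p0'[of s]] by simp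
  let ?s = "\<nu> * t"
  from rotating_path_derivative[OF has_vector_derivative_add[OF J_has_vector_derivative[OF u] p], where \<nu> = \<nu> and t = t and b = 1]
  have "((\<lambda>t. rot t *v (J *v (u0 (\<nu> * t) $ j) + p0 (\<nu> * t) $ j)) has_vector_derivative
    rot t *v (J *v (J *v (u0 ?s $ j) + p0 ?s $ j) + \<nu> *\<^sub>R (J *v (slowness \<epsilon> *\<^sub>R p0 ?s $ j) +
      slowness \<epsilon> *\<^sub>R (u0 ?s $ j + outer \<epsilon> ?s (st ?s) j - 2 *\<^sub>R (J *v (p0 ?s $ j)) + l0 *\<^sub>R (J *v (a0 $ j)))))) (at t)"
    by simp
  moreover have "J *v (J *v (u0 ?s $ j) + p0 ?s $ j) + \<nu> *\<^sub>R (J *v (slowness \<epsilon> *\<^sub>R p0 ?s $ j) +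
      slowness \<epsilon> *\<^sub>R (u0 ?s $ j + outer \<epsilon> ?s (st ?s) j - 2 *\<^sub>R (J *v (p0 ?s $ j)) + l0 *\<^sub>R (J *v (a0 $ j)))) =
      outer \<epsilon> ?s (st ?s) j + l0 *\<^sub>R (J *v (a0 $ j))"
    by (simp only: J_linear_simps scaleR_add_right[of \<nu>] scaleR_scaleR \<nu>s J_J)
      (simp add: scaleR_2)
  ultimately show "((\<lambda>t. rot t *v (J *v (u0 (\<nu> * t) $ j) + p0 (\<nu> * t) $ j)) has_vector_derivative
     rot t *v (outer \<epsilon> (\<nu> * t) (st (\<nu> * t)) j + l0 *\<^sub>R (J *v (a0 $ j)))) (at t)" by simp
qed

lemma body_derivative: "(body b has_vector_derivative vel b t) (at t)"
proof (cases b)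
  case (Inl k)
  have "((\<lambda>s. u1 s $ k) has_vector_derivative p1 s $ k) (at s)" for s
    using bounded_linear.has_vector_derivative[OF bounded_linear_vec_nth u1'] by simp
  from has_vector_derivative_add[OF outer_body_derivatives(1)[of c t]
      bounded_linear.has_vector_derivative[OF bounded_linear_scaleR_right rotating_path_derivative[OF this, where \<nu> = \<nu> and t = t and b = \<omega>], of \<epsilon>]]
  show ?thesis unfolding Inl body_vel_fun by simp
next
  case (Inr j)
  show ?thesis unfolding Inr body_vel_fun by (rule outer_body_derivatives(1))
qed

text \<open>Two differentiations in \<open>s\<close> yield \<open>\<nu>\<^sup>2\<close>, which turns
  the factor \<open>stretch \<epsilon>\<close> into \<omega>. Kepler's law then gives the internal
  forces the factor \<open>1 / \<epsilon>\<^sup>2\<close> of Newtonian attraction at distances of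
  order \<epsilon>, and the tidal terms the factor 1.\<close>

lemma vel_derivative: "(vel b has_vector_derivative acc b t) (at t)"
proof (cases b)
  case (Inr j)
  have "acc b t = rot t *v (outer \<epsilon> (\<nu> * t) (st (\<nu> * t)) j + l0 *\<^sub>R (J *v (a0 $ j)))"
    by (simp add: Inr rot_plus rot_scaleR)
  then show ?thesis using outer_body_derivatives(2)[of j t] unfolding Inr body_vel_fun by simp
next
  case (Inl k)
  let ?s = "\<nu> * t" and ?B = "stretch \<epsilon>"
  let ?z = "tidal \<epsilon> ?s (st ?s) k - mean_tidal \<epsilon> ?s (st ?s)"
  have u: "((\<lambda>s. u1 s $ k) has_vector_derivative p1 s $ k) (at s)" for s
    using bounded_linear.has_vector_derivative[OF bounded_linear_vec_nth u1'] by simp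
  have p: "((\<lambda>s. p1 s $ k) has_vector_derivative ?B\<^sup>2 *\<^sub>R (u1 s $ k + accel m1 (u1 s) k
            + \<epsilon>\<^sup>2 *\<^sub>R (rot (- s) *v (tidal \<epsilon> s (st s) k - mean_tidal \<epsilon> s (st s))))
          - (2 * ?B) *\<^sub>R (J *v (p1 s $ k)) + l1 *\<^sub>R (J *v (a1 $ k))) (at s)" for s
    using bounded_linear.has_vector_derivative[OF bounded_linear_vec_nth[of k] p1'[of s]] by simp
  have d: "((\<lambda>s. \<omega> *\<^sub>R (J *v (u1 s $ k)) + \<nu> *\<^sub>R (p1 s $ k)) has_vector_derivative \<omega> *\<^sub>R (J *v (p1 s $ k)) +
     \<nu> *\<^sub>R (?B\<^sup>2 *\<^sub>R (u1 s $ k + accel m1 (u1 s) k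
            + \<epsilon>\<^sup>2 *\<^sub>R (rot (- s) *v (tidal \<epsilon> s (st s) k - mean_tidal \<epsilon> s (st s))))
          - (2 * ?B) *\<^sub>R (J *v (p1 s $ k)) + l1 *\<^sub>R (J *v (a1 $ k)))) (at s)" for s
    by (intro has_vector_derivative_add bounded_linear.has_vector_derivative[OF bounded_linear_scaleR_right]
        J_has_vector_derivative u p)
  have \<nu>B: "\<nu> * ?B = \<omega>" "\<nu>\<^sup>2 * ?B\<^sup>2 = \<omega>\<^sup>2" using frequencies(2,4) by (simp_all add: power_divide)
  \<comment> \<open>Passing from the frame rotating with \<omega> to the inertial one cancels the
    centrifugal term \<open>x\<close> and the Coriolis term \<open>p\<close>.\<close>
  have alg: "\<omega> *\<^sub>R (J *v (\<omega> *\<^sub>R (J *v x) + \<nu> *\<^sub>R p)) + \<nu> *\<^sub>R (\<omega> *\<^sub>R (J *v p) +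
      \<nu> *\<^sub>R (?B\<^sup>2 *\<^sub>R (x + y + w) - (2 * ?B) *\<^sub>R (J *v p) + l1 *\<^sub>R a)) = \<omega>\<^sup>2 *\<^sub>R (y + w) + (\<nu>\<^sup>2 * l1) *\<^sub>R a" for x p y w a
  proof -
    have "\<nu> \<noteq> 0" "?B = \<omega> / \<nu>" using frequencies(2,4) by simp_all
    then show ?thesis
      unfolding \<open>?B = \<omega> / \<nu>\<close> by (simp add: vec_eq_iff forall_2 J_apply vector_2 field_simps power2_eq_square)
  qed
  have \<epsilon>\<omega>: "\<epsilon> * \<omega>\<^sup>2 = 1 / \<epsilon>\<^sup>2"
    using frequencies(5) eps by (simp add: field_simps power2_eq_square power3_eq_cube)
  have "\<epsilon> *\<^sub>R (rot (\<omega> * t) *v (\<omega>\<^sup>2 *\<^sub>R (accel m1 (u1 ?s) k + \<epsilon>\<^sup>2 *\<^sub>R (rot (- ?s) *v ?z)) + (\<nu>\<^sup>2 * l1) *\<^sub>R (J *v (a1 $ k)))) =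
      (1 / \<epsilon>\<^sup>2) *\<^sub>R (rot (\<omega> * t) *v accel m1 (u1 ?s) k) + rot t *v ?z + \<kappa> *\<^sub>R (rot (\<omega> * t) *v (J *v (a1 $ k)))"
  proof -
    have "\<epsilon> *\<^sub>R (rot (\<omega> * t) *v (\<omega>\<^sup>2 *\<^sub>R (y + \<epsilon>\<^sup>2 *\<^sub>R w) + (\<nu>\<^sup>2 * l1) *\<^sub>R a)) =
        (\<epsilon> * \<omega>\<^sup>2) *\<^sub>R (rot (\<omega> * t) *v y) + ((\<epsilon> * \<omega>\<^sup>2) * \<epsilon>\<^sup>2) *\<^sub>R (rot (\<omega> * t) *v w) + \<kappa> *\<^sub>R (rot (\<omega> * t) *v a)" for y w a
      by (simp add: rot_plus rot_scaleR scaleR_add_right \<kappa>_def mult_ac)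
    moreover have "(\<epsilon> * \<omega>\<^sup>2) * \<epsilon>\<^sup>2 = 1" using \<epsilon>\<omega> eps by simp
    moreover have "rot (\<omega> * t) *v (rot (- ?s) *v ?z) = rot t *v ?z" unfolding rot_\<omega> by simp
    ultimately show ?thesis by (simp add: \<epsilon>\<omega>)
  qed
  then have eq: "\<epsilon> *\<^sub>R (rot (\<omega> * t) *v (\<omega> *\<^sub>R (J *v (\<omega> *\<^sub>R (J *v (u1 ?s $ k)) + \<nu> *\<^sub>R (p1 ?s $ k))) +
     \<nu> *\<^sub>R (\<omega> *\<^sub>R (J *v (p1 ?s $ k)) + \<nu> *\<^sub>R (?B\<^sup>2 *\<^sub>R (u1 ?s $ k + accel m1 (u1 ?s) k
            + \<epsilon>\<^sup>2 *\<^sub>R (rot (- ?s) *v ?z)) - (2 * ?B) *\<^sub>R (J *v (p1 ?s $ k)) + l1 *\<^sub>R (J *v (a1 $ k)))))) =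
      (1 / \<epsilon>\<^sup>2) *\<^sub>R (rot (\<omega> * t) *v accel m1 (u1 ?s) k) + rot t *v ?z + \<kappa> *\<^sub>R (rot (\<omega> * t) *v (J *v (a1 $ k)))"
    unfolding alg .
  have "((\<lambda>t. \<epsilon> *\<^sub>R (rot (\<omega> * t) *v (\<omega> *\<^sub>R (J *v (u1 (\<nu> * t) $ k)) + \<nu> *\<^sub>R (p1 (\<nu> * t) $ k)))) has_vector_derivative
      (1 / \<epsilon>\<^sup>2) *\<^sub>R (rot (\<omega> * t) *v accel m1 (u1 ?s) k) + rot t *v ?z + \<kappa> *\<^sub>R (rot (\<omega> * t) *v (J *v (a1 $ k)))) (at t)"
    using bounded_linear.has_vector_derivative[OF bounded_linear_scaleR_right rotating_path_derivative[OF d, where \<nu> = \<nu> and t = t and b = \<omega>], of \<epsilon>]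
    unfolding eq .
  from has_vector_derivative_add[OF outer_body_derivatives(2)[of c t] this]
  have "(vel b has_vector_derivative rot t *v (outer \<epsilon> ?s (st ?s) c + l0 *\<^sub>R (J *v (a0 $ c))) +
      ((1 / \<epsilon>\<^sup>2) *\<^sub>R (rot (\<omega> * t) *v accel m1 (u1 ?s) k) + rot t *v ?z + \<kappa> *\<^sub>R (rot (\<omega> * t) *v (J *v (a1 $ k))))) (at t)"
    unfolding Inl body_vel_fun .
  moreover have "rot t *v (outer \<epsilon> ?s (st ?s) c + l0 *\<^sub>R (J *v (a0 $ c))) +
      ((1 / \<epsilon>\<^sup>2) *\<^sub>R (rot (\<omega> * t) *v accel m1 (u1 ?s) k) + rot t *v ?z + \<kappa> *\<^sub>R (rot (\<omega> * t) *v (J *v (a1 $ k)))) = acc b t"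
    unfolding Inl by (simp add: outer_def a0_c rot_diff)
  ultimately show ?thesis by simp
qed

definition weight :: "'a + 'b \<Rightarrow> real" where
  "weight b = (case b of Inl k \<Rightarrow> m1 k | Inr j \<Rightarrow> if j = c then 0 else mo j)"

lemma sum_bodies:
  fixes f :: "'a + 'b \<Rightarrow> 'v::real_vector"
  shows "(\<Sum>b\<in>UNIV. weight b *\<^sub>R f b) = (\<Sum>k\<in>UNIV. m1 k *\<^sub>R f (Inl k)) + (\<Sum>j\<in>- {c}. mo j *\<^sub>R f (Inr j))"
proof -
  have "(\<Sum>b\<in>UNIV. weight b *\<^sub>R f b) = (\<Sum>k\<in>UNIV. m1 k *\<^sub>R f (Inl k)) + (\<Sum>j\<in>UNIV. (if j = c then 0 else mo j) *\<^sub>R f (Inr j))"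
    unfolding UNIV_Plus_UNIV[symmetric] by (subst sum.Plus) (simp_all add: weight_def)
  also have "(\<Sum>j\<in>UNIV. (if j = c then 0 else mo j) *\<^sub>R f (Inr j)) = (\<Sum>j\<in>- {c}. mo j *\<^sub>R f (Inr j))"
    by (rule sum.mono_neutral_cong_right) auto
  finally show ?thesis .
qed

lemma body_member: "body (Inl k) t = rot t *v member \<epsilon> (\<nu> * t) (st (\<nu> * t)) k"
  by (simp add: member_def rot_plus rot_scaleR rot_\<omega>)

lemma newton_equations:
  assumes "b \<noteq> Inr c"
  shows "acc b t = accel weight (\<chi> b. body b t) b + extra b t"
proof -
  let ?s = "\<nu> * t"
  have a: "accel weight (\<chi> b. body b t) b = - ((\<Sum>k\<in>UNIV. m1 k *\<^sub>R grav (body b t - body (Inl k) t)) +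
      (\<Sum>j\<in>- {c}. mo j *\<^sub>R grav (body b t - body (Inr j) t)))" for b
    unfolding accel_def sum_bodies by simp
  show ?thesis
  proof (cases b)
    case (Inl k)
    have "body (Inl k) t - body (Inl l) t = \<epsilon> *\<^sub>R (rot (\<omega> * t) *v (u1 ?s $ k - u1 ?s $ l))" for l
      by (simp add: rot_diff scaleR_diff_right)
    then have "grav (body (Inl k) t - body (Inl l) t) = (1 / \<epsilon>\<^sup>2) *\<^sub>R (rot (\<omega> * t) *v grav (u1 ?s $ k - u1 ?s $ l))" for l
      using eps by (simp only: grav_scaleR grav_rot)
    then have 1: "(\<Sum>l\<in>UNIV. m1 l *\<^sub>R grav (body b t - body (Inl l) t)) = - ((1 / \<epsilon>\<^sup>2) *\<^sub>R (rot (\<omega> * t) *v accel m1 (u1 ?s) k))"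
      unfolding Inl by (simp add: accel_def rot_minus rot_sum rot_scaleR scaleR_right.sum mult.commute)
    have "body (Inl k) t - body (Inr j) t = rot t *v (member \<epsilon> ?s (st ?s) k - fst (fst (st ?s)) $ j)" for j
      unfolding body_member by (simp add: rot_diff)
    then have "grav (body (Inl k) t - body (Inr j) t) = rot t *v grav (member \<epsilon> ?s (st ?s) k - fst (fst (st ?s)) $ j)" for j
      by (simp only: grav_rot)
    then have 2: "(\<Sum>j\<in>- {c}. mo j *\<^sub>R grav (body b t - body (Inr j) t)) = - (rot t *v tidal \<epsilon> ?s (st ?s) k)"
      unfolding Inl by (simp add: tidal_def rot_minus rot_sum rot_scaleR)
    show ?thesis unfolding a 1 2 by (simp add: Inl)
  next
    case (Inr j)
    then have j: "j \<noteq> c" using assms by auto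
    have "body (Inr j) t - body (Inl k) t = rot t *v (fst (fst (st ?s)) $ j - member \<epsilon> ?s (st ?s) k)" for k
      unfolding body_member by (simp add: rot_diff)
    then have 1: "grav (body (Inr j) t - body (Inl k) t) = rot t *v grav (fst (fst (st ?s)) $ j - member \<epsilon> ?s (st ?s) k)" for k
      by (simp only: grav_rot)
    have "body (Inr j) t - body (Inr i) t = rot t *v (fst (fst (st ?s)) $ j - fst (fst (st ?s)) $ i)" for i
      by (simp add: rot_diff)
    then have 2: "grav (body (Inr j) t - body (Inr i) t) = rot t *v grav (fst (fst (st ?s)) $ j - fst (fst (st ?s)) $ i)" for i
      by (simp only: grav_rot)
    show ?thesis unfolding a Inr 1 2
      using j by (simp add: outer_def rot_diff rot_minus rot_sum rot_scaleR)
  qed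
qed

lemma bodies_distinct:
  assumes "b \<noteq> b'" "b \<noteq> Inr c" "b' \<noteq> Inr c"
  shows "body b t \<noteq> body b' t"
proof
  assume eq: "body b t = body b' t"
  have inj: "x = y" if "rot r *v x = rot r *v y" for r x y
    using arg_cong[OF that, of "\<lambda>x. rot (- r) *v x"] by simp
  let ?s = "\<nu> * t"
  have mixed: "body (Inl k) t \<noteq> body (Inr j) t" if "j \<noteq> c" for k j
  proof
    assume "body (Inl k) t = body (Inr j) t"
    then have "rot t *v member \<epsilon> ?s (st ?s) k = rot t *v (u0 ?s $ j)" by (simp only: body_member body.simps)
    then have "member \<epsilon> ?s (st ?s) k = u0 ?s $ j" by (rule inj)
    then show False using cf_member[OF that, of ?s k] by (simp add: member_def)
  qed
  show False
  proof (cases b; cases b')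
    fix k l assume b: "b = Inl k" "b' = Inl l"
    with eq have "rot (\<omega> * t) *v (u1 ?s $ k) = rot (\<omega> * t) *v (u1 ?s $ l)" using eps by simp
    then have "u1 ?s $ k = u1 ?s $ l" by (rule inj)
    then show False using cf_u1[of ?s] assms b by (auto simp: collision_free_def)
  next
    fix i j assume b: "b = Inr i" "b' = Inr j"
    with eq have "rot t *v (u0 ?s $ i) = rot t *v (u0 ?s $ j)" by simp
    then have "u0 ?s $ i = u0 ?s $ j" by (rule inj)
    then show False using cf_u0[of ?s] assms b by (auto simp: collision_free_def)
  next
    fix k j assume "b = Inl k" "b' = Inr j"
    then show False using mixed[of j k] eq assms by auto
  next
    fix k j assume "b = Inr j" "b' = Inl k"
    then show False using mixed[of j k] eq assms by auto
  qed
qed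

text \<open>Over one relative period the configuration is rotated rigidly, so that angular momentum \<open>L\<close> and
  energy \<open>E\<close> return to their values. The function \<open>H\<close> is a primitive of the power of the constant forces
  on the relative velocities; since \<open>\<omega> = \<nu> + 1\<close>, the derivatives of \<open>\<omega> L - E + H\<close> and \<open>L - E + H\<close> involve
  only \<open>l0\<close> and only \<open>\<kappa>\<close>, each with a factor of constant sign.\<close>

lemma multipliers_zero: "l0 = 0" "\<kappa> = 0"
proof -
  define w where "w t = (\<chi> b. body b t)" for t
  define v where "v t = (\<chi> b. vel b t)" for t
  define L where "L t = angular_momentum weight (w t) (v t)" for t
  define E where "E t = energy weight (w t) (v t)" for t
  define X where "X s = u0 s \<bullet> mass_weight M a0" for s
  define Y where "Y s = u1 s \<bullet> mass_weight m1 a1" for s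
  define Z0 where "Z0 s = p0 s \<bullet> mass_weight M (J_all a0)" for s
  define Z1 where "Z1 s = p1 s \<bullet> mass_weight m1 (J_all a1)" for s
  have dw: "(w has_vector_derivative v t) (at t)" for t
    unfolding w_def v_def by (rule has_vector_derivative_vec[OF body_derivative])
  have dv: "(v has_vector_derivative (\<chi> b. acc b t)) (at t)" for t
    unfolding v_def by (rule has_vector_derivative_vec[OF vel_derivative])
  have A: "weight b *\<^sub>R (\<chi> b. acc b t) $ b = weight b *\<^sub>R (accel weight (w t) b + extra b t)" for b t
  proof (cases "b = Inr c")
    case True
    then show ?thesis by (simp add: weight_def)
  next
    case False
    then show ?thesis using newton_equations[OF False, of t] by (simp add: w_def)
  qed
  have cf: "w t $ i \<noteq> w t $ j" if "i \<noteq> j" "weight i * weight j \<noteq> 0" for i j t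
  proof -
    have "i \<noteq> Inr c" "j \<noteq> Inr c" using that(2) by (auto simp: weight_def)
    then show ?thesis using bodies_distinct[OF that(1)] by (simp add: w_def)
  qed
  \<comment> \<open>The multiplier force on the cluster has no resultant, so position and velocity
    of the center of the cluster contribute neither torque nor power.\<close>
  have com: "(\<Sum>k\<in>UNIV. m1 k *\<^sub>R (rot r *v (J *v (a1 $ k)))) = 0" for r
    using arg_cong[OF E_red_a(2), of "\<lambda>x. rot r *v (J *v x)"]
    by (simp add: J_sum rot_sum J_linear_simps rot_scaleR)
  have real_sum_bodies: "(\<Sum>b\<in>UNIV. weight b * f b) = (\<Sum>k\<in>UNIV. m1 k * f (Inl k)) + (\<Sum>j\<in>- {c}. mo j * f (Inr j))" for f :: "'a + 'b \<Rightarrow> real"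
    using sum_bodies[of f] by simp
  have sum_outer_M: "(\<Sum>j\<in>- {c}. mo j * f j) = (\<Sum>j\<in>UNIV. M j * f j)" if "f c = 0" for f :: "'b \<Rightarrow> real"
    by (rule sum.mono_neutral_cong_left) (use that M_other in auto)
  have dL: "(L has_real_derivative \<kappa> * \<epsilon> * Y (\<nu> * t) + l0 * X (\<nu> * t)) (at t)" for t
  proof -
    let ?s = "\<nu> * t"
    have "(L has_real_derivative (\<Sum>b\<in>UNIV. weight b * ((J *v (w t $ b)) \<bullet> extra b t))) (at t)"
      unfolding L_def by (rule angular_momentum_balance[where v = v, OF dw dv A])
    also have "(\<Sum>b\<in>UNIV. weight b * ((J *v (w t $ b)) \<bullet> extra b t)) =
       (\<Sum>k\<in>UNIV. m1 k * (\<kappa> * ((J *v (rot t *v (u0 ?s $ c))) \<bullet> (rot (\<omega> * t) *v (J *v (a1 $ k)))) + \<kappa> * \<epsilon> * (u1 ?s $ k \<bullet> a1 $ k)))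
       + (\<Sum>j\<in>- {c}. mo j * (l0 * (u0 ?s $ j \<bullet> a0 $ j)))"
      unfolding real_sum_bodies
      by (simp add: w_def J_linear_simps inner_add_left rot_J[symmetric] algebra_simps)
    also have "(\<Sum>k\<in>UNIV. m1 k * (\<kappa> * ((J *v (rot t *v (u0 ?s $ c))) \<bullet> (rot (\<omega> * t) *v (J *v (a1 $ k)))) + \<kappa> * \<epsilon> * (u1 ?s $ k \<bullet> a1 $ k))) =
       \<kappa> * ((J *v (rot t *v (u0 ?s $ c))) \<bullet> (\<Sum>k\<in>UNIV. m1 k *\<^sub>R (rot (\<omega> * t) *v (J *v (a1 $ k))))) + \<kappa> * \<epsilon> * Y ?s"
      by (simp add: Y_def inner_mass_weight inner_sum_right sum_distrib_left sum.distrib distrib_left mult_ac)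
    also have "(\<Sum>j\<in>- {c}. mo j * (l0 * (u0 ?s $ j \<bullet> a0 $ j))) = l0 * X ?s"
      by (subst sum_outer_M) (simp_all add: a0_c X_def inner_mass_weight sum_distrib_left mult_ac)
    finally show ?thesis by (simp add: com)
  qed
  have dE: "(E has_real_derivative \<kappa> * \<epsilon> * (\<omega> * Y (\<nu> * t) + \<nu> * Z1 (\<nu> * t)) + l0 * (X (\<nu> * t) + Z0 (\<nu> * t))) (at t)" for t
  proof -
    let ?s = "\<nu> * t"
    have "(E has_real_derivative (\<Sum>b\<in>UNIV. weight b * (v t $ b \<bullet> extra b t))) (at t)"
      unfolding E_def by (rule energy_balance[where v = v, OF dw dv cf A])
    also have "(\<Sum>b\<in>UNIV. weight b * (v t $ b \<bullet> extra b t)) =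
       (\<Sum>k\<in>UNIV. m1 k * (\<kappa> * ((rot t *v (J *v (u0 ?s $ c) + p0 ?s $ c)) \<bullet> (rot (\<omega> * t) *v (J *v (a1 $ k))))
          + \<kappa> * \<epsilon> * (\<omega> * (u1 ?s $ k \<bullet> a1 $ k) + \<nu> * (p1 ?s $ k \<bullet> (J *v (a1 $ k))))))
       + (\<Sum>j\<in>- {c}. mo j * (l0 * (u0 ?s $ j \<bullet> a0 $ j + p0 ?s $ j \<bullet> (J *v (a0 $ j)))))"
      unfolding real_sum_bodies
      by (simp only: v_def vec_lambda_beta vel.simps extra.simps inner_add_left inner_scaleR_left inner_scaleR_right rot_inner inner_J_J)
        (simp add: algebra_simps)
    also have "(\<Sum>k\<in>UNIV. m1 k * (\<kappa> * ((rot t *v (J *v (u0 ?s $ c) + p0 ?s $ c)) \<bullet> (rot (\<omega> * t) *v (J *v (a1 $ k))))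
          + \<kappa> * \<epsilon> * (\<omega> * (u1 ?s $ k \<bullet> a1 $ k) + \<nu> * (p1 ?s $ k \<bullet> (J *v (a1 $ k)))))) =
       \<kappa> * ((rot t *v (J *v (u0 ?s $ c) + p0 ?s $ c)) \<bullet> (\<Sum>k\<in>UNIV. m1 k *\<^sub>R (rot (\<omega> * t) *v (J *v (a1 $ k)))))
         + \<kappa> * \<epsilon> * (\<omega> * Y ?s + \<nu> * Z1 ?s)"
      by (simp add: Y_def Z1_def inner_mass_weight inner_sum_right sum_distrib_left sum.distrib distrib_left mult_ac)
    also have "(\<Sum>j\<in>- {c}. mo j * (l0 * (u0 ?s $ j \<bullet> a0 $ j + p0 ?s $ j \<bullet> (J *v (a0 $ j))))) = l0 * (X ?s + Z0 ?s)"
      by (subst sum_outer_M) (simp_all add: a0_c X_def Z0_def inner_mass_weight sum_distrib_left sum.distrib distrib_left mult_ac)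
    finally show ?thesis by (simp add: com)
  qed
  define H where "H t = \<kappa> * \<epsilon> * (u1 (\<nu> * t) \<bullet> mass_weight m1 (J_all a1)) + l0 * (u0 (\<nu> * t) \<bullet> mass_weight M (J_all a0))" for t
  have dH: "(H has_real_derivative \<kappa> * \<epsilon> * (\<nu> * Z1 (\<nu> * t)) + l0 * Z0 (\<nu> * t)) (at t)" for t
  proof -
    have "((\<lambda>t. u1 (\<nu> * t) \<bullet> mass_weight m1 (J_all a1)) has_real_derivative \<nu> * Z1 (\<nu> * t)) (at t)"
      using bounded_linear.has_vector_derivative[OF bounded_linear_inner_left vector_derivative_scaled_argument[OF u1', of \<nu> t]]
      unfolding has_real_derivative_iff_has_vector_derivative by (simp add: Z1_def)
    moreover have "((\<lambda>t. u0 (\<nu> * t) \<bullet> mass_weight M (J_all a0)) has_real_derivative Z0 (\<nu> * t)) (at t)"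
      using bounded_linear.has_vector_derivative[OF bounded_linear_inner_left vector_derivative_scaled_argument[OF u0', of \<nu> t]]
        frequencies(2,3)
      unfolding has_real_derivative_iff_has_vector_derivative by (simp add: Z0_def)
    ultimately show ?thesis unfolding H_def by (intro DERIV_add DERIV_cmult)
  qed
  define T where "T = 2 * pi / \<nu>"
  have T: "T > 0" "\<nu> * T = 2 * pi" using frequencies(2) by (simp_all add: T_def)
  have u: "u0 (2 * pi) = u0 0" "p0 (2 * pi) = p0 0" "u1 (2 * pi) = u1 0" "p1 (2 * pi) = p1 0"
    using per_u0[of 0] per_p0[of 0] per_u1'[of 0] per_p1'[of 0] by simp_all
  \<comment> \<open>After the relative period the two frames have turned by angles that differ by a
    full turn, hence by the same rotation.\<close>
  have "rot (\<omega> * T) *v x = rot T *v x" for x unfolding rot_\<omega> T(2) by (simp add: rot_two_pi)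
  then have wT: "w T $ b = rot T *v (w 0 $ b)" and vT: "v T $ b = rot T *v (v 0 $ b)" for b
    by (cases b; simp add: w_def v_def T(2) u rot_plus rot_scaleR)+
  have LT: "L T = L 0" unfolding L_def by (rule angular_momentum_rot[OF wT vT])
  have ET: "E T = E 0" unfolding E_def by (rule energy_rot[OF wT vT])
  have HT: "H T = H 0" by (simp add: H_def T(2) u)
  \<comment> \<open>The factor \<omega> cancels the term \<open>\<omega> * Y\<close> in the power on
    the cluster, and \<open>H\<close> cancels the terms with \<open>Z0\<close> and
    \<open>Z1\<close>. For \<open>X\<close> the coefficient \<open>\<omega> - 1\<close>, which is
    \<nu>, remains.\<close>
  have D1: "((\<lambda>t. \<omega> * L t - E t + H t) has_real_derivative \<nu> * (l0 * X (\<nu> * t))) (at t)" for t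
    using DERIV_add[OF DERIV_diff[OF DERIV_cmult[OF dL[of t], of \<omega>] dE[of t]] dH[of t]]
    by (simp add: frequencies(1) algebra_simps)
  have P1: "\<omega> * L T - E T + H T = \<omega> * L 0 - E 0 + H 0" by (simp only: LT ET HT)
  obtain z where "\<nu> * (l0 * X (\<nu> * z)) = 0"
    by (rule periodic_derivative_zero[OF T(1) P1 D1])
  then show l0: "l0 = 0" using frequencies(2) pos0[of "\<nu> * z"] by (simp add: X_def)
  \<comment> \<open>Now the terms with \<open>X\<close> cancel, while \<open>Y\<close> keeps the
    coefficient \<open>1 - \<omega>\<close>, that is, minus \<nu>.\<close>
  have D2: "((\<lambda>t. L t - E t + H t) has_real_derivative - (\<nu> * (\<kappa> * \<epsilon> * Y (\<nu> * t)))) (at t)" for t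
    using DERIV_add[OF DERIV_diff[OF dL[of t] dE[of t]] dH[of t]]
    by (simp add: frequencies(1) algebra_simps)
  have P2: "L T - E T + H T = L 0 - E 0 + H 0" by (simp only: LT ET HT)
  obtain z where "- (\<nu> * (\<kappa> * \<epsilon> * Y (\<nu> * z))) = 0"
    by (rule periodic_derivative_zero[OF T(1) P2 D2])
  then show "\<kappa> = 0" using frequencies(2) pos1[of "\<nu> * z"] eps by (simp add: Y_def)
qed

lemma body_solution: "nbody_solution (cluster_bodies c) (case_sum m1 mo) body"
proof -
  have c: "b \<noteq> Inr c" if "b \<in> cluster_bodies c" for b :: "'a + 'b"
    using that by (auto simp: cluster_bodies_def)
  have inj: "inj_on (\<lambda>i. body i t) (cluster_bodies c)" for t
  proof (rule inj_onI)
    fix i j assume "i \<in> cluster_bodies c" "j \<in> cluster_bodies c" "body i t = body j t"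
    then show "i = j" using bodies_distinct[of i j t] c by blast
  qed
  let ?\<mu> = "case_sum m1 mo :: 'a + 'b \<Rightarrow> real"
  have w: "weight i = ?\<mu> i" if "i \<in> cluster_bodies c" for i
    using that by (auto simp: weight_def cluster_bodies_def split: sum.split)
  have eq: "?\<mu> b *\<^sub>R acc b t = - (\<Sum>j\<in>cluster_bodies c - {b}. (?\<mu> b * ?\<mu> j / norm (body b t - body j t) ^ 3) *\<^sub>R (body b t - body j t))"
    if b: "b \<in> cluster_bodies c" for b t
  proof -
  have "extra b t = 0" by (cases b) (simp_all only: extra.simps, simp_all add: multipliers_zero)
  then have "acc b t = - (\<Sum>i\<in>UNIV. weight i *\<^sub>R grav (body b t - body i t))"
    using newton_equations[OF c[OF b], of t] by (simp add: accel_def)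
  also have "(\<Sum>i\<in>UNIV. weight i *\<^sub>R grav (body b t - body i t)) = (\<Sum>i\<in>cluster_bodies c - {b}. ?\<mu> i *\<^sub>R grav (body b t - body i t))"
  proof (rule sum.mono_neutral_cong_right)
    show "\<forall>i\<in>UNIV - (cluster_bodies c - {b}). weight i *\<^sub>R grav (body b t - body i t) = 0"
    proof
      fix i assume "i \<in> UNIV - (cluster_bodies c - {b})"
      then consider "i = b" | "i = Inr c" by (cases i) (auto simp: cluster_bodies_def)
      then show "weight i *\<^sub>R grav (body b t - body i t) = 0" by cases (simp_all add: weight_def)
    qed
  qed (auto simp: w)
  finally show ?thesis by (simp add: scaleR_right.sum grav_def)
  qed
  show ?thesis
    unfolding nbody_solution_def using inj eq body_derivative vel_derivative by blast
qed

end

subsection \<open>Time shifts\<close>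

lemma nbody_solution_rot_shift:
  assumes "nbody_solution I \<mu> q"
  shows "nbody_solution I \<mu> (\<lambda>i t. rot \<phi> *v q i (t + \<tau>))"
proof -
  have inj: "inj_on (\<lambda>i. q i t) I" for t using assms by (simp add: nbody_solution_def)
  obtain v acc where va: "\<forall>i\<in>I. \<forall>t. (q i has_vector_derivative v i t) (at t) \<and>
        (v i has_vector_derivative acc i t) (at t) \<and>
        \<mu> i *\<^sub>R acc i t = - (\<Sum>j\<in>I - {i}. (\<mu> i * \<mu> j / norm (q i t - q j t) ^ 3) *\<^sub>R (q i t - q j t))"
    using assms unfolding nbody_solution_def by blast
  have rd: "((\<lambda>t. rot \<phi> *v f (t + \<tau>)) has_vector_derivative rot \<phi> *v f') (at t)"
    if "(f has_vector_derivative f') (at (t + \<tau>))" for f f' t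
    by (rule bounded_linear.has_vector_derivative[OF matrix_vector_mul_bounded_linear vector_derivative_shifted_argument[OF that]])
  show ?thesis
    unfolding nbody_solution_def
  proof (rule conjI, rule allI)
    fix t
    show "inj_on (\<lambda>i. rot \<phi> *v q i (t + \<tau>)) I"
    proof (rule inj_onI)
      fix i j assume ij: "i \<in> I" "j \<in> I" and eq: "rot \<phi> *v q i (t + \<tau>) = rot \<phi> *v q j (t + \<tau>)"
      have "q i (t + \<tau>) = q j (t + \<tau>)" using arg_cong[OF eq, of "\<lambda>x. rot (- \<phi>) *v x"] by simp
      then show "i = j" using inj[of "t + \<tau>"] ij by (auto dest: inj_onD)
    qed
  next
    have eqn: "\<mu> i *\<^sub>R (rot \<phi> *v acc i (t + \<tau>)) = - (\<Sum>j\<in>I - {i}. (\<mu> i * \<mu> j / norm (rot \<phi> *v q i (t + \<tau>) - rot \<phi> *v q j (t + \<tau>)) ^ 3) *\<^sub>R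
        (rot \<phi> *v q i (t + \<tau>) - rot \<phi> *v q j (t + \<tau>)))" if "i \<in> I" for i t
    proof -
      have "\<mu> i *\<^sub>R acc i (t + \<tau>) = - (\<Sum>j\<in>I - {i}. (\<mu> i * \<mu> j / norm (q i (t + \<tau>) - q j (t + \<tau>)) ^ 3) *\<^sub>R (q i (t + \<tau>) - q j (t + \<tau>)))"
        using va that by blast
      from arg_cong[OF this, of "\<lambda>x. rot \<phi> *v x"] show ?thesis
        by (simp only: rot_scaleR rot_minus rot_sum rot_diff[symmetric] rot_norm)
    qed
    show "\<exists>v acc. \<forall>i\<in>I. \<forall>t. ((\<lambda>t. rot \<phi> *v q i (t + \<tau>)) has_vector_derivative v i t) (at t) \<and>
        (v i has_vector_derivative acc i t) (at t) \<and>
        \<mu> i *\<^sub>R acc i t = - (\<Sum>j\<in>I - {i}. (\<mu> i * \<mu> j / norm (rot \<phi> *v q i (t + \<tau>) - rot \<phi> *v q j (t + \<tau>)) ^ 3) *\<^sub>R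
          (rot \<phi> *v q i (t + \<tau>) - rot \<phi> *v q j (t + \<tau>)))"
      by (rule exI[of _ "\<lambda>i t. rot \<phi> *v v i (t + \<tau>)"], rule exI[of _ "\<lambda>i t. rot \<phi> *v acc i (t + \<tau>)"])
        (use va rd eqn in blast)
  qed
qed

text \<open>Path and derivative each contribute at most \<open>2 * pi * B\<^sup>2\<close> to the
  square of the norm, and pi < 4 bounds the sum by the square of \<open>4 * B\<close>.\<close>

lemma norm_h1_diff_const_le:
  fixes u :: "real \<Rightarrow> 'a::euclidean_space"
  assumes u: "\<And>s. (u has_vector_derivative p s) (at s)" and p: "continuous_on UNIV p"
    and per: "\<And>s. u (s + 2 * pi) = u s"
    and bnd: "\<And>s. norm (u s - a) \<le> B" "\<And>s. norm (p s) \<le> B"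
  shows "norm (Abs_h1 u - h1_const a) \<le> 4 * B"
proof -
  let ?w = "Abs_h1 u - h1_const a"
  have B: "B \<ge> 0" using bnd(2) norm_ge_zero order_trans by blast
  have cu: "continuous_on UNIV u"
    using u by (meson continuous_at_imp_continuous_on has_vector_derivative_continuous)
  have wd: "has_weak_deriv u p" by (rule has_weak_deriv_classical[OF u p])
  have path: "h1_path ?w = (\<lambda>s. u s - a)"
    unfolding minus_h1_def uminus_h1_def path_add path_scaleR h1_path_Abs_h1[OF wd per] h1_path_const by simp
  have "has_weak_deriv (h1_path ?w) p"
    unfolding path using has_weak_deriv_add[OF wd has_weak_deriv_const[of "- a"]] by simp
  then have ae: "AE s in lborel. s \<in> {0..2*pi} \<longrightarrow> wderiv ?w s = p s"
    by (rule weak_deriv_unique[OF has_weak_deriv_wderiv])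
  have bound: "(LINT s:{0..2*pi}|lborel. f s \<bullet> f s) \<le> 2 * pi * B\<^sup>2"
    if f: "continuous_on UNIV f" "\<And>s. norm (f s) \<le> B" for f :: "real \<Rightarrow> 'a"
  proof -
    have c: "continuous_on {0..2*pi} (\<lambda>s. f s \<bullet> f s)"
      by (intro continuous_intros continuous_on_subset[OF f(1)]) simp_all
    have "integral {0..2*pi} (\<lambda>s. f s \<bullet> f s) \<le> integral {0..2*pi} (\<lambda>s. B\<^sup>2)"
    proof (rule integral_le)
      fix s show "f s \<bullet> f s \<le> B\<^sup>2"
        using power_mono[OF f(2)[of s], of 2] by (simp add: power2_norm_eq_inner)
    qed (use c in \<open>auto intro: integrable_continuous_real\<close>)
    then show ?thesis by (simp add: set_lebesgue_integral_continuous[OF c])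
  qed
  have "(LINT s:{0..2*pi}|lborel. wderiv ?w s \<bullet> wderiv ?w s) = (LINT s:{0..2*pi}|lborel. p s \<bullet> p s)"
  proof (rule set_lebesgue_integral_cong_AE)
    note [measurable] = wderiv_measurable[of ?w] borel_measurable_continuous_onI[OF p]
    show "(\<lambda>s. wderiv ?w s \<bullet> wderiv ?w s) \<in> borel_measurable lborel"
      "(\<lambda>s. p s \<bullet> p s) \<in> borel_measurable lborel" by measurable
    show "AE s\<in>{0..2*pi} in lborel. wderiv ?w s \<bullet> wderiv ?w s = p s \<bullet> p s"
      using ae by eventually_elim auto
  qed simp
  then have "?w \<bullet> ?w \<le> 2 * pi * B\<^sup>2 + 2 * pi * B\<^sup>2"
    unfolding inner_h1_def path
    using bound[of "\<lambda>s. u s - a"] bound[OF p bnd(2)] bnd(1) cu by (simp add: continuous_intros)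
  also have "\<dots> = pi * (2 * B)\<^sup>2" by (simp add: power2_eq_square)
  also have "\<dots> \<le> 4 * (2 * B)\<^sup>2" using pi_less_4 by (intro mult_right_mono) auto
  also have "\<dots> = (4 * B)\<^sup>2" by (simp add: power2_eq_square)
  finally show ?thesis unfolding norm_h1_def using B by (intro real_le_lsqrt) auto
qed

lemma rotation_equivalent_sym:
  assumes "rotation_equivalent I q p" shows "rotation_equivalent I p q"
proof -
  obtain \<phi> where "\<forall>i\<in>I. \<forall>t. p i t = rot \<phi> *v q i t" using assms by (auto simp: rotation_equivalent_def)
  then have "\<forall>i\<in>I. \<forall>t. q i t = rot (- \<phi>) *v p i t" by simp
  then show ?thesis by (auto simp: rotation_equivalent_def)
qed

lemma rot_pi: "rot pi *v x = - x"
  by (simp add: rot_apply)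

context projected_path
begin

text \<open>The time shift advances the relative phase \<open>\<nu> * t\<close> by \<phi> and turns
  the outer frame by \<open>\<phi> / \<nu>\<close>. The rotation undoes the latter, and since the
  cluster frame turns by \<open>\<omega> * \<phi> / \<nu>\<close>, it is left turned by exactly
  \<phi>.\<close>

definition shifted :: "real \<Rightarrow> 'a + 'b \<Rightarrow> real \<Rightarrow> real^2" where
  "shifted \<phi> b t = rot (- (\<phi> / \<nu>)) *v body b (t + \<phi> / \<nu>)"

lemma shifted_Inr: "shifted \<phi> (Inr j) t = rot t *v (u0 (\<nu> * t + \<phi>) $ j)"
proof -
  have "\<nu> * (t + \<phi> / \<nu>) = \<nu> * t + \<phi>" using frequencies(2) by (simp add: field_simps)
  then show ?thesis by (simp add: shifted_def rot_add[symmetric])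
qed

lemma shifted_Inl:
  "shifted \<phi> (Inl k) t = rot t *v (u0 (\<nu> * t + \<phi>) $ c) + \<epsilon> *\<^sub>R (rot (t * \<omega>) *v (rot \<phi> *v (u1 (\<nu> * t + \<phi>) $ k)))"
proof -
  have "\<nu> * (t + \<phi> / \<nu>) = \<nu> * t + \<phi>" using frequencies(2) by (simp add: field_simps)
  moreover have "- (\<phi> / \<nu>) + \<omega> * (t + \<phi> / \<nu>) = t * \<omega> + \<phi>"
    using frequencies(1,2) by (simp add: field_simps)
  ultimately show ?thesis by (simp add: shifted_def rot_plus rot_scaleR rot_add[symmetric])
qed

lemma shifted_solution: "nbody_solution (cluster_bodies c) (case_sum m1 mo) (shifted \<phi>)"
  unfolding shifted_def[abs_def] by (rule nbody_solution_rot_shift[OF body_solution])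

lemma shifted_h1:
  assumes B: "\<And>s. norm (u0 s - a0) \<le> B" "\<And>s. norm (p0 s) \<le> B" "\<And>s. norm (u1 s - a1) \<le> B" "\<And>s. norm (p1 s) \<le> B"
  shows "\<exists>(h0 :: 'b \<Rightarrow> (real^2) h1) (h1 :: 'a \<Rightarrow> (real^2) h1).
            (\<forall>k t. shifted \<phi> (Inl k) t =
               rot t *v h1_path (h0 c) (\<nu> * t) + \<epsilon> *\<^sub>R (rot (t * \<omega>) *v h1_path (h1 k) (\<nu> * t))) \<and>
            (\<forall>j t. j \<noteq> c \<longrightarrow> shifted \<phi> (Inr j) t = rot t *v h1_path (h0 j) (\<nu> * t)) \<and>
            (\<forall>j. norm (h0 j - h1_const (a0 $ j)) \<le> 4 * B) \<and>
            (\<forall>k. norm (h1 k - h1_const (rot \<phi> *v (a1 $ k))) \<le> 4 * B) \<and>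
            (\<forall>s. (\<Sum>j\<in>UNIV. M j *\<^sub>R h1_path (h0 j) s) = 0) \<and>
            (\<forall>s. (\<Sum>k\<in>UNIV. m1 k *\<^sub>R h1_path (h1 k) s) = 0) \<and>
            (\<forall>k s. h1_path (h1 k) (s + 2*pi / real m) = h1_path (h1 k) s) \<and>
            (\<forall>j s. h1_path (h0 j) s = rot (- \<theta>) *v h1_path (h0 (\<sigma> j)) (s + \<theta>))"
proof -
  define f0 where "f0 j s = u0 (s + \<phi>) $ j" for j s
  define f1 where "f1 k s = rot \<phi> *v (u1 (s + \<phi>) $ k)" for k s
  have cont: "continuous_on UNIV p0" "continuous_on UNIV p1"
    using p0' p1' by (meson continuous_at_imp_continuous_on has_vector_derivative_continuous)+
  have d0: "(f0 j has_vector_derivative slowness \<epsilon> *\<^sub>R p0 (s + \<phi>) $ j) (at s)" for j s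
    unfolding f0_def
    using bounded_linear.has_vector_derivative[OF bounded_linear_vec_nth vector_derivative_shifted_argument[OF u0']] by simp
  have d1: "(f1 k has_vector_derivative rot \<phi> *v (p1 (s + \<phi>) $ k)) (at s)" for k s
    unfolding f1_def
    by (rule bounded_linear.has_vector_derivative[OF matrix_vector_mul_bounded_linear
          bounded_linear.has_vector_derivative[OF bounded_linear_vec_nth vector_derivative_shifted_argument[OF u1']]])
  have c0: "continuous_on UNIV (\<lambda>s. slowness \<epsilon> *\<^sub>R p0 (s + \<phi>) $ j)" for j
    by (intro continuous_intros continuous_on_compose2[OF cont(1)]) auto
  have c1: "continuous_on UNIV (\<lambda>s. rot \<phi> *v (p1 (s + \<phi>) $ k))" for k
    by (intro bounded_linear.continuous_on[OF matrix_vector_mul_bounded_linear] continuous_intros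
        continuous_on_compose2[OF cont(2)]) auto
  have per0: "f0 j (s + 2 * pi) = f0 j s" for j s
    using per_u0[of "s + \<phi>"] by (simp add: f0_def add_ac)
  have per1: "f1 k (s + 2 * pi) = f1 k s" for k s
    using per_u1'[of "s + \<phi>"] by (simp add: f1_def add_ac)
  have path0: "h1_path (Abs_h1 (f0 j)) = f0 j" for j
    by (rule h1_path_Abs_h1[OF has_weak_deriv_classical[OF d0 c0] per0])
  have path1: "h1_path (Abs_h1 (f1 k)) = f1 k" for k
    by (rule h1_path_Abs_h1[OF has_weak_deriv_classical[OF d1 c1] per1])
  have n0: "norm (Abs_h1 (f0 j) - h1_const (a0 $ j)) \<le> 4 * B" for j
  proof (rule norm_h1_diff_const_le[OF d0 c0 per0])
    fix s
    have "norm ((u0 (s + \<phi>) - a0) $ j) \<le> B" by (rule order_trans[OF Finite_Cartesian_Product.norm_nth_le B(1)])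
    then show "norm (f0 j s - a0 $ j) \<le> B" by (simp add: f0_def)
    have "norm (p0 (s + \<phi>) $ j) \<le> B" by (rule order_trans[OF Finite_Cartesian_Product.norm_nth_le B(2)])
    then have "slowness \<epsilon> * norm (p0 (s + \<phi>) $ j) \<le> 1 * B" using frequencies(6,7) by (intro mult_mono) auto
    then show "norm (slowness \<epsilon> *\<^sub>R p0 (s + \<phi>) $ j) \<le> B" using frequencies(6) by simp
  qed
  have n1: "norm (Abs_h1 (f1 k) - h1_const (rot \<phi> *v (a1 $ k))) \<le> 4 * B" for k
  proof (rule norm_h1_diff_const_le[OF d1 c1 per1])
    fix s
    have "norm ((u1 (s + \<phi>) - a1) $ k) \<le> B" by (rule order_trans[OF Finite_Cartesian_Product.norm_nth_le B(3)])
    then show "norm (f1 k s - rot \<phi> *v (a1 $ k)) \<le> B" by (simp add: f1_def rot_diff[symmetric])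
    show "norm (rot \<phi> *v (p1 (s + \<phi>) $ k)) \<le> B"
      using order_trans[OF Finite_Cartesian_Product.norm_nth_le B(4)] by simp
  qed
  show ?thesis
  proof (rule exI[of _ "\<lambda>j. Abs_h1 (f0 j)"], rule exI[of _ "\<lambda>k. Abs_h1 (f1 k)"], unfold path0 path1, intro conjI allI impI n0 n1)
    show "shifted \<phi> (Inl k) t = rot t *v f0 c (\<nu> * t) + \<epsilon> *\<^sub>R (rot (t * \<omega>) *v f1 k (\<nu> * t))" for k t
      by (simp add: shifted_Inl f0_def f1_def)
    show "shifted \<phi> (Inr j) t = rot t *v f0 j (\<nu> * t)" for j t
      by (simp add: shifted_Inr f0_def)
    show "(\<Sum>j\<in>UNIV. M j *\<^sub>R f0 j s) = 0" for s
      by (simp add: f0_def center_of_mass_u0)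
    have "(\<Sum>k\<in>UNIV. m1 k *\<^sub>R f1 k s) = rot \<phi> *v (\<Sum>k\<in>UNIV. m1 k *\<^sub>R u1 (s + \<phi>) $ k)" for s
      by (simp add: f1_def rot_sum rot_scaleR)
    then show "(\<Sum>k\<in>UNIV. m1 k *\<^sub>R f1 k s) = 0" for s by (simp add: center_of_mass_u1)
    show "f1 k (s + 2 * pi / real m) = f1 k s" for k s
      using per_u1[of "s + \<phi>"] by (simp add: f1_def \<theta> add_ac)
    show "f0 j s = rot (- \<theta>) *v f0 (\<sigma> j) (s + \<theta>)" for j s
    proof -
      have "u0 (s + \<theta> + \<phi>) = symm (u0 (s + \<phi>))" using sym_u0[of "s + \<phi>"] by (simp add: add_ac)
      then show ?thesis by (simp add: f0_def)
    qed
  qed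
qed

text \<open>At time 0 the outer body \<open>j\<close> is near the same position in both solutions,
  which forces \<open>cos \<psi> > 1/2\<close> for a connecting rotation \<psi>. The difference of
  the cluster bodies \<open>k\<close> and \<open>l\<close> is nearly reversed, which forces
  \<open>cos \<psi> < - 1/2\<close>.\<close>

lemma shifted_not_equivalent:
  assumes B: "\<And>s. norm (u0 s - a0) \<le> B" "\<And>s. norm (u1 s - a1) \<le> B"
    and j: "j \<noteq> c" "2 * B < norm (a0 $ j)" and kl: "4 * B < norm (a1 $ k - a1 $ l)"
  shows "\<not> rotation_equivalent (cluster_bodies c) (shifted 0) (shifted pi)"
proof
  assume "rotation_equivalent (cluster_bodies c) (shifted 0) (shifted pi)"
  then obtain \<psi> where \<psi>: "\<And>b. b \<in> cluster_bodies c \<Longrightarrow> shifted pi b 0 = rot \<psi> *v shifted 0 b 0"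
    unfolding rotation_equivalent_def by blast
  have B0: "B \<ge> 0" using B(1) norm_ge_zero order_trans by blast
  have u: "norm (u0 s $ j - a0 $ j) \<le> B" "norm (u1 s $ i - a1 $ i) \<le> B" for s i
    using order_trans[OF Finite_Cartesian_Product.norm_nth_le B(1), of s j]
      order_trans[OF Finite_Cartesian_Product.norm_nth_le B(2), of s i] by simp_all
  have mem: "Inr j \<in> cluster_bodies c" "Inl i \<in> cluster_bodies c" for i :: 'a
    using j by (auto simp: cluster_bodies_def)
  have o: "u0 pi $ j = rot \<psi> *v (u0 0 $ j)" using \<psi>[OF mem(1)] by (simp add: shifted_Inr)
  have i: "u0 pi $ c - \<epsilon> *\<^sub>R (u1 pi $ i) = rot \<psi> *v (u0 0 $ c) + \<epsilon> *\<^sub>R (rot \<psi> *v (u1 0 $ i))" for i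
    using \<psi>[OF mem(2)[of i]] by (simp add: shifted_Inl rot_pi rot_plus rot_scaleR)
  \<comment> \<open>Subtracting the relations of two members eliminates the center of the cluster,
    whose deviation need not be small compared with \<epsilon>.\<close>
  have "\<epsilon> *\<^sub>R ((u1 pi $ k - u1 pi $ l) + rot \<psi> *v (u1 0 $ k - u1 0 $ l)) = 0"
    using i[of k] i[of l] by (simp add: rot_diff algebra_simps)
  then have d: "(u1 pi $ k - u1 pi $ l) + rot \<psi> *v (u1 0 $ k - u1 0 $ l) = 0" using eps by simp
  let ?d = "a1 $ k - a1 $ l"
  have "norm (a0 $ j - rot \<psi> *v (a0 $ j)) = norm (rot \<psi> *v (u0 0 $ j - a0 $ j) - (u0 pi $ j - a0 $ j))"
    by (simp add: o rot_diff)
  also have "\<dots> \<le> norm (u0 0 $ j - a0 $ j) + norm (u0 pi $ j - a0 $ j)"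
    by (rule order_trans[OF norm_triangle_ineq4]) simp
  also have "\<dots> \<le> 2 * B" using u(1)[of 0] u(1)[of pi] by simp
  finally have "(norm (a0 $ j - rot \<psi> *v (a0 $ j)))\<^sup>2 \<le> (2 * B)\<^sup>2" by (intro power_mono) auto
  moreover have "(2 * B)\<^sup>2 < (norm (a0 $ j))\<^sup>2" using j B0 by (intro power_strict_mono) auto
  ultimately have "2 * (1 - cos \<psi>) * (norm (a0 $ j))\<^sup>2 < 1 * (norm (a0 $ j))\<^sup>2"
    unfolding norm_diff_rot by linarith
  then have 1: "2 * (1 - cos \<psi>) < 1" by (rule mult_right_less_imp_less) simp
  have "norm (?d + rot \<psi> *v ?d) = norm (((u1 pi $ l - a1 $ l) - (u1 pi $ k - a1 $ k)) + rot \<psi> *v ((u1 0 $ l - a1 $ l) - (u1 0 $ k - a1 $ k)))"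
  proof -
    have e: "?d + rot \<psi> *v ?d = ((u1 pi $ k - u1 pi $ l) + rot \<psi> *v (u1 0 $ k - u1 0 $ l)) +
        (((u1 pi $ l - a1 $ l) - (u1 pi $ k - a1 $ k)) + rot \<psi> *v ((u1 0 $ l - a1 $ l) - (u1 0 $ k - a1 $ k)))"
      by (simp add: rot_diff)
    show ?thesis by (rule arg_cong[OF e[unfolded d add_0_left]])
  qed
  also have "\<dots> \<le> norm ((u1 pi $ l - a1 $ l) - (u1 pi $ k - a1 $ k)) + norm ((u1 0 $ l - a1 $ l) - (u1 0 $ k - a1 $ k))"
    by (rule order_trans[OF norm_triangle_ineq]) simp
  also have "\<dots> \<le> (norm (u1 pi $ l - a1 $ l) + norm (u1 pi $ k - a1 $ k)) + (norm (u1 0 $ l - a1 $ l) + norm (u1 0 $ k - a1 $ k))"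
    by (intro add_mono norm_triangle_ineq4)
  also have "\<dots> \<le> 4 * B" using u(2)[of pi l] u(2)[of pi k] u(2)[of 0 l] u(2)[of 0 k] by simp
  finally have "(norm (?d + rot \<psi> *v ?d))\<^sup>2 \<le> (4 * B)\<^sup>2" by (intro power_mono) auto
  moreover have "(4 * B)\<^sup>2 < (norm ?d)\<^sup>2" using kl B0 by (intro power_strict_mono) auto
  ultimately have "2 * (1 + cos \<psi>) * (norm ?d)\<^sup>2 < 1 * (norm ?d)\<^sup>2"
    unfolding norm_add_rot by linarith
  then have 2: "2 * (1 + cos \<psi>) < 1" by (rule mult_right_less_imp_less) simp
  from 1 2 show False by simp
qed

end

section \<open>Choice of the small parameter and conclusion\<close>

lemma norm_axis: "norm (axis i x) = norm (x :: 'a::real_normed_vector)"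
proof -
  have "(\<Sum>j\<in>UNIV. (norm (axis i x $ j))\<^sup>2) = (\<Sum>j\<in>UNIV. if j = i then (norm x)\<^sup>2 else 0)"
    by (rule sum.cong) (auto simp: axis_def)
  then show ?thesis by (simp add: norm_vec_def L2_set_def sum.delta)
qed

lemma positive_pairing_near:
  fixes a m :: "'a::real_inner"
  assumes "a \<bullet> m > 0"
  obtains r where "r > 0" "\<And>u. norm (u - a) < r \<Longrightarrow> u \<bullet> m > 0"
proof (rule that[of "a \<bullet> m / (norm m + 1)"])
  show "a \<bullet> m / (norm m + 1) > 0" using assms by (simp add: add_nonneg_pos)
  fix u assume "norm (u - a) < a \<bullet> m / (norm m + 1)"
  then have "norm (u - a) * (norm m + 1) < a \<bullet> m" by (simp add: pos_less_divide_eq add_nonneg_pos)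
  moreover have "\<bar>(u - a) \<bullet> m\<bar> \<le> norm (u - a) * norm m" by (rule Cauchy_Schwarz_ineq2)
  moreover have "norm (u - a) * (norm m + 1) = norm (u - a) * norm m + norm (u - a)" by (simp add: distrib_left)
  ultimately have "\<bar>(u - a) \<bullet> m\<bar> < a \<bullet> m" using norm_ge_zero[of "u - a"] by linarith
  then show "u \<bullet> m > 0" by (simp add: inner_diff_left)
qed

context symmetric_cluster
begin

text \<open>The additional bound \<zeta> makes room for the inequivalence argument, which needs
  deviations small compared with the two central configurations.\<close>

lemma projected_path_exists:
  assumes \<zeta>: "\<zeta> > 0"
  shows "\<exists>C \<epsilon>1. \<epsilon>1 > 0 \<and> (\<forall>\<epsilon>. 0 < \<epsilon> \<longrightarrow> \<epsilon> < \<epsilon>1 \<longrightarrow> C * \<epsilon> < \<zeta> \<and> (\<exists>u0 p0 u1 p1 l0 l1.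
    projected_path m1 mo c a0 a1 m \<theta> \<sigma> \<epsilon> u0 p0 u1 p1 l0 l1 \<and>
    (\<forall>s. norm (u0 s - a0) \<le> C * \<epsilon> \<and> norm (p0 s) \<le> C * \<epsilon> \<and> norm (u1 s - a1) \<le> C * \<epsilon> \<and> norm (p1 s) \<le> C * \<epsilon>)))"
proof -
  obtain C' \<epsilon>1 where \<epsilon>1: "\<epsilon>1 > 0" and sol: "\<And>\<epsilon>. 0 < \<epsilon> \<Longrightarrow> \<epsilon> < \<epsilon>1 \<Longrightarrow> (\<exists>u0 p0 u1 p1 l0 l1.
    (\<forall>s. norm (u0 s - a0) \<le> C' * \<epsilon> \<and> norm (p0 s) \<le> C' * \<epsilon> \<and> norm (u1 s - a1) \<le> C' * \<epsilon> \<and> norm (p1 s) \<le> C' * \<epsilon>) \<and>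
    (\<forall>s. u0 (s + \<theta>) = symm (u0 s) \<and> p0 (s + \<theta>) = symm (p0 s) \<and> u1 (s + \<theta>) = u1 s \<and> p1 (s + \<theta>) = p1 s) \<and>
    (\<forall>s. (u0 has_vector_derivative slowness \<epsilon> *\<^sub>R p0 s) (at s)) \<and>
    (\<forall>s. (p0 has_vector_derivative slowness \<epsilon> *\<^sub>R (\<chi> j. u0 s $ j + outer \<epsilon> s ((u0 s, p0 s), (u1 s, p1 s)) j
         - 2 *\<^sub>R (J *v (p0 s $ j)) + l0 *\<^sub>R (J *v (a0 $ j)))) (at s)) \<and>
    (\<forall>s. (u1 has_vector_derivative p1 s) (at s)) \<and>
    (\<forall>s. (p1 has_vector_derivative (\<chi> k. (stretch \<epsilon>)\<^sup>2 *\<^sub>R (u1 s $ k + accel m1 (u1 s) k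
            + \<epsilon>\<^sup>2 *\<^sub>R (rot (- s) *v (tidal \<epsilon> s ((u0 s, p0 s), (u1 s, p1 s)) k - mean_tidal \<epsilon> s ((u0 s, p0 s), (u1 s, p1 s)))))
          - (2 * stretch \<epsilon>) *\<^sub>R (J *v (p1 s $ k)) + l1 *\<^sub>R (J *v (a1 $ k)))) (at s)))"
    using projected_solutions by blast
  define C where "C = max C' 1"
  have C: "C > 0" "\<And>x \<epsilon>. 0 < \<epsilon> \<Longrightarrow> x \<le> C' * \<epsilon> \<Longrightarrow> x \<le> C * \<epsilon>"
    by (auto simp: C_def intro: order_trans[OF _ mult_right_mono])
  obtain r0 where r0: "r0 > 0" "\<And>u. norm (u - a0) < r0 \<Longrightarrow> collision_free u" using collision_free_ball[OF cf0] by blast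
  obtain r1 where r1: "r1 > 0" "\<And>u. norm (u - a1) < r1 \<Longrightarrow> collision_free u" using collision_free_ball[OF cf1] by blast
  have "a0 \<bullet> mass_weight M a0 > 0" "a1 \<bullet> mass_weight m1 a1 > 0"
    unfolding inner_mass_weight
    using mass_norm_pos[of M a0, OF M_pos cf0 card_n] mass_norm_pos[of m1 a1, OF m1_pos cf1 card_k] by simp_all
  then obtain r2 r3 where r2: "r2 > 0" "\<And>u. norm (u - a0) < r2 \<Longrightarrow> u \<bullet> mass_weight M a0 > 0"
    and r3: "r3 > 0" "\<And>u. norm (u - a1) < r3 \<Longrightarrow> u \<bullet> mass_weight m1 a1 > 0"
    using positive_pairing_near by metis
  \<comment> \<open>Only half of the collision-free radius \<open>r0\<close> is granted to the outer
    configuration. The other half is kept for the displacement of a cluster member from the center,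
    which the last entry of the minimum \<open>\<epsilon>2\<close> controls.\<close>
  define r where "r = min (min (r0 / 2) r1) (min (min r2 r3) (min \<zeta> 1))"
  have r: "r > 0" "r \<le> r0 / 2" "r \<le> r1" "r \<le> r2" "r \<le> r3" "r \<le> \<zeta>" "r \<le> 1"
    using r0 r1 r2 r3 \<zeta> by (auto simp: r_def)
  define \<epsilon>2 where "\<epsilon>2 = min (min \<epsilon>1 (1/2)) (min (r / C) (r0 / 2 / (norm a1 + 1)))"
  have \<epsilon>2: "\<epsilon>2 > 0" using \<epsilon>1 r C r0 by (simp add: \<epsilon>2_def add_nonneg_pos)
  show ?thesis
  proof (rule exI[of _ C], rule exI[of _ \<epsilon>2], intro conjI \<epsilon>2 allI impI)
    fix \<epsilon> :: real assume \<epsilon>: "0 < \<epsilon>" "\<epsilon> < \<epsilon>2"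
    have C\<epsilon>: "C * \<epsilon> < r" using \<epsilon> C by (simp add: \<epsilon>2_def pos_less_divide_eq mult.commute)
    then show "C * \<epsilon> < \<zeta>" using r by linarith
    have pos: "norm a1 + 1 > 0" by (simp add: add_nonneg_pos)
    have "\<epsilon> < r0 / 2 / (norm a1 + 1)" using \<epsilon>(2) unfolding \<epsilon>2_def min_less_iff_conj by blast
    then have \<epsilon>a: "\<epsilon> * (norm a1 + 1) < r0 / 2" unfolding pos_less_divide_eq[OF pos] .
    have "\<epsilon> < \<epsilon>1" "\<epsilon> < 1/2" using \<epsilon> by (simp_all add: \<epsilon>2_def)
    from sol[OF \<epsilon>(1) this(1)] obtain u0 p0 u1 p1 l0 l1 where
      bnd: "\<forall>s. norm (u0 s - a0) \<le> C' * \<epsilon> \<and> norm (p0 s) \<le> C' * \<epsilon> \<and> norm (u1 s - a1) \<le> C' * \<epsilon> \<and> norm (p1 s) \<le> C' * \<epsilon>"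
      and rest: "\<forall>s. u0 (s + \<theta>) = symm (u0 s) \<and> p0 (s + \<theta>) = symm (p0 s) \<and> u1 (s + \<theta>) = u1 s \<and> p1 (s + \<theta>) = p1 s"
      "\<forall>s. (u0 has_vector_derivative slowness \<epsilon> *\<^sub>R p0 s) (at s)"
      "\<forall>s. (p0 has_vector_derivative slowness \<epsilon> *\<^sub>R (\<chi> j. u0 s $ j + outer \<epsilon> s ((u0 s, p0 s), (u1 s, p1 s)) j
         - 2 *\<^sub>R (J *v (p0 s $ j)) + l0 *\<^sub>R (J *v (a0 $ j)))) (at s)"
      "\<forall>s. (u1 has_vector_derivative p1 s) (at s)"
      "\<forall>s. (p1 has_vector_derivative (\<chi> k. (stretch \<epsilon>)\<^sup>2 *\<^sub>R (u1 s $ k + accel m1 (u1 s) k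
            + \<epsilon>\<^sup>2 *\<^sub>R (rot (- s) *v (tidal \<epsilon> s ((u0 s, p0 s), (u1 s, p1 s)) k - mean_tidal \<epsilon> s ((u0 s, p0 s), (u1 s, p1 s)))))
          - (2 * stretch \<epsilon>) *\<^sub>R (J *v (p1 s $ k)) + l1 *\<^sub>R (J *v (a1 $ k)))) (at s)"
      by (elim exE conjE) (rule that)
    have b: "norm (u0 s - a0) \<le> C * \<epsilon>" "norm (p0 s) \<le> C * \<epsilon>" "norm (u1 s - a1) \<le> C * \<epsilon>" "norm (p1 s) \<le> C * \<epsilon>" for s
      using bnd[rule_format, of s] C(2)[OF \<epsilon>(1)] by blast+
    have near: "norm (u0 s - a0) < r" "norm (u1 s - a1) < r" for s
      using b(1)[of s] b(3)[of s] C\<epsilon> by linarith+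
    have "projected_path m1 mo c a0 a1 m \<theta> \<sigma> \<epsilon> u0 p0 u1 p1 l0 l1"
    proof
      show "0 < \<epsilon>" "\<epsilon> < 1/2" by fact+
      fix s
      show "collision_free (u0 s)" using near(1)[of s] r r0 by (intro r0) linarith
      show "collision_free (u1 s)" using near(2)[of s] r by (intro r1) linarith
      show "0 < u0 s \<bullet> mass_weight M a0" using near(1)[of s] r by (intro r2) linarith
      show "0 < u1 s \<bullet> mass_weight m1 a1" using near(2)[of s] r by (intro r3) linarith
      show "u0 s $ c + \<epsilon> *\<^sub>R (rot s *v (u1 s $ k)) \<noteq> u0 s $ j" if "j \<noteq> c" for k j
      proof -
        let ?x = "\<epsilon> *\<^sub>R (rot s *v (u1 s $ k))"
        have "norm (u1 s $ k) \<le> norm a1 + 1"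
          using Finite_Cartesian_Product.norm_nth_le[of "u1 s" k] norm_triangle_sub[of "u1 s" a1] near(2)[of s] r(7)
          by linarith
        then have "norm ?x \<le> \<epsilon> * (norm a1 + 1)" using \<epsilon> by simp
        then have x: "norm ?x < r0 / 2" using \<epsilon>a by linarith
        \<comment> \<open>A member of the cluster stays away from the outer bodies because moving
          the entry \<open>c\<close> to the place of that member still leaves the configuration
          within \<open>r0\<close> of \<open>a0\<close>.\<close>
        have "collision_free (u0 s + axis c ?x)"
        proof (rule r0(2))
          have "norm (u0 s + axis c ?x - a0) \<le> norm (u0 s - a0) + norm (axis c ?x)"
            using norm_triangle_ineq[of "u0 s - a0" "axis c ?x"] by (simp add: algebra_simps)
          also have "norm (axis c ?x) = norm ?x"
            by (rule norm_axis)
          finally show "norm (u0 s + axis c ?x - a0) < r0" using x near(1)[of s] r(2) by linarith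
        qed
        then have "(u0 s + axis c ?x) $ c \<noteq> (u0 s + axis c ?x) $ j"
          using that unfolding collision_free_def by metis
        then show ?thesis using that by (simp add: axis_def)
      qed
    qed (use rest in blast)+
    then show "\<exists>u0 p0 u1 p1 l0 l1. projected_path m1 mo c a0 a1 m \<theta> \<sigma> \<epsilon> u0 p0 u1 p1 l0 l1 \<and>
      (\<forall>s. norm (u0 s - a0) \<le> C * \<epsilon> \<and> norm (p0 s) \<le> C * \<epsilon> \<and> norm (u1 s - a1) \<le> C * \<epsilon> \<and> norm (p1 s) \<le> C * \<epsilon>)"
      using b by blast
  qed
qed

end

theorem theorem3p9:
  fixes m1 :: "'k::finite \<Rightarrow> real"
    and mo :: "'n::finite \<Rightarrow> real"
    and c :: 'n
    and m :: nat
    and \<theta> :: real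
    and \<sigma> :: "'n \<Rightarrow> 'n"
    and a0 :: "(real^2)^'n"
    and a1 :: "(real^2)^'k"
  assumes "CARD('n) \<ge> 2" and "CARD('k) > 1"
    and "\<And>k. m1 k > 0" and "\<And>j. j \<noteq> c \<Longrightarrow> mo j > 0"
    and "m \<ge> 2" and "\<theta> = 2*pi / real m"
    and "\<sigma> permutes UNIV" and "\<sigma> ^^ m = id" and "\<sigma> c = c"
    and "\<And>j. j \<noteq> c \<Longrightarrow> mo (\<sigma> j) = mo j"
    and "nondegenerate_cc (total_masses c m1 mo) a0"
    and "\<And>j. a0 $ j = rot (- \<theta>) *v (a0 $ \<sigma> j)"
    and "periodic_nondegenerate_cc m m1 a1"
  shows "\<exists>C \<epsilon>0. \<epsilon>0 > 0 \<and>
    (\<forall>\<epsilon> r1 \<omega>1 \<nu>. 0 < \<epsilon> \<and> \<epsilon> < \<epsilon>0 \<and> r1 = \<epsilon> \<and> \<omega>1 = \<epsilon> powr (-3/2) \<and> \<nu> = \<epsilon> powr (-3/2) - 1 \<longrightarrow>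
      (\<exists>Q :: ('k + 'n \<Rightarrow> real \<Rightarrow> real^2) set.
        card Q = 2 \<and>
        (\<forall>q\<in>Q. \<forall>p\<in>Q. q \<noteq> p \<longrightarrow> \<not> rotation_equivalent (cluster_bodies c) q p) \<and>
        (\<forall>q\<in>Q.
          nbody_solution (cluster_bodies c) (case_sum m1 mo) q \<and>
          (\<exists>(u0 :: 'n \<Rightarrow> (real^2) h1) (u1 :: 'k \<Rightarrow> (real^2) h1) (\<phi>1 :: real).
            (\<forall>k t. q (Inl k) t =
               rot t *v h1_path (u0 c) (\<nu> * t) + r1 *\<^sub>R (rot (t * \<omega>1) *v h1_path (u1 k) (\<nu> * t))) \<and>
            (\<forall>j t. j \<noteq> c \<longrightarrow> q (Inr j) t = rot t *v h1_path (u0 j) (\<nu> * t)) \<and>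
            (\<forall>j. norm (u0 j - h1_const (a0 $ j)) \<le> C * \<epsilon>) \<and>
            (\<forall>k. norm (u1 k - h1_const (rot \<phi>1 *v (a1 $ k))) \<le> C * \<epsilon>) \<and>
            (\<forall>s. (\<Sum>j\<in>UNIV. total_masses c m1 mo j *\<^sub>R h1_path (u0 j) s) = 0) \<and>
            (\<forall>s. (\<Sum>k\<in>UNIV. m1 k *\<^sub>R h1_path (u1 k) s) = 0) \<and>
            (\<forall>k s. h1_path (u1 k) (s + 2*pi / real m) = h1_path (u1 k) s) \<and>
            (\<forall>j s. h1_path (u0 j) s = rot (- \<theta>) *v h1_path (u0 (\<sigma> j)) (s + \<theta>))))))"
proof -
  have mpos: "total_masses c m1 mo j > 0" for j
    using assms(3,4) by (auto simp: total_masses_def intro!: sum_pos)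
  have cc: "central_configuration (total_masses c m1 mo) a0" "central_configuration m1 a1"
    using assms(11,13) by (simp_all add: nondegenerate_cc_def periodic_nondegenerate_cc_def)
  interpret symmetric_cluster m1 mo c a0 a1 m \<theta> \<sigma>
  proof
    show "collision_free a0" "collision_free a1" using cc by (simp_all add: central_configuration_def)
    show "a0 $ j + accel (total_masses c m1 mo) a0 j = 0" for j
      by (rule central_configuration_eq[of "total_masses c m1 mo" a0, OF mpos cc(1)])
    show "a1 $ k + accel m1 a1 k = 0" for k
      by (rule central_configuration_eq[of m1 a1, OF assms(3) cc(2)])
    show "bij \<sigma>" using assms(7) by (rule permutes_bij)
    show "a0 $ \<sigma> j = rot \<theta> *v (a0 $ j)" for j
      using arg_cong[OF assms(12)[of j], of "\<lambda>x. rot \<theta> *v x"] by simp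
  qed (use assms in auto)
  obtain j where j: "j \<noteq> c"
    using assms(1) by (metis (full_types) UNIV_I card_2_iff' card_le_Suc0_iff_eq finite not_less_eq_eq numeral_2_eq_2)
  obtain k l :: 'k where kl: "k \<noteq> l"
    using card_k by (metis (full_types) UNIV_I card_2_iff' card_le_Suc0_iff_eq finite not_less_eq_eq numeral_2_eq_2)
  have "a0 $ c = 0"
  proof (rule rot_fixed_point)
    show "rot \<theta> *v (a0 $ c) = a0 $ c" using a0_sym[of c] \<sigma>(3) by simp
    show "cos \<theta> \<noteq> 1" using m by (intro cos_neq_1) (simp_all add: \<theta> field_simps)
  qed
  then have "a0 $ j \<noteq> 0" "a1 $ k - a1 $ l \<noteq> 0"
    using cf0 cf1 j kl unfolding collision_free_def by (metis, simp)
  \<comment> \<open>These are the thresholds of \<open>shifted_not_equivalent\<close>. They are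
    positive because \<open>a0 $ j\<close> differs from \<open>a0 $ c\<close>, which is 0, and
    because \<open>a1\<close> is free of collisions.\<close>
  define \<zeta> where "\<zeta> = min (norm (a0 $ j) / 2) (norm (a1 $ k - a1 $ l) / 4)"
  have \<zeta>: "\<zeta> > 0" using \<open>a0 $ j \<noteq> 0\<close> \<open>a1 $ k - a1 $ l \<noteq> 0\<close> by (simp add: \<zeta>_def)
  obtain C \<epsilon>1 where \<epsilon>1: "\<epsilon>1 > 0" and sol: "\<And>\<epsilon>. 0 < \<epsilon> \<Longrightarrow> \<epsilon> < \<epsilon>1 \<Longrightarrow> C * \<epsilon> < \<zeta> \<and> (\<exists>u0 p0 u1 p1 l0 l1.
    projected_path m1 mo c a0 a1 m \<theta> \<sigma> \<epsilon> u0 p0 u1 p1 l0 l1 \<and>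
    (\<forall>s. norm (u0 s - a0) \<le> C * \<epsilon> \<and> norm (p0 s) \<le> C * \<epsilon> \<and> norm (u1 s - a1) \<le> C * \<epsilon> \<and> norm (p1 s) \<le> C * \<epsilon>))"
    using projected_path_exists[OF \<zeta>] by blast
  show ?thesis
  \<comment> \<open>The factor 4 is the price for passing from bounds on path and derivative to the
    Sobolev norm.\<close>
  proof (rule exI[of _ "4 * C"], rule exI[of _ \<epsilon>1], intro conjI \<epsilon>1 allI impI, elim conjE)
    fix \<epsilon> r1 \<omega>1 \<nu> :: real
    assume \<epsilon>: "0 < \<epsilon>" "\<epsilon> < \<epsilon>1" and defs: "r1 = \<epsilon>" "\<omega>1 = \<epsilon> powr (-3/2)" "\<nu> = \<epsilon> powr (-3/2) - 1"
    from sol[OF \<epsilon>] obtain u0 p0 u1 p1 l0 l1 where small: "C * \<epsilon> < \<zeta>"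
      and pp: "projected_path m1 mo c a0 a1 m \<theta> \<sigma> \<epsilon> u0 p0 u1 p1 l0 l1"
      and all_bnd: "\<forall>s. norm (u0 s - a0) \<le> C * \<epsilon> \<and> norm (p0 s) \<le> C * \<epsilon> \<and> norm (u1 s - a1) \<le> C * \<epsilon> \<and> norm (p1 s) \<le> C * \<epsilon>"
      by (elim exE conjE) (rule that)
    have bnd: "norm (u0 s - a0) \<le> C * \<epsilon>" "norm (p0 s) \<le> C * \<epsilon>"
        "norm (u1 s - a1) \<le> C * \<epsilon>" "norm (p1 s) \<le> C * \<epsilon>" for s
      using all_bnd by blast+
    interpret P: projected_path m1 mo c a0 a1 m \<theta> \<sigma> \<epsilon> u0 p0 u1 p1 l0 l1 by (rule pp)
    have freq: "\<nu> = P.\<nu>" "\<omega>1 = P.\<omega>" by (simp_all add: defs P.\<nu>_def P.\<omega>_def)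
    have ne: "\<not> rotation_equivalent (cluster_bodies c) (P.shifted 0) (P.shifted pi)"
      by (rule P.shifted_not_equivalent[OF bnd(1,3) j, of k l]) (use small in \<open>simp_all add: \<zeta>_def\<close>)
    then have ne': "\<not> rotation_equivalent (cluster_bodies c) (P.shifted pi) (P.shifted 0)"
      using rotation_equivalent_sym by blast
    have "P.shifted 0 \<noteq> P.shifted pi"
    proof
      assume "P.shifted 0 = P.shifted pi"
      then have "rotation_equivalent (cluster_bodies c) (P.shifted 0) (P.shifted pi)"
        unfolding rotation_equivalent_def by (intro exI[of _ 0]) simp
      with ne show False ..
    qed
    then have card: "card {P.shifted 0, P.shifted pi} = 2" by simp
    have bnd4: "4 * C * \<epsilon> = 4 * (C * \<epsilon>)" by simp
    have good: "nbody_solution (cluster_bodies c) (case_sum m1 mo) (P.shifted \<phi>) \<and>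
          (\<exists>(u0 :: 'n \<Rightarrow> (real^2) h1) (u1 :: 'k \<Rightarrow> (real^2) h1) (\<phi>1 :: real).
            (\<forall>k t. P.shifted \<phi> (Inl k) t =
               rot t *v h1_path (u0 c) (\<nu> * t) + r1 *\<^sub>R (rot (t * \<omega>1) *v h1_path (u1 k) (\<nu> * t))) \<and>
            (\<forall>j t. j \<noteq> c \<longrightarrow> P.shifted \<phi> (Inr j) t = rot t *v h1_path (u0 j) (\<nu> * t)) \<and>
            (\<forall>j. norm (u0 j - h1_const (a0 $ j)) \<le> 4 * C * \<epsilon>) \<and>
            (\<forall>k. norm (u1 k - h1_const (rot \<phi>1 *v (a1 $ k))) \<le> 4 * C * \<epsilon>) \<and>
            (\<forall>s. (\<Sum>j\<in>UNIV. total_masses c m1 mo j *\<^sub>R h1_path (u0 j) s) = 0) \<and>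
            (\<forall>s. (\<Sum>k\<in>UNIV. m1 k *\<^sub>R h1_path (u1 k) s) = 0) \<and>
            (\<forall>k s. h1_path (u1 k) (s + 2*pi / real m) = h1_path (u1 k) s) \<and>
            (\<forall>j s. h1_path (u0 j) s = rot (- \<theta>) *v h1_path (u0 (\<sigma> j)) (s + \<theta>)))" for \<phi>
      using P.shifted_solution[of \<phi>] P.shifted_h1[OF bnd, of \<phi>] unfolding freq defs(1) bnd4 by blast
    show "\<exists>Q :: ('k + 'n \<Rightarrow> real \<Rightarrow> real^2) set.
        card Q = 2 \<and>
        (\<forall>q\<in>Q. \<forall>p\<in>Q. q \<noteq> p \<longrightarrow> \<not> rotation_equivalent (cluster_bodies c) q p) \<and>
        (\<forall>q\<in>Q.
          nbody_solution (cluster_bodies c) (case_sum m1 mo) q \<and>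
          (\<exists>(u0 :: 'n \<Rightarrow> (real^2) h1) (u1 :: 'k \<Rightarrow> (real^2) h1) (\<phi>1 :: real).
            (\<forall>k t. q (Inl k) t =
               rot t *v h1_path (u0 c) (\<nu> * t) + r1 *\<^sub>R (rot (t * \<omega>1) *v h1_path (u1 k) (\<nu> * t))) \<and>
            (\<forall>j t. j \<noteq> c \<longrightarrow> q (Inr j) t = rot t *v h1_path (u0 j) (\<nu> * t)) \<and>
            (\<forall>j. norm (u0 j - h1_const (a0 $ j)) \<le> 4 * C * \<epsilon>) \<and>
            (\<forall>k. norm (u1 k - h1_const (rot \<phi>1 *v (a1 $ k))) \<le> 4 * C * \<epsilon>) \<and>
            (\<forall>s. (\<Sum>j\<in>UNIV. total_masses c m1 mo j *\<^sub>R h1_path (u0 j) s) = 0) \<and>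
            (\<forall>s. (\<Sum>k\<in>UNIV. m1 k *\<^sub>R h1_path (u1 k) s) = 0) \<and>
            (\<forall>k s. h1_path (u1 k) (s + 2*pi / real m) = h1_path (u1 k) s) \<and>
            (\<forall>j s. h1_path (u0 j) s = rot (- \<theta>) *v h1_path (u0 (\<sigma> j)) (s + \<theta>))))"
    proof (intro exI[of _ "{P.shifted 0, P.shifted pi}"] conjI card)
      show "\<forall>q\<in>{P.shifted 0, P.shifted pi}. \<forall>p\<in>{P.shifted 0, P.shifted pi}. q \<noteq> p \<longrightarrow>
          \<not> rotation_equivalent (cluster_bodies c) q p"
        using ne ne' by blast
    qed (use good in blast)
  qed
qed

end
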